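(* Let $k$ be an algebraically closed field of characteristic zero and $R=k[x_1,\ldots,x_n]$ with $n\ge3$. Let $J\subseteq R$ be a $3$-equigenerated ideal of codimension at least two with minimal graded free resolution $$0\to R(-\delta_1-\delta_2-\delta_3)\to\bigoplus_{i=1}^3R(-3-\delta_i)\to R(-3)^3\to J\to0.$$ Then the list of all possible vectors $\underline\delta=(\delta_1,\delta_2,\delta_3)$ and $\underline\epsilon=(\epsilon_1)$ and their respective values $\deg(R/J)$ and $\mathrm{Bour}(J)$ is: - $\underline\delta=(1,3,3)$, $\underline\epsilon=(1)$, $\deg(R/J)=6$, $\mathrm{Bour}(J)=1$; - $\underline\delta=(2,2,2)$, $\underline\epsilon=(1)$, $\deg(R/J)=6$, $\mathrm{Bour}(J)=1$; - $\underline\delta=(2,2,3)$, $\underline\epsilon=(1)$, $\deg(R/J)=5$, $\mathrm{Bour}(J)=2$; - $\underline\delta=(2,3,3)$, $\underline\epsilon=(2)$, $\deg(R/J)=3$, $\mathrm{Bour}(J)=4$; - $\underline\delta=(3,3,3)$, $\underline\epsilon=(3)$, $\deg(R/J)=0$, $\mathrm{Bour}(J)=9$.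
   Context: $J=(f_1,f_2,f_3)$ is minimally generated by three forms of degree $d=3$. In general the minimal resolution is written $0\to\bigoplus_{j=1}^{m-2}R(-d-\delta_{j+2}-\epsilon_j)\to\bigoplus_{i=1}^mR(-d-\delta_i)\to R(-d)^3\to J\to0$ with $1\le\delta_1\le\cdots\le\delta_m$, positive integers $\epsilon_j$ and $\delta_3+\epsilon_1\le\cdots\le\delta_m+\epsilon_{m-2}$; here $m=3$, and $\epsilon_1$ is defined by $d+\delta_3+\epsilon_1=\delta_1+\delta_2+\delta_3$. $\deg(R/J)$ is the codimension-two degree: the usual multiplicity of $R/J$ if $\mathrm{ht}(J)=2$, and $0$ if $\mathrm{ht}(J)\ge3$. Bourbaki degree: $\mathrm{Syz}(J)\subseteq R^3$ carries the standard grading, $e=\mathrm{indeg}(\mathrm{Syz}(J))$ is the least degree of a nonzero homogeneous syzygy (so $e=\delta_1$), and $\nu$ is a minimal generator of degree $e$. If $J$ is perfect of height two put $\mathrm{Bour}(J)=0$; otherwise $\mathrm{Syz}(J)/R\nu$ is isomorphic, up to shift, to an unmixed homogeneous ideal $I_\nu$ of height $2$ and $\mathrm{Bour}(J)=\deg(R/I_\nu)$. In all cases $\mathrm{Bour}(J)=d^2-ed+e^2-\deg(R/J)$. *)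

theory Defs
  imports
    "HOL-Library.Poly_Mapping"
    "HOL-Library.Extended_Nat"
    "HOL-Library.Cardinality"
    "HOL-Computational_Algebra.Polynomial"
    "Jordan_Normal_Form.Matrix_Kernel"
begin

text \<open>
  The ring \<open>R = k[x\<^sub>1, \<dots>, x\<^sub>n]\<close>, with the variables indexed by a finite, linearly ordered
  type \<open>'n\<close> (so \<open>n = CARD('n)\<close>). The order plays no role in the definitions; it makes the
  library's integral domain instance for polynomial mappings applicable.
\<close>

type_synonym ('n, 'k) mpoly = "('n \<Rightarrow>\<^sub>0 nat) \<Rightarrow>\<^sub>0 'k"

definition monom_degree :: "('n \<Rightarrow>\<^sub>0 nat) \<Rightarrow> nat" where
  "monom_degree m = (\<Sum>i\<in>Poly_Mapping.keys m. Poly_Mapping.lookup m i)"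

text \<open>
  Degrees of forms are integers, so that the entries of a graded matrix can be described without
  case distinctions: the only form of negative degree is \<open>0\<close>, and \<open>0\<close> is a form of every degree.
\<close>

definition form :: "int \<Rightarrow> ('n, 'k::zero) mpoly \<Rightarrow> bool" where
  "form d p \<longleftrightarrow> (\<forall>m\<in>Poly_Mapping.keys p. int (monom_degree m) = d)"

definition form_vec :: "int \<Rightarrow> ('n, 'k::zero) mpoly vec \<Rightarrow> bool" where
  "form_vec d v \<longleftrightarrow> (\<forall>i<dim_vec v. form d (v $ i))"


section \<open>Ideals, primes and height\<close>

text \<open>
  Ideals of \<open>'a\<close> are the subspaces of \<open>'a\<close> as a module over itself, and \<open>ring_ideal.span S\<close> is
  the ideal generated by \<open>S\<close>.
\<close>

global_interpretation ring_ideal: Modules.module "(*) :: 'a::comm_ring_1 \<Rightarrow> 'a \<Rightarrow> 'a"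
  by standard (simp_all add: algebra_simps)

definition prime_ideal :: "'a::comm_ring_1 set \<Rightarrow> bool" where
  "prime_ideal P \<longleftrightarrow> ring_ideal.subspace P \<and> 1 \<notin> P \<and> (\<forall>x y. x * y \<in> P \<longrightarrow> x \<in> P \<or> y \<in> P)"

definition prime_height :: "'a::comm_ring_1 set \<Rightarrow> enat" where
  "prime_height P = Sup {enat m | m. \<exists>C. (\<forall>i\<le>m. prime_ideal (C i)) \<and>
                                         (\<forall>i<m. C i \<subset> C (Suc i)) \<and> C m = P}"

definition height :: "'a::comm_ring_1 set \<Rightarrow> enat" where
  "height I = Inf (prime_height ` {P. prime_ideal P \<and> I \<subseteq> P})"

definition associated_prime :: "'a::comm_ring_1 set \<Rightarrow> 'a set \<Rightarrow> bool" where
  "associated_prime I P \<longleftrightarrow> prime_ideal P \<and> (\<exists>g. P = {r. r * g \<in> I})"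

definition unmixed :: "'a::comm_ring_1 set \<Rightarrow> bool" where
  "unmixed I \<longleftrightarrow> (\<forall>P. associated_prime I P \<longrightarrow> height P = height I)"

definition homogeneous_ideal :: "('n, 'k::comm_ring_1) mpoly set \<Rightarrow> bool" where
  "homogeneous_ideal I \<longleftrightarrow> ring_ideal.subspace I \<and> I = ring_ideal.span {p \<in> I. \<exists>d. form d p}"


section \<open>Hilbert polynomial and degree\<close>

definition mpoly_scale :: "'k::field \<Rightarrow> ('n, 'k) mpoly \<Rightarrow> ('n, 'k) mpoly" where
  "mpoly_scale c p = Poly_Mapping.single 0 c * p"

global_interpretation mpoly_vs:
  Vector_Spaces.vector_space "mpoly_scale :: 'k::field \<Rightarrow> ('n, 'k) mpoly \<Rightarrow> ('n, 'k) mpoly"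
  by standard
    (simp_all add: mpoly_scale_def distrib_left distrib_right single_add mult_single
      flip: mult.assoc)

text \<open>
  The Hilbert function \<open>dim\<^sub>k (R/I)\<^sub>d = dim\<^sub>k R\<^sub>d - dim\<^sub>k I\<^sub>d\<close> of \<open>R/I\<close>, for a homogeneous
  ideal \<open>I\<close>.
\<close>

definition hilbert_function :: "('n, 'k::field) mpoly set \<Rightarrow> nat \<Rightarrow> int" where
  "hilbert_function I d =
     int (mpoly_vs.dim {p :: ('n, 'k) mpoly. form (int d) p}) -
     int (mpoly_vs.dim {p \<in> I. form (int d) p})"

definition hilbert_poly :: "('n, 'k::field) mpoly set \<Rightarrow> rat poly" where
  "hilbert_poly I =
     (THE P. \<exists>d0. \<forall>d\<ge>d0. poly P (of_nat d) = of_int (hilbert_function I d))"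

text \<open>
  The multiplicity of \<open>R/I\<close>. The Hilbert polynomial has degree \<open>dim (R/I) - 1\<close>; it vanishes
  exactly when \<open>R/I\<close> has finite length, and then the multiplicity is this length.
\<close>

definition multiplicity :: "('n, 'k::field) mpoly set \<Rightarrow> rat" where
  "multiplicity I =
     (let P = hilbert_poly I in
      if P = 0 then \<Sum>d | hilbert_function I d \<noteq> 0. of_int (hilbert_function I d)
      else fact (Polynomial.degree P) * lead_coeff P)"

text \<open>
  The codimension-two degree \<open>deg (R/I)\<close>; it is meant for ideals of height at least two.
\<close>

definition codim2_degree :: "('n, 'k::field) mpoly set \<Rightarrow> rat" where
  "codim2_degree I = (if height I = 2 then multiplicity I else 0)"


section \<open>Graded free resolutions\<close>

text \<open>
  A graded free module \<open>R(-a\<^sub>0) \<oplus> \<dots> \<oplus> R(-a\<^sub>r)\<close> is given by the list \<open>[a\<^sub>0, \<dots>, a\<^sub>r]\<close>; its elements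
  are column vectors. The matrix of a homomorphism of degree \<open>0\<close> from \<open>\<Oplus>\<^sub>j R(-b\<^sub>j)\<close> to
  \<open>\<Oplus>\<^sub>i R(-a\<^sub>i)\<close> has forms of degree \<open>b\<^sub>j - a\<^sub>i\<close> as entries.
\<close>

definition graded_matrix :: "int list \<Rightarrow> int list \<Rightarrow> ('n, 'k::zero) mpoly mat \<Rightarrow> bool" where
  "graded_matrix a b M \<longleftrightarrow> M \<in> carrier_mat (length a) (length b) \<and>
     (\<forall>i<length a. \<forall>j<length b. form (b ! j - a ! i) (M $$ (i, j)))"

definition mat_image :: "'a::semiring_0 mat \<Rightarrow> 'a vec set" where
  "mat_image M = (\<lambda>v. M *\<^sub>v v) ` carrier_vec (dim_col M)"

text \<open>The \<open>i\<close>-th term of a complex, which is \<open>0\<close> beyond the length of the list.\<close>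

definition complex_term :: "int list list \<Rightarrow> nat \<Rightarrow> int list" where
  "complex_term F i = (if i < length F then F ! i else [])"

text \<open>
  \<open>0 \<rightarrow> F ! (l - 1) \<rightarrow> \<dots> \<rightarrow> F ! 1 \<rightarrow> F ! 0 \<rightarrow> J \<rightarrow> 0\<close> with \<open>l = length F\<close>. The matrix \<open>A 0\<close> is the
  augmentation, viewed as a map to \<open>R\<close>; \<open>A (Suc i)\<close> maps the term \<open>Suc i\<close> to the term \<open>i\<close>.
  Since the terms from \<open>l\<close> on are \<open>0\<close>, exactness includes injectivity of the leftmost map.
\<close>

definition graded_free_resolution ::
  "('n, 'k::comm_ring_1) mpoly set \<Rightarrow> int list list \<Rightarrow> (nat \<Rightarrow> ('n, 'k) mpoly mat) \<Rightarrow> bool" where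
  "graded_free_resolution J F A \<longleftrightarrow>
     graded_matrix [0] (complex_term F 0) (A 0) \<and>
     (\<forall>i. graded_matrix (complex_term F i) (complex_term F (Suc i)) (A (Suc i))) \<and>
     (\<lambda>v. v $ 0) ` mat_image (A 0) = J \<and>
     (\<forall>i. mat_kernel (A i) = mat_image (A (Suc i)))"

text \<open>Minimality: the entries of the differentials lie in the ideal \<open>(x\<^sub>1, \<dots>, x\<^sub>n)\<close>.\<close>

definition minimal_graded_free_resolution ::
  "('n, 'k::comm_ring_1) mpoly set \<Rightarrow> int list list \<Rightarrow> (nat \<Rightarrow> ('n, 'k) mpoly mat) \<Rightarrow> bool" where
  "minimal_graded_free_resolution J F A \<longleftrightarrow> graded_free_resolution J F A \<and>
     (\<forall>i. \<forall>p \<in> elements_mat (A (Suc i)). Poly_Mapping.lookup p 0 = 0)"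

text \<open>
  The projective dimension of \<open>R/J\<close>. A resolution of \<open>J\<close> with terms \<open>F ! 0, \<dots>, F ! (l - 1)\<close> gives
  one of \<open>R/J\<close> of length \<open>l = length F\<close> by appending \<open>R\<close> on the right. For homogeneous \<open>J\<close>, graded
  free resolutions by modules of finite rank compute the projective dimension.
\<close>

definition proj_dim_quotient :: "('n, 'k::comm_ring_1) mpoly set \<Rightarrow> enat" where
  "proj_dim_quotient J = Inf {enat (length F) | F. \<exists>A. graded_free_resolution J F A}"

text \<open>
  \<open>J\<close> is perfect if the projective dimension of \<open>R/J\<close> is the grade of \<open>J\<close>, which is the height of
  \<open>J\<close> because polynomial rings over fields are Cohen-Macaulay.
\<close>

definition perfect_of_height_two :: "('n, 'k::comm_ring_1) mpoly set \<Rightarrow> bool" where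
  "perfect_of_height_two J \<longleftrightarrow> height J = 2 \<and> proj_dim_quotient J = height J"


section \<open>Ideals generated by three forms and their Bourbaki degree\<close>

definition minimally_generated_by_three_forms ::
  "('n, 'k::comm_ring_1) mpoly set \<Rightarrow> nat \<Rightarrow> ('n, 'k) mpoly vec \<Rightarrow> bool" where
  "minimally_generated_by_three_forms J d f \<longleftrightarrow>
     f \<in> carrier_vec 3 \<and> form_vec (int d) f \<and>
     J = ring_ideal.span {f $ j | j. j < 3} \<and>
     (\<forall>i<3. f $ i \<notin> ring_ideal.span {f $ j | j. j < 3 \<and> j \<noteq> i})"

definition Syz :: "'a::comm_ring_1 vec \<Rightarrow> 'a vec set" where
  "Syz f = {v \<in> carrier_vec (dim_vec f). f \<bullet> v = 0}"

definition indeg_Syz :: "('n, 'k::comm_ring_1) mpoly vec \<Rightarrow> nat" where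
  "indeg_Syz f = (LEAST e. \<exists>v \<in> Syz f. v \<noteq> 0\<^sub>v (dim_vec f) \<and> form_vec (int e) v)"

text \<open>
  A nonzero homogeneous syzygy of the least possible degree. By the choice of the degree it does
  not lie in \<open>(x\<^sub>1, \<dots>, x\<^sub>n) Syz f\<close>, that is, it is a minimal generator.
\<close>

definition initial_syzygy :: "('n, 'k::comm_ring_1) mpoly vec \<Rightarrow> ('n, 'k) mpoly vec \<Rightarrow> bool" where
  "initial_syzygy f v \<longleftrightarrow> v \<in> Syz f \<and> v \<noteq> 0\<^sub>v (dim_vec f) \<and> form_vec (int (indeg_Syz f)) v"

text \<open>
  \<open>Syz f / R v\<close> is isomorphic to \<open>I\<close> up to a shift \<open>s\<close> of the grading. The isomorphism is given
  by the homomorphism \<open>h\<close> from \<open>Syz f\<close> onto \<open>I\<close> with kernel \<open>R v\<close> which induces it.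
\<close>

definition syz_quotient_iso ::
  "('n, 'k::comm_ring_1) mpoly vec \<Rightarrow> ('n, 'k) mpoly vec \<Rightarrow> ('n, 'k) mpoly set \<Rightarrow> bool" where
  "syz_quotient_iso f v I \<longleftrightarrow> (\<exists>h s.
     (\<forall>u \<in> Syz f. \<forall>w \<in> Syz f. h (u + w) = h u + h w) \<and>
     (\<forall>r. \<forall>u \<in> Syz f. h (r \<cdot>\<^sub>v u) = r * h u) \<and>
     (\<forall>d. \<forall>u \<in> Syz f. form_vec d u \<longrightarrow> form (d + s) (h u)) \<and>
     h ` Syz f = I \<and>
     {u \<in> Syz f. h u = 0} = {r \<cdot>\<^sub>v v | r. True})"

definition bourbaki_degree :: "('n, 'k::field) mpoly set \<Rightarrow> rat" where
  "bourbaki_degree J =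
     (if perfect_of_height_two J then 0
      else THE b. \<exists>d f v I. minimally_generated_by_three_forms J d f \<and> initial_syzygy f v \<and>
             homogeneous_ideal I \<and> unmixed I \<and> height I = 2 \<and> syz_quotient_iso f v I \<and>
             b = codim2_degree I)"

end

theory Submission
  imports Defs "HOL-Library.Product_Plus"
begin

text \<open>
  Write the resolution as \<open>0 \<rightarrow> R \<rightarrow> R\<^sup>3 \<rightarrow> R\<^sup>3 \<rightarrow> R\<close> with maps \<open>c\<close>, \<open>A\<close>, \<open>f\<close>. As in the
  Buchsbaum-Eisenbud criterion, every row of \<open>A\<close> is a cross product \<open>p \<times> c\<close> of \<open>c\<close> with a vector of
  forms of degrees \<open>3 - \<delta>\<^sub>i\<close>. If \<open>\<delta>\<^sub>3 > 3\<close>, the last entries of all these vectors vanish, which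
  contradicts exactness; so \<open>\<delta>\<^sub>3 \<le> 3\<close>, and as the last entry of \<open>c\<close> has degree
  \<open>\<delta>\<^sub>1 + \<delta>\<^sub>2 - 3 \<ge> 1\<close>, only five vectors remain. The Hilbert function of \<open>R/J\<close> is read off the
  resolution; its degree in codimension two is \<open>3 (\<delta>\<^sub>1 + \<delta>\<^sub>2 + \<delta>\<^sub>3) - (\<delta>\<^sub>1 \<delta>\<^sub>2 + \<delta>\<^sub>1 \<delta>\<^sub>3 + \<delta>\<^sub>2 \<delta>\<^sub>3)\<close>,
  which vanishes only for \<open>(3, 3, 3)\<close>, where \<open>J\<close> contains the regular sequence formed by the
  entries of \<open>c\<close>.

  A minimal resolution with three terms rules out perfection. If \<open>\<nu>\<close> is the first column of \<open>A\<close>,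
  then \<open>Syz(J)/R\<nu>\<close> is isomorphic to the complete intersection generated by the last two entries of
  \<open>c\<close>, which has degree \<open>(\<delta>\<^sub>1 + \<delta>\<^sub>2 - 3) (\<delta>\<^sub>1 + \<delta>\<^sub>3 - 3)\<close>; any other choice of generators and of
  the initial syzygy gives an ideal of height two with the same Hilbert function up to a shift,
  hence with the same degree.

  Conversely, if \<open>c\<close> consists of powers of three variables, multiplying the rows of the Koszul
  matrix of \<open>c\<close> by suitable powers of variables gives a resolution for each of the five vectors.
\<close>

(* For the module of a ring over itself this is associativity, oriented against mult.assoc. *)
declare ring_ideal.scale_scale [simp del]

text \<open>Heights are defined by chains of primes and degrees by Hilbert polynomials, and the two
  must be linked. A lower bound for a height comes from a regular sequence: a nonzerodivisor modulo
  an ideal lies in no minimal prime over it, so a prime containing the whole sequence has a smaller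
  one below it at every stage. An upper bound comes from the Hilbert polynomial: if it has degree r,
  then some r + 1 variables are independent modulo the ideal. A prime avoiding all nonzero
  polynomials in these variables carries only chains of length at most n - r - 1, since each step of
  a chain contributes one more algebraically independent element and R has room for n of them.

  Hilbert polynomials are sums of w * H(X - a) over the twists a of a free resolution, where H
  belongs to R itself. Their top coefficients depend only on the sums of w, w * a and w * a^2. If
  the first two vanish, half of the third is the degree in codimension two; this is the origin of
  the quadratic expressions in the shifts.\<close>

abbreviation "keys \<equiv> Poly_Mapping.keys"
abbreviation "lookup \<equiv> Poly_Mapping.lookup"
abbreviation "single \<equiv> Poly_Mapping.single"

section \<open>Forms and homogeneous components\<close>

lemma monom_degree_superset:
  assumes "finite S" "keys m \<subseteq> S"
  shows "monom_degree m = (\<Sum>i\<in>S. lookup m i)"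
  unfolding monom_degree_def using assms
  by (intro sum.mono_neutral_left) (auto simp: in_keys_iff)

lemma monom_degree_add [simp]: "monom_degree (m + u) = monom_degree m + monom_degree u"
proof -
  let ?S = "keys m \<union> keys u"
  have "monom_degree (m + u) = (\<Sum>i\<in>?S. lookup (m + u) i)"
    using keys_add[of m u] by (intro monom_degree_superset) auto
  also have "\<dots> = monom_degree m + monom_degree u"
    by (simp add: lookup_add sum.distrib monom_degree_superset[of ?S])
  finally show ?thesis .
qed

lemma monom_degree_0 [simp]: "monom_degree 0 = 0"
  by (simp add: monom_degree_def)

lemma monom_degree_single [simp]: "monom_degree (single i n) = n"
  by (simp add: monom_degree_def)

lemma monom_degree_eq_0_iff [simp]: "monom_degree m = 0 \<longleftrightarrow> m = 0"
  by (auto simp: monom_degree_def intro!: poly_mapping_eqI) (metis in_keys_iff)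

lemma lookup_le_monom_degree: "lookup m i \<le> monom_degree m"
  unfolding monom_degree_def
  by (cases "i \<in> keys m") (auto simp: in_keys_iff member_le_sum)

lemma monom_add_eq_0_iff [simp]: "(m :: 'n \<Rightarrow>\<^sub>0 nat) + u = 0 \<longleftrightarrow> m = 0 \<and> u = 0"
  by (metis add_is_0 monom_degree_add monom_degree_eq_0_iff add.right_neutral)

lemma lookup_single_mult:
  fixes p :: "'a :: cancel_comm_monoid_add \<Rightarrow>\<^sub>0 'b :: comm_semiring_1"
  shows "lookup (single u c * p) (u + m) = c * lookup p m"
proof -
  have "lookup (single u c * p) (u + m) = Sum_any (\<lambda>l. (c * lookup p m) when l = u)"
    unfolding lookup_mult by (rule Sum_any.cong) (auto simp: lookup_single when_def)
  then show ?thesis by simp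
qed

lemma keys_single_mult:
  fixes p :: "'a :: cancel_comm_monoid_add \<Rightarrow>\<^sub>0 'b :: idom"
  assumes "c \<noteq> 0"
  shows "keys (single u c * p) = (+) u ` keys p"
proof
  show "keys (single u c * p) \<subseteq> (+) u ` keys p"
    using keys_mult[of "single u c" p] assms by auto
  show "(+) u ` keys p \<subseteq> keys (single u c * p)"
    using assms by (auto simp: in_keys_iff lookup_single_mult)
qed

lemma poly_mapping_sum_monomials: "p = (\<Sum>m\<in>keys p. single m (lookup p m))"
proof (rule poly_mapping_eqI)
  fix k
  have "(\<Sum>m\<in>keys p. lookup (single m (lookup p m)) k) = (\<Sum>m\<in>keys p. if m = k then lookup p k else 0)"
    by (intro sum.cong) (auto simp: lookup_single when_def)
  then show "lookup p k = lookup (\<Sum>m\<in>keys p. single m (lookup p m)) k"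
    by (simp add: lookup_sum in_keys_iff)
qed

text \<open>One truncation operator serves homogeneous components, splitting by the exponent of a
  variable, and extracting the monomials divisible by a power of a variable.\<close>

definition restrict_keys :: "'a set \<Rightarrow> ('a \<Rightarrow>\<^sub>0 'b) \<Rightarrow> ('a \<Rightarrow>\<^sub>0 'b::zero)" where
  "restrict_keys S p = Abs_poly_mapping (\<lambda>m. lookup p m when m \<in> S)"

lemma lookup_restrict_keys: "lookup (restrict_keys S p) m = (lookup p m when m \<in> S)"
proof -
  have "finite {m. (lookup p m when m \<in> S) \<noteq> 0}"
    by (rule finite_subset[OF _ finite_keys[of p]]) (auto simp: in_keys_iff)
  then show ?thesis by (simp add: restrict_keys_def)
qed

lemma keys_restrict_keys: "keys (restrict_keys S p) = keys p \<inter> S"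
  by (auto simp: in_keys_iff lookup_restrict_keys)

lemma restrict_keys_add: "restrict_keys S (p + q) = restrict_keys S p + restrict_keys S (q :: 'a \<Rightarrow>\<^sub>0 'b :: monoid_add)"
  by (rule poly_mapping_eqI) (simp add: lookup_restrict_keys lookup_add when_def)

lemma restrict_keys_id: "keys p \<subseteq> S \<Longrightarrow> restrict_keys S p = p"
  by (rule poly_mapping_eqI) (auto simp: lookup_restrict_keys when_def in_keys_iff)

lemma restrict_keys_0: "keys p \<inter> S = {} \<Longrightarrow> restrict_keys S p = 0"
  by (rule poly_mapping_eqI) (auto simp: lookup_restrict_keys when_def in_keys_iff)

lemma form_0 [simp]: "form d 0"
  by (simp add: form_def)

lemma form_add: "form d p \<Longrightarrow> form d q \<Longrightarrow> form d (p + q)"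
  unfolding form_def using keys_add[of p q] by blast

lemma form_uminus [simp]: "form d (- p) \<longleftrightarrow> form d (p :: ('n, 'k::ab_group_add) mpoly)"
  by (auto simp: form_def in_keys_iff)

lemma form_diff: "form d p \<Longrightarrow> form d q \<Longrightarrow> form d (p - q :: ('n, 'k::ab_group_add) mpoly)"
  using form_add[of d p "- q"] by simp

lemma form_mult: "form d p \<Longrightarrow> form e q \<Longrightarrow> form (d + e) (p * q)"
  unfolding form_def using keys_mult[of p q] by fastforce

lemma form_mult': "form d p \<Longrightarrow> form e q \<Longrightarrow> d + e = b \<Longrightarrow> form b (p * q)"
  using form_mult by blast

lemma form_single: "form d (single m c) \<longleftrightarrow> c = 0 \<or> int (monom_degree m) = d"
  by (simp add: form_def)

lemma form_negative: "form d p \<Longrightarrow> d < 0 \<Longrightarrow> p = 0"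
  unfolding form_def by (metis of_nat_less_0_iff keys_eq_empty equals0I)

lemma form_mult_single_0: "form d p \<Longrightarrow> form d (single 0 c * p)"
  using form_mult[of 0 "single 0 c" d p] by (simp add: form_single)

definition hom_component :: "int \<Rightarrow> ('n, 'k::zero) mpoly \<Rightarrow> ('n, 'k) mpoly" where
  "hom_component d = restrict_keys {m. int (monom_degree m) = d}"

lemma form_hom_component [simp]: "form d (hom_component d p)"
  by (simp add: form_def hom_component_def keys_restrict_keys)

lemma hom_component_form: "form e p \<Longrightarrow> hom_component d p = (if d = e then p else 0)"
  by (auto simp: form_def hom_component_def intro: restrict_keys_id restrict_keys_0)

lemma hom_component_0 [simp]: "hom_component d 0 = 0"
  by (simp add: hom_component_def restrict_keys_0)

lemma hom_component_add: "hom_component d (p + q) = hom_component d p + hom_component d (q :: ('n, 'k::monoid_add) mpoly)"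
  by (simp add: hom_component_def restrict_keys_add)

lemma hom_component_sum: "hom_component d (sum f A) = (\<Sum>i\<in>A. hom_component d (f i :: ('n, 'k::comm_monoid_add) mpoly))"
  by (induction A rule: infinite_finite_induct) (auto simp: hom_component_add)

lemma hom_component_uminus: "hom_component d (- p) = - hom_component d (p :: ('n, 'k::ab_group_add) mpoly)"
  by (rule poly_mapping_eqI) (simp add: hom_component_def lookup_restrict_keys when_def)

lemma hom_component_diff: "hom_component d (p - q) = hom_component d p - hom_component d (q :: ('n, 'k::ab_group_add) mpoly)"
  using hom_component_add[of d p "- q"] by (simp add: hom_component_uminus)

definition degree_support :: "('n, 'k::zero) mpoly \<Rightarrow> int set" where
  "degree_support p = (int \<circ> monom_degree) ` keys p"

lemma finite_degree_support [simp]: "finite (degree_support p)"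
  by (simp add: degree_support_def)

lemma sum_hom_components:
  fixes p :: "('n, 'k::comm_monoid_add) mpoly"
  assumes "finite D" "degree_support p \<subseteq> D"
  shows "(\<Sum>d\<in>D. hom_component d p) = p"
proof (rule poly_mapping_eqI)
  fix m
  have "(\<Sum>d\<in>D. lookup (hom_component d p) m) = (\<Sum>d\<in>D. if d = int (monom_degree m) then lookup p m else 0)"
    by (intro sum.cong) (auto simp: hom_component_def lookup_restrict_keys when_def)
  also have "\<dots> = lookup p m"
    using assms by (auto simp: degree_support_def in_keys_iff image_subset_iff)
  finally show "lookup (\<Sum>d\<in>D. hom_component d p) m = lookup p m"
    by (simp add: lookup_sum)
qed

lemma hom_component_eqI:
  fixes p q :: "('n, 'k::comm_monoid_add) mpoly"
  assumes "\<And>d. hom_component d p = hom_component d q"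
  shows "p = q"
proof -
  let ?D = "degree_support p \<union> degree_support q"
  have "p = (\<Sum>d\<in>?D. hom_component d p)" by (simp add: sum_hom_components)
  also have "\<dots> = (\<Sum>d\<in>?D. hom_component d q)" by (simp add: assms)
  also have "\<dots> = q" by (simp add: sum_hom_components)
  finally show ?thesis .
qed

text \<open>Multiplication by a form shifts all homogeneous components by its degree
  \<open>e\<close>, so only the component of \<open>p\<close> in degree \<open>d - e\<close> reaches
  degree \<open>d\<close>.\<close>

lemma hom_component_mult_form:
  fixes f p :: "('n, 'k::comm_semiring_1) mpoly"
  assumes "form e f"
  shows "hom_component d (f * p) = f * hom_component (d - e) p"
proof -
  let ?D = "insert (d - e) (degree_support p)"
  have "hom_component d (f * p) = hom_component d (\<Sum>j\<in>?D. f * hom_component j p)"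
    by (simp only: sum_hom_components[of ?D p] finite_insert finite_degree_support subset_insertI simp_thms flip: sum_distrib_left)
  also have "\<dots> = (\<Sum>j\<in>?D. hom_component d (f * hom_component j p))"
    by (simp only: hom_component_sum)
  also have "\<dots> = (\<Sum>j\<in>?D. if j = d - e then f * hom_component (d - e) p else 0)"
    by (intro sum.cong refl) (subst hom_component_form[OF form_mult[OF assms form_hom_component]], auto)
  also have "\<dots> = f * hom_component (d - e) p" by (subst sum.delta) auto
  finally show ?thesis .
qed

lemma hom_component_mult_form': 
  fixes f p :: "('n, 'k::comm_semiring_1) mpoly"
  assumes "form e f"
  shows "hom_component d (p * f) = hom_component (d - e) p * f"
  using hom_component_mult_form[OF assms, of d p] by (simp add: mult.commute)

text \<open>Since \<open>p\<close> is homogeneous, the component of \<open>r\<close> in degree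
  \<open>j\<close> times \<open>p\<close> is the component of \<open>r * p\<close> in degree
  \<open>j + e\<close>. After cancelling \<open>p\<close>, only \<open>j = d - e\<close> survives.
  This gives the degrees of coefficients, for instance of multiples of a homogeneous syzygy.\<close>

lemma form_cancel:
  fixes p q :: "('n::linorder, 'k::idom) mpoly"
  assumes "form d (r * p)" "form e p" "p \<noteq> 0"
  shows "form (d - e) r"
proof -
  have "hom_component j r = hom_component j (hom_component (d - e) r)" for j
  proof -
    have "hom_component j r * p = hom_component (j + e) (r * p)"
      using hom_component_mult_form'[OF assms(2), of "j + e" r] by simp
    also have "\<dots> = (if j = d - e then r * p else 0)"
      using hom_component_form[OF assms(1), of "j + e"] by auto
    finally have *: "hom_component j r * p = (if j = d - e then r * p else 0)" .
    show ?thesis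
      using * assms(3) by (cases "j = d - e") (auto simp: hom_component_form[OF form_hom_component])
  qed
  then have "r = hom_component (d - e) r" by (rule hom_component_eqI)
  then show ?thesis using form_hom_component by metis
qed

text \<open>Exponents are natural numbers, so \<open>0\<close> splits only as \<open>0 + 0\<close>.
  The constant term is thus a ring homomorphism, namely the residue map modulo the ideal of the
  variables, through which minimality of a resolution is expressed.\<close>

lemma lookup_0_mult: "lookup (p * q) 0 = lookup p 0 * lookup (q :: ('n, 'k::comm_semiring_1) mpoly) 0"
proof -
  have "lookup (p * q) 0 = Sum_any (\<lambda>l. lookup p 0 * lookup q 0 when l = (0 :: 'n \<Rightarrow>\<^sub>0 nat))"
    unfolding lookup_mult
  proof (rule Sum_any.cong)
    fix l :: "'n \<Rightarrow>\<^sub>0 nat"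
    have "(0 = l + u) = (l = 0 \<and> u = 0)" for u
      by (metis monom_add_eq_0_iff)
    then have "Sum_any (\<lambda>u. lookup q u when 0 = l + u) = Sum_any (\<lambda>u. (lookup q 0 when l = 0) when u = (0 :: 'n \<Rightarrow>\<^sub>0 nat))"
      by (intro Sum_any.cong) (auto simp: when_def)
    then show "lookup p l * Sum_any (\<lambda>u. lookup q u when 0 = l + u) = (lookup p 0 * lookup q 0 when l = 0)"
      by (auto simp: when_def)
  qed
  then show ?thesis by simp
qed

lemma lookup_0_form: "form d p \<Longrightarrow> d \<noteq> 0 \<Longrightarrow> lookup p 0 = 0"
  unfolding form_def by (metis in_keys_iff monom_degree_0 of_nat_0)

lemma form_0_eq: "form 0 p \<Longrightarrow> p = single 0 (lookup p 0)"
  by (rule poly_mapping_eqI) (auto simp: form_def in_keys_iff lookup_single when_def)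

section \<open>Prime ideals and height\<close>

text \<open>Krull's argument: an ideal that is maximal among those containing \<open>I\<close> and
  disjoint from the multiplicative set \<open>M\<close> is prime.\<close>

lemma exists_prime_avoiding:
  fixes I M :: "'a::comm_ring_1 set"
  assumes I: "ring_ideal.subspace I" and M: "1 \<in> M" "\<And>x y. x \<in> M \<Longrightarrow> y \<in> M \<Longrightarrow> x * y \<in> M"
    and disj: "I \<inter> M = {}"
  obtains P where "prime_ideal P" "I \<subseteq> P" "P \<inter> M = {}"
proof -
  define \<A> where "\<A> = {K. ring_ideal.subspace K \<and> I \<subseteq> K \<and> K \<inter> M = {}}"
  have "\<exists>P\<in>\<A>. \<forall>X\<in>\<A>. P \<subseteq> X \<longrightarrow> X = P"
  proof (rule subset_Zorn_nonempty)
    show "\<A> \<noteq> {}" using I disj by (auto simp: \<A>_def)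
    fix C assume C: "C \<noteq> {}" "subset.chain \<A> C"
    obtain K0 where "K0 \<in> C" "K0 \<in> \<A>" using C by (auto simp: subset_chain_def)
    then have K0: "K0 \<in> C" "ring_ideal.subspace K0" "I \<subseteq> K0" by (auto simp: \<A>_def)
    have "ring_ideal.subspace (\<Union>C)"
    proof (rule ring_ideal.subspaceI)
      show "0 \<in> \<Union>C" using K0 ring_ideal.subspace_0 by blast
      fix x y assume "x \<in> \<Union>C" "y \<in> \<Union>C"
      then obtain K L where KL: "K \<in> C" "L \<in> C" "x \<in> K" "y \<in> L" by auto
      then have "K \<subseteq> L \<or> L \<subseteq> K" using C(2) by (auto simp: subset_chain_def)
      then obtain N where N: "N \<in> C" "x \<in> N" "y \<in> N" using KL by blast
      then have "ring_ideal.subspace N" using C(2) by (auto simp: \<A>_def subset_chain_def)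
      from ring_ideal.subspace_add[OF this N(2,3)] show "x + y \<in> \<Union>C" using N(1) by auto
    next
      fix c x assume "x \<in> \<Union>C"
      then obtain N where N: "N \<in> C" "x \<in> N" by blast
      then have "ring_ideal.subspace N" using C(2) by (auto simp: \<A>_def subset_chain_def)
      from ring_ideal.subspace_scale[OF this N(2)] show "c * x \<in> \<Union>C" using N(1) by auto
    qed
    moreover have "I \<subseteq> \<Union>C" using K0 by auto
    moreover have "\<Union>C \<inter> M = {}" using C(2) by (auto simp: \<A>_def subset_chain_def)
    ultimately show "\<Union>C \<in> \<A>" by (simp add: \<A>_def)
  qed
  then obtain P where P: "ring_ideal.subspace P" "I \<subseteq> P" "P \<inter> M = {}"
    and max: "\<And>X. X \<in> \<A> \<Longrightarrow> P \<subseteq> X \<Longrightarrow> X = P"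
    by (auto simp: \<A>_def)
  \<comment> \<open>By maximality of \<open>P\<close>, the larger ideal \<open>P + (x)\<close> has
    to meet \<open>M\<close>.\<close>
  have meets: "\<exists>p\<in>P. \<exists>r. p + r * x \<in> M" if x: "x \<notin> P" for x
  proof (rule ccontr)
    assume neg: "\<not> ?thesis"
    let ?X = "{p + r * x | p r. p \<in> P}"
    have "ring_ideal.subspace ?X"
    proof (rule ring_ideal.subspaceI)
      have "\<exists>p r. 0 = p + r * x \<and> p \<in> P"
        by (rule exI[of _ 0], rule exI[of _ 0]) (simp add: ring_ideal.subspace_0[OF P(1)])
      then show "0 \<in> ?X" by simp
      fix a b assume "a \<in> ?X" "b \<in> ?X"
      then obtain p q r t where "a = p + r * x" "b = q + t * x" "p \<in> P" "q \<in> P" by auto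
      then have "a + b = (p + q) + (r + t) * x" "p + q \<in> P"
        using ring_ideal.subspace_add[OF P(1)] by (auto simp: algebra_simps)
      then show "a + b \<in> ?X" by blast
    next
      fix c a assume "a \<in> ?X"
      then obtain p r where "a = p + r * x" "p \<in> P" by auto
      then have "c * a = c * p + (c * r) * x" "c * p \<in> P"
        using ring_ideal.subspace_scale[OF P(1), of p c] by (auto simp: distrib_left mult.assoc)
      then show "c * a \<in> ?X" by blast
    qed
    moreover have sub: "P \<subseteq> ?X"
    proof
      fix p assume "p \<in> P"
      then have "\<exists>q r. p = q + r * x \<and> q \<in> P"
        by (intro exI[of _ p] exI[of _ 0]) simp
      then show "p \<in> ?X" by simp
    qed
    moreover have "?X \<inter> M = {}" using neg by blast
    ultimately have "?X \<in> \<A>" using P(2) unfolding \<A>_def by blast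
    then have "?X = P" using sub by (rule max)
    moreover have "\<exists>p r. x = p + r * x \<and> p \<in> P"
      by (rule exI[of _ 0], rule exI[of _ 1]) (simp add: ring_ideal.subspace_0[OF P(1)])
    then have "x \<in> ?X" by simp
    ultimately show False using x by blast
  qed
  have "prime_ideal P"
    unfolding prime_ideal_def
  proof (intro conjI allI impI)
    show "1 \<notin> P" using P(3) M(1) by auto
    fix x y assume xy: "x * y \<in> P"
    show "x \<in> P \<or> y \<in> P"
    proof (rule ccontr)
      assume "\<not> ?thesis"
      then have "\<exists>p\<in>P. \<exists>r. p + r * x \<in> M" "\<exists>p\<in>P. \<exists>r. p + r * y \<in> M"
        by (simp_all add: meets)
      then obtain p r q t where *: "p \<in> P" "p + r * x \<in> M" "q \<in> P" "q + t * y \<in> M"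
        by blast
      have "(p + r * x) * (q + t * y) = (q + t * y) * p + (r * x) * q + (r * t) * (x * y)"
        by (simp add: algebra_simps)
      also have "\<dots> \<in> P"
        by (intro ring_ideal.subspace_add[OF P(1)] ring_ideal.subspace_scale[OF P(1)] *(1,3) xy)
      finally show False using M(2)[OF *(2,4)] P(3) by auto
    qed
  qed (fact P)
  with P that show thesis by blast
qed

lemma ideal_add_cancel_right:
  assumes "ring_ideal.subspace I" "b \<in> I" "a + b \<in> I"
  shows "a \<in> I"
  using ring_ideal.subspace_diff[OF assms(1,3,2)] by simp

lemma prime_ideal_subspace: "prime_ideal P \<Longrightarrow> ring_ideal.subspace P"
  by (simp add: prime_ideal_def)

lemma prime_ideal_multD: "prime_ideal P \<Longrightarrow> x * y \<in> P \<Longrightarrow> x \<in> P \<or> y \<in> P"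
  by (simp add: prime_ideal_def)

text \<open>Localisation in disguise: products of a power of \<open>x\<close> with an element
  outside \<open>Q\<close> avoid \<open>I\<close>, because \<open>x\<close> is a nonzerodivisor
  modulo \<open>I\<close>. A prime avoiding them is contained in \<open>Q\<close> (exponent
  \<open>0\<close>) and misses \<open>x\<close> (cofactor \<open>1\<close>).\<close>

lemma prime_below:
  fixes I Q :: "'a::comm_ring_1 set"
  assumes I: "ring_ideal.subspace I" "I \<subseteq> Q" and Q: "prime_ideal Q" and x: "x \<in> Q"
    and nzd: "\<And>z. x * z \<in> I \<Longrightarrow> z \<in> I"
  obtains P where "prime_ideal P" "I \<subseteq> P" "P \<subset> Q"
proof -
  define M where "M = {t * x ^ n | t n. t \<notin> Q}"
  have one: "1 \<notin> Q" using Q by (simp add: prime_ideal_def)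
  have mem: "t * x ^ n \<in> I \<Longrightarrow> t \<in> I" for t n
  proof (induction n)
    case (Suc n)
    have "x * (t * x ^ n) \<in> I" using Suc.prems by (simp add: mult.left_commute mult.assoc)
    then show ?case by (rule Suc.IH[OF nzd])
  qed simp
  have MI: "t * x ^ n \<in> M" if "t \<notin> Q" for t n
    using that unfolding M_def by blast
  have M1: "1 \<in> M" using MI[OF one, of 0] by simp
  have M2: "a * b \<in> M" if ab: "a \<in> M" "b \<in> M" for a b
  proof -
    obtain t n where t: "a = t * x ^ n" "t \<notin> Q" using ab(1) unfolding M_def by blast
    obtain u m where u: "b = u * x ^ m" "u \<notin> Q" using ab(2) unfolding M_def by blast
    have tu: "t * u \<notin> Q" using Q t(2) u(2) unfolding prime_ideal_def by blast
    note ab' = t(1) u(1)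
    from MI[OF tu, of "n + m"] show ?thesis unfolding ab' by (simp add: power_add mult_ac)
  qed
  have disj: "I \<inter> M = {}"
  proof (rule equals0I)
    fix a assume "a \<in> I \<inter> M"
    then obtain t n where "t * x ^ n \<in> I" "t \<notin> Q" unfolding M_def by blast
    with mem[of t n] I(2) show False by blast
  qed
  obtain P where P: "prime_ideal P" "I \<subseteq> P" "P \<inter> M = {}"
    by (rule exists_prime_avoiding[OF I(1) M1 M2 disj])
  have "P \<subseteq> Q"
  proof
    fix p assume "p \<in> P"
    then have "p \<notin> M" using P(3) by auto
    then show "p \<in> Q" using MI[of p 0] by auto
  qed
  moreover have "x \<in> M" using MI[OF one, of 1] by simp
  then have "x \<notin> P" using P(3) by auto
  ultimately have "P \<subset> Q" using x by auto
  with P(1,2) show thesis by (rule that)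
qed

section \<open>Chains of primes and bounds for the height\<close>

definition prime_chain :: "nat \<Rightarrow> 'a::comm_ring_1 set \<Rightarrow> bool" where
  "prime_chain m P \<longleftrightarrow> (\<exists>C. (\<forall>i\<le>m. prime_ideal (C i)) \<and> (\<forall>i<m. C i \<subset> C (Suc i)) \<and> C m = P)"

lemma prime_chain_0: "prime_ideal P \<Longrightarrow> prime_chain 0 P"
  by (auto simp: prime_chain_def)

lemma prime_chain_prime: "prime_chain m P \<Longrightarrow> prime_ideal P"
  by (auto simp: prime_chain_def)

lemma prime_chain_Suc_iff:
  "prime_chain (Suc m) Q \<longleftrightarrow> prime_ideal Q \<and> (\<exists>P. P \<subset> Q \<and> prime_chain m P)"
proof
  assume "prime_chain (Suc m) Q"
  then obtain C where C: "\<forall>i\<le>Suc m. prime_ideal (C i)" "\<forall>i<Suc m. C i \<subset> C (Suc i)" "C (Suc m) = Q"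
    by (auto simp: prime_chain_def)
  then have "\<forall>i\<le>m. prime_ideal (C i)" "\<forall>i<m. C i \<subset> C (Suc i)" "C m \<subset> Q"
    using C(2)[rule_format, of m] by simp_all
  then have "prime_chain m (C m)" "C m \<subset> Q" unfolding prime_chain_def by blast+
  then show "prime_ideal Q \<and> (\<exists>P. P \<subset> Q \<and> prime_chain m P)" using C by auto
next
  assume "prime_ideal Q \<and> (\<exists>P. P \<subset> Q \<and> prime_chain m P)"
  then obtain C where C: "prime_ideal Q" "\<forall>i\<le>m. prime_ideal (C i)" "\<forall>i<m. C i \<subset> C (Suc i)" "C m \<subset> Q"
    by (auto simp: prime_chain_def)
  have "(\<forall>i\<le>Suc m. prime_ideal ((C(Suc m := Q)) i)) \<and> 
    (\<forall>i<Suc m. (C(Suc m := Q)) i \<subset> (C(Suc m := Q)) (Suc i)) \<and> (C(Suc m := Q)) (Suc m) = Q"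
    using C by (simp add: less_Suc_eq le_Suc_eq)
  then show "prime_chain (Suc m) Q" unfolding prime_chain_def by blast
qed

lemma prime_height_eq: "prime_height P = Sup {enat m | m. prime_chain m P}"
  by (simp add: prime_height_def prime_chain_def)

lemma height_ge:
  assumes "\<And>P. prime_ideal P \<Longrightarrow> I \<subseteq> P \<Longrightarrow> prime_chain m P"
  shows "enat m \<le> height I"
  unfolding height_def
proof (rule Inf_greatest)
  fix h assume "h \<in> prime_height ` {P. prime_ideal P \<and> I \<subseteq> P}"
  then show "enat m \<le> h" using assms by (auto simp: prime_height_eq intro!: Sup_upper)
qed

lemma height_le:
  assumes "prime_ideal P" "I \<subseteq> P" "\<And>l. prime_chain l P \<Longrightarrow> l \<le> m"
  shows "height I \<le> enat m"
proof -
  have "height I \<le> prime_height P" using assms(1,2) by (auto simp: height_def intro: Inf_lower)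
  also have "\<dots> \<le> enat m" using assms(3) by (auto simp: prime_height_eq intro!: Sup_least)
  finally show ?thesis .
qed

lemma prime_chain_1:
  fixes Q :: "'a::idom set"
  assumes "prime_ideal Q" "x \<in> Q" "x \<noteq> 0"
  shows "prime_chain 1 Q"
proof -
  have "prime_ideal ({0} :: 'a set)" by (auto simp: prime_ideal_def)
  moreover have "{0} \<subset> Q" using assms by (auto simp: prime_ideal_def ring_ideal.subspace_0)
  ultimately have "prime_chain (Suc 0) Q" 
    using assms(1) prime_chain_0 unfolding prime_chain_Suc_iff by blast
  then show ?thesis by simp
qed

text \<open>The hypothesis \<open>nzd\<close> says that \<open>y\<close> is a nonzerodivisor modulo
  \<open>(x)\<close>, so some prime over \<open>(x)\<close> lies strictly below \<open>Q\<close>; it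
  contains the nonzero element \<open>x\<close>, and \<open>{0}\<close> continues the chain.\<close>

lemma prime_chain_2:
  fixes Q :: "'a::idom set"
  assumes Q: "prime_ideal Q" "x \<in> Q" "y \<in> Q" and "x \<noteq> 0" 
    and nzd: "\<And>z w. y * z = x * w \<Longrightarrow> x dvd z"
  shows "prime_chain 2 Q"
proof -
  let ?I = "ring_ideal.span {x}"
  have I: "?I = {w * x | w. True}" by (auto simp: ring_ideal.span_singleton)
  have "?I \<subseteq> Q" using Q by (intro ring_ideal.span_minimal) (auto simp: prime_ideal_def)
  moreover have "z \<in> ?I" if "y * z \<in> ?I" for z
  proof -
    from that obtain w where "y * z = x * w" unfolding I by (auto simp: mult.commute)
    from nzd[OF this] obtain k where "z = k * x" by (metis dvdE mult.commute)
    then show ?thesis unfolding I by blast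
  qed
  ultimately obtain P where P: "prime_ideal P" "?I \<subseteq> P" "P \<subset> Q"
    using prime_below[OF ring_ideal.subspace_span _ Q(1,3)] by blast
  have "prime_chain 1 P" using P \<open>x \<noteq> 0\<close> ring_ideal.span_base[of x "{x}"] by (intro prime_chain_1[of P x]) blast+
  then have "prime_chain (Suc 1) Q" using P(3) Q(1) unfolding prime_chain_Suc_iff[of 1] by blast
  then show ?thesis by (simp add: numeral_2_eq_2)
qed

text \<open>The same descent for a regular sequence of length three. It serves the vector
  \<open>(3, 3, 3)\<close>, where the height exceeds two and the degree in codimension two is
  therefore zero.\<close>

lemma prime_chain_3:
  fixes Q :: "'a::idom set"
  assumes Q: "prime_ideal Q" "x \<in> Q" "y \<in> Q" "z \<in> Q" and "x \<noteq> 0" 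
    and nzd: "\<And>u w. y * u = x * w \<Longrightarrow> x dvd u"
    and nzd2: "\<And>u v w. z * u = x * v + y * w \<Longrightarrow> \<exists>a b. u = x * a + y * b"
  shows "prime_chain 3 Q"
proof -
  let ?I = "ring_ideal.span {x, y}"
  have I: "?I = {x * v + y * w | v w. True}"
    unfolding insert_is_Un[of x "{y}"] ring_ideal.span_Un ring_ideal.span_singleton
    by (auto simp: mult.commute)
  have "?I \<subseteq> Q" using Q by (intro ring_ideal.span_minimal) (auto simp: prime_ideal_def)
  moreover have "u \<in> ?I" if "z * u \<in> ?I" for u
  proof -
    from that obtain v w where "z * u = x * v + y * w" unfolding I by blast
    from nzd2[OF this] show ?thesis unfolding I by blast
  qed
  ultimately obtain P where P: "prime_ideal P" "?I \<subseteq> P" "P \<subset> Q"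
    using prime_below[OF ring_ideal.subspace_span _ Q(1,4)] by blast
  have "x \<in> P" "y \<in> P" using P(2) ring_ideal.span_superset[of "{x, y}"] by auto
  then have "prime_chain 2 P"
    by (rule prime_chain_2[OF P(1) _ _ \<open>x \<noteq> 0\<close> nzd])
  then have "prime_chain (Suc 2) Q" using P(3) Q(1) unfolding prime_chain_Suc_iff[of 2] by blast
  then show ?thesis by simp
qed

section \<open>Algebraic independence modulo a prime ideal\<close>

text \<open>Each exponent is bounded separately instead of the total degree: the box is a product,
  so it can be treated by recursion on the list and has exactly \<open>Suc N ^ r\<close>
  elements.\<close>

definition exponents :: "nat \<Rightarrow> nat \<Rightarrow> nat list set" where
  "exponents r N = {xs. set xs \<subseteq> {..N} \<and> length xs = r}"

lemma finite_exponents [simp]: "finite (exponents r N)"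
  unfolding exponents_def by (rule finite_lists_length_eq) simp

lemma card_exponents: "card (exponents r N) = Suc N ^ r"
  unfolding exponents_def by (subst card_lists_length_eq) auto

lemma exponents_Suc: "exponents (Suc r) N = (\<lambda>(j, xs). j # xs) ` ({..N} \<times> exponents r N)"
  by (auto simp: exponents_def image_iff length_Suc_conv)

definition power_product :: "'a::comm_ring_1 list \<Rightarrow> nat list \<Rightarrow> 'a" where
  "power_product zs xs = prod_list (map2 (^) zs xs)"

lemma power_product_Cons [simp]: "power_product (z # zs) (j # xs) = z ^ j * power_product zs xs"
  by (simp add: power_product_def)

lemma power_product_Nil [simp]: "power_product [] xs = 1"
  by (simp add: power_product_def)

abbreviation "const_poly \<equiv> single 0"

text \<open>Algebraic independence over \<open>k\<close> of the residue classes of \<open>zs\<close>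
  in \<open>R / P\<close>, where a polynomial relation is encoded by its coefficients
  \<open>c\<close> on a box of exponents.\<close>

definition alg_indep_mod :: "('n, 'k::comm_ring_1) mpoly set \<Rightarrow> ('n, 'k) mpoly list \<Rightarrow> bool" where
  "alg_indep_mod P zs \<longleftrightarrow> (\<forall>N c.
     (\<Sum>xs\<in>exponents (length zs) N. const_poly (c xs) * power_product zs xs) \<in> P \<longrightarrow>
     (\<forall>xs\<in>exponents (length zs) N. c xs = 0))"

text \<open>A relation modulo \<open>P\<close> is read as a polynomial in \<open>p\<close>. Modulo
  \<open>Q\<close> only its constant coefficient survives, which vanishes by independence modulo
  \<open>Q\<close>; what remains is divisible by \<open>p\<close>, and \<open>p\<close> may be
  cancelled modulo the prime \<open>P\<close>.\<close>

lemma alg_indep_mod_Cons: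
  assumes PQ: "prime_ideal P" "prime_ideal Q" "P \<subset> Q" and p: "p \<in> Q" "p \<notin> P"
    and indep: "alg_indep_mod Q zs"
  shows "alg_indep_mod P (p # zs)"
  unfolding alg_indep_mod_def
proof (intro allI impI)
  fix N and c :: "nat list \<Rightarrow> 'b"
  let ?r = "length zs"
  define v where "v c' = (\<Sum>xs\<in>exponents ?r N. const_poly (c' xs) * power_product zs xs)" for c'
  assume "(\<Sum>xs\<in>exponents (length (p # zs)) N. const_poly (c xs) * power_product (p # zs) xs) \<in> P"
  also have "(\<Sum>xs\<in>exponents (length (p # zs)) N. const_poly (c xs) * power_product (p # zs) xs) =
     (\<Sum>(j, xs)\<in>{..N} \<times> exponents ?r N. const_poly (c (j # xs)) * power_product (p # zs) (j # xs))"
    by (simp add: exponents_Suc, subst sum.reindex) (auto simp: inj_on_def intro!: sum.cong)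
  also have "\<dots> = (\<Sum>j\<le>N. p ^ j * v (\<lambda>xs. c (j # xs)))"
    by (simp add: sum.cartesian_product[symmetric] v_def sum_distrib_left mult_ac)
  finally have *: "(\<Sum>j\<le>N. p ^ j * v (\<lambda>xs. c (j # xs))) \<in> P" .
  \<comment> \<open>Induction on the degree \<open>M\<close> in \<open>p\<close>, with the
    coefficients \<open>d\<close> generalised because cancelling \<open>p\<close> shifts them by
    one.\<close>
  have claim: "\<forall>j\<le>M. \<forall>xs\<in>exponents ?r N. d j xs = 0" if "(\<Sum>j\<le>M. p ^ j * v (d j)) \<in> P" for M d
    using that
  proof (induction M arbitrary: d)
    case 0
    then have "v (d 0) \<in> Q" using PQ by auto
    then show ?case using indep by (auto simp: alg_indep_mod_def v_def)
  next
    case (Suc M)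
    have eq: "(\<Sum>j\<le>Suc M. p ^ j * v (d j)) = v (d 0) + (\<Sum>j\<le>M. p ^ j * v (d (Suc j))) * p"
      by (subst sum.atMost_Suc_shift) (simp add: sum_distrib_left sum_distrib_right mult_ac)
    have "(\<Sum>j\<le>M. p ^ j * v (d (Suc j))) * p \<in> Q"
      using p(1) PQ(2) by (intro ring_ideal.subspace_scale prime_ideal_subspace)
    moreover have "v (d 0) + (\<Sum>j\<le>M. p ^ j * v (d (Suc j))) * p \<in> Q"
      using Suc.prems PQ(3) unfolding eq by auto
    ultimately have "v (d 0) \<in> Q"
      by (rule ideal_add_cancel_right[OF prime_ideal_subspace[OF PQ(2)]])
    then have d0: "\<forall>xs\<in>exponents ?r N. d 0 xs = 0" using indep by (simp add: alg_indep_mod_def v_def)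
    then have "v (d 0) = 0" by (simp add: v_def)
    then have "(\<Sum>j\<le>M. p ^ j * v (d (Suc j))) * p \<in> P" using Suc.prems unfolding eq by simp
    then have "(\<Sum>j\<le>M. p ^ j * v (d (Suc j))) \<in> P" using prime_ideal_multD[OF PQ(1)] p(2) by blast
    note IH = Suc.IH[OF this]
    show ?case
    proof (rule allI, rule impI)
      fix j assume "j \<le> Suc M"
      then show "\<forall>xs\<in>exponents ?r N. d j xs = 0" using d0 IH by (cases j) auto
    qed
  qed
  show "\<forall>xs\<in>exponents (length (p # zs)) N. c xs = 0"
    using claim[OF *] by (auto simp: exponents_Suc)
qed

text \<open>Going down the chain, each strict inclusion supplies an element of the larger prime
  outside the smaller one, and this element extends the independent list.\<close>

lemma prime_chain_alg_indep:
  fixes Q :: "('n, 'k::comm_ring_1) mpoly set"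
  assumes "prime_chain m Q" "alg_indep_mod Q zs"
  shows "\<exists>(P :: ('n, 'k) mpoly set) zs'. prime_ideal P \<and> alg_indep_mod P zs' \<and> length zs' = m + length zs"
  using assms
proof (induction m arbitrary: Q zs)
  case 0
  then show ?case using prime_chain_prime[of 0 Q] by (intro exI[of _ Q] exI[of _ zs]) simp
next
  case (Suc m)
  then obtain P where P: "prime_ideal Q" "P \<subset> Q" "prime_chain m P" by (auto simp: prime_chain_Suc_iff)
  then obtain p where "p \<in> Q" "p \<notin> P" by auto
  then have "alg_indep_mod P (p # zs)" using P Suc.prems(2) prime_chain_prime alg_indep_mod_Cons by blast
  from Suc.IH[OF P(3) this] show ?case by simp
qed

definition exponent_bound :: "nat \<Rightarrow> ('n, 'k::zero) mpoly \<Rightarrow> bool" where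
  "exponent_bound K p \<longleftrightarrow> (\<forall>m\<in>keys p. \<forall>i. lookup m i \<le> K)"

lemma exponent_bound_mult:
  "exponent_bound K p \<Longrightarrow> exponent_bound L q \<Longrightarrow> exponent_bound (K + L) (p * q :: ('n, 'k::comm_ring_1) mpoly)"
  unfolding exponent_bound_def using keys_mult[of p q] 
  by (fastforce simp: lookup_add intro: add_mono)

lemma exponent_bound_mono: "exponent_bound K p \<Longrightarrow> K \<le> L \<Longrightarrow> exponent_bound L p"
  unfolding exponent_bound_def using order_trans by blast

lemma exponent_bound_1: "exponent_bound K (1 :: ('n, 'k::comm_ring_1) mpoly)"
  by (simp add: exponent_bound_def flip: single_one)

lemma exponent_bound_power:
  "exponent_bound K (p :: ('n, 'k::comm_ring_1) mpoly) \<Longrightarrow> exponent_bound (n * K) (p ^ n)"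
  by (induction n) (auto intro: exponent_bound_mult exponent_bound_1)

lemma exponent_bound_exists: 
  fixes zs :: "('n, 'k::comm_ring_1) mpoly list"
  shows "\<exists>K. \<forall>z\<in>set zs. exponent_bound K z"
proof -
  let ?S = "\<Union>z\<in>set zs. monom_degree ` keys z"
  have "finite ?S" by simp
  then have "d \<le> Max ?S" if "d \<in> ?S" for d using that by simp
  then have "\<forall>z\<in>set zs. exponent_bound (Max ?S) z"
    unfolding exponent_bound_def by (meson UN_I imageI lookup_le_monom_degree order_trans)
  then show ?thesis by blast
qed

lemma exponent_bound_power_product:
  assumes "\<forall>z\<in>set zs. exponent_bound K z" "xs \<in> exponents (length zs) N"
  shows "exponent_bound (length zs * K * N) (power_product zs xs)"
  using assms
proof (induction zs arbitrary: xs)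
  case Nil
  then show ?case by (simp add: exponent_bound_1)
next
  case (Cons z zs)
  then obtain j ys where xs: "xs = j # ys" "j \<le> N" "ys \<in> exponents (length zs) N"
    by (auto simp: exponents_Suc)
  have "exponent_bound (j * K) (z ^ j)" using Cons.prems(1) by (auto intro: exponent_bound_power)
  then have "exponent_bound (N * K) (z ^ j)" by (rule exponent_bound_mono) (use xs(2) in simp)
  from exponent_bound_mult[OF this Cons.IH[OF _ xs(3)]] Cons.prems(1)
  show ?case by (simp add: xs(1) algebra_simps)
qed

lemma card_bounded_monomials:
  shows "finite {m :: 'n::finite \<Rightarrow>\<^sub>0 nat. \<forall>i. lookup m i \<le> K}"
    and "card {m :: 'n::finite \<Rightarrow>\<^sub>0 nat. \<forall>i. lookup m i \<le> K} \<le> Suc K ^ CARD('n)"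
proof -
  let ?S = "{m :: 'n \<Rightarrow>\<^sub>0 nat. \<forall>i. lookup m i \<le> K}" 
  let ?F = "PiE (UNIV :: 'n set) (\<lambda>_. {..K})"
  have inj: "inj_on lookup ?S" by (auto simp: inj_on_def)
  have sub: "lookup ` ?S \<subseteq> ?F" by auto
  have fin: "finite ?F" by (rule finite_PiE) auto
  show "finite ?S" using inj sub fin by (rule inj_on_finite)
  have "card ?S \<le> card ?F" using inj sub fin by (rule card_inj_on_le)
  then show "card ?S \<le> Suc K ^ CARD('n)" by (simp add: card_PiE)
qed

lemma mpoly_in_span_monomials:
  "keys p \<subseteq> S \<Longrightarrow> p \<in> mpoly_vs.span ((\<lambda>m. single m 1) ` S)"
proof -
  assume S: "keys p \<subseteq> S"
  have "p = (\<Sum>m\<in>keys p. mpoly_scale (lookup p m) (single m 1))"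
    by (subst poly_mapping_sum_monomials[of p]) (simp add: mpoly_scale_def mult_single)
  also have "\<dots> \<in> mpoly_vs.span ((\<lambda>m. single m 1) ` S)"
    using S by (intro mpoly_vs.span_sum mpoly_vs.span_scale mpoly_vs.span_base) auto
  finally show ?thesis .
qed

text \<open>A count in place of transcendence degree: the \<open>Suc N ^ r\<close> power products
  are linearly independent over \<open>k\<close>, and they lie in the span of the monomials with all
  exponents at most \<open>r * K * N\<close>. As \<open>N\<close> grows, this is impossible for
  \<open>r\<close> larger than the number \<open>n\<close> of variables.\<close>

lemma alg_indep_mod_length_le:
  fixes zs :: "('n::finite, 'k::field) mpoly list"
  assumes "0 \<in> P" "alg_indep_mod P zs"
  shows "length zs \<le> CARD('n)"
proof (rule ccontr)
  assume neg: "\<not> ?thesis"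
  let ?r = "length zs" and ?n = "CARD('n)"
  obtain K where K: "\<forall>z\<in>set zs. exponent_bound K z" using exponent_bound_exists by blast
  have le: "Suc N ^ ?r \<le> Suc (?r * K * N) ^ ?n" for N
  proof -
    let ?E = "exponents ?r N"
    let ?S = "{m :: 'n \<Rightarrow>\<^sub>0 nat. \<forall>i. lookup m i \<le> ?r * K * N}"
    let ?b = "power_product zs"
    have zero: "\<forall>xs\<in>?E. c xs = 0" if "(\<Sum>xs\<in>?E. const_poly (c xs) * ?b xs) = 0" for c
    proof -
      have "(\<Sum>xs\<in>?E. const_poly (c xs) * ?b xs) \<in> P" using that assms(1) by simp
      then show ?thesis using assms(2) unfolding alg_indep_mod_def by blast
    qed
    have inj: "inj_on ?b ?E"
    proof (rule inj_onI, rule ccontr)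
      fix xs ys assume *: "xs \<in> ?E" "ys \<in> ?E" "?b xs = ?b ys" "xs \<noteq> ys"
      \<comment> \<open>Two equal power products would give the relation with coefficients
        \<open>1\<close> and \<open>-1\<close>.\<close>
      let ?c = "\<lambda>zs. if zs = xs then 1 else if zs = ys then - 1 else (0 :: 'k)"
      have "(\<Sum>zs\<in>?E. const_poly (?c zs) * ?b zs) = (\<Sum>zs\<in>{xs, ys}. const_poly (?c zs) * ?b zs)"
        using * by (intro sum.mono_neutral_right) auto
      also have "\<dots> = 0" using * by (simp add: single_uminus)
      finally have "?c xs = 0" using *(1) by (rule zero[THEN bspec])
      then show False by simp
    qed
    have indep: "mpoly_vs.independent (?b ` ?E)"
    proof (rule mpoly_vs.independent_if_scalars_zero)
      fix f x assume "(\<Sum>x\<in>?b ` ?E. mpoly_scale (f x) x) = 0" and x: "x \<in> ?b ` ?E"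
      then have "(\<Sum>xs\<in>?E. const_poly (f (?b xs)) * ?b xs) = 0"
        by (simp add: sum.reindex[OF inj] mpoly_scale_def)
      from zero[OF this] x show "f x = 0" by auto
    qed simp
    have "?b ` ?E \<subseteq> mpoly_vs.span ((\<lambda>m. single m 1) ` ?S)"
      using exponent_bound_power_product[OF K] 
      by (auto intro!: mpoly_in_span_monomials simp: exponent_bound_def)
    then have "card (?b ` ?E) \<le> card ((\<lambda>m. single m (1::'k)) ` ?S)"
      using mpoly_vs.independent_span_bound[OF _ indep] card_bounded_monomials(1) by blast
    also have "\<dots> \<le> card ?S" by (rule card_image_le) (rule card_bounded_monomials)
    also have "\<dots> \<le> Suc (?r * K * N) ^ ?n" by (rule card_bounded_monomials)
    finally show ?thesis by (simp add: card_image[OF inj] card_exponents)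
  qed
  \<comment> \<open>With \<open>N = L\<close> the count gives
    \<open>Suc L * Suc L ^ n \<le> L * Suc L ^ n\<close>; the value of \<open>L\<close> is exactly
    the factor lost in bounding \<open>r * K * L + 1\<close> by
    \<open>(r * K + 1) * (L + 1)\<close>.\<close>
  define L where "L = Suc (?r * K) ^ ?n"
  have "Suc L * Suc L ^ ?n = Suc L ^ Suc ?n" by simp
  also have "\<dots> \<le> Suc L ^ ?r" using neg by (intro power_increasing) auto
  also have "\<dots> \<le> Suc (?r * K * L) ^ ?n" by (rule le)
  also have "\<dots> \<le> (Suc (?r * K) * Suc L) ^ ?n" by (intro power_mono) auto
  also have "\<dots> = L * Suc L ^ ?n" unfolding power_mult_distrib by (simp only: L_def)
  finally show False by simp
qed

definition poly_in :: "'n set \<Rightarrow> ('n, 'k::zero) mpoly \<Rightarrow> bool" where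
  "poly_in Z p \<longleftrightarrow> (\<forall>m\<in>keys p. keys m \<subseteq> Z)"

text \<open>The variables in \<open>Z\<close> form the list: their power products are pairwise
  distinct monomials, so the coefficients of a relation are the coefficients of a polynomial in
  \<open>Z\<close>.\<close>

lemma poly_in_variables_alg_indep:
  fixes Q :: "('n::finite, 'k::field) mpoly set"
  assumes Q: "\<And>p. p \<in> Q \<Longrightarrow> poly_in Z p \<Longrightarrow> p = 0"
  shows "\<exists>zs. length zs = card Z \<and> alg_indep_mod Q zs"
proof -
  obtain vs where vs: "set vs = Z" "distinct vs" "length vs = card Z"
    using finite_distinct_list[of Z] distinct_card by (metis finite)
  define expo where "expo js xs = (\<Sum>(j, x)\<leftarrow>zip js xs. single j x)" for js :: "'n list" and xs :: "nat list"
  have expo_Cons: "expo (j # js) (x # xs) = single j x + expo js xs" for j js x xs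
    by (simp add: expo_def)
  have keys_expo: "keys (expo js xs) \<subseteq> set js" if "length xs = length js" for js xs
    using that
  proof (induction xs js rule: list_induct2)
    case (Cons x xs j js)
    then show ?case using keys_add[of "single j x" "expo js xs"] by (auto simp: expo_Cons split: if_splits)
  qed (simp add: expo_def)
  have inj: "xs = ys" if "length xs = length js" "length ys = length js" "distinct js" "expo js xs = expo js ys" for js xs ys
    using that
  proof (induction js arbitrary: xs ys)
    case (Cons j js)
    then obtain x xs' y ys' where e: "xs = x # xs'" "ys = y # ys'" 
      by (metis length_Suc_conv length_Cons)
    have l: "length xs' = length js" "length ys' = length js" using Cons.prems e by auto
    have "j \<notin> keys (expo js xs')" "j \<notin> keys (expo js ys')"
      using keys_expo l Cons.prems(3) by fastforce+
    moreover have eq: "single j x + expo js xs' = single j y + expo js ys'"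
      using Cons.prems(4) by (simp add: e expo_Cons)
    then have "lookup (single j x + expo js xs') j = lookup (single j y + expo js ys') j" by simp
    ultimately have "x = y" by (simp add: lookup_add in_keys_iff)
    then show ?case using Cons.IH[OF l] Cons.prems(3) eq e by simp
  qed simp
  have pp: "power_product (map (\<lambda>i. single (single i (1 :: nat)) (1 :: 'k)) js) xs = single (expo js xs) 1"
    if "length xs = length js" for js xs
    using that
  proof (induction xs js rule: list_induct2)
    case (Cons x xs j js)
    have "single (single j (1 :: nat)) (1 :: 'k) ^ x = single (single j x) 1" for x
      by (induction x) (simp_all add: mult_single flip: single_add)
    then show ?case using Cons by (simp add: mult_single expo_Cons)
  qed (simp add: expo_def)
  let ?zs = "map (\<lambda>i. single (single i (1 :: nat)) (1 :: 'k)) vs"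
  have "alg_indep_mod Q ?zs"
    unfolding alg_indep_mod_def
  proof (intro allI impI ballI)
    fix N and c :: "nat list \<Rightarrow> 'k" and xs
    let ?E = "exponents (length ?zs) N"
    let ?s = "\<Sum>xs\<in>?E. const_poly (c xs) * power_product ?zs xs"
    assume s: "?s \<in> Q" and xs: "xs \<in> ?E"
    have len: "length ys = length vs" if "ys \<in> ?E" for ys using that by (simp add: exponents_def)
    have s_eq: "?s = (\<Sum>xs\<in>?E. single (expo vs xs) (c xs))"
      using pp len by (intro sum.cong) (auto simp: mult_single)
    have "keys ?s \<subseteq> (\<Union>xs\<in>?E. {expo vs xs})" unfolding s_eq
      by (rule order_trans[OF keys_sum]) auto
    moreover have "keys (expo vs ys) \<subseteq> Z" if "ys \<in> ?E" for ys
      using keys_expo[OF len[OF that]] vs(1) by simp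
    ultimately have "poly_in Z ?s" unfolding poly_in_def by fast
    then have "?s = 0" by (rule Q[OF s])
    then have "lookup (\<Sum>xs\<in>?E. single (expo vs xs) (c xs)) (expo vs xs) = 0"
      unfolding s_eq by simp
    also have "lookup (\<Sum>xs\<in>?E. single (expo vs xs) (c xs)) (expo vs xs) = (\<Sum>ys\<in>?E. if ys = xs then c xs else 0)"
      unfolding lookup_sum using inj[OF len len vs(2)] xs
      by (intro sum.cong) (auto simp: lookup_single when_def)
    also have "\<dots> = c xs" using xs by simp
    finally show "c xs = 0" .
  qed
  then show ?thesis using vs(3) by (intro exI[of _ ?zs]) simp
qed

text \<open>The inequality half of the dimension formula: a chain of length \<open>m\<close> below
  \<open>Q\<close> and the variables in \<open>Z\<close>, independent modulo \<open>Q\<close>,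
  together give \<open>m + card Z\<close> algebraically independent elements.\<close>

lemma prime_chain_length_le:
  fixes Q :: "('n::finite, 'k::field) mpoly set"
  assumes "\<And>p. p \<in> Q \<Longrightarrow> poly_in Z p \<Longrightarrow> p = 0" "prime_chain m Q"
  shows "m + card Z \<le> CARD('n)"
proof -
  obtain zs where zs: "length zs = card Z" "alg_indep_mod Q zs" using poly_in_variables_alg_indep assms(1) by blast
  obtain P and zs' :: "('n, 'k) mpoly list" where "prime_ideal P" "alg_indep_mod P zs'" "length zs' = m + length zs"
    using prime_chain_alg_indep[OF assms(2) zs(2)] by blast
  then show ?thesis using alg_indep_mod_length_le[of P zs'] zs(1)
    by (simp add: prime_ideal_def ring_ideal.subspace_0)
qed

section \<open>Dimension counts\<close>

lemma (in vector_space) span_Int_span_of_disjoint_independent: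
  assumes "independent C" "A \<subseteq> C" "B \<subseteq> C" "A \<inter> B = {}" "x \<in> span A" "x \<in> span B"
  shows "x = 0"
proof -
  have "representation C x b = 0" for b
    using representation_extend[OF assms(1,5,2)] representation_extend[OF assms(1,6,3)]
      representation_ne_zero[of A x b] representation_ne_zero[of B x b] assms(4)
    by (metis disjoint_iff)
  moreover have "x \<in> span C" using assms(2,5) span_mono by blast
  ultimately show ?thesis using sum_nonzero_representation_eq[OF assms(1), of x] by simp
qed

text \<open>Rank-nullity for a subspace of finite dimension in a possibly infinite dimensional
  space: a basis \<open>B\<close> of the kernel is extended to a basis \<open>C\<close> of
  \<open>V\<close>, and \<open>f\<close> is injective on the span of \<open>C - B\<close>.\<close>

lemma (in vector_space_pair) dim_kernel_image:
  assumes f: "Vector_Spaces.linear s1 s2 f" and V: "vs1.subspace V" and S: "finite S" "V \<subseteq> vs1.span S"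
  shows "vs1.dim V = vs1.dim {v \<in> V. f v = 0} + vs2.dim (f ` V)"
proof -
  interpret f: Vector_Spaces.linear s1 s2 f by (fact f)
  let ?K = "{v \<in> V. f v = 0}"
  obtain B where B: "B \<subseteq> ?K" "vs1.independent B" "?K \<subseteq> vs1.span B"
    using vs1.maximal_independent_subset[of ?K] by blast
  have "B \<subseteq> V" using B(1) by blast
  then obtain C where C: "B \<subseteq> C" "C \<subseteq> V" "vs1.independent C" "V \<subseteq> vs1.span C"
    using vs1.maximal_independent_subset_extend[OF _ B(2), of V] by blast
  have "C \<subseteq> vs1.span S" using C(2) S(2) by blast
  then have finC: "finite C" using vs1.independent_span_bound[OF S(1) C(3)] by simp
  have "vs1.span (C - B) \<subseteq> V" using C(2) V by (intro vs1.span_minimal) auto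
  then have ker: "x = 0" if "x \<in> vs1.span (C - B)" "f x = 0" for x
    using that B(3) vs1.span_Int_span_of_disjoint_independent[OF C(3), of "C - B" B x] C(1) by blast
  have inj: "inj_on f (vs1.span (C - B))"
    using f.inj_on_iff_eq_0[OF vs1.subspace_span, of "C - B"] ker by blast
  have indep: "vs2.independent (f ` (C - B))"
    using f.independent_injective_image[OF vs1.independent_mono[OF C(3)] inj] by blast
  have "f ` V \<subseteq> vs2.span (f ` (C - B))"
  proof -
    have "f ` C \<subseteq> insert 0 (f ` (C - B))" using B(1) by auto
    then have "vs2.span (f ` C) \<subseteq> vs2.span (insert 0 (f ` (C - B)))" by (rule vs2.span_mono)
    then show ?thesis using f.spans_image[OF C(4)] by simp
  qed
  then have "vs2.dim (f ` V) = card (f ` (C - B))"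
    using indep C(2) by (intro vs2.dim_unique[of "f ` (C - B)"]) auto
  also have "\<dots> = card (C - B)"
    using inj_on_subset[OF inj vs1.span_superset] by (rule card_image)
  also have "\<dots> = card C - card B" using C(1) finC by (intro card_Diff_subset) (auto dest: finite_subset)
  finally have "vs2.dim (f ` V) = card C - card B" .
  moreover have "card B \<le> card C" using C(1) finC by (rule card_mono[rotated])
  moreover have "vs1.dim V = card C" using C by (intro vs1.dim_unique[of C]) auto
  moreover have "vs1.dim ?K = card B" using B by (intro vs1.dim_unique[of B]) auto
  ultimately show ?thesis by simp
qed

lemma (in vector_space) dim_0 [simp]: "dim {0} = 0"
  by (rule dim_unique[of "{}"]) (auto simp: independent_empty)

lemma (in vector_space_pair) dim_injective_image:
  assumes f: "Vector_Spaces.linear s1 s2 f" and V: "vs1.subspace V" and S: "finite S" "V \<subseteq> vs1.span S"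
    and inj: "\<And>v. v \<in> V \<Longrightarrow> f v = 0 \<Longrightarrow> v = 0"
  shows "vs2.dim (f ` V) = vs1.dim V"
proof -
  interpret f: Vector_Spaces.linear s1 s2 f by (fact f)
  have "{v \<in> V. f v = 0} = {0}" using inj vs1.subspace_0[OF V] by auto
  then show ?thesis using dim_kernel_image[OF f V S] by simp
qed

text \<open>Triples model \<open>R^3\<close> as a vector space over \<open>k\<close>. Unlike vectors
  of arbitrary dimension they form an additive group as a type, so rank-nullity applies to maps into
  and out of them.\<close>

definition mpoly3_scale :: "'k::field \<Rightarrow> ('n, 'k) mpoly \<times> ('n, 'k) mpoly \<times> ('n, 'k) mpoly \<Rightarrow> _" where
  "mpoly3_scale c = (\<lambda>(p, q, r). (mpoly_scale c p, mpoly_scale c q, mpoly_scale c r))"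

global_interpretation mpoly3_vs: Vector_Spaces.vector_space 
  "mpoly3_scale :: 'k::field \<Rightarrow> ('n, 'k) mpoly \<times> ('n, 'k) mpoly \<times> ('n, 'k) mpoly \<Rightarrow> _"
  by standard (auto simp: mpoly3_scale_def mpoly_vs.scale_right_distrib mpoly_vs.scale_left_distrib)

global_interpretation mpoly_pair13: vector_space_pair 
  "mpoly_scale :: 'k::field \<Rightarrow> ('n, 'k) mpoly \<Rightarrow> _" 
  "mpoly3_scale :: 'k::field \<Rightarrow> ('n, 'k) mpoly \<times> ('n, 'k) mpoly \<times> ('n, 'k) mpoly \<Rightarrow> _" ..

global_interpretation mpoly_pair31: vector_space_pair 
  "mpoly3_scale :: 'k::field \<Rightarrow> ('n, 'k) mpoly \<times> ('n, 'k) mpoly \<times> ('n, 'k) mpoly \<Rightarrow> _" 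
  "mpoly_scale :: 'k::field \<Rightarrow> ('n, 'k) mpoly \<Rightarrow> _" ..

global_interpretation mpoly_pair33: vector_space_pair 
  "mpoly3_scale :: 'k::field \<Rightarrow> ('n, 'k) mpoly \<times> ('n, 'k) mpoly \<times> ('n, 'k) mpoly \<Rightarrow> _" 
  "mpoly3_scale :: 'k::field \<Rightarrow> ('n, 'k) mpoly \<times> ('n, 'k) mpoly \<times> ('n, 'k) mpoly \<Rightarrow> _" ..

section \<open>The dimension of the space of forms of a given degree\<close>

definition forms :: "int \<Rightarrow> ('n, 'k::zero) mpoly set" where
  "forms d = {p. form d p}"

lemma subspace_forms [simp]: "mpoly_vs.subspace (forms d)"
  by (auto simp: forms_def mpoly_vs.subspace_def mpoly_scale_def form_add form_mult_single_0)

lemma finite_monomials_of_degree: "finite {m :: 'n::finite \<Rightarrow>\<^sub>0 nat. int (monom_degree m) = d}"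
  by (rule finite_subset[OF _ card_bounded_monomials(1)[of "nat d"]])
    (auto simp: lookup_le_monom_degree)

lemma forms_finite_span:
  "forms d \<subseteq> mpoly_vs.span ((\<lambda>m. single m (1::'k::field)) ` {m :: 'n::finite \<Rightarrow>\<^sub>0 nat. int (monom_degree m) = d})"
  by (auto simp: forms_def form_def intro!: mpoly_in_span_monomials)

lemma inj_on_single_1: "inj_on (\<lambda>m. single m (1::'k::zero_neq_one)) S"
proof (rule inj_onI)
  fix m u assume "single m (1::'k) = single u 1"
  then have "lookup (single m (1::'k)) m = lookup (single u 1) m" by simp
  then show "m = u" by (simp add: lookup_single when_def split: if_splits)
qed

lemma independent_monomials:
  "mpoly_vs.independent ((\<lambda>m. single m (1::'k::field)) ` S)"
proof -
  have "mpoly_vs.independent ((\<lambda>m. single m (1::'k::field)) ` T)" if fin: "finite T" for T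
  proof (rule mpoly_vs.independent_if_scalars_zero)
    fix f :: "_ \<Rightarrow> 'k" and x assume *: "(\<Sum>x\<in>(\<lambda>m. single m (1::'k)) ` T. mpoly_scale (f x) x) = 0" "x \<in> (\<lambda>m. single m (1::'k)) ` T"
    then obtain m where m: "m \<in> T" "x = single m 1" by auto
    note inj = inj_on_single_1[where 'k = 'k, of T]
    have "0 = lookup (\<Sum>x\<in>(\<lambda>m. single m (1::'k)) ` T. mpoly_scale (f x) x) m" using *(1) by simp
    also have "\<dots> = (\<Sum>u\<in>T. if u = m then f (single m 1) else 0)"
      unfolding lookup_sum sum.reindex[OF inj]
      by (intro sum.cong) (auto simp: mpoly_scale_def mult_single lookup_single when_def)
    also have "\<dots> = f x" using m fin by simp
    finally show "f x = 0" by simp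
  qed (use fin in simp)
  note fin = this
  show ?thesis
    unfolding mpoly_vs.independent_explicit_finite_subsets
  proof (rule allI, rule impI, rule impI)
    fix U assume "U \<subseteq> (\<lambda>m. single m (1::'k)) ` S" "finite U"
    then obtain T where T: "T \<subseteq> S" "finite T" "U = (\<lambda>m. single m (1::'k)) ` T"
      using finite_subset_image by blast
    have "mpoly_vs.independent U" unfolding T(3) by (rule fin[OF T(2)])
    then show "\<forall>u. (\<Sum>v\<in>U. mpoly_scale (u v) v) = 0 \<longrightarrow> (\<forall>v\<in>U. u v = 0)"
      unfolding mpoly_vs.independent_explicit_finite_subsets using \<open>finite U\<close> by blast
  qed
qed

lemma dim_forms:
  "mpoly_vs.dim (forms d :: ('n::finite, 'k::field) mpoly set) = card {m :: 'n \<Rightarrow>\<^sub>0 nat. int (monom_degree m) = d}"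
proof -
  let ?M = "{m :: 'n \<Rightarrow>\<^sub>0 nat. int (monom_degree m) = d}"
  have "mpoly_vs.dim (forms d :: ('n::finite, 'k::field) mpoly set) = card ((\<lambda>m. single m (1::'k)) ` ?M)"
    using forms_finite_span[of d] independent_monomials
    by (intro mpoly_vs.dim_unique[of "(\<lambda>m. single m (1::'k)) ` ?M"]) (auto simp: forms_def form_single)
  also have "\<dots> = card ?M"
    by (rule card_image) (rule inj_on_single_1)
  finally show ?thesis .
qed

lemma monom_degree_UNIV: "monom_degree (m :: 'n::finite \<Rightarrow>\<^sub>0 nat) = (\<Sum>i\<in>UNIV. lookup m i)"
  by (rule monom_degree_superset) auto

text \<open>Listing the exponents in a fixed order of the variables identifies these monomials with
  the lists of length \<open>n\<close> and sum \<open>d\<close>, which are counted by stars and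
  bars.\<close>

lemma card_monomials_of_degree:
  "card {m :: 'n::finite \<Rightarrow>\<^sub>0 nat. monom_degree m = d} = (d + CARD('n) - 1) choose d"
proof -
  obtain vs :: "'n list" where vs: "set vs = UNIV" "distinct vs"
    using finite_distinct_list[OF finite[of "UNIV :: 'n set"]] by auto
  then have len: "length vs = CARD('n)" using distinct_card[of vs] by simp
  let ?f = "\<lambda>m :: 'n \<Rightarrow>\<^sub>0 nat. map (lookup m) vs"
  have inj: "inj_on ?f {m. monom_degree m = d}"
  proof (rule inj_onI)
    fix m u assume "?f m = ?f u"
    then show "m = u" using vs(1) by (intro poly_mapping_eqI) simp
  qed
  have "?f ` {m. monom_degree m = d} = {l. length l = CARD('n) \<and> sum_list l = d}"
  proof (intro equalityI subsetI)
    fix l assume "l \<in> ?f ` {m. monom_degree m = d}"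
    then obtain m where m: "l = ?f m" "monom_degree m = d" by blast
    have "sum_list (?f m) = (\<Sum>i\<in>set vs. lookup m i)" using vs(2) by (rule sum_list_distinct_conv_sum_set)
    then show "l \<in> {l. length l = CARD('n) \<and> sum_list l = d}"
      using m vs(1) len by (simp add: monom_degree_UNIV)
  next
    fix l :: "nat list" assume "l \<in> {l. length l = CARD('n) \<and> sum_list l = d}"
    then have l: "length l = CARD('n)" "sum_list l = d" by auto
    define m where "m = Abs_poly_mapping (\<lambda>i. the (map_of (zip vs l) i))"
    have lookup_m: "lookup m i = the (map_of (zip vs l) i)" for i
      by (simp add: m_def)
    have "?f m = l"
      by (rule nth_equalityI) (use l len vs(2) in \<open>auto simp: lookup_m map_of_zip_nth\<close>)
    moreover have "monom_degree m = sum_list (?f m)"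
      using vs by (simp add: monom_degree_UNIV sum_list_distinct_conv_sum_set)
    ultimately show "l \<in> ?f ` {m. monom_degree m = d}" using l(2) by (intro image_eqI[of _ _ m]) auto
  qed
  then have "card {m :: 'n \<Rightarrow>\<^sub>0 nat. monom_degree m = d} = card {l :: nat list. length l = CARD('n) \<and> sum_list l = d}"
    using card_image[OF inj] by simp
  then show ?thesis by (simp add: card_length_sum_list)
qed

text \<open>The Hilbert polynomial of \<open>R\<close>:
  \<open>(X + 1) ... (X + n - 1) / (n - 1)!\<close>, that is, the binomial coefficient of
  \<open>X + n - 1\<close> over \<open>n - 1\<close>.\<close>

definition forms_dim_poly :: "nat \<Rightarrow> rat poly" where
  "forms_dim_poly n = Polynomial.smult (1 / fact (n - 1)) (pochhammer [:1, 1:] (n - 1))"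

lemma degree_lead_coeff_pochhammer:
  "degree (pochhammer [:1, 1::rat:] k) = k \<and> coeff (pochhammer [:1, 1::rat:] k) k = 1"
proof (induction k)
  case (Suc k)
  let ?p = "pochhammer [:1, 1::rat:] k" and ?r = "[:1 + of_nat k, 1::rat:]"
  have eq: "([:1, 1:] :: rat poly) + of_nat k = ?r"
    by (simp add: of_nat_poly)
  have p: "degree ?p = k" "coeff ?p k = 1" using Suc.IH by auto
  then have "?p \<noteq> 0" by auto
  then have "degree (?p * ?r) = Suc k"
    using p(1) by (subst degree_mult_eq) auto
  moreover have "coeff (?p * ?r) (Suc k) = 1"
    using coeff_mult_degree_sum[of ?p ?r] p by simp
  ultimately show ?case by (simp only: pochhammer_Suc eq simp_thms)
qed simp

lemma degree_forms_dim_poly: "degree (forms_dim_poly n) = n - 1"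
  and lead_coeff_forms_dim_poly: "coeff (forms_dim_poly n) (n - 1) = 1 / fact (n - 1)"
  using degree_lead_coeff_pochhammer[of "n - 1"] by (auto simp: forms_dim_poly_def)

lemma poly_pochhammer: "poly (pochhammer p k) x = pochhammer (poly p x) (k :: nat)"
  for x :: "'a::comm_ring_1"
  by (induction k) (simp_all add: pochhammer_Suc)

lemma poly_forms_dim_poly:
  assumes "d \<ge> 0"
  shows "of_nat (mpoly_vs.dim (forms d :: ('n::finite, 'k::field) mpoly set)) = poly (forms_dim_poly CARD('n)) (of_int d)"
proof -
  obtain e where e: "d = int e" using assms nonneg_int_cases by blast
  obtain n where n: "CARD('n) = Suc n" using gr0_implies_Suc[OF zero_less_card_finite[where 'a = 'n]] by blast
  have "mpoly_vs.dim (forms d :: ('n::finite, 'k::field) mpoly set) = (e + n) choose e"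
    unfolding dim_forms e using card_monomials_of_degree[where 'n = 'n, of e] by (simp add: n)
  also have "\<dots> = (e + n) choose n" using binomial_symmetric[of e "e + n"] by simp
  finally have *: "mpoly_vs.dim (forms d :: ('n::finite, 'k::field) mpoly set) = (e + n) choose n" .
  have "of_nat ((e + n) choose n) = (pochhammer (of_nat e + 1) n / fact n :: rat)"
    unfolding binomial_gbinomial gbinomial_pochhammer' by simp
  then show ?thesis unfolding * by (simp add: e n forms_dim_poly_def poly_pochhammer add.commute[of "of_nat e" 1])
qed

lemma dim_forms_negative: "d < 0 \<Longrightarrow> mpoly_vs.dim (forms d :: ('n::finite, 'k::field) mpoly set) = 0"
  by (simp add: dim_forms)

section \<open>Hilbert polynomials of alternating sums of twists\<close>

lemma coeff_pcompose_shift: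
  assumes "degree q \<le> N"
  shows "coeff (pcompose q [:- a, 1:]) j = (\<Sum>i\<le>N. coeff q i * (if j \<le> i then of_nat (i choose j) * (- a :: 'a::field) ^ (i - j) else 0))"
proof -
  have "pcompose q [:- a, 1:] = (\<Sum>i\<le>N. pcompose (Polynomial.monom (coeff q i) i) [:- a, 1:])"
    by (subst poly_as_sum_of_monoms'[OF assms, symmetric]) (simp add: pcompose_sum)
  also have "\<dots> = (\<Sum>i\<le>N. Polynomial.smult (coeff q i) ([:- a, 1:] ^ i))"
    by (intro sum.cong) (auto simp: pcompose_altdef map_poly_monom poly_monom smult_conv_map_poly)
  finally have *: "pcompose q [:- a, 1:] = (\<Sum>i\<le>N. Polynomial.smult (coeff q i) ([:- a, 1:] ^ i))" .
  have deg: "degree ([:- a, 1:] ^ i) = i" for i by (simp add: degree_power_eq)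
  show ?thesis unfolding * coeff_sum
    by (intro sum.cong) (auto simp: coeff_linear_poly_power intro!: coeff_eq_0 simp: deg)
qed

text \<open>A pair \<open>(w, a)\<close> stands for the summand \<open>R(-a)\<close> of a
  resolution, counted with sign and multiplicity \<open>w\<close>; with \<open>q\<close> the Hilbert
  polynomial of \<open>R\<close>, this is the Hilbert polynomial of the resolved module.\<close>

definition shifted_sum :: "rat poly \<Rightarrow> (rat \<times> int) list \<Rightarrow> rat poly" where
  "shifted_sum q ws = (\<Sum>(w, a)\<leftarrow>ws. Polynomial.smult w (pcompose q [:- of_int a, 1:]))"

lemma poly_shifted_sum: "poly (shifted_sum q ws) x = (\<Sum>(w, a)\<leftarrow>ws. w * poly q (x - of_int a))"
  by (induction ws) (auto simp: shifted_sum_def poly_pcompose)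

lemma degree_shifted_sum: "degree (shifted_sum q ws) \<le> degree q"
proof (induction ws)
  case (Cons wa ws)
  obtain w a where wa: "wa = (w, a)" by fastforce
  have "degree (Polynomial.smult w (pcompose q [:- of_int a, 1:])) \<le> degree q"
    by (simp add: degree_pcompose)
  then show ?case using Cons by (simp add: shifted_sum_def wa degree_add_le)
qed (simp add: shifted_sum_def)

text \<open>The Taylor expansion of \<open>q(X - a)\<close> shows that the three top coefficients
  involve only the moments of order zero, one and two of the twists.\<close>

lemma coeff_shifted_sum_top:
  fixes q :: "rat poly"
  assumes "degree q \<le> Suc (Suc N)"
  shows "coeff (shifted_sum q ws) (Suc (Suc N)) = coeff q (Suc (Suc N)) * (\<Sum>(w, a)\<leftarrow>ws. w)"
    and "coeff (shifted_sum q ws) (Suc N) = coeff q (Suc N) * (\<Sum>(w, a)\<leftarrow>ws. w) - of_nat (Suc (Suc N)) * coeff q (Suc (Suc N)) * (\<Sum>(w, a)\<leftarrow>ws. w * of_int a)"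
    and "coeff (shifted_sum q ws) N = coeff q N * (\<Sum>(w, a)\<leftarrow>ws. w) - of_nat (Suc N) * coeff q (Suc N) * (\<Sum>(w, a)\<leftarrow>ws. w * of_int a)
       + of_nat (Suc (Suc N) choose N) * coeff q (Suc (Suc N)) * (\<Sum>(w, a)\<leftarrow>ws. w * of_int a ^ 2)"
proof -
  have zero: "(\<Sum>i<N. coeff q i * (if j \<le> i then of_nat (i choose j) * (- a) ^ (i - j) else 0)) = 0" if "j \<ge> N" for j a
    using that by (intro sum.neutral) auto
  note c = coeff_pcompose_shift[OF assms, unfolded lessThan_Suc_atMost[symmetric] sum.lessThan_Suc]
  have 1: "coeff (pcompose q [:- a, 1:]) (Suc (Suc N)) = coeff q (Suc (Suc N))" for a
    unfolding c by (simp add: zero)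
  have 2: "coeff (pcompose q [:- a, 1:]) (Suc N) = coeff q (Suc N) - of_nat (Suc (Suc N)) * coeff q (Suc (Suc N)) * a" for a
    unfolding c by (simp add: zero)
  have 3: "coeff (pcompose q [:- a, 1:]) N = coeff q N - of_nat (Suc N) * coeff q (Suc N) * a + of_nat (Suc (Suc N) choose N) * coeff q (Suc (Suc N)) * a ^ 2" for a
    unfolding c by (simp add: zero Suc_diff_le power2_eq_square)
  show "coeff (shifted_sum q ws) (Suc (Suc N)) = coeff q (Suc (Suc N)) * (\<Sum>(w, a)\<leftarrow>ws. w)"
    by (induction ws) (auto simp: shifted_sum_def 1 algebra_simps)
  show "coeff (shifted_sum q ws) (Suc N) = coeff q (Suc N) * (\<Sum>(w, a)\<leftarrow>ws. w) - of_nat (Suc (Suc N)) * coeff q (Suc (Suc N)) * (\<Sum>(w, a)\<leftarrow>ws. w * of_int a)"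
    by (induction ws) (auto simp: shifted_sum_def 2 algebra_simps)
  show "coeff (shifted_sum q ws) N = coeff q N * (\<Sum>(w, a)\<leftarrow>ws. w) - of_nat (Suc N) * coeff q (Suc N) * (\<Sum>(w, a)\<leftarrow>ws. w * of_int a)
       + of_nat (Suc (Suc N) choose N) * coeff q (Suc (Suc N)) * (\<Sum>(w, a)\<leftarrow>ws. w * of_int a ^ 2)"
    by (induction ws) (auto simp: shifted_sum_def 3 algebra_simps)
qed

lemma degree_neq_of_coeff_0: "degree p \<noteq> Suc n" if "coeff p (Suc n) = 0"
proof
  assume "degree p = Suc n"
  with that have *: "coeff p (Suc n) = 0" "degree p = Suc n" by simp_all
  then have "coeff p (degree p) = 0" by (simp only:)
  then have "p = 0" by simp
  then show False using *(2) by simp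
qed

text \<open>Codimension one: the rank vanishes but the first moment does not, so the degree drops by
  exactly one from \<open>n - 1\<close>.\<close>

lemma degree_shifted_sum_forms_1:
  assumes "n \<ge> 3" "(\<Sum>(w, a)\<leftarrow>ws. w) = 0" "(\<Sum>(w, a)\<leftarrow>ws. w * rat_of_int a) \<noteq> 0"
  shows "degree (shifted_sum (forms_dim_poly n) ws) = n - 2"
proof -
  obtain N where n: "n = Suc (Suc (Suc N))" using assms(1) by (auto simp: numeral_3_eq_3 Suc_le_eq dest!: less_imp_Suc_add)
  let ?q = "forms_dim_poly n" and ?P = "shifted_sum (forms_dim_poly n) ws"
  have q: "degree ?q = Suc (Suc N)" "coeff ?q (Suc (Suc N)) \<noteq> 0"
    using degree_forms_dim_poly[of n] lead_coeff_forms_dim_poly[of n] by (auto simp: n)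
  note c = coeff_shifted_sum_top[of ?q N ws, unfolded q(1), OF order_refl]
  have c2: "coeff ?P (Suc (Suc N)) = 0" using c(1) assms(2) by simp
  have c1: "coeff ?P (Suc N) \<noteq> 0" using c(2) assms(2,3) q(2) by simp
  have "degree ?P \<le> Suc (Suc N)" using degree_shifted_sum[of ?q ws] q(1) by simp
  moreover have "degree ?P \<noteq> Suc (Suc N)" using c2 by (rule degree_neq_of_coeff_0)
  moreover have "degree ?P \<ge> Suc N" using c1 by (rule le_degree)
  ultimately show ?thesis by (simp add: n)
qed

text \<open>Codimension two: with \<open>n = N + 3\<close>, the coefficient of degree
  \<open>N\<close> is \<open>1 / (N + 2)!\<close> times the binomial coefficient of
  \<open>N + 2\<close> over \<open>N\<close> times the second moment \<open>2 * e\<close>, which is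
  \<open>e / N!\<close>.\<close>

lemma degree_shifted_sum_forms_2:
  assumes "n \<ge> 3" "(\<Sum>(w, a)\<leftarrow>ws. w) = 0" "(\<Sum>(w, a)\<leftarrow>ws. w * rat_of_int a) = 0"
    "(\<Sum>(w, a)\<leftarrow>ws. w * rat_of_int a ^ 2) = 2 * e" "e \<noteq> 0"
  shows "degree (shifted_sum (forms_dim_poly n) ws) = n - 3"
    "fact (n - 3) * lead_coeff (shifted_sum (forms_dim_poly n) ws) = e"
proof -
  obtain N where n: "n = Suc (Suc (Suc N))" using assms(1) by (auto simp: numeral_3_eq_3 Suc_le_eq dest!: less_imp_Suc_add)
  let ?q = "forms_dim_poly n" and ?P = "shifted_sum (forms_dim_poly n) ws"
  have q: "degree ?q = Suc (Suc N)" "coeff ?q (Suc (Suc N)) = 1 / fact (Suc (Suc N))"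
    using degree_forms_dim_poly[of n] lead_coeff_forms_dim_poly[of n] by (auto simp: n)
  note c = coeff_shifted_sum_top[of ?q N ws, unfolded q(1), OF order_refl]
  have c2: "coeff ?P (Suc (Suc N)) = 0" using c(1) assms(2) by simp
  have c1: "coeff ?P (Suc N) = 0" using c(2) assms(2,3) by simp
  have choose_eq: "of_nat (Suc (Suc N) choose N) = (fact (Suc (Suc N)) / (fact N * fact 2) :: rat)"
    by (subst binomial_fact) auto
  have "coeff ?P N = of_nat (Suc (Suc N) choose N) * (1 / fact (Suc (Suc N))) * (2 * e)"
    unfolding c(3) assms(2-4) q(2) by (simp only: mult_zero_right diff_zero add_0)
  then have "coeff ?P N = e / fact N" unfolding choose_eq by (simp del: fact_Suc)
  then have c0: "coeff ?P N = e / fact N" "coeff ?P N \<noteq> 0" using assms(5) by auto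
  have "degree ?P \<le> Suc (Suc N)" using degree_shifted_sum[of ?q ws] q(1) by simp
  moreover have "degree ?P \<noteq> Suc (Suc N)" using c2 by (rule degree_neq_of_coeff_0)
  moreover have "degree ?P \<noteq> Suc N" using c1 by (rule degree_neq_of_coeff_0)
  moreover have "degree ?P \<ge> N" using c0(2) by (rule le_degree)
  ultimately have "degree ?P = N" by linarith
  then show "degree ?P = n - 3" "fact (n - 3) * lead_coeff ?P = e" using c0 by (simp_all add: n)
qed

text \<open>Two polynomials that agree at all large natural numbers are equal, so the definite
  description has a unique solution.\<close>

lemma hilbert_poly_eqI:
  assumes "\<And>d. d \<ge> d0 \<Longrightarrow> poly P (of_nat d) = of_int (hilbert_function I d)"
  shows "hilbert_poly I = P"
  unfolding hilbert_poly_def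
proof (rule the_equality)
  show "\<exists>d0. \<forall>d\<ge>d0. poly P (of_nat d) = of_int (hilbert_function I d)" using assms by blast
  fix Q :: "rat poly" assume "\<exists>d0. \<forall>d\<ge>d0. poly Q (of_nat d) = of_int (hilbert_function I d)"
  then obtain d1 where d1: "\<And>d. d \<ge> d1 \<Longrightarrow> poly Q (of_nat d) = of_int (hilbert_function I d)" by blast
  have "(of_nat ` {max d0 d1..} :: rat set) \<subseteq> {x. poly (Q - P) x = 0}" using assms d1 by auto
  moreover have "infinite (of_nat ` {max d0 d1..} :: rat set)"
    by (subst finite_image_iff) (auto simp: inj_on_def infinite_Ici)
  ultimately have "infinite {x. poly (Q - P) x = 0}" using finite_subset by blast
  then show "Q = P" using poly_roots_finite[of "Q - P"] by auto
qed

section \<open>Growth of Hilbert functions and dimension\<close>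

lemma homogeneous_ideal_subspace: "homogeneous_ideal I \<Longrightarrow> ring_ideal.subspace I"
  by (simp add: homogeneous_ideal_def)

lemma hom_component_mem:
  fixes I :: "('n, 'k::comm_ring_1) mpoly set"
  assumes I: "homogeneous_ideal I" and p: "p \<in> I"
  shows "hom_component d p \<in> I"
proof -
  have sub: "ring_ideal.subspace I" using I by (rule homogeneous_ideal_subspace)
  have "p \<in> ring_ideal.span {p \<in> I. \<exists>d. form d p}"
    using I p unfolding homogeneous_ideal_def by blast
  then show ?thesis
  proof (induction rule: ring_ideal.span_induct_alt)
    case base
    then show ?case using ring_ideal.subspace_0[OF sub] by simp
  next
    case (step c x y)
    then obtain e where e: "form e x" "x \<in> I" by blast
    have "hom_component d (c * x + y) = hom_component (d - e) c * x + hom_component d y"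
      by (simp add: hom_component_add hom_component_mult_form'[OF e(1)])
    then show ?case using step.IH e(2) sub by (simp add: ring_ideal.subspace_add ring_ideal.subspace_scale)
  qed
qed

lemma homogeneous_ideal_span_forms:
  fixes S :: "('n, 'k::comm_ring_1) mpoly set"
  assumes "\<And>p. p \<in> S \<Longrightarrow> \<exists>d. form d p"
  shows "homogeneous_ideal (ring_ideal.span S)"
proof -
  have "S \<subseteq> {p \<in> ring_ideal.span S. \<exists>d. form d p}" using assms ring_ideal.span_base by auto
  then have "ring_ideal.span S \<subseteq> ring_ideal.span {p \<in> ring_ideal.span S. \<exists>d. form d p}"
    by (rule ring_ideal.span_mono)
  moreover have "ring_ideal.span {p \<in> ring_ideal.span S. \<exists>d. form d p} \<subseteq> ring_ideal.span S"
    by (intro ring_ideal.span_minimal) auto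
  ultimately show ?thesis by (simp add: homogeneous_ideal_def)
qed

text \<open>\<open>Max\<close> refers to the linear order on exponents, which is compatible with
  addition. Only forms are considered, so that each Hilbert function value can be treated within one
  degree.\<close>

definition leading_monomials :: "('n::linorder, 'k::zero) mpoly set \<Rightarrow> ('n \<Rightarrow>\<^sub>0 nat) set" where
  "leading_monomials I = {Max (keys F) | F. F \<in> I \<and> F \<noteq> 0 \<and> (\<exists>e. form e F)}"

definition standard_monomials :: "('n::linorder, 'k::zero) mpoly set \<Rightarrow> ('n \<Rightarrow>\<^sub>0 nat) set" where
  "standard_monomials I = {m. \<forall>u\<in>leading_monomials I. \<forall>v. m \<noteq> v + u}"

text \<open>Reduction by leading monomials: a nonstandard \<open>m\<close> is the leading monomial
  of a multiple of some form in \<open>I\<close>, hence modulo \<open>I\<close> a combination of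
  smaller monomials. In a fixed degree there are finitely many of them, so their number can serve as
  the induction measure.\<close>

lemma monomial_in_span_standard:
  fixes I :: "('n::{finite, linorder}, 'k::field) mpoly set"
  assumes I: "ring_ideal.subspace I"
  shows "monom_degree m = d \<Longrightarrow> single m 1 \<in> mpoly_vs.span ({p \<in> I. form (int d) p} \<union> 
     (\<lambda>m. single m 1) ` {m \<in> standard_monomials I. monom_degree m = d})"
proof (induction "card {u. monom_degree u = d \<and> u < m}" arbitrary: m rule: less_induct)
  case less
  let ?V = "mpoly_vs.span ({p \<in> I. form (int d) p} \<union> (\<lambda>m. single m 1) ` {m \<in> standard_monomials I. monom_degree m = d})"
  show ?case
  proof (cases "m \<in> standard_monomials I")
    case True
    then show ?thesis using less.prems by (intro mpoly_vs.span_base) auto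
  next
    case False
    then obtain u v where uv: "u \<in> leading_monomials I" "m = v + u" unfolding standard_monomials_def by blast
    then obtain F e where F: "F \<in> I" "F \<noteq> 0" "form e F" "u = Max (keys F)"
      unfolding leading_monomials_def by blast
    have u: "u \<in> keys F" using F(2,4) by simp
    define c where "c = lookup F u"
    have c: "c \<noteq> 0" using u by (simp add: c_def in_keys_iff)
    define G where "G = single v (inverse c) * F"
    have G: "G \<in> I" unfolding G_def using I F(1) by (rule ring_ideal.subspace_scale)
    have e: "e = int (monom_degree u)" using F(3) u by (simp add: form_def)
    have formG: "form (int d) G" unfolding G_def
      by (rule form_mult'[OF _ F(3), of "int (monom_degree v)"]) (use less.prems e in \<open>auto simp: form_single uv(2)\<close>)
    have Gm: "lookup G m = 1" using c by (simp add: G_def uv(2) lookup_single_mult c_def)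
    have smaller: "w < m" if "w \<in> keys G" "w \<noteq> m" for w
    proof -
      have "w \<in> (+) v ` keys F" using that(1) keys_single_mult[of "inverse c" v F] c by (simp add: G_def)
      then obtain t where t: "t \<in> keys F" "w = v + t" by blast
      then have "t \<le> u" using F(4) by simp
      then have "w \<le> m" using t(2) uv(2) add_left_mono by blast
      then show ?thesis using that(2) by simp
    qed
    have G_sum: "G = single m 1 + (\<Sum>w\<in>keys G - {m}. single w (lookup G w))"
    proof -
      have "m \<in> keys G" using Gm by (simp add: in_keys_iff)
      then show ?thesis using poly_mapping_sum_monomials[of G] Gm
        by (simp add: sum.remove[of "keys G" m])
    qed
    have "(\<Sum>w\<in>keys G - {m}. single w (lookup G w)) = (\<Sum>w\<in>keys G - {m}. mpoly_scale (lookup G w) (single w 1))"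
      by (simp add: mpoly_scale_def mult_single)
    also have "\<dots> \<in> ?V"
    proof (intro mpoly_vs.span_sum mpoly_vs.span_scale)
      fix w assume w: "w \<in> keys G - {m}"
      then have lt: "w < m" using smaller by blast
      have deg: "monom_degree w = d" using formG w by (auto simp: form_def)
      have fin: "finite {u. monom_degree u = d \<and> u < m}"
        by (rule finite_subset[OF _ finite_monomials_of_degree[of "int d"]]) auto
      have "{u. monom_degree u = d \<and> u < w} \<subset> {u. monom_degree u = d \<and> u < m}"
        using lt deg by (auto dest: less_trans)
      then have "card {u. monom_degree u = d \<and> u < w} < card {u. monom_degree u = d \<and> u < m}"
        by (rule psubset_card_mono[OF fin])
      then show "single w 1 \<in> ?V" using less.hyps deg by blast
    qed
    finally have "(\<Sum>w\<in>keys G - {m}. single w (lookup G w)) \<in> ?V" .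
    moreover have "G \<in> ?V" using G formG by (intro mpoly_vs.span_base) auto
    ultimately have "G - (\<Sum>w\<in>keys G - {m}. single w (lookup G w)) \<in> ?V" by (rule mpoly_vs.span_diff[rotated])
    moreover have "G - (\<Sum>w\<in>keys G - {m}. single w (lookup G w)) = single m 1"
      by (subst (1) G_sum) simp
    ultimately show ?thesis by simp
  qed
qed

lemma finite_spanned_basis:
  fixes V :: "('n::finite, 'k::field) mpoly set"
  assumes "V \<subseteq> forms d"
  obtains B where "B \<subseteq> V" "finite B" "V \<subseteq> mpoly_vs.span B" "card B = mpoly_vs.dim V" "mpoly_vs.independent B"
proof -
  obtain B where B: "B \<subseteq> V" "mpoly_vs.independent B" "V \<subseteq> mpoly_vs.span B" "card B = mpoly_vs.dim V"
    using mpoly_vs.basis_exists by blast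
  have "B \<subseteq> mpoly_vs.span ((\<lambda>m. single m 1) ` {m :: 'n \<Rightarrow>\<^sub>0 nat. int (monom_degree m) = d})"
    using B(1) assms forms_finite_span by blast
  then have "finite B" using mpoly_vs.independent_span_bound[OF _ B(2)] finite_monomials_of_degree by blast
  with B that show thesis by blast
qed

text \<open>Standard monomials span the forms of degree \<open>d\<close> modulo those in
  \<open>I\<close>, which bounds the Hilbert function from above; it is nonnegative because the
  forms in \<open>I\<close> are a subspace of all forms.\<close>

lemma hilbert_function_bounds:
  fixes I :: "('n::{finite, linorder}, 'k::field) mpoly set"
  assumes I: "ring_ideal.subspace I"
  shows "0 \<le> hilbert_function I d"
    and "hilbert_function I d \<le> int (card {m \<in> standard_monomials I. monom_degree m = d})"
proof -
  let ?Id = "{p \<in> I. form (int d) p}" and ?S = "{m \<in> standard_monomials I. monom_degree m = d}"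
  obtain B where B: "B \<subseteq> ?Id" "finite B" "?Id \<subseteq> mpoly_vs.span B" "card B = mpoly_vs.dim ?Id" "mpoly_vs.independent B"
    by (rule finite_spanned_basis[of ?Id "int d"]) (auto simp: forms_def)
  have finS: "finite ?S" by (rule finite_subset[OF _ finite_monomials_of_degree[of "int d"]]) auto
  let ?T = "B \<union> (\<lambda>m. single m 1) ` ?S"
  have 1: "?Id \<union> (\<lambda>m. single m 1) ` ?S \<subseteq> mpoly_vs.span ?T"
    using B(3) mpoly_vs.span_mono[of B ?T] mpoly_vs.span_superset[of ?T] by blast
  then have 2: "mpoly_vs.span (?Id \<union> (\<lambda>m. single m 1) ` ?S) \<subseteq> mpoly_vs.span ?T"
    by (intro mpoly_vs.span_minimal) auto
  have "(\<lambda>m. single m 1) ` {m. int (monom_degree m) = int d} \<subseteq> mpoly_vs.span ?T"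
    using monomial_in_span_standard[OF I] 2 by auto
  then have "mpoly_vs.span ((\<lambda>m. single m 1) ` {m. int (monom_degree m) = int d}) \<subseteq> mpoly_vs.span ?T"
    by (intro mpoly_vs.span_minimal) auto
  then have "(forms (int d) :: ('n, 'k) mpoly set) \<subseteq> mpoly_vs.span ?T" using forms_finite_span[of "int d"] by blast
  then have "mpoly_vs.dim (forms (int d) :: ('n, 'k) mpoly set) \<le> card ?T"
    using B(2) finS by (intro mpoly_vs.dim_le_card) auto
  also have "\<dots> \<le> card B + card ((\<lambda>m. single m (1::'k)) ` ?S)" by (rule card_Un_le)
  also have "\<dots> \<le> card B + card ?S" using card_image_le[OF finS] by simp
  finally show "hilbert_function I d \<le> int (card ?S)"
    using B(4) by (simp add: hilbert_function_def forms_def)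
  obtain C where C: "C \<subseteq> (forms (int d) :: ('n, 'k) mpoly set)" "finite C" "(forms (int d) :: ('n, 'k) mpoly set) \<subseteq> mpoly_vs.span C" 
     "card C = mpoly_vs.dim (forms (int d) :: ('n, 'k) mpoly set)" "mpoly_vs.independent C"
    by (rule finite_spanned_basis[OF order_refl])
  have "B \<subseteq> mpoly_vs.span C" using B(1) C(3) by (auto simp: forms_def)
  then have "card B \<le> card C" using mpoly_vs.independent_span_bound[OF C(2) B(5)] by simp
  then show "0 \<le> hilbert_function I d" using B(4) C(4) by (simp add: hilbert_function_def forms_def)
qed

lemma poly_abs_bound: 
  fixes q :: "rat poly"
  shows "\<exists>K\<ge>0. \<forall>d::nat. \<bar>poly q (of_nat d)\<bar> \<le> K * (of_nat d + 1) ^ degree q"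
proof -
  define K where "K = (\<Sum>i\<le>degree q. \<bar>coeff q i\<bar>)"
  have "\<bar>poly q (of_nat d)\<bar> \<le> K * (of_nat d + 1) ^ degree q" for d :: nat
  proof -
    have "\<bar>poly q (of_nat d)\<bar> \<le> (\<Sum>i\<le>degree q. \<bar>coeff q i * of_nat d ^ i\<bar>)"
      unfolding poly_altdef by (rule sum_abs)
    also have "\<dots> \<le> (\<Sum>i\<le>degree q. \<bar>coeff q i\<bar> * (of_nat d + 1) ^ degree q)"
    proof (rule sum_mono)
      fix i assume "i \<in> {..degree q}"
      have "(of_nat d :: rat) ^ i \<le> (of_nat d + 1) ^ i" by (rule power_mono) auto
      also have "\<dots> \<le> (of_nat d + 1) ^ degree q" using \<open>i \<in> _\<close> by (intro power_increasing) auto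
      finally show "\<bar>coeff q i * of_nat d ^ i\<bar> \<le> \<bar>coeff q i\<bar> * (of_nat d + 1) ^ degree q"
        by (simp add: abs_mult mult_left_mono)
    qed
    finally show ?thesis by (simp add: K_def sum_distrib_right)
  qed
  moreover have "K \<ge> 0" by (simp add: K_def sum_nonneg)
  ultimately show ?thesis by blast
qed

text \<open>Separating the leading term turns the bound into
  \<open>\<bar>c\<bar> * d^(r+1) \<le> (C + K) * (d + 1)^r\<close>. Since
  \<open>d + 1 \<le> 2 * d\<close>, this bounds \<open>d\<close> itself.\<close>

lemma poly_growth_contradiction:
  fixes q :: "rat poly"
  assumes deg: "degree q = Suc r" and bound: "\<And>d. d \<ge> d0 \<Longrightarrow> \<bar>poly q (of_nat d)\<bar> \<le> C * (of_nat d + 1) ^ r"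
  shows False
proof -
  define c where "c = lead_coeff q"
  have c: "c \<noteq> 0" using deg degree_neq_of_coeff_0[of q r] unfolding c_def by auto
  define q' where "q' = q - Polynomial.monom c (Suc r)"
  have "degree q' \<le> r"
  proof -
    have "degree q' \<le> Suc r" unfolding q'_def using deg by (intro degree_diff_le) (auto simp: degree_monom_le)
    moreover have "coeff q' (Suc r) = 0" by (simp add: q'_def c_def deg)
    ultimately show ?thesis using degree_neq_of_coeff_0[of q' r] by simp
  qed
  obtain K where K: "K \<ge> 0" "\<And>d::nat. \<bar>poly q' (of_nat d)\<bar> \<le> K * (of_nat d + 1) ^ degree q'"
    using poly_abs_bound by blast
  have main: "\<bar>c\<bar> * of_nat d \<le> (C + K) * 2 ^ r" if d: "d \<ge> d0" "d \<ge> 1" for d :: nat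
  proof -
    have "poly q (of_nat d) = c * of_nat d ^ Suc r + poly q' (of_nat d)"
      by (simp add: q'_def poly_monom)
    then have "\<bar>c\<bar> * of_nat d ^ Suc r \<le> \<bar>poly q (of_nat d)\<bar> + \<bar>poly q' (of_nat d)\<bar>"
      using abs_mult[of c "of_nat d ^ Suc r"] by simp
    also have "\<bar>poly q' (of_nat d)\<bar> \<le> K * (of_nat d + 1) ^ degree q'" by (rule K)
    also have "\<dots> \<le> K * (of_nat d + 1) ^ r"
      using \<open>degree q' \<le> r\<close> K(1) by (intro mult_left_mono power_increasing) auto
    also have "\<bar>poly q (of_nat d)\<bar> \<le> C * (of_nat d + 1) ^ r" using bound d(1) by blast
    finally have 1: "\<bar>c\<bar> * of_nat d ^ Suc r \<le> (C + K) * (of_nat d + 1) ^ r" by (simp add: distrib_right)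
    have nonneg: "0 \<le> C + K"
    proof (rule ccontr)
      assume "\<not> ?thesis"
      then have "(C + K) * (of_nat d + 1) ^ r < 0" by (intro mult_neg_pos) auto
      moreover have "0 \<le> \<bar>c\<bar> * (of_nat d :: rat) ^ Suc r" by simp
      ultimately show False using 1 by linarith
    qed
    have "(of_nat d + 1 :: rat) ^ r \<le> (2 * of_nat d) ^ r" using d(2) by (intro power_mono) auto
    then have "(C + K) * (of_nat d + 1) ^ r \<le> (C + K) * (2 * of_nat d) ^ r" using nonneg by (rule mult_left_mono)
    with 1 have "(\<bar>c\<bar> * of_nat d) * of_nat d ^ r \<le> ((C + K) * 2 ^ r) * of_nat d ^ r"
      by (simp add: power_mult_distrib mult_ac)
    then show ?thesis using d(2) by (simp add: mult_le_cancel_right)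
  qed
  obtain N :: nat where "(C + K) * 2 ^ r / \<bar>c\<bar> < of_nat N" using reals_Archimedean2 by blast
  then have "(C + K) * 2 ^ r < \<bar>c\<bar> * of_nat N" using c by (simp add: field_simps)
  also have "\<dots> \<le> \<bar>c\<bar> * of_nat (max N (max d0 1))" by (intro mult_left_mono) auto
  also have "\<dots> \<le> (C + K) * 2 ^ r" by (rule main) auto
  finally show False by simp
qed

lemma poly_in_hom_component: "poly_in Z p \<Longrightarrow> poly_in Z (hom_component d p)"
  by (auto simp: poly_in_def hom_component_def keys_restrict_keys)

text \<open>For each set \<open>Z\<close> of \<open>r + 1\<close> variables, \<open>I\<close> has a
  leading monomial in \<open>Z\<close> alone. A standard monomial is not divisible by it, so at most
  \<open>r\<close> of its exponents are large; as the total degree is fixed, one of them depends on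
  the others. The count is thus of order \<open>d^(r-1)\<close>, and the factor \<open>Suc d\<close>
  on the left covers \<open>r = 0\<close> without a negative exponent.\<close>

lemma card_standard_monomials:
  fixes I :: "('n::{finite, linorder}, 'k::field) mpoly set"
  assumes I: "homogeneous_ideal I"
    and nonzero: "\<And>Z :: 'n set. card Z = Suc r \<Longrightarrow> \<exists>p\<in>I. poly_in Z p \<and> p \<noteq> 0"
  shows "\<exists>C d0. \<forall>d\<ge>d0. card {m \<in> standard_monomials I. monom_degree m = d} * Suc d \<le> C * Suc d ^ r"
proof -
  let ?n = "CARD('n)"
  have ex: "\<exists>u. u \<in> leading_monomials I \<and> keys u \<subseteq> Z" if Z: "card Z = Suc r" for Z :: "'n set"
  proof -
    obtain p where p: "p \<in> I" "poly_in Z p" "p \<noteq> 0" using nonzero[OF Z] by blast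
    obtain d where d: "hom_component d p \<noteq> 0" using p(3) hom_component_eqI[of p 0] by auto
    have "Max (keys (hom_component d p)) \<in> keys (hom_component d p)" using d by simp
    then have "keys (Max (keys (hom_component d p))) \<subseteq> Z"
      using poly_in_hom_component[OF p(2), of d] by (simp add: poly_in_def)
    moreover have "Max (keys (hom_component d p)) \<in> leading_monomials I"
      using hom_component_mem[OF I p(1), of d] d form_hom_component unfolding leading_monomials_def by blast
    ultimately show ?thesis by blast
  qed
  define u where "u Z = (SOME u. u \<in> leading_monomials I \<and> keys u \<subseteq> Z)" for Z :: "'n set"
  have u: "u Z \<in> leading_monomials I" "keys (u Z) \<subseteq> Z" if "card Z = Suc r" for Z
    using someI_ex[OF ex[OF that]] unfolding u_def by blast+
  \<comment> \<open>\<open>D\<close> exceeds every exponent of all the chosen leading monomials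
    \<open>u Z\<close>, so \<open>u Z\<close> divides any monomial whose exponents on
    \<open>Z\<close> are at least \<open>D\<close>.\<close>
  define D where "D = Suc (Max (monom_degree ` range u))"
  have D: "lookup (u Z) i < D" for Z i
  proof -
    have "lookup (u Z) i \<le> monom_degree (u Z)" by (rule lookup_le_monom_degree)
    also have "\<dots> \<le> Max (monom_degree ` range u)" by (rule Max_ge) auto
    finally show ?thesis by (simp add: D_def)
  qed
  define big where "big m = {i. lookup m i \<ge> D}" for m :: "'n \<Rightarrow>\<^sub>0 nat"
  have card_big: "card (big m) \<le> r" if m: "m \<in> standard_monomials I" for m
  proof (rule ccontr)
    assume "\<not> ?thesis"
    then obtain Z where Z: "Z \<subseteq> big m" "card Z = Suc r"
      using obtain_subset_with_card_n[of "Suc r" "big m"] by (auto simp: not_le Suc_le_eq)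
    have "lookup (u Z) i \<le> lookup m i" for i
    proof (cases "i \<in> Z")
      case True
      then show ?thesis using Z(1) D[of Z i] by (auto simp: big_def)
    next
      case False
      then have "i \<notin> keys (u Z)" using u(2)[OF Z(2)] by blast
      then show ?thesis by (simp add: in_keys_iff)
    qed
    then have "m = (m - u Z) + u Z" by (intro poly_mapping_eqI) (simp add: lookup_add lookup_minus)
    then show False using m u(1)[OF Z(2)] unfolding standard_monomials_def by blast
  qed
  let ?T = "\<lambda>d. SIGMA B:{B :: 'n set. card B \<le> r}. PiE UNIV (\<lambda>i. if i \<in> B then {..d} else {..<D})"
  have card_T: "card (?T d) \<le> 2 ^ ?n * D ^ ?n * Suc d ^ r" for d
  proof -
    have "card (?T d) = (\<Sum>B\<in>{B :: 'n set. card B \<le> r}. card (PiE UNIV (\<lambda>i. if i \<in> B then {..d} else {..<D})))"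
      by (rule card_SigmaI) (auto intro!: finite_PiE)
    also have "\<dots> \<le> (\<Sum>B\<in>{B :: 'n set. card B \<le> r}. D ^ ?n * Suc d ^ r)"
    proof (rule sum_mono)
      fix B :: "'n set" assume B: "B \<in> {B. card B \<le> r}"
      have "card (PiE UNIV (\<lambda>i. if i \<in> B then {..d} else {..<D})) = (\<Prod>i\<in>UNIV. if i \<in> B then Suc d else D)"
        by (subst card_PiE) (auto intro!: prod.cong)
      also have "\<dots> = Suc d ^ card B * D ^ card (- B)"
        by (subst prod.If_cases) (auto simp: prod_constant)
      also have "\<dots> \<le> Suc d ^ r * D ^ ?n"
        using B by (intro mult_mono power_increasing) (auto simp: D_def intro: card_mono)
      finally show "card (PiE UNIV (\<lambda>i. if i \<in> B then {..d} else {..<D})) \<le> D ^ ?n * Suc d ^ r" by (simp add: mult.commute)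
    qed
    also have "\<dots> = card {B :: 'n set. card B \<le> r} * (D ^ ?n * Suc d ^ r)" by simp
    also have "card {B :: 'n set. card B \<le> r} \<le> card (UNIV :: 'n set set)" by (rule card_mono) auto
    also have "card (UNIV :: 'n set set) = 2 ^ ?n" by (simp add: card_UNIV_set)
    finally show ?thesis by (simp add: mult_ac)
  qed
  have "card {m \<in> standard_monomials I. monom_degree m = d} * Suc d \<le> 2 ^ ?n * D ^ ?n * Suc d ^ r"
    if d: "d \<ge> ?n * D" for d
  proof -
    let ?S = "{m \<in> standard_monomials I. monom_degree m = d}"
    \<comment> \<open>The exponent at the first large index is determined by the total degree, so it
      can be overwritten by an arbitrary \<open>j \<le> d\<close> without losing injectivity; this
      uses up the factor \<open>Suc d\<close>.\<close>
    let ?f = "\<lambda>(m, j). (big m, (lookup m)(Min (big m) := j))"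
    \<comment> \<open>A degree of at least \<open>n * D\<close> forces some exponent to be large, so
      the index to be overwritten exists.\<close>
    have nonempty: "big m \<noteq> {}" if "monom_degree m = d" for m
    proof
      assume "big m = {}"
      then have "lookup m i < D" for i by (auto simp: big_def not_le)
      then have "monom_degree m < (\<Sum>i\<in>(UNIV :: 'n set). D)"
        unfolding monom_degree_UNIV by (intro sum_strict_mono) auto
      then show False using that d by simp
    qed
    have inj: "inj_on ?f (?S \<times> {..d})"
    proof (rule inj_onI)
      fix x y assume xy: "x \<in> ?S \<times> {..d}" "y \<in> ?S \<times> {..d}" "?f x = ?f y"
      obtain m j m' j' where mj: "x = (m, j)" "y = (m', j')" by (cases x, cases y) blast
      have *: "monom_degree m = d" "monom_degree m' = monom_degree m"
        "big m = big m'" "(lookup m)(Min (big m) := j) = (lookup m')(Min (big m') := j')"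
        using xy unfolding mj by auto
      let ?i = "Min (big m)"
      have eq: "lookup m i = lookup m' i" if "i \<noteq> ?i" for i
        using fun_cong[OF *(4), of i] that *(3) by simp
      have sum: "monom_degree m = lookup m ?i + (\<Sum>i\<in>UNIV - {?i}. lookup m i)"
        "monom_degree m' = lookup m' ?i + (\<Sum>i\<in>UNIV - {?i}. lookup m' i)"
        unfolding monom_degree_UNIV by (simp_all add: sum.remove[of UNIV ?i])
      have "(\<Sum>i\<in>UNIV - {?i}. lookup m i) = (\<Sum>i\<in>UNIV - {?i}. lookup m' i)"
        using eq by (intro sum.cong) auto
      then have "lookup m ?i = lookup m' ?i" using sum *(2) by simp
      then have "lookup m i = lookup m' i" for i using eq by (cases "i = ?i") simp_all
      then have "m = m'" by (rule poly_mapping_eqI)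
      moreover have "j = j'" using fun_cong[OF *(4), of ?i] *(3) by simp
      ultimately show "x = y" by (simp add: mj)
    qed
    have "?f ` (?S \<times> {..d}) \<subseteq> ?T d"
    proof (rule image_subsetI)
      fix x assume x: "x \<in> ?S \<times> {..d}"
      obtain m j where mj: "x = (m, j)" by (cases x) blast
      have *: "m \<in> standard_monomials I" "monom_degree m = d" "j \<le> d" using x unfolding mj by auto
      have min: "Min (big m) \<in> big m" by (rule Min_in[OF finite nonempty[OF *(2)]])
      have "lookup m i \<le> d" for i using lookup_le_monom_degree[of m i] *(2) by simp
      moreover have "lookup m i < D" if "i \<notin> big m" for i using that by (simp add: big_def)
      ultimately have "((lookup m)(Min (big m) := j)) i \<in> (if i \<in> big m then {..d} else {..<D})" for i
        using *(3) min by auto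
      then have "(lookup m)(Min (big m) := j) \<in> PiE UNIV (\<lambda>i. if i \<in> big m then {..d} else {..<D})"
        by (simp add: PiE_UNIV_domain)
      then show "?f x \<in> ?T d" using card_big[OF *(1)] by (simp add: mj)
    qed
    then have "card (?S \<times> {..d}) \<le> card (?T d)"
      by (rule card_inj_on_le[OF inj]) (auto intro!: finite_PiE)
    also have "\<dots> \<le> 2 ^ ?n * D ^ ?n * Suc d ^ r" by (rule card_T)
    finally show ?thesis by (simp add: card_cartesian_product)
  qed
  then show ?thesis by blast
qed

text \<open>If no \<open>r + 1\<close> variables were independent modulo \<open>I\<close>, there
  would be too few standard monomials for a Hilbert polynomial of degree \<open>r\<close>. A prime
  over \<open>I\<close> that avoids the nonzero polynomials in \<open>r + 1\<close> independent
  variables then has height at most \<open>n - r - 1\<close>.\<close>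

lemma height_le_of_hilbert_function:
  fixes I :: "('n::{finite, linorder}, 'k::field) mpoly set" and P :: "rat poly"
  assumes I: "homogeneous_ideal I" and deg: "degree P = r" "r < CARD('n)" "P \<noteq> 0"
    and P: "\<And>d. d \<ge> d0 \<Longrightarrow> poly P (of_nat d) = of_int (hilbert_function I d)"
  shows "height I \<le> enat (CARD('n) - Suc r)"
proof -
  have sub: "ring_ideal.subspace I" using I by (rule homogeneous_ideal_subspace)
  have "\<exists>Z :: 'n set. card Z = Suc r \<and> (\<forall>p\<in>I. poly_in Z p \<longrightarrow> p = 0)"
  proof (rule ccontr)
    assume "\<not> ?thesis"
    then obtain C d1 where C: "\<And>d. d \<ge> d1 \<Longrightarrow> card {m \<in> standard_monomials I. monom_degree m = d} * Suc d \<le> C * Suc d ^ r"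
      using card_standard_monomials[OF I, of r] by blast
    \<comment> \<open>The factor \<open>X + 1\<close> mirrors the factor \<open>Suc d\<close> in the
      count of standard monomials: degree \<open>r + 1\<close> is compared with growth of order
      \<open>r\<close>.\<close>
    have degq: "degree (P * [:1, 1:]) = Suc r"
      using deg by (subst degree_mult_eq) auto
    show False
    proof (rule poly_growth_contradiction[OF degq])
      fix d assume d: "d \<ge> max d0 d1"
      let ?h = "hilbert_function I d"
      let ?c = "card {m \<in> standard_monomials I. monom_degree m = d}"
      have "poly (P * [:1, 1:]) (of_nat d) = of_int ?h * (of_nat d + 1)"
        using P d by (simp add: algebra_simps)
      then have "\<bar>poly (P * [:1, 1:]) (of_nat d)\<bar> = of_int ?h * (of_nat d + 1)"
        using hilbert_function_bounds(1)[OF sub, of d] by simp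
      also have "(of_int ?h :: rat) \<le> of_int (int ?c)"
        using hilbert_function_bounds(2)[OF sub, of d] by (simp only: of_int_le_iff)
      then have "of_int ?h * (of_nat d + 1) \<le> (of_nat ?c * (of_nat d + 1) :: rat)"
        by (intro mult_right_mono) auto
      also have "\<dots> = of_nat (?c * Suc d)" by (simp add: algebra_simps)
      also have "\<dots> \<le> (of_nat (C * Suc d ^ r) :: rat)"
        using C[of d] d by (simp only: of_nat_le_iff max.bounded_iff)
      also have "\<dots> = of_nat C * (of_nat d + 1) ^ r" by (simp add: add.commute)
      finally show "\<bar>poly (P * [:1, 1:]) (of_nat d)\<bar> \<le> of_nat C * (of_nat d + 1) ^ r" .
    qed
  qed
  then obtain Z :: "'n set" where Z: "card Z = Suc r" "\<And>p. p \<in> I \<Longrightarrow> poly_in Z p \<Longrightarrow> p = 0" by blast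
  define M where "M = {p :: ('n, 'k) mpoly. poly_in Z p \<and> p \<noteq> 0}"
  have M1: "1 \<in> M" by (simp add: M_def poly_in_def)
  have M2: "p * q \<in> M" if "p \<in> M" "q \<in> M" for p q
  proof -
    have "keys m \<subseteq> Z" if m: "m \<in> keys (p * q)" for m
    proof -
      obtain a b where "m = a + b" "a \<in> keys p" "b \<in> keys q" using keys_mult[of p q] m by blast
      then show ?thesis using keys_add[of a b] \<open>p \<in> M\<close> \<open>q \<in> M\<close> unfolding M_def poly_in_def by blast
    qed
    then show ?thesis using that by (simp add: M_def poly_in_def)
  qed
  have "I \<inter> M = {}" using Z(2) unfolding M_def by blast
  then obtain Q where Q: "prime_ideal Q" "I \<subseteq> Q" "Q \<inter> M = {}"
    using exists_prime_avoiding[OF sub M1 M2] by blast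
  show ?thesis
  proof (rule height_le[OF Q(1,2)])
    fix l assume "prime_chain l Q"
    then have "l + card Z \<le> CARD('n)"
      using Q(3) by (intro prime_chain_length_le[of Q]) (auto simp: M_def)
    then show "l \<le> CARD('n) - Suc r" using Z(1) by simp
  qed
qed

section \<open>Unmixedness of complete intersections of codimension two\<close>

text \<open>With a strict bound on the degree in \<open>t\<close>, the value \<open>1\<close> says
  that \<open>t\<close> does not occur and \<open>0\<close> that the polynomial vanishes.\<close>

definition deg_less :: "'n \<Rightarrow> nat \<Rightarrow> ('n, 'k::zero) mpoly \<Rightarrow> bool" where
  "deg_less t e p \<longleftrightarrow> (\<forall>m\<in>keys p. lookup m t < e)"

lemma deg_less_mono: "deg_less t e p \<Longrightarrow> e \<le> f \<Longrightarrow> deg_less t f p"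
  by (auto simp: deg_less_def)

lemma deg_less_add: "deg_less t e p \<Longrightarrow> deg_less t e q \<Longrightarrow> deg_less t e (p + q :: ('n, 'k::comm_ring_1) mpoly)"
  unfolding deg_less_def using keys_add[of p q] by blast

lemma deg_less_uminus: "deg_less t e (- p :: ('n, 'k::comm_ring_1) mpoly) \<longleftrightarrow> deg_less t e p"
  by (simp add: deg_less_def in_keys_iff)

lemma deg_less_diff: "deg_less t e p \<Longrightarrow> deg_less t e q \<Longrightarrow> deg_less t e (p - q :: ('n, 'k::comm_ring_1) mpoly)"
  using deg_less_add[of t e p "- q"] by (simp add: deg_less_uminus)

lemma deg_less_mult:
  assumes "deg_less t e p" "deg_less t (Suc f) q"
  shows "deg_less t (e + f) (p * q :: ('n, 'k::comm_ring_1) mpoly)"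
  unfolding deg_less_def
proof
  fix m assume "m \<in> keys (p * q)"
  then obtain a b where "m = a + b" "a \<in> keys p" "b \<in> keys q" using keys_mult[of p q] by blast
  then show "lookup m t < e + f" using assms by (fastforce simp: deg_less_def lookup_add)
qed

lemma deg_less_mult_0: "deg_less t e p \<Longrightarrow> deg_less t 1 q \<Longrightarrow> deg_less t e (p * q :: ('n, 'k::comm_ring_1) mpoly)"
  using deg_less_mult[of t e p 0 q] by simp

lemma deg_less_mult_0': "deg_less t e p \<Longrightarrow> deg_less t 1 q \<Longrightarrow> deg_less t e (q * p :: ('n, 'k::comm_ring_1) mpoly)"
  using deg_less_mult_0[of t e p q] by (simp add: mult.commute)

lemma deg_less_poly_in: "poly_in Z p \<Longrightarrow> t \<notin> Z \<Longrightarrow> deg_less t 1 p"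
  unfolding poly_in_def deg_less_def by (metis in_keys_iff less_one subsetD)

lemma poly_in_mult:
  assumes "poly_in Z p" "poly_in Z q"
  shows "poly_in Z (p * q :: ('n, 'k::comm_ring_1) mpoly)"
  unfolding poly_in_def
proof
  fix m assume "m \<in> keys (p * q)"
  then obtain a b where "m = a + b" "a \<in> keys p" "b \<in> keys q" using keys_mult[of p q] by blast
  then show "keys m \<subseteq> Z" using assms keys_add[of a b] unfolding poly_in_def by blast
qed

abbreviation var_power :: "'n \<Rightarrow> nat \<Rightarrow> ('n, 'k::comm_ring_1) mpoly" where
  "var_power t e \<equiv> single (single t e) 1"

lemma var_power_mult: "var_power t a * var_power t b = var_power t (a + b)"
  by (simp add: mult_single single_add)

lemma deg_less_var_power: "deg_less t (Suc e) (var_power t e)"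
  by (simp add: deg_less_def)

lemma deg_less_var_power_other: "s \<noteq> t \<Longrightarrow> deg_less s 1 (var_power t e)"
  by (simp add: deg_less_def lookup_single)

text \<open>Splits off the coefficient of the top power of \<open>t\<close>. The last two clauses
  record that \<open>c\<close> acquires no new variables and that degrees in other variables do not
  grow, as needed when reductions in two variables are combined.\<close>

lemma top_split:
  fixes p :: "('n, 'k::comm_ring_1) mpoly"
  assumes p: "deg_less t (Suc D) p"
  shows "\<exists>c p'. p = c * var_power t D + p' \<and> deg_less t 1 c \<and> deg_less t D p' \<and>
    (\<forall>Z. poly_in (insert t Z) p \<longrightarrow> poly_in Z c) \<and>
    (\<forall>s f. s \<noteq> t \<longrightarrow> deg_less s f p \<longrightarrow> deg_less s f c \<and> deg_less s f p')"
proof -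
  define p' where "p' = restrict_keys {m. lookup m t < D} p"
  define q where "q = restrict_keys {m. lookup m t = D} p"
  define c where "c = (\<Sum>m\<in>keys q. single (m - single t D) (lookup q m))"
  have kq: "keys q = keys p \<inter> {m. lookup m t = D}" by (simp add: q_def keys_restrict_keys)
  have kp': "keys p' = keys p \<inter> {m. lookup m t < D}" by (simp add: p'_def keys_restrict_keys)
  have lt: "lookup m t < Suc D" if "m \<in> keys p" for m using p that by (simp add: deg_less_def)
  have "p = q + p'"
  proof (rule poly_mapping_eqI)
    fix m show "lookup p m = lookup (q + p') m"
      using lt[of m] by (cases "m \<in> keys p") (auto simp: q_def p'_def lookup_add lookup_restrict_keys when_def in_keys_iff)
  qed
  moreover have "c * var_power t D = q"
  proof -
    have "(m - single t D) + single t D = m" if "m \<in> keys q" for m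
      using that unfolding kq by (intro poly_mapping_eqI) (auto simp: lookup_add lookup_minus lookup_single when_def)
    then have "c * var_power t D = (\<Sum>m\<in>keys q. single m (lookup q m))"
      unfolding c_def sum_distrib_right by (intro sum.cong) (auto simp: mult_single)
    then show ?thesis using poly_mapping_sum_monomials[of q] by simp
  qed
  moreover have kc: "\<exists>u\<in>keys p. lookup u t = D \<and> m = u - single t D" if "m \<in> keys c" for m
  proof -
    have "m \<in> (\<Union>u\<in>keys q. keys (single (u - single t D) (lookup q u)))"
      by (rule subsetD[OF keys_sum that[unfolded c_def]])
    then obtain u where u: "u \<in> keys q" "m \<in> keys (single (u - single t D) (lookup q u))" by blast
    then have "m = u - single t D" by (metis keys_single empty_iff singletonD)
    then show ?thesis using u(1) unfolding kq by blast
  qed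
  have "deg_less t 1 c" unfolding deg_less_def using kc by (fastforce simp: lookup_minus)
  moreover have "deg_less t D p'" unfolding deg_less_def kp' by simp
  moreover have "poly_in Z c" if "poly_in (insert t Z) p" for Z
    unfolding poly_in_def
  proof
    fix m assume "m \<in> keys c"
    then obtain u where u: "u \<in> keys p" "lookup u t = D" "m = u - single t D" using kc by blast
    show "keys m \<subseteq> Z"
    proof
      fix i assume "i \<in> keys m"
      then have "i \<noteq> t" "i \<in> keys u" using u by (auto simp: in_keys_iff lookup_minus lookup_single when_def split: if_splits)
      then show "i \<in> Z" using that u(1) by (auto simp: poly_in_def)
    qed
  qed
  moreover have "deg_less s f c \<and> deg_less s f p'" if "s \<noteq> t" "deg_less s f p" for s f
  proof
    show "deg_less s f p'" using that(2) kp' by (simp add: deg_less_def)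
    show "deg_less s f c"
      unfolding deg_less_def
    proof
      fix m assume "m \<in> keys c"
      then obtain u where u: "u \<in> keys p" "m = u - single t D" using kc by blast
      then have "lookup m s = lookup u s" using that(1) by (simp add: lookup_minus lookup_single)
      then show "lookup m s < f" using that(2) u(1) by (simp add: deg_less_def)
    qed
  qed
  ultimately show ?thesis by blast
qed

lemma deg_less_exists: "\<exists>D. deg_less t D p"
proof -
  have "deg_less t (Suc (Max (insert 0 ((\<lambda>m. lookup m t) ` keys p)))) p"
    unfolding deg_less_def by (auto simp: less_Suc_eq_le intro: Max_ge)
  then show ?thesis by blast
qed

definition is_leading :: "'n \<Rightarrow> nat \<Rightarrow> ('n, 'k::comm_ring_1) mpoly \<Rightarrow> ('n, 'k) mpoly \<Rightarrow> ('n, 'k) mpoly \<Rightarrow> bool" where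
  "is_leading t e a F' F \<longleftrightarrow> F = a * var_power t e + F' \<and> a \<noteq> 0 \<and> deg_less t 1 a \<and> deg_less t e F'"

lemma leading_exists:
  fixes p :: "('n, 'k::comm_ring_1) mpoly"
  assumes "p \<noteq> 0"
  shows "\<exists>e c p'. is_leading t e c p' p \<and> (\<forall>Z. poly_in (insert t Z) p \<longrightarrow> poly_in Z c) \<and>
    (\<forall>s f. s \<noteq> t \<longrightarrow> deg_less s f p \<longrightarrow> deg_less s f c \<and> deg_less s f p')"
proof -
  define D where "D = (LEAST D. deg_less t D p)"
  have D: "deg_less t D p" unfolding D_def using deg_less_exists by (rule LeastI_ex)
  have "D \<noteq> 0"
  proof
    assume "D = 0"
    then have "keys p = {}" using D by (auto simp: deg_less_def)
    then show False using assms by simp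
  qed
  then obtain e where e: "D = Suc e" using not0_implies_Suc by blast
  obtain c p' where *: "p = c * var_power t e + p'" "deg_less t 1 c" "deg_less t e p'"
    "\<forall>Z. poly_in (insert t Z) p \<longrightarrow> poly_in Z c"
    "\<forall>s f. s \<noteq> t \<longrightarrow> deg_less s f p \<longrightarrow> deg_less s f c \<and> deg_less s f p'"
    using top_split[of t e p] D unfolding e by blast
  have "c \<noteq> 0"
  proof
    assume "c = 0"
    then have "deg_less t e p" using *(1,3) by simp
    then have "D \<le> e" unfolding D_def by (rule Least_le)
    then show False using e by simp
  qed
  then show ?thesis using * unfolding is_leading_def by blast
qed

text \<open>In a domain the leading terms in \<open>t\<close> have a nonzero product, so a nonzero
  multiple of \<open>F\<close> has degree at least \<open>e\<close> in \<open>t\<close>. The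
  reduction arguments below end here.\<close>

lemma leading_mult_nonzero:
  fixes F v :: "('n::linorder, 'k::idom) mpoly"
  assumes F: "is_leading t e a F' F" and small: "deg_less t e (F * v)"
  shows "v = 0"
proof (rule ccontr)
  assume "v \<noteq> 0"
  then obtain D c v' where v: "is_leading t D c v' v" using leading_exists[of v t] by blast
  have F: "F = a * var_power t e + F'" "a \<noteq> 0" "deg_less t 1 a" "deg_less t e F'"
    using F by (auto simp: is_leading_def)
  have v: "v = c * var_power t D + v'" "c \<noteq> 0" "deg_less t 1 c" "deg_less t D v'"
    using v by (auto simp: is_leading_def)
  define rest where "rest = v' * (a * var_power t e) + F' * (c * var_power t D) + F' * v'"
  have "F * v = (var_power t e * var_power t D) * (a * c) + rest"
    unfolding F(1) v(1) rest_def by (simp add: algebra_simps)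
  then have eq: "F * v = var_power t (e + D) * (a * c) + rest" unfolding var_power_mult .
  have "deg_less t (D + e) (v' * (a * var_power t e))"
    by (rule deg_less_mult[OF v(4) deg_less_mult_0'[OF deg_less_var_power F(3)]])
  moreover have "deg_less t (e + D) (F' * (c * var_power t D))"
    by (rule deg_less_mult[OF F(4) deg_less_mult_0'[OF deg_less_var_power v(3)]])
  moreover have "deg_less t (e + D) (F' * v')"
    using deg_less_mult[of t e F' D v'] deg_less_mono[of t D v' "Suc D"] F(4) v(4) by simp
  ultimately have rest: "deg_less t (e + D) rest" unfolding rest_def
    by (intro deg_less_add) (simp_all add: add.commute)
  have "keys (a * c) \<noteq> {}" using F(2) v(2) by simp
  then obtain m where m: "m \<in> keys (a * c)" by blast
  let ?m = "single t (e + D) + m"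
  have "lookup ?m t \<ge> e + D" by (simp add: lookup_add)
  then have "?m \<notin> keys rest" using rest by (auto simp: deg_less_def)
  moreover have "?m \<in> keys (single (single t (e + D)) 1 * (a * c))"
    using m keys_single_mult[of 1 "single t (e + D)" "a * c"] by simp
  ultimately have "?m \<in> keys (F * v)" unfolding eq by (simp add: in_keys_iff lookup_add)
  then show False using small \<open>lookup ?m t \<ge> e + D\<close> by (auto simp: deg_less_def)
qed

text \<open>The denominators of the field of fractions \<open>k(Z)\<close>: statements up to a
  factor from this set are statements over \<open>k(Z)\<close> with denominators cleared.\<close>

definition nonzero_polys :: "'n set \<Rightarrow> ('n, 'k::zero) mpoly set" where
  "nonzero_polys Z = {a. a \<noteq> 0 \<and> poly_in Z a}"

lemma nonzero_polys_mult: 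
  "a \<in> nonzero_polys Z \<Longrightarrow> b \<in> nonzero_polys Z \<Longrightarrow> a * b \<in> nonzero_polys (Z :: 'n::linorder set)"
  for a b :: "('n::linorder, 'k::idom) mpoly"
  by (simp add: nonzero_polys_def poly_in_mult)

lemma one_nonzero_polys: "(1 :: ('n, 'k::idom) mpoly) \<in> nonzero_polys Z"
  by (simp add: nonzero_polys_def poly_in_def)

text \<open>Division with remainder by \<open>F\<close> as a polynomial in \<open>t\<close> whose
  leading coefficient is a unit over \<open>k(Z)\<close>; \<open>b\<close> clears the denominators.
  The final clause says that degrees in variables outside \<open>Z\<close> and different from
  \<open>t\<close> are not raised.\<close>

lemma pseudo_division:
  fixes F h :: "('n::linorder, 'k::idom) mpoly"
  assumes F: "is_leading t e a F' F" "a \<in> nonzero_polys Z"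
    and other: "\<And>s. s \<noteq> t \<Longrightarrow> s \<notin> Z \<Longrightarrow> deg_less s 1 F'"
  shows "\<exists>b q r. b \<in> nonzero_polys Z \<and> b * h = q * F + r \<and> deg_less t e r \<and>
     (\<forall>s f. s \<noteq> t \<longrightarrow> s \<notin> Z \<longrightarrow> deg_less s f h \<longrightarrow> deg_less s f r)"
proof -
  have main: "\<exists>b q r. b \<in> nonzero_polys Z \<and> b * h = q * F + r \<and> deg_less t e r \<and>
     (\<forall>s f. s \<noteq> t \<longrightarrow> s \<notin> Z \<longrightarrow> deg_less s f h \<longrightarrow> deg_less s f r)" if "deg_less t (e + k) h" for k
    using that
  proof (induction k arbitrary: h)
    case 0
    then show ?case using one_nonzero_polys by (intro exI[of _ 1] exI[of _ 0] exI[of _ h]) simp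
  next
    case (Suc k)
    have Fa: "F = a * var_power t e + F'" "deg_less t 1 a" "deg_less t e F'" "poly_in Z a"
      using F by (auto simp: is_leading_def nonzero_polys_def)
    obtain c h' where c: "h = c * var_power t (e + k) + h'" "deg_less t 1 c" "deg_less t (e + k) h'"
      "\<forall>s f. s \<noteq> t \<longrightarrow> deg_less s f h \<longrightarrow> deg_less s f c \<and> deg_less s f h'"
      using top_split[of t "e + k" h] Suc.prems by auto
    define g where "g = a * h' - F' * (c * var_power t k)"
    have g: "a * h = (c * var_power t k) * F + g"
      unfolding g_def c(1) Fa(1) var_power_mult[of t e k, symmetric] by (simp add: algebra_simps)
    have "deg_less t (e + k) (F' * (c * var_power t k))"
      by (rule deg_less_mult[OF Fa(3) deg_less_mult_0'[OF deg_less_var_power c(2)]])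
    then have "deg_less t (e + k) g"
      unfolding g_def by (rule deg_less_diff[OF deg_less_mult_0'[OF c(3) Fa(2)]])
    from Suc.IH[OF this] obtain b q r where IH: "b \<in> nonzero_polys Z" "b * g = q * F + r" "deg_less t e r"
      "\<forall>s f. s \<noteq> t \<longrightarrow> s \<notin> Z \<longrightarrow> deg_less s f g \<longrightarrow> deg_less s f r" by blast
    have gs: "deg_less s f g" if s: "s \<noteq> t" "s \<notin> Z" "deg_less s f h" for s f
    proof -
      have "deg_less s f h'" "deg_less s f c" using c(4) s by blast+
      then show ?thesis unfolding g_def
        by (intro deg_less_diff deg_less_mult_0'[OF _ deg_less_poly_in[OF Fa(4) s(2)]]
            deg_less_mult_0'[OF _ other[OF s(1,2)]] deg_less_mult_0[OF _ deg_less_var_power_other[OF s(1)]])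
    qed
    have "b * a \<in> nonzero_polys Z" using IH(1) F(2) by (rule nonzero_polys_mult)
    moreover have "(b * a) * h = (q + b * (c * var_power t k)) * F + r"
    proof -
      have "(b * a) * h = b * (c * var_power t k) * F + b * g" unfolding mult.assoc g by (simp add: algebra_simps)
      then show ?thesis unfolding IH(2) by (simp add: algebra_simps)
    qed
    moreover have "deg_less s f r" if "s \<noteq> t" "s \<notin> Z" "deg_less s f h" for s f
      using IH(4) gs that by simp
    ultimately show ?case using IH(3) by (intro exI[of _ "b * a"] exI[of _ "q + b * (c * var_power t k)"] exI[of _ r]) simp
  qed
  from deg_less_exists[of t h] obtain D where "deg_less t D h" ..
  then have "deg_less t (e + D) h" by (rule deg_less_mono) simp
  then show ?thesis by (rule main)
qed

text \<open>Over \<open>k(Z)\<close>, each of the three polynomials involves a single variable of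
  its own, so regularity of the sequence can be shown by division with remainder in one variable at
  a time.\<close>

locale three_separate_polys =
  fixes Z :: "'n::linorder set" and t1 t2 t3 :: 'n and F1 F2 F3 :: "('n, 'k::idom) mpoly"
  assumes distinct: "t1 \<notin> Z" "t2 \<notin> Z" "t3 \<notin> Z" "t1 \<noteq> t2" "t1 \<noteq> t3" "t2 \<noteq> t3"
    and F: "F1 \<noteq> 0" "F2 \<noteq> 0" "F3 \<noteq> 0"
    "poly_in (insert t1 Z) F1" "poly_in (insert t2 Z) F2" "poly_in (insert t3 Z) F3"
begin

lemma division_F1:
  "\<exists>e1 a1 F1'. is_leading t1 e1 a1 F1' F1 \<and> (\<forall>h. \<exists>b q r. b \<in> nonzero_polys Z \<and> b * h = q * F1 + r \<and> deg_less t1 e1 r)"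
proof -
  obtain e a F' where l: "is_leading t1 e a F' F1" "\<forall>Z. poly_in (insert t1 Z) F1 \<longrightarrow> poly_in Z a"
    "\<forall>s f. s \<noteq> t1 \<longrightarrow> deg_less s f F1 \<longrightarrow> deg_less s f a \<and> deg_less s f F'"
    using leading_exists[OF F(1), of t1] by blast
  have "deg_less s 1 F'" if "s \<noteq> t1" "s \<notin> Z" for s
    using l(3) that deg_less_poly_in[OF F(4), of s] by blast
  moreover have "a \<in> nonzero_polys Z" using l(1,2) F(4) by (simp add: nonzero_polys_def is_leading_def)
  ultimately have "\<exists>b q r. b \<in> nonzero_polys Z \<and> b * h = q * F1 + r \<and> deg_less t1 e r" for h
    using pseudo_division[OF l(1), of Z h] by blast
  then show ?thesis using l(1) by blast
qed

text \<open>Beyond \<open>Z\<close>, \<open>F2\<close> involves only \<open>t2\<close>, so dividing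
  by it does not raise the degree in \<open>t1\<close>: a remainder reduced modulo \<open>F1\<close>
  stays reduced.\<close>

lemma division_F2:
  "\<exists>e2 a2 F2'. is_leading t2 e2 a2 F2' F2 \<and> (\<forall>h. \<exists>b q r. b \<in> nonzero_polys Z \<and> b * h = q * F2 + r \<and> deg_less t2 e2 r \<and>
     (\<forall>f. deg_less t1 f h \<longrightarrow> deg_less t1 f r))"
proof -
  obtain e a F' where l: "is_leading t2 e a F' F2" "\<forall>Z. poly_in (insert t2 Z) F2 \<longrightarrow> poly_in Z a"
    "\<forall>s f. s \<noteq> t2 \<longrightarrow> deg_less s f F2 \<longrightarrow> deg_less s f a \<and> deg_less s f F'"
    using leading_exists[OF F(2), of t2] by blast
  have o: "deg_less s 1 F'" if "s \<noteq> t2" "s \<notin> Z" for s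
    using l(3) that deg_less_poly_in[OF F(5), of s] by blast
  have a: "a \<in> nonzero_polys Z" using l(1,2) F(5) by (simp add: nonzero_polys_def is_leading_def)
  have "\<exists>b q r. b \<in> nonzero_polys Z \<and> b * h = q * F2 + r \<and> deg_less t2 e r \<and> (\<forall>f. deg_less t1 f h \<longrightarrow> deg_less t1 f r)" for h
    using pseudo_division[OF l(1) a o, of h] distinct(1,4) by blast
  then show ?thesis using l(1) by blast
qed

text \<open>For the remainder \<open>r\<close> of \<open>u\<close> modulo \<open>F1\<close>, the
  product \<open>F2 * r\<close> is a multiple of \<open>F1\<close> whose degree in \<open>t1\<close>
  is below that of \<open>F1\<close>, because \<open>F2\<close> is free of \<open>t1\<close>; so it
  vanishes.\<close>

lemma regular_pair:
  assumes eq: "F2 * u = F1 * v"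
  shows "\<exists>a w. a \<in> nonzero_polys Z \<and> a * u = F1 * w"
proof -
  obtain e1 a1 F1' where l: "is_leading t1 e1 a1 F1' F1"
    "\<forall>h. \<exists>b q r. b \<in> nonzero_polys Z \<and> b * h = q * F1 + r \<and> deg_less t1 e1 r" using division_F1 by blast
  obtain a q r where r: "a \<in> nonzero_polys Z" "a * u = q * F1 + r" "deg_less t1 e1 r" using l(2) by blast
  have "F2 * r = a * (F2 * u) - F2 * (q * F1)" using r(2) by (simp add: algebra_simps)
  also have "\<dots> = F1 * (a * v - q * F2)" unfolding eq by (simp add: algebra_simps)
  finally have 1: "F2 * r = F1 * (a * v - q * F2)" .
  have "deg_less t1 1 F2" by (rule deg_less_poly_in[OF F(5)]) (use distinct in auto)
  then have "deg_less t1 e1 (F2 * r)" by (rule deg_less_mult_0'[OF r(3)])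
  then have "a * v - q * F2 = 0" using leading_mult_nonzero[OF l(1)] unfolding 1 by blast
  then have "r = 0" using 1 F(2) by simp
  then have "a * u = F1 * q" using r(2) by (simp add: mult.commute)
  then show ?thesis using r(1) by blast
qed

text \<open>First \<open>u\<close> is reduced modulo \<open>F1\<close> and \<open>F2\<close>, and
  then the coefficient of \<open>F2\<close> modulo \<open>F1\<close>. Comparing degrees in
  \<open>t1\<close> removes the multiple of \<open>F1\<close>, and comparing degrees in
  \<open>t2\<close> removes the multiple of \<open>F2\<close>.\<close>

lemma regular_triple:
  assumes eq: "F3 * u = F1 * v + F2 * w"
  shows "\<exists>a c d. a \<in> nonzero_polys Z \<and> a * u = F1 * c + F2 * d"
proof -
  obtain e1 a1 F1' where l1: "is_leading t1 e1 a1 F1' F1"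
    "\<forall>h. \<exists>b q r. b \<in> nonzero_polys Z \<and> b * h = q * F1 + r \<and> deg_less t1 e1 r" using division_F1 by blast
  obtain e2 a2 F2' where l2: "is_leading t2 e2 a2 F2' F2"
    "\<forall>h. \<exists>b q r. b \<in> nonzero_polys Z \<and> b * h = q * F2 + r \<and> deg_less t2 e2 r \<and>
      (\<forall>f. deg_less t1 f h \<longrightarrow> deg_less t1 f r)" using division_F2 by blast
  obtain a q1 r1 where r1: "a \<in> nonzero_polys Z" "a * u = q1 * F1 + r1" "deg_less t1 e1 r1" using l1(2) by blast
  obtain b q2 r2 where r2: "b \<in> nonzero_polys Z" "b * r1 = q2 * F2 + r2" "deg_less t2 e2 r2" "deg_less t1 e1 r2" 
    using l2(2) r1(3) by blast
  have abu: "(b * a) * u = b * q1 * F1 + q2 * F2 + r2"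
    unfolding mult.assoc r1(2) distrib_left r2(2) by (simp add: algebra_simps)
  define v' w' where "v' = b * a * v - F3 * b * q1" and "w' = b * a * w - F3 * q2"
  have "F3 * r2 = (b * a) * (F3 * u) - F3 * (b * q1 * F1 + q2 * F2)"
    using abu by (simp add: algebra_simps)
  also have "\<dots> = F1 * v' + F2 * w'" unfolding eq v'_def w'_def by (simp add: algebra_simps)
  finally have 1: "F3 * r2 = F1 * v' + F2 * w'" .
  obtain c q r where r: "c \<in> nonzero_polys Z" "c * w' = q * F1 + r" "deg_less t1 e1 r" using l1(2) by blast
  have "c * (F3 * r2) = F1 * (c * v') + F2 * (c * w')" unfolding 1 by (simp add: algebra_simps)
  then have 2: "c * (F3 * r2) - F2 * r = F1 * (c * v' + F2 * q)" unfolding r(2) by (simp add: algebra_simps)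
  have c: "poly_in Z c" "c \<noteq> 0" using r(1) by (auto simp: nonzero_polys_def)
  have free: "deg_less t1 1 F2"
    by (rule deg_less_poly_in[OF F(5)]) (use distinct in auto)
  have free3: "deg_less t1 1 F3" "deg_less t2 1 F3"
    by (rule deg_less_poly_in[OF F(6)]; use distinct in simp)+
  have cfree: "deg_less t1 1 c" "deg_less t2 1 c"
    by (rule deg_less_poly_in[OF c(1)]; use distinct in simp)+
  have "deg_less t1 e1 (c * (F3 * r2) - F2 * r)"
    by (intro deg_less_diff deg_less_mult_0' r2(4) r(3) free free3 cfree)
  then have "c * v' + F2 * q = 0" using leading_mult_nonzero[OF l1(1)] unfolding 2 by blast
  then have 3: "c * (F3 * r2) = F2 * r" using 2 by simp
  have "deg_less t2 e2 (F2 * r)" unfolding 3[symmetric]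
    by (intro deg_less_mult_0' r2(3) free free3 cfree)
  then have "r = 0" using leading_mult_nonzero[OF l2(1)] by blast
  then have "r2 = 0" using 3 c(2) F(3) by simp
  then have "(b * a) * u = F1 * (b * q1) + F2 * q2" using abu by (simp add: algebra_simps)
  then show ?thesis using nonzero_polys_mult[OF r2(1) r1(1)] by blast
qed

text \<open>
  This is the vanishing of \<open>Ext\<^sup>2(R/Q, R) = Hom(R/Q, R/(x, y))\<close>, up to multiples by polynomials in
  the variables \<open>Z\<close>, for an ideal \<open>Q\<close> that contains \<open>F1, F2, F3\<close>.
\<close>

lemma socle_trivial:
  assumes reg: "\<And>a b. x * a + y * b = 0 \<Longrightarrow> \<exists>t. a = y * t \<and> b = - (x * t)" and y: "y \<noteq> 0"
    and g: "F1 * g = x * \<alpha>1 + y * \<beta>1" "F2 * g = x * \<alpha>2 + y * \<beta>2" "F3 * g = x * \<alpha>3 + y * \<beta>3"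
  shows "\<exists>a c d. a \<in> nonzero_polys Z \<and> a * g = x * c + y * d"
proof -
  \<comment> \<open>Multiplying two of the equations crosswise gives a syzygy of
    \<open>x, y\<close>, which by \<open>reg\<close> is a multiple of
    \<open>(y, -x)\<close>.\<close>
  have h: "\<exists>h. G * \<alpha> - F * \<alpha>' = y * h \<and> G * \<beta> - F * \<beta>' = - (x * h)"
    if "F * g = x * \<alpha> + y * \<beta>" "G * g = x * \<alpha>' + y * \<beta>'" for F G \<alpha> \<beta> \<alpha>' \<beta>'
  proof (rule reg)
    have "x * (G * \<alpha> - F * \<alpha>') + y * (G * \<beta> - F * \<beta>') = G * (x * \<alpha> + y * \<beta>) - F * (x * \<alpha>' + y * \<beta>')"
      by (simp add: algebra_simps)
    also have "\<dots> = 0" unfolding that[symmetric] by (simp add: algebra_simps)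
    finally show "x * (G * \<alpha> - F * \<alpha>') + y * (G * \<beta> - F * \<beta>') = 0" .
  qed
  obtain h12 where h12: "F2 * \<alpha>1 - F1 * \<alpha>2 = y * h12" "F2 * \<beta>1 - F1 * \<beta>2 = - (x * h12)" using h[OF g(1,2)] by blast
  obtain h13 where h13: "F3 * \<alpha>1 - F1 * \<alpha>3 = y * h13" using h[OF g(1,3)] by blast
  obtain h23 where h23: "F3 * \<alpha>2 - F2 * \<alpha>3 = y * h23" using h[OF g(2,3)] by blast
  \<comment> \<open>The elements \<open>h12\<close>, \<open>h13\<close>, \<open>h23\<close> satisfy
    the cocycle relation of the Koszul complex of \<open>F1, F2, F3\<close>, so regularity puts a
    multiple of \<open>h12\<close> into \<open>(F1, F2)\<close>.\<close>
  have "y * (F3 * h12 - F2 * h13 + F1 * h23) = F3 * (y * h12) - F2 * (y * h13) + F1 * (y * h23)"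
    by (simp add: algebra_simps)
  also have "\<dots> = 0" unfolding h12(1)[symmetric] h13[symmetric] h23[symmetric] by (simp add: algebra_simps)
  finally have "F3 * h12 - F2 * h13 + F1 * h23 = 0" using y by simp
  then have "F3 * h12 = F1 * (- h23) + F2 * h13" by (simp add: algebra_simps)
  then obtain a c d where a: "a \<in> nonzero_polys Z" "a * h12 = F1 * c + F2 * d" using regular_triple by blast
  \<comment> \<open>Correcting by \<open>c\<close> and \<open>d\<close> makes the coefficients of
    \<open>x\<close> and \<open>y\<close> divisible by \<open>F1\<close> up to denominators;
    cancelling \<open>F1\<close> from \<open>F1 * g\<close> then puts a multiple of \<open>g\<close>
    into \<open>(x, y)\<close>.\<close>
  have "a * (F2 * \<alpha>1 - F1 * \<alpha>2) = y * (F1 * c + F2 * d)" unfolding h12(1) a(2)[symmetric] by (simp add: algebra_simps)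
  then have "F2 * (a * \<alpha>1 - y * d) = F1 * (a * \<alpha>2 + y * c)" by (simp add: algebra_simps)
  then obtain b v where b: "b \<in> nonzero_polys Z" "b * (a * \<alpha>1 - y * d) = F1 * v" using regular_pair by blast
  have "a * (F2 * \<beta>1 - F1 * \<beta>2) = - (x * (F1 * c + F2 * d))" unfolding h12(2) a(2)[symmetric] by (simp add: algebra_simps)
  then have "F2 * (a * \<beta>1 + x * d) = F1 * (a * \<beta>2 - x * c)" by (simp add: algebra_simps)
  then obtain b' v' where b': "b' \<in> nonzero_polys Z" "b' * (a * \<beta>1 + x * d) = F1 * v'" using regular_pair by blast
  have "F1 * ((b * b' * a) * g) = (b * b' * a) * (F1 * g)" by (simp add: algebra_simps)
  also have "\<dots> = b' * x * (b * (a * \<alpha>1 - y * d)) + b * y * (b' * (a * \<beta>1 + x * d))"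
    unfolding g(1) by (simp add: algebra_simps)
  also have "\<dots> = F1 * (x * (b' * v) + y * (b * v'))" unfolding b(2) b'(2) by (simp add: algebra_simps)
  finally have "(b * b' * a) * g = x * (b' * v) + y * (b * v')" using F(1) by simp
  then show ?thesis using nonzero_polys_mult[OF nonzero_polys_mult[OF b(1) b'(1)] a(1)] by blast
qed

end

text \<open>Let \<open>Z\<close> be a maximal set of variables independent modulo \<open>Q\<close>.
  A chain of length three leaves at least three variables outside \<open>Z\<close>, each algebraic
  over \<open>Z\<close> modulo \<open>Q\<close>. The resulting elements of \<open>Q\<close> in
  separate variables force a nonzero polynomial in \<open>Z\<close> into \<open>Q\<close>.\<close>

lemma associated_prime_chain_le_2:
  fixes x y :: "('n::{finite, linorder}, 'k::field) mpoly"
  assumes reg: "\<And>a b. x * a + y * b = 0 \<Longrightarrow> \<exists>t. a = y * t \<and> b = - (x * t)" and y: "y \<noteq> 0"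
    and Q: "prime_ideal Q" "Q = {r. \<exists>a b. r * g = x * a + y * b}" and chain: "prime_chain l Q"
  shows "l \<le> 2"
proof -
  let ?good = "\<lambda>Z :: 'n set. \<forall>p\<in>Q. poly_in Z p \<longrightarrow> p = 0"
  \<comment> \<open>A proper ideal contains no nonzero constant, so the empty set is a starting
    point for the maximal choice.\<close>
  have "?good {}"
  proof (intro ballI impI)
    fix p assume p: "p \<in> Q" "poly_in {} p"
    then have "form 0 p" by (simp add: poly_in_def form_def)
    from form_0_eq[OF this] obtain c where c: "p = const_poly c" ..
    show "p = 0"
    proof (rule ccontr)
      assume "p \<noteq> 0"
      then have "c \<noteq> 0" using c by auto
      then have "const_poly (inverse c) * p = 1" unfolding c by (simp add: mult_single)
      moreover have "const_poly (inverse c) * p \<in> Q"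
        using p(1) prime_ideal_subspace[OF Q(1)] by (intro ring_ideal.subspace_scale)
      ultimately show False using Q(1) by (simp add: prime_ideal_def)
    qed
  qed
  then have "{} \<in> {Z. ?good Z}" by simp
  then obtain Z where Z: "?good Z" and max: "\<And>Y. ?good Y \<Longrightarrow> Z \<subseteq> Y \<Longrightarrow> Z = Y"
    using finite_has_maximal[of "{Z. ?good Z}"] by auto
  have len: "l + card Z \<le> CARD('n)" using Z chain by (intro prime_chain_length_le[of Q]) auto
  show ?thesis
  proof (rule ccontr)
    assume "\<not> l \<le> 2"
    then have "3 \<le> card (- Z)" using len by (simp add: Compl_eq_Diff_UNIV card_Diff_subset)
    then obtain T where T: "T \<subseteq> - Z" "card T = 3" by (rule obtain_subset_with_card_n)
    from T(2) obtain t1 t2 t3 where t: "T = {t1, t2, t3}" "t1 \<noteq> t2" "t2 \<noteq> t3" "t1 \<noteq> t3"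
      unfolding card_3_iff by blast
    \<comment> \<open>By maximality of \<open>Z\<close>, adding one more variable produces a nonzero
      element of \<open>Q\<close>.\<close>
    have ex: "\<exists>F\<in>Q. poly_in (insert t Z) F \<and> F \<noteq> 0" if "t \<in> T" for t
    proof (rule ccontr)
      assume "\<not> ?thesis"
      then have "?good (insert t Z)" by blast
      then have "Z = insert t Z" by (rule max) auto
      then show False using that T(1) by blast
    qed
    obtain F1 where F1: "F1 \<in> Q" "poly_in (insert t1 Z) F1" "F1 \<noteq> 0" using ex[of t1] t(1) by auto
    obtain F2 where F2: "F2 \<in> Q" "poly_in (insert t2 Z) F2" "F2 \<noteq> 0" using ex[of t2] t(1) by auto
    obtain F3 where F3: "F3 \<in> Q" "poly_in (insert t3 Z) F3" "F3 \<noteq> 0" using ex[of t3] t(1) by auto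
    interpret three_separate_polys Z t1 t2 t3 F1 F2 F3
      by standard (use F1 F2 F3 t T in auto)
    obtain a1 b1 a2 b2 a3 b3 where "F1 * g = x * a1 + y * b1" "F2 * g = x * a2 + y * b2" "F3 * g = x * a3 + y * b3"
      using F1(1) F2(1) F3(1) unfolding Q(2) by blast
    then obtain a c d where a: "a \<in> nonzero_polys Z" "a * g = x * c + y * d"
      using socle_trivial[OF reg y] by blast
    then have "a \<in> Q" unfolding Q(2) by blast
    then show False using a(1) Z by (auto simp: nonzero_polys_def)
  qed
qed

section \<open>Exact complexes of length three\<close>

text \<open>The maps are written entrywise, with \<open>A a i\<close> in row \<open>a\<close> and
  column \<open>i\<close>. The homomorphism \<open>ct\<close> abstracts the constant term, and its
  vanishing on \<open>A\<close> and \<open>c\<close> is the minimality of the resolution.\<close>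

locale exact_complex =
  fixes f :: "nat \<Rightarrow> 'a::idom" and A :: "nat \<Rightarrow> nat \<Rightarrow> 'a" and c :: "nat \<Rightarrow> 'a" and ct :: "'a \<Rightarrow> 'k::field"
  assumes exact0: "\<And>p q r. f 0 * p + f 1 * q + f 2 * r = 0 \<Longrightarrow> \<exists>x y z.
      p = A 0 0 * x + A 0 1 * y + A 0 2 * z \<and>
      q = A 1 0 * x + A 1 1 * y + A 1 2 * z \<and>
      r = A 2 0 * x + A 2 1 * y + A 2 2 * z"
    and complex0: "\<And>j. j < 3 \<Longrightarrow> f 0 * A 0 j + f 1 * A 1 j + f 2 * A 2 j = 0"
    and exact1: "\<And>x y z. (\<And>a. a < 3 \<Longrightarrow> A a 0 * x + A a 1 * y + A a 2 * z = 0) \<Longrightarrow> \<exists>t. x = c 0 * t \<and> y = c 1 * t \<and> z = c 2 * t"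
    and complex1: "\<And>a. a < 3 \<Longrightarrow> A a 0 * c 0 + A a 1 * c 1 + A a 2 * c 2 = 0"
    and c_nonzero_ex: "c 0 \<noteq> 0 \<or> c 1 \<noteq> 0 \<or> c 2 \<noteq> 0"
    and ct_add: "ct (x + y) = ct x + ct y"
    and ct_mult: "ct (x * y) = ct x * ct y"
    and ct_1: "ct 1 = 1"
    and ct_A: "a < 3 \<Longrightarrow> i < 3 \<Longrightarrow> ct (A a i) = 0"
    and ct_c: "i < 3 \<Longrightarrow> ct (c i) = 0"
begin

lemma ct_0: "ct 0 = 0"
  using ct_add[of 0 0] by (metis add.right_neutral add_left_cancel)

lemma ct_uminus: "ct (- x) = - ct x"
  using ct_add[of x "- x"] by (simp add: ct_0 add_eq_0_iff2)

lemma ct_diff: "ct (x - y) = ct x - ct y"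
  using ct_add[of x "- y"] by (simp add: ct_uminus)

lemma exact1_rows:
  assumes "A 0 0 * x + A 0 1 * y + A 0 2 * z = 0" "A 1 0 * x + A 1 1 * y + A 1 2 * z = 0"
    "A 2 0 * x + A 2 1 * y + A 2 2 * z = 0"
  shows "\<exists>t. x = c 0 * t \<and> y = c 1 * t \<and> z = c 2 * t"
proof (rule exact1)
  fix a :: nat assume "a < 3"
  then have "a = 0 \<or> a = 1 \<or> a = 2" by linarith
  then show "A a 0 * x + A a 1 * y + A a 2 * z = 0" using assms by blast
qed

text \<open>The hypotheses say that the cross product with \<open>c\<close> is zero. Multiplying a
  row of \<open>A\<close> applied to \<open>(x, y, z)\<close> by an entry of \<open>c\<close>
  therefore gives a multiple of that row applied to \<open>c\<close>, which is zero; so the vector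
  lies in the kernel of \<open>A\<close>.\<close>

lemma parallel_to_c:
  assumes "y * c 2 = z * c 1" "z * c 0 = x * c 2" "x * c 1 = y * c 0"
  shows "\<exists>t. x = c 0 * t \<and> y = c 1 * t \<and> z = c 2 * t"
proof (rule exact1)
  fix a :: nat assume "a < 3"
  note e = complex1[OF this]
  let ?s = "A a 0 * x + A a 1 * y + A a 2 * z"
  have "c 0 * ?s = x * (A a 0 * c 0 + A a 1 * c 1 + A a 2 * c 2)" using assms by Groebner_Basis.algebra
  moreover have "c 1 * ?s = y * (A a 0 * c 0 + A a 1 * c 1 + A a 2 * c 2)" using assms by Groebner_Basis.algebra
  moreover have "c 2 * ?s = z * (A a 0 * c 0 + A a 1 * c 1 + A a 2 * c 2)" using assms by Groebner_Basis.algebra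
  ultimately show "?s = 0" using c_nonzero_ex unfolding e by auto
qed

lemma sum_f_zero:
  assumes "c 0 * s = 0" "c 1 * s = 0" "c 2 * s = 0"
  shows "s = 0"
  using assms c_nonzero_ex by auto

text \<open>
  The Koszul complex of \<open>c\<close> is exact in degree one: this is the comparison of the given complex
  with the Koszul complex in the proof of the Buchsbaum-Eisenbud criterion.
\<close>

lemma koszul_exact:
  assumes r: "r0 * c 0 + r1 * c 1 + r2 * c 2 = 0"
  shows "\<exists>b0 b1 b2. r0 = b1 * c 2 - b2 * c 1 \<and> r1 = b2 * c 0 - b0 * c 2 \<and> r2 = b0 * c 1 - b1 * c 0"
proof -
  \<comment> \<open>Each row of \<open>A\<close> and the vector \<open>r\<close> are both orthogonal
    to \<open>c\<close>, so their cross product is a multiple of \<open>c\<close>.\<close>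
  have row: "\<exists>w. A a 1 * r2 - A a 2 * r1 = c 0 * w \<and> A a 2 * r0 - A a 0 * r2 = c 1 * w \<and> A a 0 * r1 - A a 1 * r0 = c 2 * w"
    if a: "a < 3" for a
  proof (rule parallel_to_c)
    note e = complex1[OF a]
    show "(A a 2 * r0 - A a 0 * r2) * c 2 = (A a 0 * r1 - A a 1 * r0) * c 1" using r e by Groebner_Basis.algebra
    show "(A a 0 * r1 - A a 1 * r0) * c 0 = (A a 1 * r2 - A a 2 * r1) * c 2" using r e by Groebner_Basis.algebra
    show "(A a 1 * r2 - A a 2 * r1) * c 1 = (A a 2 * r0 - A a 0 * r2) * c 0" using r e by Groebner_Basis.algebra
  qed
  obtain w0 where w0: "A 0 1 * r2 - A 0 2 * r1 = c 0 * w0" "A 0 2 * r0 - A 0 0 * r2 = c 1 * w0" "A 0 0 * r1 - A 0 1 * r0 = c 2 * w0"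
    using row[of 0] by auto
  obtain w1 where w1: "A 1 1 * r2 - A 1 2 * r1 = c 0 * w1" "A 1 2 * r0 - A 1 0 * r2 = c 1 * w1" "A 1 0 * r1 - A 1 1 * r0 = c 2 * w1"
    using row[of 1] by auto
  obtain w2 where w2: "A 2 1 * r2 - A 2 2 * r1 = c 0 * w2" "A 2 2 * r0 - A 2 0 * r2 = c 1 * w2" "A 2 0 * r1 - A 2 1 * r0 = c 2 * w2"
    using row[of 2] by auto
  have f: "f 0 * A 0 0 + f 1 * A 1 0 + f 2 * A 2 0 = 0" "f 0 * A 0 1 + f 1 * A 1 1 + f 2 * A 2 1 = 0"
    "f 0 * A 0 2 + f 1 * A 1 2 + f 2 * A 2 2 = 0" using complex0[of 0] complex0[of 1] complex0[of 2] by simp_all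
  \<comment> \<open>As \<open>f\<close> kills \<open>A\<close>, the combination of the factors with
    coefficients \<open>f\<close> vanishes after multiplication by \<open>c\<close>. The factors
    form a syzygy of \<open>f\<close> and lift through \<open>A\<close>.\<close>
  have "f 0 * w0 + f 1 * w1 + f 2 * w2 = 0"
  proof (rule sum_f_zero)
    show "c 0 * (f 0 * w0 + f 1 * w1 + f 2 * w2) = 0" using w0(1) w1(1) w2(1) f by Groebner_Basis.algebra
    show "c 1 * (f 0 * w0 + f 1 * w1 + f 2 * w2) = 0" using w0(2) w1(2) w2(2) f by Groebner_Basis.algebra
    show "c 2 * (f 0 * w0 + f 1 * w1 + f 2 * w2) = 0" using w0(3) w1(3) w2(3) f by Groebner_Basis.algebra
  qed
  then obtain z0 z1 z2 where z: "w0 = A 0 0 * z0 + A 0 1 * z1 + A 0 2 * z2"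
    "w1 = A 1 0 * z0 + A 1 1 * z1 + A 1 2 * z2" "w2 = A 2 0 * z0 + A 2 1 * z1 + A 2 2 * z2"
    using exact0 by blast
  \<comment> \<open>Inserting the lift into one coordinate of the cross products yields a vector
    killed by \<open>A\<close>, hence a multiple of \<open>c\<close>; the same is done for the other
    two coordinates.\<close>
  have "\<exists>t. - (z0 * c 0) = c 0 * t \<and> r2 - z1 * c 0 = c 1 * t \<and> - r1 - z2 * c 0 = c 2 * t"
    by (rule exact1_rows; use w0(1) w1(1) w2(1) z in Groebner_Basis.algebra)
  then obtain t0 where t0: "- (z0 * c 0) = c 0 * t0" "r2 - z1 * c 0 = c 1 * t0" "- r1 - z2 * c 0 = c 2 * t0" by blast
  have "\<exists>t. - r2 - z0 * c 1 = c 0 * t \<and> - (z1 * c 1) = c 1 * t \<and> r0 - z2 * c 1 = c 2 * t"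
    by (rule exact1_rows; use w0(2) w1(2) w2(2) z in Groebner_Basis.algebra)
  then obtain t1 where t1: "- r2 - z0 * c 1 = c 0 * t1" "- (z1 * c 1) = c 1 * t1" "r0 - z2 * c 1 = c 2 * t1" by blast
  have "\<exists>t. r1 - z0 * c 2 = c 0 * t \<and> - r0 - z1 * c 2 = c 1 * t \<and> - (z2 * c 2) = c 2 * t"
    by (rule exact1_rows; use w0(3) w1(3) w2(3) z in Groebner_Basis.algebra)
  then obtain t2 where t2: "r1 - z0 * c 2 = c 0 * t2" "- r0 - z1 * c 2 = c 1 * t2" "- (z2 * c 2) = c 2 * t2" by blast
  \<comment> \<open>The three multipliers are the coefficients sought. The identities are verified
    after multiplication by each entry of \<open>c\<close>, one of which is nonzero.\<close>
  have r0: "r0 - (t1 * c 2 - t2 * c 1) = 0"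
  proof (rule sum_f_zero)
    show "c 0 * (r0 - (t1 * c 2 - t2 * c 1)) = 0" using r t0(1) t1(1) t2(1) by Groebner_Basis.algebra
    show "c 1 * (r0 - (t1 * c 2 - t2 * c 1)) = 0" using r t0(2) t1(2) t2(2) by Groebner_Basis.algebra
    show "c 2 * (r0 - (t1 * c 2 - t2 * c 1)) = 0" using r t0(3) t1(3) t2(3) by Groebner_Basis.algebra
  qed
  have r1: "r1 - (t2 * c 0 - t0 * c 2) = 0"
  proof (rule sum_f_zero)
    show "c 0 * (r1 - (t2 * c 0 - t0 * c 2)) = 0" using r t0(1) t1(1) t2(1) by Groebner_Basis.algebra
    show "c 1 * (r1 - (t2 * c 0 - t0 * c 2)) = 0" using r t0(2) t1(2) t2(2) by Groebner_Basis.algebra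
    show "c 2 * (r1 - (t2 * c 0 - t0 * c 2)) = 0" using r t0(3) t1(3) t2(3) by Groebner_Basis.algebra
  qed
  have r2: "r2 - (t0 * c 1 - t1 * c 0) = 0"
  proof (rule sum_f_zero)
    show "c 0 * (r2 - (t0 * c 1 - t1 * c 0)) = 0" using r t0(1) t1(1) t2(1) by Groebner_Basis.algebra
    show "c 1 * (r2 - (t0 * c 1 - t1 * c 0)) = 0" using r t0(2) t1(2) t2(2) by Groebner_Basis.algebra
    show "c 2 * (r2 - (t0 * c 1 - t1 * c 0)) = 0" using r t0(3) t1(3) t2(3) by Groebner_Basis.algebra
  qed
  show ?thesis using r0 r1 r2 by auto
qed

text \<open>If an entry of \<open>c\<close> were zero, the corresponding unit vector would be
  orthogonal to \<open>c\<close>, and exactness of the Koszul complex would write \<open>1\<close>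
  as a combination of the other two entries, whose constant terms vanish.\<close>

lemma c_nonzero: "c 0 \<noteq> 0" "c 1 \<noteq> 0" "c 2 \<noteq> 0"
proof -
  have ct: "ct (x * c i - y * c j) = 0" if "i < 3" "j < 3" for x y i j
    using that by (simp add: ct_diff ct_mult ct_c)
  show "c 0 \<noteq> 0"
  proof
    assume "c 0 = 0"
    then obtain b0 b1 b2 where "1 = b1 * c 2 - b2 * c 1" using koszul_exact[of 1 0 0] by auto
    then show False using ct[of 2 1 b1 b2] ct_1 by simp
  qed
  show "c 1 \<noteq> 0"
  proof
    assume "c 1 = 0"
    then obtain b0 b1 b2 where "1 = b2 * c 0 - b0 * c 2" using koszul_exact[of 0 1 0] by auto
    then show False using ct[of 0 2 b2 b0] ct_1 by simp
  qed
  show "c 2 \<noteq> 0"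
  proof
    assume "c 2 = 0"
    then obtain b0 b1 b2 where "1 = b0 * c 1 - b1 * c 0" using koszul_exact[of 0 0 1] by auto
    then show False using ct[of 1 0 b0 b1] ct_1 by simp
  qed
qed

lemma ct_image: "a < 3 \<Longrightarrow> ct (A a 0 * x + A a 1 * y + A a 2 * z) = 0"
  by (simp add: ct_add ct_mult ct_A)

lemma syzygy_ct:
  assumes "f 0 * p + f 1 * q + f 2 * r = 0"
  shows "ct p = 0" "ct q = 0" "ct r = 0"
  using exact0[OF assms] ct_image[of 0] ct_image[of 1] ct_image[of 2] by auto

lemma row_koszul:
  assumes "a < 3"
  shows "\<exists>p :: nat \<Rightarrow> 'a. A a 0 = p 1 * c 2 - p 2 * c 1 \<and> A a 1 = p 2 * c 0 - p 0 * c 2 \<and> A a 2 = p 0 * c 1 - p 1 * c 0"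
proof -
  obtain b0 b1 b2 where b: "A a 0 = b1 * c 2 - b2 * c 1" "A a 1 = b2 * c 0 - b0 * c 2" "A a 2 = b0 * c 1 - b1 * c 0"
    using koszul_exact[OF complex1[OF assms]] by blast
  then show ?thesis by (intro exI[of _ "\<lambda>i. if i = 0 then b0 else if i = 1 then b1 else b2"]) simp
qed

text \<open>The hypotheses describe cross products of \<open>c\<close> with vectors
  \<open>(q a, p a, 0)\<close>. The second column of \<open>A\<close> then shows that
  \<open>q\<close> is a syzygy of \<open>f\<close>; lifting it through \<open>A\<close> gives a
  vector \<open>(\<gamma>, -\<alpha>, 0)\<close> in the kernel of \<open>A\<close>. Such a multiple
  of \<open>c\<close> is zero since \<open>c 2\<close> is not, but \<open>\<alpha>\<close> has
  constant term \<open>1\<close>.\<close>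

lemma factor_not_zero:
  assumes P: "\<And>a. a < 3 \<Longrightarrow> A a 0 = p a * c 2" "\<And>a. a < 3 \<Longrightarrow> A a 1 = - (q a * c 2)" 
    "\<And>a. a < 3 \<Longrightarrow> A a 2 = q a * c 1 - p a * c 0"
  shows False
proof -
  have fq: "f 0 * q 0 + f 1 * q 1 + f 2 * q 2 = 0"
  proof -
    have "f 0 * A 0 1 + f 1 * A 1 1 + f 2 * A 2 1 = 0" "A 0 1 = - (q 0 * c 2)" "A 1 1 = - (q 1 * c 2)" "A 2 1 = - (q 2 * c 2)"
      using complex0[of 1] P(2)[of 0] P(2)[of 1] P(2)[of 2] by simp_all
    then have "(f 0 * q 0 + f 1 * q 1 + f 2 * q 2) * c 2 = 0" by Groebner_Basis.algebra
    then show ?thesis using c_nonzero(3) by simp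
  qed
  obtain x y z where xyz: "q 0 = A 0 0 * x + A 0 1 * y + A 0 2 * z"
    "q 1 = A 1 0 * x + A 1 1 * y + A 1 2 * z" "q 2 = A 2 0 * x + A 2 1 * y + A 2 2 * z"
    using exact0[OF fq] by blast
  then have q: "q a = A a 0 * x + A a 1 * y + A a 2 * z" if "a < 3" for a
  proof -
    have "a = 0 \<or> a = 1 \<or> a = 2" using that by linarith
    then show ?thesis using xyz by blast
  qed
  \<comment> \<open>The coefficients of \<open>q a\<close> and \<open>p a\<close> after the lift of
    \<open>q\<close> is moved to the left-hand side.\<close>
  define \<alpha> \<gamma> where "\<alpha> = 1 + c 2 * y - c 1 * z" and "\<gamma> = c 0 * z - c 2 * x"
  have "\<exists>t. \<gamma> = c 0 * t \<and> - \<alpha> = c 1 * t \<and> 0 = c 2 * t"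
  proof (rule exact1)
    fix a :: nat assume a: "a < 3"
    have "q a * \<alpha> + p a * \<gamma> = 0" using q[OF a] P(1-3)[OF a] unfolding \<alpha>_def \<gamma>_def by Groebner_Basis.algebra
    then show "A a 0 * \<gamma> + A a 1 * - \<alpha> + A a 2 * 0 = 0" using P(1,2)[OF a] by Groebner_Basis.algebra
  qed
  then have "\<alpha> = 0" using c_nonzero(3) by auto
  moreover have "ct \<alpha> = 1" by (simp add: \<alpha>_def ct_add ct_diff ct_mult ct_1 ct_c)
  ultimately show False by (simp add: ct_0)
qed

end

section \<open>Graded exact complexes\<close>

lemma linear_mpoly31I:
  assumes "\<And>x y. h (x + y) = h x + h y" "\<And>c x. h (mpoly3_scale c x) = mpoly_scale c (h x)"
  shows "Vector_Spaces.linear mpoly3_scale mpoly_scale (h :: _ \<Rightarrow> ('n, 'k::field) mpoly)"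
  unfolding Vector_Spaces.linear_iff
  using assms mpoly_vs.vector_space_axioms mpoly3_vs.vector_space_axioms by blast

lemma linear_mpoly13I:
  assumes "\<And>x y. h (x + y) = h x + h y" "\<And>c x. h (mpoly_scale c x) = mpoly3_scale c (h x)"
  shows "Vector_Spaces.linear mpoly_scale mpoly3_scale (h :: ('n, 'k::field) mpoly \<Rightarrow> _)"
  unfolding Vector_Spaces.linear_iff
  using assms mpoly_vs.vector_space_axioms mpoly3_vs.vector_space_axioms by blast

lemma linear_mpoly33I:
  assumes "\<And>x y. h (x + y) = h x + h y" "\<And>c x. h (mpoly3_scale c x) = mpoly3_scale c (h x)"
  shows "Vector_Spaces.linear mpoly3_scale mpoly3_scale 
    (h :: ('n, 'k::field) mpoly \<times> ('n, 'k) mpoly \<times> ('n, 'k) mpoly \<Rightarrow> ('n, 'k) mpoly \<times> ('n, 'k) mpoly \<times> ('n, 'k) mpoly)"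
  unfolding Vector_Spaces.linear_iff
  using assms mpoly3_vs.vector_space_axioms by blast

section \<open>Graded pieces of free modules of rank three and of syzygies\<close>

definition forms3 :: "int \<Rightarrow> int \<Rightarrow> int \<Rightarrow> (('n, 'k::zero) mpoly \<times> ('n, 'k) mpoly \<times> ('n, 'k) mpoly) set" where
  "forms3 a b c = forms a \<times> forms b \<times> forms c"

lemma subspace_forms3: "mpoly3_vs.subspace (forms3 a b c)"
  using mpoly_vs.subspace_0[OF subspace_forms] mpoly_vs.subspace_add[OF subspace_forms] mpoly_vs.subspace_scale[OF subspace_forms]
  by (auto simp: forms3_def mpoly3_vs.subspace_def mpoly3_scale_def zero_prod_def)

lemma forms3_finite_span:
  "\<exists>S. finite S \<and> (forms3 a b c :: (('n::finite, 'k::field) mpoly \<times> ('n, 'k) mpoly \<times> ('n, 'k) mpoly) set) \<subseteq> mpoly3_vs.span S"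
proof -
  let ?i1 = "\<lambda>p :: ('n, 'k) mpoly. (p, 0, 0) :: ('n, 'k) mpoly \<times> ('n, 'k) mpoly \<times> ('n, 'k) mpoly"
  let ?i2 = "\<lambda>p :: ('n, 'k) mpoly. (0, p, 0) :: ('n, 'k) mpoly \<times> ('n, 'k) mpoly \<times> ('n, 'k) mpoly"
  let ?i3 = "\<lambda>p :: ('n, 'k) mpoly. (0, 0, p) :: ('n, 'k) mpoly \<times> ('n, 'k) mpoly \<times> ('n, 'k) mpoly"
  let ?M = "\<lambda>d. (\<lambda>m. single m (1::'k)) ` {m :: 'n \<Rightarrow>\<^sub>0 nat. int (monom_degree m) = d}"
  let ?S = "?i1 ` ?M a \<union> ?i2 ` ?M b \<union> ?i3 ` ?M c"
  interpret i1: Vector_Spaces.linear mpoly_scale mpoly3_scale ?i1 by (rule linear_mpoly13I) (auto simp: mpoly3_scale_def)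
  interpret i2: Vector_Spaces.linear mpoly_scale mpoly3_scale ?i2 by (rule linear_mpoly13I) (auto simp: mpoly3_scale_def)
  interpret i3: Vector_Spaces.linear mpoly_scale mpoly3_scale ?i3 by (rule linear_mpoly13I) (auto simp: mpoly3_scale_def)
  have sub: "mpoly3_vs.span (?i1 ` ?M a) \<subseteq> mpoly3_vs.span ?S" "mpoly3_vs.span (?i2 ` ?M b) \<subseteq> mpoly3_vs.span ?S"
    "mpoly3_vs.span (?i3 ` ?M c) \<subseteq> mpoly3_vs.span ?S"
    by (intro mpoly3_vs.span_mono; blast)+
  have "(p, q, r) \<in> mpoly3_vs.span ?S" if "p \<in> forms a" "q \<in> forms b" "r \<in> forms c" for p q r
  proof -
    have "?i1 p \<in> mpoly3_vs.span ?S" "?i2 q \<in> mpoly3_vs.span ?S" "?i3 r \<in> mpoly3_vs.span ?S"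
      using i1.spans_image[OF forms_finite_span[of a]] i2.spans_image[OF forms_finite_span[of b]]
        i3.spans_image[OF forms_finite_span[of c]] sub that by blast+
    then have "?i1 p + (?i2 q + ?i3 r) \<in> mpoly3_vs.span ?S" by (intro mpoly3_vs.span_add)
    then show ?thesis by simp
  qed
  then have "forms3 a b c \<subseteq> mpoly3_vs.span ?S" by (auto simp: forms3_def)
  moreover have "finite ?S" by (intro finite_UnI finite_imageI finite_monomials_of_degree)
  ultimately show ?thesis by (intro exI[of _ ?S] conjI)
qed

lemma dim_forms3:
  "mpoly3_vs.dim (forms3 a b c :: (('n::finite, 'k::field) mpoly \<times> ('n, 'k) mpoly \<times> ('n, 'k) mpoly) set) =
     mpoly_vs.dim (forms a :: ('n, 'k) mpoly set) + mpoly_vs.dim (forms b :: ('n, 'k) mpoly set) + mpoly_vs.dim (forms c :: ('n, 'k) mpoly set)"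
proof -
  obtain S where S: "finite S" "(forms3 a b c :: (('n, 'k) mpoly \<times> ('n, 'k) mpoly \<times> ('n, 'k) mpoly) set) \<subseteq> mpoly3_vs.span S"
    using forms3_finite_span by blast
  let ?V = "forms3 a b c :: (('n, 'k) mpoly \<times> ('n, 'k) mpoly \<times> ('n, 'k) mpoly) set"
  let ?p1 = "\<lambda>(p, q, r). p :: ('n, 'k) mpoly" and ?p2 = "\<lambda>(p, q, r). q :: ('n, 'k) mpoly" and ?p3 = "\<lambda>(p, q, r). r :: ('n, 'k) mpoly"
  have l1: "Vector_Spaces.linear mpoly3_scale mpoly_scale ?p1" by (rule linear_mpoly31I) (auto simp: mpoly3_scale_def)
  have l2: "Vector_Spaces.linear mpoly3_scale mpoly_scale ?p2" by (rule linear_mpoly31I) (auto simp: mpoly3_scale_def)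
  have l3: "Vector_Spaces.linear mpoly3_scale mpoly_scale ?p3" by (rule linear_mpoly31I) (auto simp: mpoly3_scale_def)
  let ?K1 = "{v \<in> ?V. ?p1 v = 0}" let ?K2 = "{v \<in> ?K1. ?p2 v = 0}"
  have z: "0 \<in> forms d" for d by (simp add: forms_def)
  interpret p1: Vector_Spaces.linear mpoly3_scale mpoly_scale ?p1 by (fact l1)
  interpret p2: Vector_Spaces.linear mpoly3_scale mpoly_scale ?p2 by (fact l2)
  have K1: "mpoly3_vs.subspace (?V \<inter> {v. ?p1 v = 0})"
    by (intro mpoly3_vs.subspace_inter subspace_forms3 p1.subspace_kernel)
  have K2: "mpoly3_vs.subspace ((?V \<inter> {v. ?p1 v = 0}) \<inter> {v. ?p2 v = 0})"
    by (rule mpoly3_vs.subspace_inter[OF K1 p2.subspace_kernel])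
  have "?K1 = ?V \<inter> {v. ?p1 v = 0}" "?K2 = (?V \<inter> {v. ?p1 v = 0}) \<inter> {v. ?p2 v = 0}" by auto
  then have K: "mpoly3_vs.subspace ?K1" "mpoly3_vs.subspace ?K2" using K1 K2 by (simp_all only:)
  have KS: "?K1 \<subseteq> mpoly3_vs.span S" "?K2 \<subseteq> mpoly3_vs.span S" using S(2) by auto
  have "mpoly3_vs.dim ?V = mpoly3_vs.dim ?K1 + mpoly_vs.dim (?p1 ` ?V)"
    by (rule mpoly_pair31.dim_kernel_image[OF l1 subspace_forms3 S])
  moreover have "mpoly3_vs.dim ?K1 = mpoly3_vs.dim ?K2 + mpoly_vs.dim (?p2 ` ?K1)"
    by (rule mpoly_pair31.dim_kernel_image[OF l2 K(1) S(1) KS(1)])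
  moreover have "mpoly_vs.dim (?p3 ` ?K2) = mpoly3_vs.dim ?K2"
    by (rule mpoly_pair31.dim_injective_image[OF l3 K(2) S(1) KS(2)]) (auto simp: zero_prod_def)
  moreover have "?p1 ` ?V = forms a" using z by (force simp: forms3_def image_iff)
  moreover have "?p2 ` ?K1 = forms b" using z by (force simp: forms3_def image_iff)
  moreover have "?p3 ` ?K2 = forms c" using z by (force simp: forms3_def image_iff)
  ultimately show ?thesis by simp
qed

abbreviation forms_dim :: "'n::finite itself \<Rightarrow> 'k::field itself \<Rightarrow> int \<Rightarrow> int" where
  "forms_dim n k d \<equiv> int (mpoly_vs.dim (forms d :: ('n::finite, 'k::field) mpoly set))"

definition syzygies3 :: "(nat \<Rightarrow> ('n, 'k::comm_ring_1) mpoly) \<Rightarrow> int \<Rightarrow> (('n, 'k) mpoly \<times> ('n, 'k) mpoly \<times> ('n, 'k) mpoly) set" where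
  "syzygies3 f d = {v \<in> forms3 d d d. (\<lambda>(p, q, r). f 0 * p + f 1 * q + f 2 * r) v = 0}"

definition ideal3 :: "(nat \<Rightarrow> 'a::comm_ring_1) \<Rightarrow> 'a set" where
  "ideal3 f = {f 0 * p + f 1 * q + f 2 * r | p q r. True}"

lemma linear_combination3:
  "Vector_Spaces.linear mpoly3_scale mpoly_scale (\<lambda>(p, q, r). f 0 * p + f 1 * q + f (2 :: nat) * r :: ('n, 'k::field) mpoly)"
  by (rule linear_mpoly31I) (auto simp: mpoly3_scale_def mpoly_scale_def algebra_simps)

text \<open>The coefficients of a homogeneous combination may be replaced by their components in
  degree \<open>e - d\<close>, so a graded piece of the ideal is the image of a graded piece of
  \<open>R^3\<close>.\<close>

lemma ideal3_forms:
  fixes f :: "nat \<Rightarrow> ('n, 'k::comm_ring_1) mpoly"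
  assumes f: "\<And>i. i < 3 \<Longrightarrow> form d (f i)"
  shows "{p \<in> ideal3 f. form e p} = (\<lambda>(p, q, r). f 0 * p + f 1 * q + f 2 * r) ` forms3 (e - d) (e - d) (e - d)"
proof (intro equalityI subsetI)
  fix p assume "p \<in> {p \<in> ideal3 f. form e p}"
  then obtain u v w where p: "form e p" "p = f 0 * u + f 1 * v + f 2 * w" by (auto simp: ideal3_def)
  have "p = hom_component e p" using hom_component_form[OF p(1), of e] by simp
  also have "\<dots> = f 0 * hom_component (e - d) u + f 1 * hom_component (e - d) v + f 2 * hom_component (e - d) w"
    unfolding p(2) by (simp add: hom_component_add hom_component_mult_form[OF f])
  finally show "p \<in> (\<lambda>(p, q, r). f 0 * p + f 1 * q + f 2 * r) ` forms3 (e - d) (e - d) (e - d)"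
    by (intro image_eqI[of _ _ "(hom_component (e - d) u, hom_component (e - d) v, hom_component (e - d) w)"])
      (simp_all add: forms3_def forms_def)
next
  fix p assume "p \<in> (\<lambda>(p, q, r). f 0 * p + f 1 * q + f 2 * r) ` forms3 (e - d) (e - d) (e - d)"
  then obtain u v w where p: "form (e - d) u" "form (e - d) v" "form (e - d) w" "p = f 0 * u + f 1 * v + f 2 * w"
    by (auto simp: forms3_def forms_def)
  have "form e p" unfolding p(4)
    by (intro form_add form_mult'[OF f]) (use p in auto)
  then show "p \<in> {p \<in> ideal3 f. form e p}" using p(4) by (auto simp: ideal3_def)
qed

text \<open>Rank-nullity for the map \<open>R^3 \<rightarrow> J\<close> in one degree. Apart from
  the syzygies, only the ideal and the common degree of the generators enter.\<close>

lemma dim_syzygies3: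
  fixes f :: "nat \<Rightarrow> ('n::finite, 'k::field) mpoly"
  assumes f: "\<And>i. i < 3 \<Longrightarrow> form d (f i)"
  shows "int (mpoly3_vs.dim (syzygies3 f e)) + int (mpoly_vs.dim {p \<in> ideal3 f. form (e + d) p}) = 3 * forms_dim TYPE('n) TYPE('k) e"
proof -
  obtain S where S: "finite S" "(forms3 e e e :: (('n, 'k) mpoly \<times> ('n, 'k) mpoly \<times> ('n, 'k) mpoly) set) \<subseteq> mpoly3_vs.span S"
    using forms3_finite_span by blast
  have im: "{p \<in> ideal3 f. form (e + d) p} = (\<lambda>(p, q, r). f 0 * p + f 1 * q + f 2 * r) ` forms3 e e e"
    using ideal3_forms[of d f "e + d", OF f] by (simp only: add_diff_cancel_right')
  have "mpoly3_vs.dim (forms3 e e e :: (('n, 'k) mpoly \<times> ('n, 'k) mpoly \<times> ('n, 'k) mpoly) set) =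
    mpoly3_vs.dim (syzygies3 f e) + mpoly_vs.dim {p \<in> ideal3 f. form (e + d) p}"
    unfolding syzygies3_def im
    by (rule mpoly_pair31.dim_kernel_image[OF linear_combination3[of f] subspace_forms3 S])
  then show ?thesis by (simp add: dim_forms3)
qed

text \<open>The entry \<open>c i\<close> maps the generator of \<open>R(-s)\<close> into
  \<open>R(-3 - \<delta> i)\<close>, which explains its degree
  \<open>s - 3 - \<delta> i\<close>.\<close>

locale graded_exact_complex = exact_complex f A c "\<lambda>p. lookup p 0"
  for f :: "nat \<Rightarrow> ('n::{finite, linorder}, 'k::field) mpoly" and A c +
  fixes \<delta> :: "nat \<Rightarrow> int" and s :: int
  defines s: "s \<equiv> \<delta> 0 + \<delta> 1 + \<delta> 2"
  assumes form_f: "a < 3 \<Longrightarrow> form 3 (f a)"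
    and form_A: "a < 3 \<Longrightarrow> i < 3 \<Longrightarrow> form (\<delta> i) (A a i)"
    and form_c: "i < 3 \<Longrightarrow> form (s - 3 - \<delta> i) (c i)"
begin

lemma c_nonzero': "i < 3 \<Longrightarrow> c i \<noteq> 0"
proof -
  assume "i < 3"
  then have "i = 0 \<or> i = 1 \<or> i = 2" by linarith
  then show ?thesis using c_nonzero by blast
qed

text \<open>A nonzero form with vanishing constant term has positive degree. For
  \<open>i = 2\<close> this reads \<open>\<delta> 0 + \<delta> 1 \<ge> 4\<close>, the lower bound in
  the classification.\<close>

lemma degree_c_pos: "i < 3 \<Longrightarrow> s - 3 - \<delta> i \<ge> 1"
proof (rule ccontr)
  assume i: "i < 3" "\<not> s - 3 - \<delta> i \<ge> 1"
  then consider "s - 3 - \<delta> i < 0" | "s - 3 - \<delta> i = 0" by linarith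
  then have "c i = 0"
  proof cases
    case 1
    then show ?thesis using form_negative[OF form_c[OF i(1)]] by simp
  next
    case 2
    then have "form 0 (c i)" using form_c[OF i(1)] by simp
    from form_0_eq[OF this] show ?thesis using ct_c[OF i(1)] by simp
  qed
  then show False using c_nonzero'[OF i(1)] by simp
qed

text \<open>All entries of \<open>A\<close> and \<open>c\<close> are forms, so the cross product
  representation persists when each coefficient is replaced by its component of degree
  \<open>3 - \<delta> i\<close>.\<close>

lemma rows_koszul:
  obtains p :: "nat \<Rightarrow> nat \<Rightarrow> ('n, 'k) mpoly" where 
    "\<And>a i. form (3 - \<delta> i) (p a i)"
    "\<And>a. a < 3 \<Longrightarrow> A a 0 = p a 1 * c 2 - p a 2 * c 1"
    "\<And>a. a < 3 \<Longrightarrow> A a 1 = p a 2 * c 0 - p a 0 * c 2"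
    "\<And>a. a < 3 \<Longrightarrow> A a 2 = p a 0 * c 1 - p a 1 * c 0"
proof -
  have "\<forall>a. \<exists>p :: nat \<Rightarrow> ('n, 'k) mpoly. a < 3 \<longrightarrow> A a 0 = p 1 * c 2 - p 2 * c 1 \<and> A a 1 = p 2 * c 0 - p 0 * c 2 \<and> A a 2 = p 0 * c 1 - p 1 * c 0"
    using row_koszul by blast
  from choice[OF this] obtain q :: "nat \<Rightarrow> nat \<Rightarrow> ('n, 'k) mpoly" where
    "\<forall>a. a < 3 \<longrightarrow> A a 0 = q a 1 * c 2 - q a 2 * c 1 \<and> A a 1 = q a 2 * c 0 - q a 0 * c 2 \<and> A a 2 = q a 0 * c 1 - q a 1 * c 0" ..
  note q = this[rule_format]
  define p where "p a i = hom_component (3 - \<delta> i) (q a i)" for a i :: nat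
  have deg: "\<delta> 0 - (s - 3 - \<delta> 2) = 3 - \<delta> 1" "\<delta> 0 - (s - 3 - \<delta> 1) = 3 - \<delta> 2" "\<delta> 1 - (s - 3 - \<delta> 0) = 3 - \<delta> 2"
    "\<delta> 1 - (s - 3 - \<delta> 2) = 3 - \<delta> 0" "\<delta> 2 - (s - 3 - \<delta> 1) = 3 - \<delta> 0" "\<delta> 2 - (s - 3 - \<delta> 0) = 3 - \<delta> 1"
    by (simp_all add: s)
  have hc: "hom_component e (x * c 0) = hom_component (e - (s - 3 - \<delta> 0)) x * c 0"
    "hom_component e (x * c 1) = hom_component (e - (s - 3 - \<delta> 1)) x * c 1"
    "hom_component e (x * c 2) = hom_component (e - (s - 3 - \<delta> 2)) x * c 2" for e x
    by (rule hom_component_mult_form'[OF form_c]; simp)+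
  have A: "A a i = hom_component (\<delta> i) (A a i)" if "a < 3" "i < 3" for a i
    using hom_component_form[OF form_A[OF that], of "\<delta> i"] by simp
  show thesis
  proof (rule that)
    show "form (3 - \<delta> i) (p a i)" for a i by (simp add: p_def)
    fix a :: nat assume a: "a < 3"
    note q = q[OF a]
    have A0: "A a 0 = q a 1 * c 2 - q a 2 * c 1" and A1: "A a 1 = q a 2 * c 0 - q a 0 * c 2"
      and A2: "A a 2 = q a 0 * c 1 - q a 1 * c 0" using q by blast+
    have "A a 0 = hom_component (\<delta> 0) (A a 0)" by (rule A[OF a]) simp
    then show "A a 0 = p a 1 * c 2 - p a 2 * c 1"
      by (simp only: A0 hom_component_diff hc deg p_def)
    have "A a 1 = hom_component (\<delta> 1) (A a 1)" by (rule A[OF a]) simp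
    then show "A a 1 = p a 2 * c 0 - p a 0 * c 2"
      by (simp only: A1 hom_component_diff hc deg p_def)
    have "A a 2 = hom_component (\<delta> 2) (A a 2)" by (rule A[OF a]) simp
    then show "A a 2 = p a 0 * c 1 - p a 1 * c 0"
      by (simp only: A2 hom_component_diff hc deg p_def)
  qed
qed

lemma delta_2_le: "\<delta> 2 \<le> 3"
proof (rule ccontr)
  assume "\<not> \<delta> 2 \<le> 3"
  obtain p where p: "\<And>a i. form (3 - \<delta> i) (p a i)"
    "\<And>a. a < 3 \<Longrightarrow> A a 0 = p a 1 * c 2 - p a 2 * c 1"
    "\<And>a. a < 3 \<Longrightarrow> A a 1 = p a 2 * c 0 - p a 0 * c 2"
    "\<And>a. a < 3 \<Longrightarrow> A a 2 = p a 0 * c 1 - p a 1 * c 0" by (rule rows_koszul) blast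
  have "p a 2 = 0" for a using form_negative[OF p(1)[of 2 a]] \<open>\<not> \<delta> 2 \<le> 3\<close> by simp
  then show False using factor_not_zero[of "\<lambda>a. p a 1" "\<lambda>a. p a 0"] p(2-4) by simp
qed

lemma delta_cases:
  assumes "\<delta> 0 \<le> \<delta> 1" "\<delta> 1 \<le> \<delta> 2"
  shows "(\<delta> 0, \<delta> 1, \<delta> 2) \<in> {(1, 3, 3), (2, 2, 2), (2, 2, 3), (2, 3, 3), (3, 3, 3)}"
proof -
  have "\<delta> 0 + \<delta> 1 \<ge> 4" using degree_c_pos[of 2] by (simp add: s)
  moreover note delta_2_le assms
  ultimately have "\<delta> 0 \<in> {1, 2, 3}" "\<delta> 1 \<in> {2, 3}" "\<delta> 2 \<in> {2, 3}" by auto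
  then show ?thesis using \<open>\<delta> 0 + \<delta> 1 \<ge> 4\<close> assms by auto
qed

text \<open>A graded version of the permutability of regular sequences: \<open>T / (c\<^sub>2)\<close> equals \<open>c\<^sub>0 (T / (c\<^sub>2))\<close>.\<close>

lemma regular_pair_c:
  assumes eq: "c 1 * a + c 2 * b = 0"
  shows "\<exists>t. a = c 2 * t \<and> b = - (c 1 * t)"
proof -
  let ?T = "{a. \<exists>b. c 1 * a + c 2 * b = 0}"
  \<comment> \<open>\<open>?T\<close> is the ideal of all \<open>a\<close> with
    \<open>c 1 * a\<close> in \<open>(c 2)\<close>. Koszul exactness for the vector
    \<open>(0, x, y)\<close> writes \<open>x\<close> as \<open>c 0\<close> times an element of
    \<open>?T\<close>, modulo \<open>c 2\<close>.\<close>
  have step: "\<exists>a'\<in>?T. \<exists>u. x = c 0 * a' + u * c 2" if xT: "x \<in> ?T" for x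
  proof -
    obtain y where "c 1 * x + c 2 * y = 0" using xT by blast
    then have "0 * c 0 + x * c 1 + y * c 2 = 0" by (simp add: mult.commute)
    from koszul_exact[OF this] obtain b0 b1 b2 where b: "0 = b1 * c 2 - b2 * c 1" "x = b2 * c 0 - b0 * c 2"
      by blast
    have "c 1 * b2 + c 2 * (- b1) = 0" using b(1) by (simp add: mult.commute)
    then have "b2 \<in> ?T" by blast
    moreover have "x = c 0 * b2 + (- b0) * c 2" using b(2) by (simp add: mult.commute)
    ultimately show ?thesis by blast
  qed
  have T_hc: "hom_component d x \<in> ?T" if xT: "x \<in> ?T" for x d
  proof -
    obtain y where y: "c 1 * x + c 2 * y = 0" using xT by blast
    let ?e = "d + (s - 3 - \<delta> 1)"
    have "hom_component ?e (c 1 * x + c 2 * y) = 0" unfolding y by simp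
    then have "c 1 * hom_component d x + c 2 * hom_component (?e - (s - 3 - \<delta> 2)) y = 0"
      by (simp add: hom_component_add hom_component_mult_form[OF form_c])
    then show ?thesis by blast
  qed
  \<comment> \<open>A graded Nakayama argument: the factor of \<open>c 0\<close> is again in
    \<open>?T\<close> and has smaller degree because \<open>c 0\<close> has positive degree, so
    descent ends in negative degree, where forms vanish.\<close>
  have forms_T: "\<exists>t. x = c 2 * t" if "x \<in> ?T" "form (int d) x" for x d
    using that
  proof (induction d arbitrary: x rule: less_induct)
    case (less d)
    obtain a' u where a': "a' \<in> ?T" "x = c 0 * a' + u * c 2" using step[OF less.prems(1)] by blast
    let ?g0 = "s - 3 - \<delta> 0" and ?g2 = "s - 3 - \<delta> 2"
    have "x = hom_component (int d) x" using hom_component_form[OF less.prems(2), of "int d"] by simp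
    also have "\<dots> = c 0 * hom_component (int d - ?g0) a' + hom_component (int d - ?g2) u * c 2"
      unfolding a'(2) by (simp add: hom_component_add hom_component_mult_form[OF form_c] hom_component_mult_form'[OF form_c])
    finally have x: "x = c 0 * hom_component (int d - ?g0) a' + hom_component (int d - ?g2) u * c 2" .
    have "\<exists>t. hom_component (int d - ?g0) a' = c 2 * t"
    proof (cases "int d - ?g0 < 0")
      case True
      then have "hom_component (int d - ?g0) a' = 0" using form_negative[OF form_hom_component] by blast
      then show ?thesis by (intro exI[of _ 0]) simp
    next
      case False
      have "nat (int d - ?g0) < d" using degree_c_pos[of 0] False by simp
      moreover have "form (int (nat (int d - ?g0))) (hom_component (int d - ?g0) a')" using False by simp
      ultimately show ?thesis using less.IH T_hc[OF a'(1)] by blast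
    qed
    then obtain t where "hom_component (int d - ?g0) a' = c 2 * t" by blast
    then have "x = c 2 * (c 0 * t + hom_component (int d - ?g2) u)" using x by (simp add: algebra_simps)
    then show ?case by blast
  qed
  have "a \<in> ?T" using eq by blast
  have "\<exists>t. hom_component d a = c 2 * t" for d
  proof (cases "d < 0")
    case True
    then show ?thesis using form_negative[OF form_hom_component] by (intro exI[of _ 0]) simp
  next
    case False
    then have "int (nat d) = d" by simp
    then have "form (int (nat d)) (hom_component d a)" by (simp only: form_hom_component)
    then show ?thesis by (rule forms_T[OF T_hc[OF \<open>a \<in> ?T\<close>]])
  qed
  then have "\<exists>t. \<forall>d. hom_component d a = c 2 * t d" by (intro choice allI)
  then obtain t where "\<forall>d. hom_component d a = c 2 * t d" ..
  note t = this[rule_format]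
  have "a = (\<Sum>d\<in>degree_support a. hom_component d a)"
    using sum_hom_components[OF finite_degree_support order_refl, of a] by (rule sym)
  also have "\<dots> = c 2 * (\<Sum>d\<in>degree_support a. t d)" by (simp add: t sum_distrib_left)
  finally have a: "a = c 2 * (\<Sum>d\<in>degree_support a. t d)" .
  define u where "u = (\<Sum>d\<in>degree_support a. t d)"
  have au: "a = c 2 * u" unfolding u_def by (fact a)
  have "c 2 * (c 1 * u + b) = c 1 * (c 2 * u) + c 2 * b" by (simp add: algebra_simps)
  also have "\<dots> = 0" using eq unfolding au .
  finally have "c 2 * (c 1 * u + b) = 0" .
  then have "c 1 * u + b = 0" using c_nonzero(3) by simp
  then have "b = - (c 1 * u)" by (simp add: add_eq_0_iff)
  then show ?thesis using au by (intro exI[of _ u] conjI)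
qed

text \<open>All \<open>p a i\<close> are now constants. The vector \<open>X\<close>, the combination
  of the rows of \<open>p\<close> with coefficients \<open>f\<close>, has cross product zero with
  \<open>c\<close> because \<open>f\<close> kills \<open>A\<close>, so it is a constant multiple of
  \<open>c\<close>; it remains to see that the constant is not zero.\<close>

lemma c_in_ideal:
  assumes "\<And>i. i < 3 \<Longrightarrow> \<delta> i = 3" "i < 3"
  shows "c i \<in> ideal3 f"
proof -
  have s9: "s = 9" using assms(1) by (simp add: s)
  obtain p where p: "\<And>a i. form (3 - \<delta> i) (p a i)"
    "\<And>a. a < 3 \<Longrightarrow> A a 0 = p a 1 * c 2 - p a 2 * c 1"
    "\<And>a. a < 3 \<Longrightarrow> A a 1 = p a 2 * c 0 - p a 0 * c 2"
    "\<And>a. a < 3 \<Longrightarrow> A a 2 = p a 0 * c 1 - p a 1 * c 0" by (rule rows_koszul) blast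
  have p0: "form 0 (p a i)" if "i < 3" for a i using p(1)[of i a] assms(1)[OF that] by simp
  define X where "X i = f 0 * p 0 i + f 1 * p 1 i + f 2 * p 2 i" for i
  have f: "f 0 * A 0 0 + f 1 * A 1 0 + f 2 * A 2 0 = 0" "f 0 * A 0 1 + f 1 * A 1 1 + f 2 * A 2 1 = 0"
    "f 0 * A 0 2 + f 1 * A 1 2 + f 2 * A 2 2 = 0" using complex0[of 0] complex0[of 1] complex0[of 2] by simp_all
  have l3: "(0 :: nat) < 3" "(1 :: nat) < 3" "(2 :: nat) < 3" by simp_all
  have "X 1 * c 2 - X 2 * c 1 = f 0 * A 0 0 + f 1 * A 1 0 + f 2 * A 2 0"
    unfolding X_def p(2)[OF l3(1)] p(2)[OF l3(2)] p(2)[OF l3(3)] by (simp add: algebra_simps)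
  moreover have "X 2 * c 0 - X 0 * c 2 = f 0 * A 0 1 + f 1 * A 1 1 + f 2 * A 2 1"
    unfolding X_def p(3)[OF l3(1)] p(3)[OF l3(2)] p(3)[OF l3(3)] by (simp add: algebra_simps)
  moreover have "X 0 * c 1 - X 1 * c 0 = f 0 * A 0 2 + f 1 * A 1 2 + f 2 * A 2 2"
    unfolding X_def p(4)[OF l3(1)] p(4)[OF l3(2)] p(4)[OF l3(3)] by (simp add: algebra_simps)
  ultimately have "X 1 * c 2 = X 2 * c 1" "X 2 * c 0 = X 0 * c 2" "X 0 * c 1 = X 1 * c 0"
    unfolding f by simp_all
  then obtain q where q: "X 0 = c 0 * q" "X 1 = c 1 * q" "X 2 = c 2 * q"
    using parallel_to_c[of "X 1" "X 2" "X 0"] by blast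
  have X: "X i = c i * hom_component 0 q" if i: "i < 3" for i
  proof -
    have "i = 0 \<or> i = 1 \<or> i = 2" using i by linarith
    then have Xq: "X i = c i * q" using q by blast
    have "form 3 (X i)" unfolding X_def
      by (intro form_add form_mult'[OF form_f p0[OF i]]) auto
    then have "X i = hom_component 3 (X i)" using hom_component_form[of 3 "X i" 3] by simp
    also have "\<dots> = c i * hom_component 0 q"
      unfolding Xq using hom_component_mult_form[OF form_c[OF i], of 3 q] assms(1)[OF i] by (simp add: s9)
    finally show ?thesis .
  qed
  obtain k where k: "hom_component 0 q = const_poly k" using form_0_eq[OF form_hom_component] by blast
  show ?thesis
  proof (cases "k = 0")
    case True
    \<comment> \<open>If the constant is zero, the columns of \<open>p\<close> are syzygies of
      \<open>f\<close> with constant entries. By minimality they vanish, so \<open>A = 0\<close>,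
      and its kernel would be all of \<open>R^3\<close> instead of \<open>R c\<close>.\<close>
    have pz: "p a i = 0" if "a < 3" "i < 3" for a i
    proof -
      have "f 0 * p 0 i + f 1 * p 1 i + f 2 * p 2 i = 0" using X[OF that(2)] k True by (simp add: X_def)
      from syzygy_ct[OF this] have "lookup (p 0 i) 0 = 0" "lookup (p 1 i) 0 = 0" "lookup (p 2 i) 0 = 0" .
      moreover have "a = 0 \<or> a = 1 \<or> a = 2" using that(1) by linarith
      ultimately have "lookup (p a i) 0 = 0" by blast
      then show ?thesis using form_0_eq[OF p0[OF that(2)], of a] by simp
    qed
    have "\<exists>t. 1 = c 0 * t \<and> 0 = c 1 * t \<and> 0 = c 2 * t"
      by (rule exact1) (simp add: p(2-4) pz)
    then obtain t where "1 = c 0 * t" by blast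
    then have "lookup (1 :: ('n, 'k) mpoly) 0 = lookup (c 0 * t) 0" by simp
    then show ?thesis by (simp add: lookup_0_mult ct_c)
  next
    case False
    have "c i = const_poly (inverse k) * X i"
      using X[OF assms(2)] k False by (simp add: mult.left_commute mult_single)
    also have "\<dots> = f 0 * (const_poly (inverse k) * p 0 i) + f 1 * (const_poly (inverse k) * p 1 i) + f 2 * (const_poly (inverse k) * p 2 i)"
      by (simp add: X_def algebra_simps)
    finally show ?thesis unfolding ideal3_def by blast
  qed
qed

end

section \<open>Hilbert functions\<close>

text \<open>For maps that are linear only on \<open>V\<close>, such as a homomorphism defined on
  syzygies: a linear map on the whole space that agrees on a basis of \<open>V\<close> replaces
  \<open>f\<close>.\<close>

lemma (in vector_space_pair) dim_kernel_image_on: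
  assumes V: "vs1.subspace V" and S: "finite S" "V \<subseteq> vs1.span S"
    and add: "\<And>x y. x \<in> V \<Longrightarrow> y \<in> V \<Longrightarrow> f (x + y) = f x + f y"
    and scale: "\<And>c x. x \<in> V \<Longrightarrow> f (s1 c x) = s2 c (f x)"
  shows "vs1.dim V = vs1.dim {v \<in> V. f v = 0} + vs2.dim (f ` V)"
proof -
  obtain B where B: "B \<subseteq> V" "vs1.independent B" "V \<subseteq> vs1.span B" 
    using vs1.maximal_independent_subset[of V] by blast
  from linear_independent_extend[OF B(2), of f] obtain g where
    g: "Vector_Spaces.linear s1 s2 g" "\<forall>x\<in>B. g x = f x" by blast
  interpret g: Vector_Spaces.linear s1 s2 g by (fact g(1))
  have f0: "f 0 = 0" using scale[of 0 0] vs1.subspace_0[OF V] by simp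
  have "x \<in> V \<and> g x = f x" if "x \<in> vs1.span B" for x
    using that
  proof (induction rule: vs1.span_induct_alt)
    case base
    then show ?case using f0 vs1.subspace_0[OF V] by simp
  next
    case (step c x y)
    have x: "x \<in> V" "g x = f x" using step.hyps B(1) g(2) by auto
    then have "s1 c x \<in> V" using vs1.subspace_scale[OF V] by simp
    then show ?case using step.IH x vs1.subspace_add[OF V] by (simp add: g.add g.scale add scale)
  qed
  then have eq: "g x = f x" if "x \<in> V" for x using that B(3) by blast
  have "{v \<in> V. f v = 0} = {v \<in> V. g v = 0}" "f ` V = g ` V" using eq by auto
  then show ?thesis using dim_kernel_image[OF g(1) V S] by (simp only:)
qed

lemma dim_eq_0_iff_forms3:
  fixes V :: "(('n::finite, 'k::field) mpoly \<times> ('n, 'k) mpoly \<times> ('n, 'k) mpoly) set"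
  assumes "V \<subseteq> forms3 a b c"
  shows "mpoly3_vs.dim V = 0 \<longleftrightarrow> V \<subseteq> {0}"
proof
  assume 0: "mpoly3_vs.dim V = 0"
  obtain B where B: "B \<subseteq> V" "mpoly3_vs.independent B" "V \<subseteq> mpoly3_vs.span B" "card B = mpoly3_vs.dim V"
    using mpoly3_vs.basis_exists by blast
  obtain S where S: "finite S" "(forms3 a b c :: (('n, 'k) mpoly \<times> ('n, 'k) mpoly \<times> ('n, 'k) mpoly) set) \<subseteq> mpoly3_vs.span S"
    using forms3_finite_span by blast
  have "B \<subseteq> mpoly3_vs.span S" using B(1) assms S(2) by blast
  then have "finite B" using mpoly3_vs.independent_span_bound[OF S(1) B(2)] by simp
  then have "B = {}" using B(4) 0 by simp
  then show "V \<subseteq> {0}" using B(3) by simp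
next
  assume "V \<subseteq> {0}"
  then have "V \<subseteq> mpoly3_vs.span {}" by simp
  then have "mpoly3_vs.dim V \<le> card ({} :: (('n, 'k) mpoly \<times> ('n, 'k) mpoly \<times> ('n, 'k) mpoly) set)"
    by (rule mpoly3_vs.dim_le_card) simp
  then show "mpoly3_vs.dim V = 0" by simp
qed

lemma subspace_syzygies3: "mpoly3_vs.subspace (syzygies3 f d :: (('n, 'k::field) mpoly \<times> ('n, 'k) mpoly \<times> ('n, 'k) mpoly) set)"
proof -
  let ?h = "\<lambda>(p, q, r). f 0 * p + f 1 * q + f 2 * r :: ('n, 'k) mpoly"
  interpret h: Vector_Spaces.linear mpoly3_scale mpoly_scale ?h by (rule linear_combination3)
  have "syzygies3 f d = forms3 d d d \<inter> {v. ?h v = 0}" unfolding syzygies3_def by auto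
  then show ?thesis using mpoly3_vs.subspace_inter[OF subspace_forms3 h.subspace_kernel] by (simp only:)
qed

lemma ideal3_eq_span: "ideal3 f = ring_ideal.span {f 0, f 1, f 2}"
proof
  have "f 0 * p + f 1 * q + f 2 * r \<in> ring_ideal.span {f 0, f 1, f 2}" for p q r
  proof (intro ring_ideal.span_add)
    show "f 0 * p \<in> ring_ideal.span {f 0, f 1, f 2}" "f 1 * q \<in> ring_ideal.span {f 0, f 1, f 2}" "f 2 * r \<in> ring_ideal.span {f 0, f 1, f 2}"
      using ring_ideal.span_scale[OF ring_ideal.span_base, of "f 0" "{f 0, f 1, f 2}" p]
       ring_ideal.span_scale[OF ring_ideal.span_base, of "f 1" "{f 0, f 1, f 2}" q]
       ring_ideal.span_scale[OF ring_ideal.span_base, of "f 2" "{f 0, f 1, f 2}" r] by (simp_all add: mult.commute)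
  qed
  then show "ideal3 f \<subseteq> ring_ideal.span {f 0, f 1, f 2}" unfolding ideal3_def by blast
  show "ring_ideal.span {f 0, f 1, f 2} \<subseteq> ideal3 f"
  proof (rule ring_ideal.span_minimal)
    have mem: "f 0 * p + f 1 * q + f 2 * r \<in> ideal3 f" for p q r unfolding ideal3_def by blast
    show "{f 0, f 1, f 2} \<subseteq> ideal3 f" using mem[of 1 0 0] mem[of 0 1 0] mem[of 0 0 1] by simp
    show "ring_ideal.subspace (ideal3 f)"
    proof (rule ring_ideal.subspaceI)
      show "0 \<in> ideal3 f" using mem[of 0 0 0] by simp
      fix x y assume "x \<in> ideal3 f" "y \<in> ideal3 f"
      then obtain p q r p' q' r' where "x = f 0 * p + f 1 * q + f 2 * r" "y = f 0 * p' + f 1 * q' + f 2 * r'"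
        unfolding ideal3_def by blast
      then have "x + y = f 0 * (p + p') + f 1 * (q + q') + f 2 * (r + r')" by (simp add: algebra_simps)
      then show "x + y \<in> ideal3 f" using mem by simp
    next
      fix t x assume "x \<in> ideal3 f"
      then obtain p q r where "x = f 0 * p + f 1 * q + f 2 * r" unfolding ideal3_def by blast
      then have "t * x = f 0 * (t * p) + f 1 * (t * q) + f 2 * (t * r)" by (simp add: algebra_simps)
      then show "t * x \<in> ideal3 f" using mem by simp
    qed
  qed
qed

context graded_exact_complex
begin

text \<open>In each degree, \<open>0 \<rightarrow> R(-s+3) \<rightarrow> \<Oplus>\<^sub>i
  R(-\<delta> i) \<rightarrow> Syz \<rightarrow> 0\<close> is exact; the grading of syzygies inside
  the untwisted \<open>R^3\<close> lowers all twists of the resolution by \<open>3\<close>.\<close>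

lemma dim_syzygies:
  "int (mpoly3_vs.dim (syzygies3 f d)) = forms_dim TYPE('n) TYPE('k) (d - \<delta> 0) + forms_dim TYPE('n) TYPE('k) (d - \<delta> 1)
     + forms_dim TYPE('n) TYPE('k) (d - \<delta> 2) - forms_dim TYPE('n) TYPE('k) (d - s + 3)"
proof -
  let ?V = "forms3 (d - \<delta> 0) (d - \<delta> 1) (d - \<delta> 2) :: (('n, 'k) mpoly \<times> ('n, 'k) mpoly \<times> ('n, 'k) mpoly) set"
  define L where "L = (\<lambda>(x, y, z). (A 0 0 * x + A 0 1 * y + A 0 2 * z, A 1 0 * x + A 1 1 * y + A 1 2 * z, A 2 0 * x + A 2 1 * y + A 2 2 * z))"
  define M where "M = (\<lambda>t. (c 0 * t, c 1 * t, c 2 * t))"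
  have linL: "Vector_Spaces.linear mpoly3_scale mpoly3_scale L"
    unfolding L_def by (rule linear_mpoly33I) (auto simp: mpoly3_scale_def mpoly_scale_def algebra_simps)
  have linM: "Vector_Spaces.linear mpoly_scale mpoly3_scale M"
    unfolding M_def by (rule linear_mpoly13I) (auto simp: mpoly3_scale_def mpoly_scale_def algebra_simps)
  have hcA: "hom_component d (A a i * x) = A a i * hom_component (d - \<delta> i) x" if "a < 3" "i < 3" for a i x
    by (rule hom_component_mult_form[OF form_A[OF that]])
  have hcA': "hom_component d (A a 0 * x + A a 1 * y + A a 2 * z) = 
      A a 0 * hom_component (d - \<delta> 0) x + A a 1 * hom_component (d - \<delta> 1) y + A a 2 * hom_component (d - \<delta> 2) z" if "a < 3" for a x y z
    using that by (simp only: hom_component_add hcA zero_less_numeral one_less_numeral_iff numeral_less_iff semiring_norm)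
  have l3: "(0 :: nat) < 3" "(1 :: nat) < 3" "(2 :: nat) < 3" by simp_all
  have image: "L ` ?V = syzygies3 f d"
  proof (intro equalityI subsetI)
    fix w assume "w \<in> L ` ?V"
    then obtain x y z where w: "form (d - \<delta> 0) x" "form (d - \<delta> 1) y" "form (d - \<delta> 2) z"
      "w = (A 0 0 * x + A 0 1 * y + A 0 2 * z, A 1 0 * x + A 1 1 * y + A 1 2 * z, A 2 0 * x + A 2 1 * y + A 2 2 * z)"
      by (auto simp: forms3_def forms_def L_def)
    have "form d (A a 0 * x + A a 1 * y + A a 2 * z)" if a: "a < 3" for a
      using w(1-3) by (intro form_add form_mult'[OF form_A[OF a]]) auto
    then have "w \<in> forms3 d d d" unfolding w(4) forms3_def forms_def by simp
    moreover have "f 0 * (A 0 0 * x + A 0 1 * y + A 0 2 * z) + f 1 * (A 1 0 * x + A 1 1 * y + A 1 2 * z) + f 2 * (A 2 0 * x + A 2 1 * y + A 2 2 * z) = 0"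
    proof -
      have "f 0 * (A 0 0 * x + A 0 1 * y + A 0 2 * z) + f 1 * (A 1 0 * x + A 1 1 * y + A 1 2 * z) + f 2 * (A 2 0 * x + A 2 1 * y + A 2 2 * z) =
        (f 0 * A 0 0 + f 1 * A 1 0 + f 2 * A 2 0) * x + (f 0 * A 0 1 + f 1 * A 1 1 + f 2 * A 2 1) * y + (f 0 * A 0 2 + f 1 * A 1 2 + f 2 * A 2 2) * z"
        by (simp add: algebra_simps)
      also have "\<dots> = 0" by (simp only: complex0[OF l3(1)] complex0[OF l3(2)] complex0[OF l3(3)] mult_zero_left add_0)
      finally show ?thesis .
    qed
    ultimately show "w \<in> syzygies3 f d" unfolding syzygies3_def w(4) by simp
  next
    fix w assume "w \<in> syzygies3 f d"
    then obtain p q r where w: "w = (p, q, r)" "form d p" "form d q" "form d r" "f 0 * p + f 1 * q + f 2 * r = 0"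
      by (auto simp: syzygies3_def forms3_def forms_def)
    from exact0[OF w(5)] obtain x y z where xyz: "p = A 0 0 * x + A 0 1 * y + A 0 2 * z"
      "q = A 1 0 * x + A 1 1 * y + A 1 2 * z" "r = A 2 0 * x + A 2 1 * y + A 2 2 * z" by blast
    have "w = (hom_component d p, hom_component d q, hom_component d r)"
      using w by (simp add: hom_component_form)
    also have "\<dots> = L (hom_component (d - \<delta> 0) x, hom_component (d - \<delta> 1) y, hom_component (d - \<delta> 2) z)"
      unfolding xyz L_def hcA'[OF l3(1)] hcA'[OF l3(2)] hcA'[OF l3(3)] by simp
    finally show "w \<in> L ` ?V" by (rule image_eqI) (simp add: forms3_def forms_def)
  qed
  have kernel: "{v \<in> ?V. L v = 0} = M ` forms (d - s + 3)"
  proof (intro equalityI subsetI)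
    fix v assume "v \<in> {v \<in> ?V. L v = 0}"
    then obtain x y z where v: "v = (x, y, z)" "form (d - \<delta> 0) x" "form (d - \<delta> 1) y" "form (d - \<delta> 2) z"
      "A 0 0 * x + A 0 1 * y + A 0 2 * z = 0" "A 1 0 * x + A 1 1 * y + A 1 2 * z = 0" "A 2 0 * x + A 2 1 * y + A 2 2 * z = 0"
      by (auto simp: forms3_def forms_def L_def zero_prod_def)
    from exact1_rows[OF v(5-7)] obtain t where t: "x = c 0 * t" "y = c 1 * t" "z = c 2 * t" by blast
    have ft: "form (d - s + 3) t"
      using form_cancel[OF _ form_c[OF l3(1)] c_nonzero(1), of "d - \<delta> 0" t] v(2) unfolding t(1) by (simp add: mult.commute algebra_simps)
    then show "v \<in> M ` forms (d - s + 3)" unfolding v(1) t M_def forms_def by blast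
  next
    fix v assume "v \<in> M ` forms (d - s + 3)"
    then obtain t where t: "form (d - s + 3) t" "v = (c 0 * t, c 1 * t, c 2 * t)" by (auto simp: M_def forms_def)
    have "form (d - \<delta> i) (c i * t)" if "i < 3" for i by (rule form_mult'[OF form_c[OF that] t(1)]) simp
    then have "v \<in> ?V" unfolding t(2) forms3_def forms_def by simp
    moreover have "A a 0 * (c 0 * t) + A a 1 * (c 1 * t) + A a 2 * (c 2 * t) = 0" if "a < 3" for a
    proof -
      have "A a 0 * (c 0 * t) + A a 1 * (c 1 * t) + A a 2 * (c 2 * t) = (A a 0 * c 0 + A a 1 * c 1 + A a 2 * c 2) * t"
        by (simp add: algebra_simps)
      then show ?thesis by (simp only: complex1[OF that] mult_zero_left)
    qed
    then have "L v = 0" unfolding t(2) L_def zero_prod_def using l3 by simp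
    ultimately show "v \<in> {v \<in> ?V. L v = 0}" by simp
  qed
  obtain S where S: "finite S" "?V \<subseteq> mpoly3_vs.span S" using forms3_finite_span by blast
  have "mpoly3_vs.dim (M ` forms (d - s + 3)) = mpoly_vs.dim (forms (d - s + 3) :: ('n, 'k) mpoly set)"
    by (rule mpoly_pair13.dim_injective_image[OF linM subspace_forms _ forms_finite_span])
      (use finite_monomials_of_degree c_nonzero in \<open>auto simp: M_def zero_prod_def\<close>)
  then show ?thesis
    using mpoly_pair33.dim_kernel_image[OF linL subspace_forms3 S] dim_forms3[where 'n = 'n and 'k = 'k, of "d - \<delta> 0" "d - \<delta> 1" "d - \<delta> 2"]
    unfolding kernel image by simp
qed

lemma dim_ideal:
  "int (mpoly_vs.dim {p \<in> ideal3 f. form d p}) = 3 * forms_dim TYPE('n) TYPE('k) (d - 3) - forms_dim TYPE('n) TYPE('k) (d - 3 - \<delta> 0) 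
     - forms_dim TYPE('n) TYPE('k) (d - 3 - \<delta> 1) - forms_dim TYPE('n) TYPE('k) (d - 3 - \<delta> 2) + forms_dim TYPE('n) TYPE('k) (d - s)"
  using dim_syzygies3[of 3 f "d - 3", OF form_f] dim_syzygies[of "d - 3"] by (simp add: algebra_simps)

text \<open>Rank-nullity expresses both dimensions through the same ideal, so the Hilbert function
  of the syzygies does not depend on the choice of three cubic generators.\<close>

lemma dim_syzygies_other_generators:
  assumes g: "\<And>i. i < 3 \<Longrightarrow> form 3 (g i)" "ideal3 g = ideal3 f"
  shows "mpoly3_vs.dim (syzygies3 g d) = mpoly3_vs.dim (syzygies3 f d)"
  using dim_syzygies3[of 3 g d, OF g(1)] dim_syzygies3[of 3 f d, OF form_f] unfolding g(2) by simp

lemma homogeneous_ideal3: "homogeneous_ideal (ideal3 f)"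
  unfolding ideal3_eq_span
proof (rule homogeneous_ideal_span_forms)
  fix p assume "p \<in> {f 0, f 1, f 2}"
  then show "\<exists>d. form d p" using form_f[of 0] form_f[of 1] form_f[of 2] by auto
qed

text \<open>The bound on \<open>d\<close> makes all shifted degrees nonnegative, where dimensions of
  spaces of forms agree with the Hilbert polynomial of \<open>R\<close>.\<close>

lemma hilbert_function_ideal:
  assumes "d \<ge> nat (\<bar>s\<bar> + \<bar>\<delta> 0\<bar> + \<bar>\<delta> 1\<bar> + \<bar>\<delta> 2\<bar> + 3)"
  shows "poly (shifted_sum (forms_dim_poly CARD('n)) [(1, 0), (-3, 3), (1, 3 + \<delta> 0), (1, 3 + \<delta> 1), (1, 3 + \<delta> 2), (-1, s)]) (of_nat d)
    = of_int (hilbert_function (ideal3 f) d)"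
proof -
  let ?H = "\<lambda>e. forms_dim TYPE('n) TYPE('k) e"
  have H: "of_int (?H (int d - e)) = poly (forms_dim_poly CARD('n)) (of_nat d - of_int e)" if "e \<le> int d" for e
    using poly_forms_dim_poly[of "int d - e", where 'n = 'n and 'k = 'k] that by simp
  have "hilbert_function (ideal3 f) d = ?H (int d - 0) - 3 * ?H (int d - 3) + ?H (int d - (3 + \<delta> 0)) + ?H (int d - (3 + \<delta> 1)) + ?H (int d - (3 + \<delta> 2)) - ?H (int d - s)"
    unfolding hilbert_function_def dim_ideal forms_def[symmetric] by (simp add: algebra_simps)
  also have "rat_of_int \<dots> = of_int (?H (int d - 0)) - 3 * of_int (?H (int d - 3)) + of_int (?H (int d - (3 + \<delta> 0))) + of_int (?H (int d - (3 + \<delta> 1))) + of_int (?H (int d - (3 + \<delta> 2))) - of_int (?H (int d - s))"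
    by (simp only: of_int_add of_int_diff of_int_mult of_int_numeral)
  also have "\<dots> = poly (shifted_sum (forms_dim_poly CARD('n)) [(1, 0), (-3, 3), (1, 3 + \<delta> 0), (1, 3 + \<delta> 1), (1, 3 + \<delta> 2), (-1, s)]) (of_nat d)"
    using assms by (subst H, linarith)+ (simp add: poly_shifted_sum)
  finally show ?thesis by simp
qed

text \<open>The moments of order zero and one of the twists vanish, and the second one is
  \<open>2 * e\<close>. A Hilbert polynomial of degree \<open>n - 3\<close> also yields the upper
  bound for the height.\<close>

lemma codim2_degree_ideal:
  assumes n: "CARD('n) \<ge> 3" and height: "height (ideal3 f) \<ge> 2"
    and e: "e = 3 * s - (\<delta> 0 * \<delta> 1 + \<delta> 0 * \<delta> 2 + \<delta> 1 * \<delta> 2)" "e \<noteq> 0"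
  shows "height (ideal3 f) = 2" "codim2_degree (ideal3 f) = of_int e"
proof -
  let ?ws = "[(1, 0), (-3, 3), (1, 3 + \<delta> 0), (1, 3 + \<delta> 1), (1, 3 + \<delta> 2), (-1, s)] :: (rat \<times> int) list"
  let ?P = "shifted_sum (forms_dim_poly CARD('n)) ?ws"
  have m: "(\<Sum>(w, a)\<leftarrow>?ws. w) = 0" "(\<Sum>(w, a)\<leftarrow>?ws. w * rat_of_int a) = 0"
    by (simp_all add: s)
  have "(\<Sum>(w, a)\<leftarrow>?ws. w * rat_of_int a ^ 2) = of_int (- 27 + (3 + \<delta> 0) ^ 2 + (3 + \<delta> 1) ^ 2 + (3 + \<delta> 2) ^ 2 - s ^ 2)"
    by simp
  also have "- 27 + (3 + \<delta> 0) ^ 2 + (3 + \<delta> 1) ^ 2 + (3 + \<delta> 2) ^ 2 - s ^ 2 = 2 * e"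
    unfolding e(1) s by (simp add: power2_eq_square algebra_simps)
  finally have m2: "(\<Sum>(w, a)\<leftarrow>?ws. w * rat_of_int a ^ 2) = 2 * of_int e" by simp
  note P = degree_shifted_sum_forms_2[OF n m m2]
  have e0: "rat_of_int e \<noteq> 0" using e(2) by simp
  have P0: "?P \<noteq> 0" using P(2)[OF e0] e0 by auto
  have "height (ideal3 f) \<le> enat (CARD('n) - Suc (CARD('n) - 3))"
    by (rule height_le_of_hilbert_function[OF homogeneous_ideal3 P(1)[OF e0] _ P0 hilbert_function_ideal]) (use n in auto)
  also have "CARD('n) - Suc (CARD('n) - 3) = 2" using n by simp
  finally show h: "height (ideal3 f) = 2" using height by (simp add: numeral_eq_enat antisym)
  have "hilbert_poly (ideal3 f) = ?P" using hilbert_function_ideal by (rule hilbert_poly_eqI)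
  then show "codim2_degree (ideal3 f) = of_int e"
    using h P0 P[OF e0] by (simp add: codim2_degree_def multiplicity_def)
qed

lemma c_dvd: "c 2 * u = c 1 * w \<Longrightarrow> c 1 dvd u"
proof -
  assume "c 2 * u = c 1 * w"
  then have "c 1 * w + c 2 * (- u) = 0" by simp
  from regular_pair_c[OF this] show ?thesis by auto
qed

lemma prime_chain_c:
  assumes "prime_ideal Q" "c 1 \<in> Q" "c 2 \<in> Q"
  shows "prime_chain 2 Q"
  by (rule prime_chain_2[OF assms c_nonzero(2) c_dvd])

text \<open>The entries of \<open>c\<close> form a regular sequence inside the ideal, so every prime
  over it ends a chain of length three.\<close>

lemma codim2_degree_ideal_0:
  assumes "\<And>i. i < 3 \<Longrightarrow> \<delta> i = 3"
  shows "codim2_degree (ideal3 f) = 0"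
proof -
  have "enat 3 \<le> height (ideal3 f)"
  proof (rule height_ge)
    fix Q assume Q: "prime_ideal Q" "ideal3 f \<subseteq> Q"
    have c: "c i \<in> Q" if "i < 3" for i using c_in_ideal[OF assms that] Q(2) by blast
    show "prime_chain 3 Q"
    proof (rule prime_chain_3[OF Q(1) _ _ _ c_nonzero(2) c_dvd])
      show "c 1 \<in> Q" "c 2 \<in> Q" "c 0 \<in> Q" by (rule c; simp)+
      fix u v w assume "c 0 * u = c 1 * v + c 2 * w"
      then have "u * c 0 + (- v) * c 1 + (- w) * c 2 = 0" by (simp add: algebra_simps)
      from koszul_exact[OF this] obtain b0 b1 b2 where "u = b1 * c 2 - b2 * c 1" by blast
      then have "u = c 1 * (- b2) + c 2 * b1" by (simp add: algebra_simps)
      then show "\<exists>a b. u = c 1 * a + c 2 * b" by blast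
    qed
  qed
  then have "height (ideal3 f) \<noteq> 2" by (auto simp: numeral_eq_enat)
  then show ?thesis by (simp add: codim2_degree_def)
qed

end

section \<open>The Bourbaki degree\<close>

text \<open>The bridge from triples, on which dimensions are counted, to the vectors in the
  definitions of syzygies and resolutions.\<close>

definition vec3 :: "'a \<times> 'a \<times> 'a \<Rightarrow> 'a vec" where
  "vec3 w = (case w of (p, q, r) \<Rightarrow> vec 3 (\<lambda>i. if i = 0 then p else if i = 1 then q else r))"

lemma dim_vec3 [simp]: "dim_vec (vec3 w) = 3" and vec3_carrier [simp]: "vec3 w \<in> carrier_vec 3"
  by (cases w; simp add: vec3_def)+

lemma vec3_index [simp]: "vec3 (p, q, r) $ 0 = p" "vec3 (p, q, r) $ Suc 0 = q" "vec3 (p, q, r) $ 2 = r"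
  by (simp_all add: vec3_def)

lemma less_3_cases: "(i :: nat) < 3 \<longleftrightarrow> i = 0 \<or> i = 1 \<or> i = 2"
  by linarith

lemma all_less_3: "(\<forall>i<3. P (i :: nat)) \<longleftrightarrow> P 0 \<and> P 1 \<and> P 2"
  unfolding less_3_cases by blast

lemma vec3_eqI:
  assumes "v \<in> carrier_vec 3" "w \<in> carrier_vec 3" "v $ 0 = w $ 0" "v $ 1 = w $ 1" "v $ 2 = w $ 2"
  shows "v = w"
proof (rule eq_vecI)
  fix i assume "i < dim_vec w"
  then have "i < 3" using assms(2) by simp
  then have "i = 0 \<or> i = 1 \<or> i = 2" by linarith
  then show "v $ i = w $ i" using assms by auto
qed (use assms in auto)

lemma vec3_of_carrier: "v \<in> carrier_vec 3 \<Longrightarrow> vec3 (v $ 0, v $ 1, v $ 2) = v"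
  by (rule vec3_eqI) auto

lemma vec3_add: "vec3 (u + w) = vec3 u + vec3 (w :: 'a::monoid_add \<times> 'a \<times> 'a)"
  by (rule vec3_eqI; cases u; cases w; simp)

lemma vec3_smult: "r \<cdot>\<^sub>v vec3 (p, q, t) = vec3 (r * p, r * q, r * t)"
  by (rule vec3_eqI) auto

lemma vec3_eq_0_iff: "vec3 w = 0\<^sub>v 3 \<longleftrightarrow> w = (0 :: 'a::monoid_add \<times> 'a \<times> 'a)"
proof
  obtain p q r where w: "w = (p, q, r)" by (cases w) blast
  assume "vec3 w = 0\<^sub>v 3"
  then have "vec3 w $ 0 = 0" "vec3 w $ Suc 0 = 0" "vec3 w $ 2 = 0" by simp_all
  then show "w = 0" by (simp add: w zero_prod_def)
next
  assume "w = 0"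
  then show "vec3 w = 0\<^sub>v 3" by (intro vec3_eqI) (auto simp: zero_prod_def)
qed

lemma scalar_prod_3:
  assumes "w \<in> carrier_vec 3"
  shows "v \<bullet> w = v $ 0 * w $ 0 + v $ 1 * w $ 1 + v $ 2 * (w $ 2 :: 'a::comm_ring_1)"
  using assms by (simp add: scalar_prod_def numeral_3_eq_3 numeral_2_eq_2 add.assoc)

lemma Syz_iff:
  assumes "f \<in> carrier_vec 3"
  shows "v \<in> Syz f \<longleftrightarrow> v \<in> carrier_vec 3 \<and> f $ 0 * v $ 0 + f $ 1 * v $ 1 + f $ 2 * v $ 2 = 0"
  using assms scalar_prod_3[of v f] by (auto simp: Syz_def)

lemma form_vec_iff: "v \<in> carrier_vec 3 \<Longrightarrow> form_vec d v \<longleftrightarrow> form d (v $ 0) \<and> form d (v $ 1) \<and> form d (v $ 2)"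
  using all_less_3[of "\<lambda>i. form d (v $ i)"] by (simp add: form_vec_def)

lemma syzygies3_iff:
  assumes "g \<in> carrier_vec 3"
  shows "w \<in> syzygies3 (\<lambda>i. g $ i) d \<longleftrightarrow> vec3 w \<in> Syz g \<and> form_vec d (vec3 w)"
proof -
  obtain p q r where w: "w = (p, q, r)" by (cases w) blast
  show ?thesis unfolding w Syz_iff[OF assms] form_vec_iff[OF vec3_carrier]
    by (auto simp: syzygies3_def forms3_def forms_def)
qed

lemma less_3_set: "{g $ j | j :: nat. j < 3} = {g $ 0, g $ 1, g $ 2}"
  unfolding less_3_cases by blast

lemma Syz_add:
  assumes "g \<in> carrier_vec 3" "u \<in> Syz g" "w \<in> Syz g"
  shows "u + w \<in> Syz g"
proof -
  have u: "u \<in> carrier_vec 3" "g $ 0 * u $ 0 + g $ 1 * u $ 1 + g $ 2 * u $ 2 = 0"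
    and w: "w \<in> carrier_vec 3" "g $ 0 * w $ 0 + g $ 1 * w $ 1 + g $ 2 * w $ 2 = 0"
    using assms(2,3) unfolding Syz_iff[OF assms(1)] by blast+
  have "g $ 0 * (u $ 0 + w $ 0) + g $ 1 * (u $ 1 + w $ 1) + g $ 2 * (u $ 2 + w $ 2)
    = (g $ 0 * u $ 0 + g $ 1 * u $ 1 + g $ 2 * u $ 2) + (g $ 0 * w $ 0 + g $ 1 * w $ 1 + g $ 2 * w $ 2)"
    by (simp add: algebra_simps)
  also have "\<dots> = 0" unfolding u(2) w(2) by simp
  finally show ?thesis unfolding Syz_iff[OF assms(1)] using u(1) w(1) by simp
qed

text \<open>Rank-nullity for \<open>h\<close> in degree \<open>d\<close>: the kernel
  \<open>R v\<close> contributes the forms of degree \<open>d - e\<close>, and the image is the part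
  of \<open>I\<close> in degree \<open>d + s0\<close>. Nothing about the choice of \<open>g\<close>,
  \<open>v\<close> or \<open>h\<close> enters beyond their degrees.\<close>

lemma syz_quotient_dim:
  fixes g :: "('n::{finite, linorder}, 'k::field) mpoly vec"
  assumes g: "g \<in> carrier_vec 3" "form_vec d' g"
    and v: "v \<in> Syz g" "v \<noteq> 0\<^sub>v 3" "form_vec e v"
    and add: "\<forall>u\<in>Syz g. \<forall>w\<in>Syz g. h (u + w) = h u + h w"
    and scale: "\<forall>r. \<forall>u\<in>Syz g. h (r \<cdot>\<^sub>v u) = r * h u"
    and deg: "\<forall>d. \<forall>u\<in>Syz g. form_vec d u \<longrightarrow> form (d + s0) (h u)"
    and image: "h ` Syz g = I" and kernel: "{u \<in> Syz g. h u = 0} = {r \<cdot>\<^sub>v v | r. True}"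
  shows "int (mpoly3_vs.dim (syzygies3 (\<lambda>i. g $ i) d)) = forms_dim TYPE('n) TYPE('k) (d - e) + int (mpoly_vs.dim {p \<in> I. form (d + s0) p})"
proof -
  let ?V = "syzygies3 (\<lambda>i. g $ i) d"
  let ?F = "\<lambda>w. h (vec3 w)"
  have VS: "vec3 w \<in> Syz g" "form_vec d (vec3 w)" if "w \<in> ?V" for w using that syzygies3_iff[OF g(1)] by blast+
  have gf: "form d' (g $ 0)" "form d' (g $ 1)" "form d' (g $ 2)" using form_vec_iff[OF g(1)] g(2) by blast+
  have vc: "v \<in> carrier_vec 3" using v(1) Syz_iff[OF g(1)] by blast
  have vf: "form e (v $ 0)" "form e (v $ 1)" "form e (v $ 2)" using form_vec_iff[OF vc] v(3) by blast+
  obtain S where S: "finite S" "(forms3 d d d :: (('n, 'k) mpoly \<times> ('n, 'k) mpoly \<times> ('n, 'k) mpoly) set) \<subseteq> mpoly3_vs.span S"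
    using forms3_finite_span by blast
  have VS': "?V \<subseteq> mpoly3_vs.span S" using S(2) unfolding syzygies3_def by auto
  have rank: "mpoly3_vs.dim ?V = mpoly3_vs.dim {w \<in> ?V. ?F w = 0} + mpoly_vs.dim (?F ` ?V)"
  proof (rule mpoly_pair31.dim_kernel_image_on[OF subspace_syzygies3 S(1) VS'])
    fix x y assume "x \<in> ?V" "y \<in> ?V"
    then show "?F (x + y) = ?F x + ?F y" using add VS unfolding vec3_add by blast
  next
    fix c x assume x: "x \<in> ?V"
    obtain p q r where pqr: "x = (p, q, r)" by (cases x) blast
    have "vec3 (mpoly3_scale c x) = const_poly c \<cdot>\<^sub>v vec3 x"
      unfolding pqr vec3_smult by (simp add: mpoly3_scale_def mpoly_scale_def)
    then show "?F (mpoly3_scale c x) = mpoly_scale c (?F x)"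
      using scale VS(1)[OF x] by (simp add: mpoly_scale_def)
  qed
  define M where "M r = (r * v $ 0, r * v $ 1, r * v $ 2)" for r
  have M: "vec3 (M r) = r \<cdot>\<^sub>v v" for r
    unfolding M_def using vec3_smult[of r "v $ 0" "v $ 1" "v $ 2"] vec3_of_carrier[OF vc] by simp
  have linM: "Vector_Spaces.linear mpoly_scale mpoly3_scale M"
    unfolding M_def by (rule linear_mpoly13I) (auto simp: mpoly3_scale_def mpoly_scale_def algebra_simps)
  have v_ne: "v $ 0 \<noteq> 0 \<or> v $ 1 \<noteq> 0 \<or> v $ 2 \<noteq> 0"
  proof (rule ccontr)
    assume "\<not> ?thesis"
    then have "v = 0\<^sub>v 3" using vc by (intro vec3_eqI) auto
    then show False using v(2) by simp
  qed
  have ker: "{w \<in> ?V. ?F w = 0} = M ` forms (d - e)"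
  proof (intro equalityI subsetI)
    fix w assume w: "w \<in> {w \<in> ?V. ?F w = 0}"
    then have "vec3 w \<in> {u \<in> Syz g. h u = 0}" using VS by blast
    then obtain r where r: "vec3 w = r \<cdot>\<^sub>v v" unfolding kernel by blast
    have "vec3 w = vec3 (M r)" unfolding M by (fact r)
    have wM: "w = M r"
    proof -
      obtain p q t where pqt: "w = (p, q, t)" by (cases w) blast
      have "vec3 w $ 0 = vec3 (M r) $ 0" "vec3 w $ Suc 0 = vec3 (M r) $ Suc 0" "vec3 w $ 2 = vec3 (M r) $ 2"
        using \<open>vec3 w = vec3 (M r)\<close> by simp_all
      then show ?thesis by (simp add: pqt M_def)
    qed
    have "form d (r * v $ 0)" "form d (r * v $ 1)" "form d (r * v $ 2)"
      using w unfolding wM M_def by (auto simp: syzygies3_def forms3_def forms_def)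
    then have "form (d - e) r" using v_ne form_cancel vf by blast
    then show "w \<in> M ` forms (d - e)" unfolding wM forms_def by blast
  next
    fix w assume "w \<in> M ` forms (d - e)"
    then obtain r where r: "form (d - e) r" "w = M r" unfolding forms_def by blast
    have 1: "vec3 w \<in> {u \<in> Syz g. h u = 0}" unfolding r(2) M kernel by blast
    have "form d (r * v $ 0)" "form d (r * v $ 1)" "form d (r * v $ 2)"
      using form_mult[OF r(1) vf(1)] form_mult[OF r(1) vf(2)] form_mult[OF r(1) vf(3)] by simp_all
    then have "form_vec d (vec3 w)" unfolding r(2) M_def form_vec_iff[OF vec3_carrier] by simp
    then show "w \<in> {w \<in> ?V. ?F w = 0}" using 1 syzygies3_iff[OF g(1)] by blast
  qed
  have img: "?F ` ?V = {p \<in> I. form (d + s0) p}"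
  proof (intro equalityI subsetI)
    fix p assume "p \<in> ?F ` ?V"
    then obtain w where w: "w \<in> ?V" "p = h (vec3 w)" by blast
    show "p \<in> {p \<in> I. form (d + s0) p}"
      using deg VS[OF w(1)] image unfolding w(2) by blast
  next
    fix p assume p: "p \<in> {p \<in> I. form (d + s0) p}"
    then have "p \<in> h ` Syz g" "form (d + s0) p" using image by blast+
    then obtain u where u: "u \<in> Syz g" "p = h u" by blast
    have uc: "u \<in> carrier_vec 3" "g $ 0 * u $ 0 + g $ 1 * u $ 1 + g $ 2 * u $ 2 = 0" using u(1) Syz_iff[OF g(1)] by blast+
    \<comment> \<open>A preimage of a form need not be homogeneous. Its component of degree
      \<open>d\<close> is also a preimage, since \<open>h\<close> carries the component of degree
      \<open>j\<close> to degree \<open>j + s0\<close>; additivity of \<open>h\<close> over finitely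
      many components has to be derived on syzygies only.\<close>
    define comp where "comp j = (hom_component j (u $ 0), hom_component j (u $ 1), hom_component j (u $ 2))" for j
    have comp: "comp j \<in> syzygies3 (\<lambda>i. g $ i) j" for j
    proof -
      have "hom_component (j + d') (g $ 0 * u $ 0 + g $ 1 * u $ 1 + g $ 2 * u $ 2) = 0" unfolding uc(2) by simp
      then have "g $ 0 * hom_component j (u $ 0) + g $ 1 * hom_component j (u $ 1) + g $ 2 * hom_component j (u $ 2) = 0"
        by (simp add: hom_component_add hom_component_mult_form[OF gf(1)] hom_component_mult_form[OF gf(2)[simplified]] hom_component_mult_form[OF gf(3)])
      then show ?thesis by (simp add: comp_def syzygies3_def forms3_def forms_def)
    qed
    have compS: "vec3 (comp j) \<in> Syz g" "form_vec j (vec3 (comp j))" for j using comp syzygies3_iff[OF g(1)] by blast+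
    have zero: "vec3 0 \<in> Syz g" unfolding Syz_iff[OF g(1)] zero_prod_def by simp
    have h0: "h (vec3 0) = 0"
    proof -
      have "h (vec3 0 + vec3 0) = h (vec3 0) + h (vec3 0)" using add zero by blast
      moreover have "vec3 (0 :: ('n, 'k) mpoly \<times> ('n, 'k) mpoly \<times> ('n, 'k) mpoly) + vec3 0 = vec3 0" by (simp flip: vec3_add)
      ultimately have "h (vec3 0) + h (vec3 0) = h (vec3 0)" by (simp only:)
      then show ?thesis by (simp only: add_cancel_left_right)
    qed
    have sum: "vec3 (\<Sum>j\<in>D. comp j) \<in> Syz g \<and> h (vec3 (\<Sum>j\<in>D. comp j)) = (\<Sum>j\<in>D. h (vec3 (comp j)))" if "finite D" for D
      using that
    proof (induction D rule: finite_induct)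
      case empty
      then show ?case using zero h0 by simp
    next
      case (insert j D)
      have "h (vec3 (comp j) + vec3 (\<Sum>j\<in>D. comp j)) = h (vec3 (comp j)) + h (vec3 (\<Sum>j\<in>D. comp j))"
        using add compS(1) insert.IH by blast
      moreover have "vec3 (comp j) + vec3 (\<Sum>j\<in>D. comp j) \<in> Syz g" using Syz_add[OF g(1)] compS(1) insert.IH by blast
      ultimately show ?case using insert by (simp add: vec3_add)
    qed
    define D where "D = insert d (degree_support (u $ 0) \<union> degree_support (u $ 1) \<union> degree_support (u $ 2))"
    have D: "finite D" "d \<in> D" by (simp_all add: D_def)
    have prj: "(\<Sum>j\<in>E. comp j) = (\<Sum>j\<in>E. hom_component j (u $ 0), \<Sum>j\<in>E. hom_component j (u $ 1), \<Sum>j\<in>E. hom_component j (u $ 2))" if "finite E" for E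
      using that by (induction E rule: finite_induct) (simp_all add: comp_def zero_prod_def)
    have "(\<Sum>j\<in>D. comp j) = (u $ 0, u $ 1, u $ 2)"
      unfolding prj[OF D(1)] by (simp only: prod.inject) (intro conjI sum_hom_components D(1); auto simp: D_def)
    then have "vec3 (\<Sum>j\<in>D. comp j) = u" using vec3_of_carrier[OF uc(1)] by simp
    then have "h u = (\<Sum>j\<in>D. h (vec3 (comp j)))" using sum[OF D(1)] by simp
    moreover have "hom_component (d + s0) (h (vec3 (comp j))) = (if j = d then h (vec3 (comp d)) else 0)" for j
    proof -
      have "form (j + s0) (h (vec3 (comp j)))" using deg compS by blast
      from hom_component_form[OF this, of "d + s0"] show ?thesis by auto
    qed
    ultimately have "hom_component (d + s0) (h u) = (\<Sum>j\<in>D. if j = d then h (vec3 (comp d)) else 0)"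
      by (simp add: hom_component_sum)
    also have "\<dots> = h (vec3 (comp d))" using D by simp
    finally have "hom_component (d + s0) (h u) = h (vec3 (comp d))" .
    moreover have "hom_component (d + s0) (h u) = h u"
      using hom_component_form[of "d + s0" "h u" "d + s0"] \<open>form (d + s0) p\<close> u(2) by simp
    ultimately have "p = ?F (comp d)" using u(2) by simp
    then show "p \<in> ?F ` ?V" using comp by blast
  qed
  have "mpoly3_vs.dim (M ` forms (d - e)) = mpoly_vs.dim (forms (d - e) :: ('n, 'k) mpoly set)"
    by (rule mpoly_pair13.dim_injective_image[OF linM subspace_forms _ forms_finite_span])
      (use finite_monomials_of_degree v_ne in \<open>auto simp: M_def zero_prod_def\<close>)
  then show ?thesis using rank unfolding ker img by simp
qed

lemma not_in_span_others_iff: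
  fixes g :: "'a::comm_ring_1 vec"
  shows "(\<forall>i<3. g $ i \<notin> ring_ideal.span {g $ j | j. j < 3 \<and> j \<noteq> i}) \<longleftrightarrow>
    g $ 0 \<notin> ring_ideal.span {g $ 1, g $ 2} \<and> g $ 1 \<notin> ring_ideal.span {g $ 0, g $ 2} \<and> g $ 2 \<notin> ring_ideal.span {g $ 0, g $ 1}"
proof -
  have "{g $ j | j. j < 3 \<and> j \<noteq> 0} = {g $ 1, g $ 2}" "{g $ j | j. j < 3 \<and> j \<noteq> 1} = {g $ 0, g $ 2}"
    "{g $ j | j. j < 3 \<and> j \<noteq> 2} = {g $ 0, g $ 1}"
    unfolding less_3_cases by auto
  then show ?thesis unfolding all_less_3 by simp
qed

lemma span_pair: "ring_ideal.span {x, y} = {x * a + y * b | a b. True}"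
  unfolding insert_is_Un[of x "{y}"] ring_ideal.span_Un ring_ideal.span_singleton
  by (auto simp: mult.commute)

section \<open>Independence of the Bourbaki degree from all choices\<close>

context graded_exact_complex
begin

lemma less3: "(0 :: nat) < 3" "(1 :: nat) < 3" "(2 :: nat) < 3"
  by simp_all

text \<open>A redundant generator would give a syzygy with an entry \<open>1\<close>, but all
  syzygies have entries without constant term.\<close>

lemma generators_minimal: "minimally_generated_by_three_forms (ideal3 f) 3 (vec3 (f 0, f 1, f 2))"
proof -
  have nomem: False if "f 0 * p + f 1 * q + f 2 * r = 0" "p = 1 \<or> q = 1 \<or> r = 1" for p q r
    using syzygy_ct[OF that(1)] that(2) by (auto simp: lookup_one)
  have "f 0 \<notin> ring_ideal.span {f 1, f 2}"
  proof
    assume "f 0 \<in> ring_ideal.span {f 1, f 2}"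
    then obtain a b where "f 0 = f 1 * a + f 2 * b" unfolding span_pair by blast
    then have "f 0 * 1 + f 1 * (- a) + f 2 * (- b) = 0" by simp
    then show False using nomem by blast
  qed
  moreover have "f 1 \<notin> ring_ideal.span {f 0, f 2}"
  proof
    assume "f 1 \<in> ring_ideal.span {f 0, f 2}"
    then obtain a b where "f 1 = f 0 * a + f 2 * b" unfolding span_pair by blast
    then have "f 0 * (- a) + f 1 * 1 + f 2 * (- b) = 0" by simp
    then show False using nomem by blast
  qed
  moreover have "f 2 \<notin> ring_ideal.span {f 0, f 1}"
  proof
    assume "f 2 \<in> ring_ideal.span {f 0, f 1}"
    then obtain a b where "f 2 = f 0 * a + f 1 * b" unfolding span_pair by blast
    then have "f 0 * (- a) + f 1 * (- b) + f 2 * 1 = 0" by simp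
    then show False using nomem by blast
  qed
  ultimately show ?thesis
    unfolding minimally_generated_by_three_forms_def not_in_span_others_iff form_vec_iff[OF vec3_carrier] ideal3_eq_span less_3_set
    using form_f[OF less3(1)] form_f[OF less3(2)] form_f[OF less3(3)] by simp
qed

lemma f_nonzero: "f 0 \<noteq> 0"
proof
  assume "f 0 = 0"
  then have "f 0 * 1 + f 1 * 0 + f 2 * 0 = 0" by simp
  from syzygy_ct(1)[OF this] show False by (simp add: lookup_one)
qed

text \<open>Each of the nonzero forms \<open>f 0\<close> and \<open>g $ 0\<close> is a combination
  of the other family, so neither degree can exceed the other.\<close>

lemma generators_degree:
  assumes "minimally_generated_by_three_forms (ideal3 f) d g"
  shows "d = 3" "g \<in> carrier_vec 3" "form_vec 3 g" "ideal3 (\<lambda>i. g $ i) = ideal3 f"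
proof -
  have g: "g \<in> carrier_vec 3" "form_vec (int d) g" "ideal3 f = ring_ideal.span {g $ 0, g $ 1, g $ 2}"
    "g $ 0 \<notin> ring_ideal.span {g $ 1, g $ 2}"
    using assms unfolding minimally_generated_by_three_forms_def not_in_span_others_iff less_3_set by blast+
  show gc: "g \<in> carrier_vec 3" by (fact g(1))
  show eq: "ideal3 (\<lambda>i. g $ i) = ideal3 f" unfolding g(3) by (rule ideal3_eq_span)
  have gf: "form (int d) (g $ 0)" "form (int d) (g $ 1)" "form (int d) (g $ 2)"
    using form_vec_iff[OF g(1)] g(2) by blast+
  have "g $ 0 \<noteq> 0" using g(4) ring_ideal.span_zero by metis
  have "f 0 \<in> ideal3 f" unfolding ideal3_eq_span by (rule ring_ideal.span_base) simp
  then have "f 0 \<in> ideal3 (\<lambda>i. g $ i)" unfolding eq .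
  then obtain p q r where p: "f 0 = g $ 0 * p + g $ 1 * q + g $ 2 * r" unfolding ideal3_def by blast
  have "f 0 = hom_component 3 (f 0)" using hom_component_form[OF form_f[OF less3(1)], of 3] by simp
  also have "\<dots> = hom_component 3 (g $ 0 * p) + hom_component 3 (g $ 1 * q) + hom_component 3 (g $ 2 * r)"
    unfolding p by (simp only: hom_component_add)
  also have "\<dots> = g $ 0 * hom_component (3 - int d) p + g $ 1 * hom_component (3 - int d) q + g $ 2 * hom_component (3 - int d) r"
    by (simp only: hom_component_mult_form[OF gf(1)] hom_component_mult_form[OF gf(2)] hom_component_mult_form[OF gf(3)])
  finally have f0: "f 0 = g $ 0 * hom_component (3 - int d) p + g $ 1 * hom_component (3 - int d) q + g $ 2 * hom_component (3 - int d) r" .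
  have le: "\<not> 3 - int d < 0"
  proof
    assume neg: "3 - int d < 0"
    have z: "hom_component (3 - int d) x = 0" for x :: "('n, 'k) mpoly" using form_negative[OF form_hom_component neg] .
    show False using f0 f_nonzero unfolding z by simp
  qed
  have "g $ 0 \<in> ideal3 f" unfolding g(3) by (rule ring_ideal.span_base) simp
  then obtain p q r where p: "g $ 0 = f 0 * p + f 1 * q + f 2 * r" unfolding ideal3_def by blast
  have "g $ 0 = hom_component (int d) (g $ 0)" using hom_component_form[OF gf(1), of "int d"] by simp
  also have "\<dots> = hom_component (int d) (f 0 * p) + hom_component (int d) (f 1 * q) + hom_component (int d) (f 2 * r)"
    unfolding p by (simp only: hom_component_add)
  also have "\<dots> = f 0 * hom_component (int d - 3) p + f 1 * hom_component (int d - 3) q + f 2 * hom_component (int d - 3) r"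
    by (simp only: hom_component_mult_form[OF form_f[OF less3(1)]] hom_component_mult_form[OF form_f[OF less3(2)]] hom_component_mult_form[OF form_f[OF less3(3)]])
  finally have g0: "g $ 0 = f 0 * hom_component (int d - 3) p + f 1 * hom_component (int d - 3) q + f 2 * hom_component (int d - 3) r" .
  have "\<not> int d - 3 < 0"
  proof
    assume neg: "int d - 3 < 0"
    have z: "hom_component (int d - 3) x = 0" for x :: "('n, 'k) mpoly" using form_negative[OF form_hom_component neg] .
    show False using g0 \<open>g $ 0 \<noteq> 0\<close> unfolding z by simp
  qed
  with le show d: "d = 3" by linarith
  show "form_vec 3 g" using g(2) unfolding d by simp
qed

text \<open>The initial degree is read off the dimensions, which also covers generators other than
  \<open>f\<close>. All terms vanish below \<open>\<delta> 0\<close>; at \<open>\<delta> 0\<close>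
  the constants contribute, while the subtracted term is still zero because \<open>s - 3\<close>
  exceeds \<open>\<delta> 0\<close>.\<close>

lemma indeg:
  assumes sorted: "\<delta> 0 \<le> \<delta> 1" "\<delta> 1 \<le> \<delta> 2" 
    and g: "g \<in> carrier_vec 3" "form_vec 3 g" "ideal3 (\<lambda>i. g $ i) = ideal3 f"
  shows "int (indeg_Syz g) = \<delta> 0"
proof -
  let ?H = "\<lambda>d. forms_dim TYPE('n) TYPE('k) d"
  have gf: "form 3 (g $ i)" if "i < 3" for i using g(1,2) that by (auto simp: form_vec_def)
  have d0: "\<delta> 0 \<ge> 1" using delta_cases[OF sorted] by auto
  have s3: "s - 3 \<ge> \<delta> 0 + 1" using degree_c_pos[OF less3(1)] sorted d0 degree_c_pos[of 2] by (simp add: s)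
  have dims: "int (mpoly3_vs.dim (syzygies3 (\<lambda>i. g $ i) d)) = ?H (d - \<delta> 0) + ?H (d - \<delta> 1) + ?H (d - \<delta> 2) - ?H (d - s + 3)" for d
    using dim_syzygies[of d] dim_syzygies_other_generators[of "\<lambda>i. g $ i" d, OF gf g(3)] by simp
  have ex_iff: "(\<exists>v\<in>Syz g. v \<noteq> 0\<^sub>v (dim_vec g) \<and> form_vec (int e) v) \<longleftrightarrow> mpoly3_vs.dim (syzygies3 (\<lambda>i. g $ i) (int e)) \<noteq> 0" for e
  proof -
    have sub: "syzygies3 (\<lambda>i. g $ i) (int e) \<subseteq> forms3 (int e) (int e) (int e)" unfolding syzygies3_def by auto
    have dg: "dim_vec g = 3" using g(1) by simp
    show ?thesis unfolding dim_eq_0_iff_forms3[OF sub] dg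
    proof
      assume "\<exists>v\<in>Syz g. v \<noteq> 0\<^sub>v 3 \<and> form_vec (int e) v"
      then obtain v where v: "v \<in> Syz g" "v \<noteq> 0\<^sub>v 3" "form_vec (int e) v" by blast
      have vc: "v \<in> carrier_vec 3" using v(1) Syz_iff[OF g(1)] by blast
      let ?w = "(v $ 0, v $ 1, v $ 2)"
      have "?w \<in> syzygies3 (\<lambda>i. g $ i) (int e)" unfolding syzygies3_iff[OF g(1)] vec3_of_carrier[OF vc] using v by blast
      moreover have "?w \<noteq> 0" using v(2) vec3_of_carrier[OF vc] vec3_eq_0_iff[of ?w] by simp
      ultimately show "\<not> syzygies3 (\<lambda>i. g $ i) (int e) \<subseteq> {0}" by blast
    next
      assume "\<not> syzygies3 (\<lambda>i. g $ i) (int e) \<subseteq> {0}"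
      then obtain w where w: "w \<in> syzygies3 (\<lambda>i. g $ i) (int e)" "w \<noteq> 0" by blast
      then have "vec3 w \<in> Syz g" "form_vec (int e) (vec3 w)" "vec3 w \<noteq> 0\<^sub>v 3"
        using syzygies3_iff[OF g(1)] vec3_eq_0_iff by blast+
      then show "\<exists>v\<in>Syz g. v \<noteq> 0\<^sub>v 3 \<and> form_vec (int e) v" by blast
    qed
  qed
  have "indeg_Syz g = nat (\<delta> 0)"
    unfolding indeg_Syz_def ex_iff
  proof (rule Least_equality)
    have "?H 0 \<noteq> 0"
    proof -
      have "mpoly_vs.dim (forms 0 :: ('n, 'k) mpoly set) = card {0 :: 'n \<Rightarrow>\<^sub>0 nat}"
        unfolding dim_forms by (rule arg_cong[where f = card]) auto
      then show ?thesis by simp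
    qed
    moreover have "?H (\<delta> 0 - s + 3) = 0" using dim_forms_negative[of "\<delta> 0 - s + 3"] s3 by simp
    ultimately have "int (mpoly3_vs.dim (syzygies3 (\<lambda>i. g $ i) (\<delta> 0))) \<noteq> 0" unfolding dims by simp
    then show "mpoly3_vs.dim (syzygies3 (\<lambda>i. g $ i) (int (nat (\<delta> 0)))) \<noteq> 0" using d0 by simp
  next
    fix e assume ne: "mpoly3_vs.dim (syzygies3 (\<lambda>i. g $ i) (int e)) \<noteq> 0"
    show "nat (\<delta> 0) \<le> e"
    proof (rule ccontr)
      assume "\<not> nat (\<delta> 0) \<le> e"
      then have lt: "int e < \<delta> 0" by linarith
      have "?H (int e - \<delta> 0) = 0" "?H (int e - \<delta> 1) = 0" "?H (int e - \<delta> 2) = 0" "?H (int e - s + 3) = 0"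
        using lt sorted s3 by (simp_all add: dim_forms_negative)
      then have "int (mpoly3_vs.dim (syzygies3 (\<lambda>i. g $ i) (int e))) = 0" unfolding dims by simp
      then show False using ne by simp
    qed
  qed
  then show ?thesis using d0 by simp
qed

text \<open>The first moment of the twists of \<open>R/I\<close> is
  \<open>\<delta> 0 - 3 - s0\<close>, so height two forces the shift
  \<open>s0 = \<delta> 0 - 3\<close>. Then the twists are those of a complete intersection of
  degrees \<open>p = \<delta> 0 + \<delta> 1 - 3\<close> and
  \<open>q = \<delta> 0 + \<delta> 2 - 3\<close>, with second moment
  \<open>(p + q)^2 - p^2 - q^2 = 2 * p * q\<close>.\<close>

lemma quotient_ideal_invariants:
  fixes I :: "('n, 'k) mpoly set"
  assumes n: "CARD('n) \<ge> 3" and I: "homogeneous_ideal I"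
    and dims: "\<And>d. int (mpoly3_vs.dim (syzygies3 f d)) = forms_dim TYPE('n) TYPE('k) (d - \<delta> 0) + int (mpoly_vs.dim {p \<in> I. form (d + s0) p})"
  shows "s0 \<noteq> \<delta> 0 - 3 \<Longrightarrow> height I \<le> 1" "s0 = \<delta> 0 - 3 \<Longrightarrow> height I \<le> 2"
    "s0 = \<delta> 0 - 3 \<Longrightarrow> multiplicity I = of_int ((\<delta> 0 + \<delta> 1 - 3) * (\<delta> 0 + \<delta> 2 - 3))"
proof -
  let ?H = "\<lambda>e. forms_dim TYPE('n) TYPE('k) e"
  let ?ws = "[(1, 0), (-1, s0 + \<delta> 1), (-1, s0 + \<delta> 2), (1, s0 + s - 3)] :: (rat \<times> int) list"
  let ?P = "shifted_sum (forms_dim_poly CARD('n)) ?ws"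
  let ?d0 = "nat (\<bar>s0\<bar> + \<bar>s\<bar> + \<bar>\<delta> 1\<bar> + \<bar>\<delta> 2\<bar> + 3)"
  have P: "poly ?P (of_nat d) = of_int (hilbert_function I d)" if d: "d \<ge> ?d0" for d
  proof -
    have H: "of_int (?H (int d - e)) = poly (forms_dim_poly CARD('n)) (of_nat d - of_int e)" if "e \<le> int d" for e
      using poly_forms_dim_poly[of "int d - e", where 'n = 'n and 'k = 'k] that by simp
    have "hilbert_function I d = ?H (int d - 0) - ?H (int d - (s0 + \<delta> 1)) - ?H (int d - (s0 + \<delta> 2)) + ?H (int d - (s0 + s - 3))"
      using dims[of "int d - s0"] dim_syzygies[of "int d - s0"] unfolding hilbert_function_def forms_def[symmetric] by (simp add: algebra_simps)
    also have "rat_of_int \<dots> = of_int (?H (int d - 0)) - of_int (?H (int d - (s0 + \<delta> 1))) - of_int (?H (int d - (s0 + \<delta> 2))) + of_int (?H (int d - (s0 + s - 3)))"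
      by (simp only: of_int_add of_int_diff)
    also have "\<dots> = poly ?P (of_nat d)"
      using d by (subst H, linarith)+ (simp add: poly_shifted_sum)
    finally show ?thesis by simp
  qed
  have m0: "(\<Sum>(w, a)\<leftarrow>?ws. w) = 0" by simp
  have m1: "(\<Sum>(w, a)\<leftarrow>?ws. w * rat_of_int a) = of_int (\<delta> 0 - 3 - s0)" by (simp add: s)
  show "height I \<le> 1" if "s0 \<noteq> \<delta> 0 - 3"
  proof -
    have "(\<Sum>(w, a)\<leftarrow>?ws. w * rat_of_int a) \<noteq> 0" unfolding m1 using that by simp
    from degree_shifted_sum_forms_1[OF n m0 this] have deg: "degree ?P = CARD('n) - 2" .
    then have "?P \<noteq> 0" using n by auto
    have "height I \<le> enat (CARD('n) - Suc (CARD('n) - 2))"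
      by (rule height_le_of_hilbert_function[OF I deg _ \<open>?P \<noteq> 0\<close> P]) (use n in auto)
    also have "CARD('n) - Suc (CARD('n) - 2) = 1" using n by simp
    finally show ?thesis by (simp add: one_enat_def)
  qed
  let ?pq = "(\<delta> 0 + \<delta> 1 - 3) * (\<delta> 0 + \<delta> 2 - 3)"
  have pq: "?pq \<noteq> 0" using degree_c_pos[OF less3(2)] degree_c_pos[OF less3(3)] by (auto simp: s)
  {
    assume s0: "s0 = \<delta> 0 - 3"
    have m1': "(\<Sum>(w, a)\<leftarrow>?ws. w * rat_of_int a) = 0"
      by (subst m1) (simp add: s0)
    have "(\<Sum>(w, a)\<leftarrow>?ws. w * rat_of_int a ^ 2) = of_int ((s0 + s - 3) ^ 2 - (s0 + \<delta> 1) ^ 2 - (s0 + \<delta> 2) ^ 2)"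
      by simp
    also have "(s0 + s - 3) ^ 2 - (s0 + \<delta> 1) ^ 2 - (s0 + \<delta> 2) ^ 2 = 2 * ?pq"
      unfolding s0 s by (simp add: power2_eq_square algebra_simps)
    finally have m2: "(\<Sum>(w, a)\<leftarrow>?ws. w * rat_of_int a ^ 2) = 2 * of_int ?pq" by simp
    have pq': "rat_of_int ?pq \<noteq> 0" using pq by simp
    note deg = degree_shifted_sum_forms_2[OF n m0 m1' m2 pq']
    have "?P \<noteq> 0" using deg(2) pq' by auto
    have "height I \<le> enat (CARD('n) - Suc (CARD('n) - 3))"
      by (rule height_le_of_hilbert_function[OF I deg(1) _ \<open>?P \<noteq> 0\<close> P]) (use n in auto)
    also have "CARD('n) - Suc (CARD('n) - 3) = 2" using n by simp
    finally have "height I \<le> 2" by (simp add: numeral_eq_enat)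
    moreover have "hilbert_poly I = ?P" using P by (rule hilbert_poly_eqI)
    then have "multiplicity I = of_int ?pq" using \<open>?P \<noteq> 0\<close> deg by (simp add: multiplicity_def)
    ultimately have "height I \<le> 2 \<and> multiplicity I = of_int ?pq" by simp
  }
  then show "s0 = \<delta> 0 - 3 \<Longrightarrow> height I \<le> 2" "s0 = \<delta> 0 - 3 \<Longrightarrow> multiplicity I = of_int ?pq" by simp_all
qed

lemma bourbaki_ideal_degree:
  fixes I :: "('n, 'k) mpoly set"
  assumes n: "CARD('n) \<ge> 3" and sorted: "\<delta> 0 \<le> \<delta> 1" "\<delta> 1 \<le> \<delta> 2"
    and g: "minimally_generated_by_three_forms (ideal3 f) d g" and v: "initial_syzygy g v"
    and I: "homogeneous_ideal I" "height I = 2" "syz_quotient_iso g v I"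
  shows "codim2_degree I = of_int ((\<delta> 0 + \<delta> 1 - 3) * (\<delta> 0 + \<delta> 2 - 3))"
proof -
  note g = generators_degree[OF g]
  have gf: "form 3 (g $ i)" if "i < 3" for i using g(2,3) that by (auto simp: form_vec_def)
  have v: "v \<in> Syz g" "v \<noteq> 0\<^sub>v 3" "form_vec (\<delta> 0) v"
    using v indeg[OF sorted g(2-4)] g(2) unfolding initial_syzygy_def by auto
  obtain h s0 where h: "\<forall>u\<in>Syz g. \<forall>w\<in>Syz g. h (u + w) = h u + h w" "\<forall>r. \<forall>u\<in>Syz g. h (r \<cdot>\<^sub>v u) = r * h u"
    "\<forall>d. \<forall>u\<in>Syz g. form_vec d u \<longrightarrow> form (d + s0) (h u)" "h ` Syz g = I" "{u \<in> Syz g. h u = 0} = {r \<cdot>\<^sub>v v | r. True}"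
    using I(3) unfolding syz_quotient_iso_def by blast
  have "int (mpoly3_vs.dim (syzygies3 f d)) = forms_dim TYPE('n) TYPE('k) (d - \<delta> 0) + int (mpoly_vs.dim {p \<in> I. form (d + s0) p})" for d
    using syz_quotient_dim[OF g(2,3) v h, of d] dim_syzygies_other_generators[of "\<lambda>i. g $ i" d, OF gf g(4)] by simp
  note inv = quotient_ideal_invariants[OF n I(1) this]
  have "s0 = \<delta> 0 - 3"
  proof (rule ccontr)
    assume "s0 \<noteq> \<delta> 0 - 3"
    then have "height I \<le> 1" by (rule inv(1))
    then show False using I(2) by (simp add: numeral_eq_enat one_enat_def)
  qed
  from inv(3)[OF this] show ?thesis using I(2) by (simp add: codim2_degree_def)
qed

end

section \<open>Resolutions of length two\<close>

lemma mat_image_carrier_0: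
  assumes "M \<in> carrier_mat n 0"
  shows "mat_image M = {0\<^sub>v n :: 'a::comm_ring_1 vec}"
proof -
  have "M *\<^sub>v v = 0\<^sub>v n" if "v \<in> carrier_vec 0" for v
    using assms that by (intro eq_vecI) (auto simp: scalar_prod_def)
  then have "(\<lambda>v. M *\<^sub>v v) ` carrier_vec 0 = (\<lambda>v. 0\<^sub>v n) ` (carrier_vec 0 :: 'a vec set)" by (intro image_cong) simp_all
  moreover have "(carrier_vec 0 :: 'a vec set) \<noteq> {}" using zero_carrier_vec[of 0] by blast
  ultimately show ?thesis using assms unfolding mat_image_def by (simp add: image_constant_conv)
qed

text \<open>Projectivity of free modules: a map into the image of \<open>M\<close> lifts, one column
  at a time. It supplies the comparison maps and homotopies below.\<close>

lemma lift_through_image: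
  fixes M :: "'a::comm_ring_1 mat"
  assumes M: "M \<in> carrier_mat n m" and N: "N \<in> carrier_mat n k"
    and cols: "\<And>j. j < k \<Longrightarrow> col N j \<in> mat_image M"
  shows "\<exists>X\<in>carrier_mat m k. M * X = N"
proof -
  have "\<forall>j. \<exists>x. j < k \<longrightarrow> x \<in> carrier_vec m \<and> M *\<^sub>v x = col N j"
    using cols M unfolding mat_image_def by fastforce
  from choice[OF this] obtain x where x: "\<forall>j. j < k \<longrightarrow> x j \<in> carrier_vec m \<and> M *\<^sub>v x j = col N j" ..
  define X where "X = mat m k (\<lambda>(i, j). x j $ i)"
  have X: "X \<in> carrier_mat m k" by (simp add: X_def)
  have colX: "col X j = x j" if "j < k" for j
    using x that by (intro eq_vecI) (auto simp: X_def)
  have "M * X = N"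
  proof (rule mat_col_eqI)
    fix j assume "j < dim_col N"
    then have j: "j < k" using N by simp
    show "col (M * X) j = col N j"
      unfolding col_mult2[OF M X j] colX[OF j] using x j by blast
  qed (use M N X in auto)
  then show ?thesis using X by blast
qed

lemma cols_in_kernel:
  fixes M :: "'a::comm_ring_1 mat"
  assumes M: "M \<in> carrier_mat n m" and X: "X \<in> carrier_mat m k" and "M * X = 0\<^sub>m n k" "j < k"
  shows "col X j \<in> mat_kernel M"
proof -
  have "M *\<^sub>v col X j = col (M * X) j" using col_mult2[OF M X assms(4)] by simp
  also have "\<dots> = 0\<^sub>v n" using assms(3,4) by simp
  finally show ?thesis using M X assms(4) by (intro mat_kernelI) auto
qed

lemma mult_zero_of_image_kernel:
  fixes M :: "'a::comm_ring_1 mat"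
  assumes M: "M \<in> carrier_mat n m" and N: "N \<in> carrier_mat m k" and eq: "mat_kernel M = mat_image N"
  shows "M * N = 0\<^sub>m n k"
proof (rule mat_col_eqI)
  fix j assume "j < dim_col (0\<^sub>m n k :: 'a mat)"
  then have j: "j < k" by simp
  have "col N j = N *\<^sub>v unit_vec k j"
    using N j by (intro eq_vecI) (auto simp: scalar_prod_right_unit)
  then have "col N j \<in> mat_kernel M" unfolding eq mat_image_def using N j by (intro image_eqI[of _ _ "unit_vec k j"]) auto
  then have "M *\<^sub>v col N j = 0\<^sub>v n" using mat_kernelD[OF M] by blast
  then show "col (M * N) j = col (0\<^sub>m n k) j" using col_mult2[OF M N j] j by simp
qed (use M N in auto)

text \<open>
  A minimal resolution of length three computes \<open>Tor\<^sub>3(R/J, k) \<noteq> 0\<close>; comparing it with a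
  shorter resolution expresses the last differential as a multiple of itself by an element of the
  maximal ideal.
\<close>

lemma no_short_resolution:
  fixes J :: "('n, 'k::field) mpoly set"
  assumes A: "minimal_graded_free_resolution J [a0, a1, [e]] A" and B: "graded_free_resolution J F B"
  shows "length F \<noteq> 2"
proof
  assume len: "length F = 2"
  let ?r = "length a0" and ?m = "length a1" and ?p = "length (F ! 0)" and ?q = "length (F ! 1)"
  have Af: "graded_free_resolution J [a0, a1, [e]] A" and ct: "\<And>i x. x \<in> elements_mat (A (Suc i)) \<Longrightarrow> lookup x 0 = 0"
    using A unfolding minimal_graded_free_resolution_def by blast+
  have gm: "graded_matrix (complex_term [a0, a1, [e]] i) (complex_term [a0, a1, [e]] (Suc i)) (A (Suc i))" for i
    using Af unfolding graded_free_resolution_def by blast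
  have cA: "A 0 \<in> carrier_mat 1 ?r" "A 1 \<in> carrier_mat ?r ?m" "A 2 \<in> carrier_mat ?m 1" "A 3 \<in> carrier_mat 1 0"
    using Af gm[of 0] gm[of 1] gm[of 2]
    by (auto simp: graded_free_resolution_def graded_matrix_def complex_term_def numeral_2_eq_2 numeral_3_eq_3)
  have gmB: "graded_matrix (complex_term F i) (complex_term F (Suc i)) (B (Suc i))" for i
    using B unfolding graded_free_resolution_def by blast
  have cB: "B 0 \<in> carrier_mat 1 ?p" "B 1 \<in> carrier_mat ?p ?q" "B 2 \<in> carrier_mat ?q 0"
    using B gmB[of 0] gmB[of 1] len
    by (auto simp: graded_free_resolution_def graded_matrix_def complex_term_def numeral_2_eq_2)
  have kA: "mat_kernel (A 0) = mat_image (A 1)" "mat_kernel (A 1) = mat_image (A 2)" "mat_kernel (A 2) = mat_image (A 3)"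
    using Af unfolding graded_free_resolution_def by (auto simp: numeral_2_eq_2 numeral_3_eq_3)
  have kB: "mat_kernel (B 0) = mat_image (B 1)" "mat_kernel (B 1) = mat_image (B 2)"
    using B unfolding graded_free_resolution_def by (auto simp: numeral_2_eq_2)
  have ker_A2: "mat_kernel (A 2) = {0\<^sub>v 1}" unfolding kA(3) by (rule mat_image_carrier_0[OF cA(4)])
  have ker_B1: "mat_kernel (B 1) = {0\<^sub>v ?q}" unfolding kB(2) by (rule mat_image_carrier_0[OF cB(3)])
  have image_J: "v \<in> mat_image N" if v: "v \<in> carrier_vec 1" and vN: "v $ 0 \<in> (\<lambda>v. v $ 0) ` mat_image N" and N: "N \<in> carrier_mat 1 l" for v N and l
  proof -
    obtain w where w: "w \<in> mat_image N" "v $ 0 = w $ 0" using vN by blast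
    have "w \<in> carrier_vec 1" using w(1) N unfolding mat_image_def by auto
    then have "v = w" using v w(2) by (intro eq_vecI) auto
    then show ?thesis using w(1) by simp
  qed
  have JA: "(\<lambda>v. v $ 0) ` mat_image (A 0) = J"
    using Af unfolding graded_free_resolution_def by (elim conjE)
  have JB: "(\<lambda>v. v $ 0) ` mat_image (B 0) = J"
    using B unfolding graded_free_resolution_def by (elim conjE)
  have col_image: "col N j \<in> mat_image N" if "N \<in> carrier_mat l k" "j < k" for N :: "('n, 'k) mpoly mat" and l k j
  proof -
    have "col N j = N *\<^sub>v unit_vec k j" using that by (intro eq_vecI) (auto simp: scalar_prod_right_unit)
    then show ?thesis unfolding mat_image_def using that by (intro image_eqI[of _ _ "unit_vec k j"]) auto
  qed
  have A01: "A 0 * A 1 = 0\<^sub>m 1 ?m" by (rule mult_zero_of_image_kernel[OF cA(1,2) kA(1)])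
  have A12: "A 1 * A 2 = 0\<^sub>m ?r 1" by (rule mult_zero_of_image_kernel[OF cA(2,3) kA(2)])
  have B01: "B 0 * B 1 = 0\<^sub>m 1 ?q" by (rule mult_zero_of_image_kernel[OF cB(1,2) kB(1)])
  \<comment> \<open>The comparison theorem by hand: \<open>\<phi>0\<close>, \<open>\<phi>1\<close>
    map the first resolution to the second, and \<open>\<psi>0\<close>, \<open>\<psi>1\<close> map
    back, all over the identity of \<open>J\<close>.\<close>
  have "\<exists>X\<in>carrier_mat ?p ?r. B 0 * X = A 0"
  proof (rule lift_through_image[OF cB(1) cA(1)])
    fix j assume j: "j < ?r"
    have "col (A 0) j \<in> mat_image (A 0)" by (rule col_image[OF cA(1) j])
    then have "col (A 0) j $ 0 \<in> (\<lambda>v. v $ 0) ` mat_image (B 0)" unfolding JB JA[symmetric] by blast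
    moreover have "col (A 0) j \<in> carrier_vec 1" by (rule carrier_vecI) (use cA(1) in simp)
    ultimately show "col (A 0) j \<in> mat_image (B 0)" by (rule image_J[OF _ _ cB(1), rotated])
  qed
  then obtain \<phi>0 where \<phi>0: "\<phi>0 \<in> carrier_mat ?p ?r" "B 0 * \<phi>0 = A 0" ..
  have "\<exists>X\<in>carrier_mat ?r ?p. A 0 * X = B 0"
  proof (rule lift_through_image[OF cA(1) cB(1)])
    fix j assume j: "j < ?p"
    have "col (B 0) j \<in> mat_image (B 0)" by (rule col_image[OF cB(1) j])
    then have "col (B 0) j $ 0 \<in> (\<lambda>v. v $ 0) ` mat_image (A 0)" unfolding JA JB[symmetric] by blast
    moreover have "col (B 0) j \<in> carrier_vec 1" by (rule carrier_vecI) (use cB(1) in simp)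
    ultimately show "col (B 0) j \<in> mat_image (A 0)" by (rule image_J[OF _ _ cA(1), rotated])
  qed
  then obtain \<psi>0 where \<psi>0: "\<psi>0 \<in> carrier_mat ?r ?p" "A 0 * \<psi>0 = B 0" ..
  have c1: "\<phi>0 * A 1 \<in> carrier_mat ?p ?m" "\<psi>0 * B 1 \<in> carrier_mat ?r ?q" using \<phi>0 \<psi>0 cA cB by auto
  have "B 0 * (\<phi>0 * A 1) = 0\<^sub>m 1 ?m"
    using assoc_mult_mat[OF cB(1) \<phi>0(1) cA(2)] A01 \<phi>0(2) by simp
  then have "\<exists>X\<in>carrier_mat ?q ?m. B 1 * X = \<phi>0 * A 1"
    using cols_in_kernel[OF cB(1) c1(1)] kB(1) by (intro lift_through_image[OF cB(2) c1(1)]) simp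
  then obtain \<phi>1 where \<phi>1: "\<phi>1 \<in> carrier_mat ?q ?m" "B 1 * \<phi>1 = \<phi>0 * A 1" ..
  have "A 0 * (\<psi>0 * B 1) = 0\<^sub>m 1 ?q"
    using assoc_mult_mat[OF cA(1) \<psi>0(1) cB(2)] B01 \<psi>0(2) by simp
  then have "\<exists>X\<in>carrier_mat ?m ?q. A 1 * X = \<psi>0 * B 1"
    using cols_in_kernel[OF cA(1) c1(2)] kA(1) by (intro lift_through_image[OF cA(2) c1(2)]) simp
  then obtain \<psi>1 where \<psi>1: "\<psi>1 \<in> carrier_mat ?m ?q" "A 1 * \<psi>1 = \<psi>0 * B 1" ..
  \<comment> \<open>The shorter resolution has no further term, so \<open>B 1\<close> is injective
    and \<open>\<phi>1 * A 2\<close> must vanish.\<close>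
  have \<phi>1A2: "\<phi>1 * A 2 = 0\<^sub>m ?q 1"
  proof -
    have cc: "\<phi>1 * A 2 \<in> carrier_mat ?q 1" using \<phi>1 cA by auto
    have "B 1 * (\<phi>1 * A 2) = (\<phi>0 * A 1) * A 2" using assoc_mult_mat[OF cB(2) \<phi>1(1) cA(3)] \<phi>1(2) by simp
    also have "\<dots> = \<phi>0 * (A 1 * A 2)" by (rule assoc_mult_mat[OF \<phi>0(1) cA(2,3)])
    also have "\<dots> = 0\<^sub>m ?p 1" unfolding A12 using \<phi>0 by simp
    finally have "col (\<phi>1 * A 2) 0 \<in> mat_kernel (B 1)" by (rule cols_in_kernel[OF cB(2) cc]) simp
    then have "col (\<phi>1 * A 2) 0 = 0\<^sub>v ?q" unfolding ker_B1 by simp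
    then show ?thesis using cc by (intro mat_col_eqI) auto
  qed
  \<comment> \<open>The composite \<open>\<psi> \<phi>\<close> is homotopic to the identity;
    \<open>S0\<close> and \<open>S1\<close> are the two stages of the homotopy.\<close>
  define E0 where "E0 = \<psi>0 * \<phi>0 - 1\<^sub>m ?r"
  have E0: "E0 \<in> carrier_mat ?r ?r" unfolding E0_def by (intro minus_carrier_mat one_carrier_mat)
  have "A 0 * E0 = A 0 * (\<psi>0 * \<phi>0) - A 0 * 1\<^sub>m ?r"
    unfolding E0_def by (rule mult_minus_distrib_mat[OF cA(1)]) (use \<phi>0 \<psi>0 in auto)
  also have "A 0 * (\<psi>0 * \<phi>0) = A 0"
    using assoc_mult_mat[OF cA(1) \<psi>0(1) \<phi>0(1)] \<psi>0(2) \<phi>0(2) by simp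
  finally have "A 0 * E0 = 0\<^sub>m 1 ?r" using cA(1) by simp
  then have "\<exists>X\<in>carrier_mat ?m ?r. A 1 * X = E0"
    using cols_in_kernel[OF cA(1) E0] kA(1) by (intro lift_through_image[OF cA(2) E0]) simp
  then obtain S0 where S0: "S0 \<in> carrier_mat ?m ?r" "A 1 * S0 = E0" ..
  define E1 where "E1 = (\<psi>1 * \<phi>1 - 1\<^sub>m ?m) - S0 * A 1"
  have cs: "\<psi>1 * \<phi>1 \<in> carrier_mat ?m ?m" "S0 * A 1 \<in> carrier_mat ?m ?m" "\<psi>1 * \<phi>1 - 1\<^sub>m ?m \<in> carrier_mat ?m ?m"
    by (rule mult_carrier_mat[OF \<psi>1(1) \<phi>1(1)], rule mult_carrier_mat[OF S0(1) cA(2)], intro minus_carrier_mat one_carrier_mat)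
  have E1: "E1 \<in> carrier_mat ?m ?m" unfolding E1_def by (rule minus_carrier_mat[OF cs(2)])
  have "A 1 * (\<psi>1 * \<phi>1) = \<psi>0 * (\<phi>0 * A 1)"
  proof -
    have "A 1 * (\<psi>1 * \<phi>1) = (\<psi>0 * B 1) * \<phi>1" using assoc_mult_mat[OF cA(2) \<psi>1(1) \<phi>1(1)] \<psi>1(2) by simp
    also have "\<dots> = \<psi>0 * (\<phi>0 * A 1)" using assoc_mult_mat[OF \<psi>0(1) cB(2) \<phi>1(1)] \<phi>1(2) by simp
    finally show ?thesis .
  qed
  moreover have "A 1 * (S0 * A 1) = \<psi>0 * (\<phi>0 * A 1) - A 1"
  proof -
    have "A 1 * (S0 * A 1) = E0 * A 1" using assoc_mult_mat[OF cA(2) S0(1) cA(2)] S0(2) by simp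
    also have "\<dots> = (\<psi>0 * \<phi>0) * A 1 - 1\<^sub>m ?r * A 1"
      unfolding E0_def by (rule minus_mult_distrib_mat[OF _ _ cA(2)]) (use \<phi>0 \<psi>0 in auto)
    also have "\<dots> = \<psi>0 * (\<phi>0 * A 1) - A 1"
      using assoc_mult_mat[OF \<psi>0(1) \<phi>0(1) cA(2)] cA(2) by simp
    finally show ?thesis .
  qed
  moreover have "A 1 * E1 = (A 1 * (\<psi>1 * \<phi>1) - A 1 * 1\<^sub>m ?m) - A 1 * (S0 * A 1)"
  proof -
    have "A 1 * E1 = A 1 * (\<psi>1 * \<phi>1 - 1\<^sub>m ?m) - A 1 * (S0 * A 1)"
      unfolding E1_def by (rule mult_minus_distrib_mat[OF cA(2) cs(3,2)])
    also have "A 1 * (\<psi>1 * \<phi>1 - 1\<^sub>m ?m) = A 1 * (\<psi>1 * \<phi>1) - A 1 * 1\<^sub>m ?m"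
      by (rule mult_minus_distrib_mat[OF cA(2) cs(1)]) simp
    finally show ?thesis .
  qed
  ultimately have "A 1 * E1 = (\<psi>0 * (\<phi>0 * A 1) - A 1) - (\<psi>0 * (\<phi>0 * A 1) - A 1)" using cA(2) by simp
  moreover have "\<psi>0 * (\<phi>0 * A 1) - A 1 \<in> carrier_mat ?r ?m" by (rule minus_carrier_mat[OF cA(2)])
  ultimately have "A 1 * E1 = 0\<^sub>m ?r ?m" by (auto intro!: eq_matI)
  then have "\<exists>X\<in>carrier_mat 1 ?m. A 2 * X = E1"
    using cols_in_kernel[OF cA(2) E1] kA(2) by (intro lift_through_image[OF cA(3) E1]) simp
  then obtain S1 where S1: "S1 \<in> carrier_mat 1 ?m" "A 2 * S1 = E1" ..
  have cS: "S1 * A 2 \<in> carrier_mat 1 1" using S1 cA by auto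
  have "A 2 * (S1 * A 2) = E1 * A 2" using assoc_mult_mat[OF cA(3) S1(1) cA(3)] S1(2) by simp
  also have "\<dots> = (\<psi>1 * \<phi>1 - 1\<^sub>m ?m) * A 2 - (S0 * A 1) * A 2"
    unfolding E1_def by (rule minus_mult_distrib_mat[OF cs(3,2) cA(3)])
  also have "(\<psi>1 * \<phi>1 - 1\<^sub>m ?m) * A 2 = (\<psi>1 * \<phi>1) * A 2 - 1\<^sub>m ?m * A 2"
    by (rule minus_mult_distrib_mat[OF cs(1) _ cA(3)]) simp
  also have "(\<psi>1 * \<phi>1) * A 2 = 0\<^sub>m ?m 1"
    using assoc_mult_mat[OF \<psi>1(1) \<phi>1(1) cA(3)] \<phi>1A2 \<psi>1(1) by simp
  also have "(S0 * A 1) * A 2 = 0\<^sub>m ?m 1"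
    using assoc_mult_mat[OF S0(1) cA(2,3)] A12 S0(1) by simp
  \<comment> \<open>Applying the last stage of the homotopy to \<open>A 2\<close>, where the
    composite is zero, leaves \<open>A 2 * (S1 * A 2) = - A 2\<close>. As \<open>A 2\<close> is
    injective, \<open>S1 * A 2\<close> is \<open>-1\<close>, although its constant term is
    zero.\<close>
  finally have neg: "A 2 * (S1 * A 2) = - A 2" using cA(3) by (auto intro!: eq_matI)
  have "A 2 * (S1 * A 2 + 1\<^sub>m 1) = A 2 * (S1 * A 2) + A 2 * 1\<^sub>m 1"
    by (rule mult_add_distrib_mat[OF cA(3) cS]) simp
  also have "\<dots> = 0\<^sub>m ?m 1" unfolding neg using cA(3) by (auto intro!: eq_matI)
  finally have zero: "A 2 * (S1 * A 2 + 1\<^sub>m 1) = 0\<^sub>m ?m 1" .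
  have cS1: "S1 * A 2 + 1\<^sub>m 1 \<in> carrier_mat 1 1" using cS by simp
  have "col (S1 * A 2 + 1\<^sub>m 1) 0 \<in> mat_kernel (A 2)" by (rule cols_in_kernel[OF cA(3) cS1 zero]) simp
  then have "col (S1 * A 2 + 1\<^sub>m 1) 0 $ 0 = 0\<^sub>v 1 $ 0" unfolding ker_A2 by simp
  then have "(S1 * A 2) $$ (0, 0) + 1 = 0" using cS S1(1) cA(3) by (simp add: col_def)
  moreover have "(S1 * A 2) $$ (0, 0) = (\<Sum>j = 0..<?m. S1 $$ (0, j) * A 2 $$ (j, 0))"
    using S1(1) cA(3) by (simp add: scalar_prod_def)
  ultimately have "lookup ((\<Sum>j = 0..<?m. S1 $$ (0, j) * A 2 $$ (j, 0)) + 1) 0 = 0" by simp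
  moreover have "lookup (A 2 $$ (j, 0)) 0 = 0" if "j < ?m" for j
  proof -
    have "A 2 $$ (j, 0) \<in> elements_mat (A (Suc 1))" using that cA(3) by (intro elements_matI[of _ ?m 1]) (auto simp: numeral_2_eq_2)
    then show ?thesis by (rule ct)
  qed
  ultimately show False by (simp add: lookup_add lookup_sum lookup_0_mult)
qed

text \<open>Perfection would make the projective dimension equal to two, and this infimum is
  attained by a resolution with two terms, since it is finite and extended naturals are
  well-ordered.\<close>

lemma not_perfect:
  fixes J :: "('n, 'k::field) mpoly set"
  assumes "minimal_graded_free_resolution J [a0, a1, [e]] A"
  shows "\<not> perfect_of_height_two J"
proof
  assume "perfect_of_height_two J"
  then have "proj_dim_quotient J = 2" by (simp add: perfect_of_height_two_def)
  then have inf: "Inf {enat (length F) | F. \<exists>A. graded_free_resolution J F A} = enat 2"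
    unfolding proj_dim_quotient_def by (simp add: numeral_eq_enat)
  let ?S = "{enat (length F) | F. \<exists>A. graded_free_resolution J F A}"
  have "?S \<noteq> {}"
  proof
    assume "?S = {}"
    then have "Inf ?S = Inf {}" by (rule arg_cong)
    then show False using inf by (simp add: top_enat_def)
  qed
  then obtain x where "x \<in> ?S" by (meson ex_in_conv)
  then have "Inf ?S \<in> ?S" by (rule wellorder_InfI)
  then obtain F B where "graded_free_resolution J F B" "length F = 2" unfolding inf by auto
  then show False using no_short_resolution[OF assms] by blast
qed

section \<open>Existence of the Bourbaki ideal\<close>

context graded_exact_complex
begin

text \<open>
  With \<open>\<nu>\<close> the first column of \<open>A\<close>, \<open>Syz f / R\<nu>\<close> is \<open>R\<^sup>3 / (R c + R e\<^sub>0)\<close>, which is the ideal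
  generated by the complete intersection \<open>c\<^sub>1, c\<^sub>2\<close>.
\<close>

lemma bourbaki_ideal_exists:
  assumes n: "CARD('n) \<ge> 3" and sorted: "\<delta> 0 \<le> \<delta> 1" "\<delta> 1 \<le> \<delta> 2"
  shows "\<exists>v I. initial_syzygy (vec3 (f 0, f 1, f 2)) v \<and> homogeneous_ideal I \<and> unmixed I \<and> height I = 2 \<and>
    syz_quotient_iso (vec3 (f 0, f 1, f 2)) v I"
proof -
  let ?g = "vec3 (f 0, f 1, f 2)"
  let ?v = "vec3 (A 0 0, A 1 0, A 2 0)"
  let ?I = "ring_ideal.span {c 1, c 2}"
  have g: "?g \<in> carrier_vec 3" "form_vec 3 ?g" "ideal3 (\<lambda>i. ?g $ i) = ideal3 f"
    unfolding form_vec_iff[OF vec3_carrier] using form_f[OF less3(1)] form_f[OF less3(2)] form_f[OF less3(3)]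
    by (simp_all add: ideal3_def)
  have Syz: "u \<in> Syz ?g \<longleftrightarrow> u \<in> carrier_vec 3 \<and> f 0 * u $ 0 + f 1 * u $ 1 + f 2 * u $ 2 = 0" for u
    unfolding Syz_iff[OF g(1)] by simp
  have syz3: "syzygies3 (\<lambda>i. ?g $ i) d = syzygies3 f d" for d by (simp add: syzygies3_def)
  have vS: "?v \<in> Syz ?g" unfolding Syz using complex0[OF less3(1)] by simp
  have v0: "?v \<noteq> 0\<^sub>v 3"
  proof
    assume "?v = 0\<^sub>v 3"
    then have "(A 0 0, A 1 0, A 2 0) = 0" unfolding vec3_eq_0_iff .
    then have z': "A 0 0 = 0 \<and> A 1 0 = 0 \<and> A 2 0 = 0" unfolding zero_prod_def prod.inject .
    note z = z'[THEN conjunct1] z'[THEN conjunct2, THEN conjunct1] z'[THEN conjunct2, THEN conjunct2]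
    have "\<exists>t. 1 = c 0 * t \<and> 0 = c 1 * t \<and> 0 = c 2 * t"
      by (rule exact1_rows) (simp_all only: z mult_zero_left mult_zero_right add_0)
    then obtain t where "1 = c 0 * t" by blast
    then have "lookup (1 :: ('n, 'k) mpoly) 0 = lookup (c 0 * t) 0" by simp
    then show False by (simp add: lookup_0_mult ct_c)
  qed
  have vf: "form_vec (\<delta> 0) ?v" unfolding form_vec_iff[OF vec3_carrier]
    using form_A[OF less3(1) less3(1)] form_A[OF less3(2) less3(1)] form_A[OF less3(3) less3(1)] by simp
  have init: "initial_syzygy ?g ?v"
    unfolding initial_syzygy_def using vS v0 vf indeg[OF sorted g] by simp
  \<comment> \<open>On a syzygy \<open>A (x, y, z)\<close>, \<open>h\<close> is the first coordinate
    of the cross product of \<open>(x, y, z)\<close> with \<open>c\<close>. It is well defined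
    because the kernel of \<open>A\<close> consists of multiples of \<open>c\<close>, and
    \<open>x\<close> drops out, which kills the first column \<open>\<nu>\<close>.\<close>
  define h where "h u = (THE p. \<exists>x y z. u $ 0 = A 0 0 * x + A 0 1 * y + A 0 2 * z \<and>
     u $ 1 = A 1 0 * x + A 1 1 * y + A 1 2 * z \<and> u $ 2 = A 2 0 * x + A 2 1 * y + A 2 2 * z \<and> p = y * c 2 - z * c 1)" for u
  have h: "h u = y * c 2 - z * c 1" if u: "u $ 0 = A 0 0 * x + A 0 1 * y + A 0 2 * z"
    "u $ 1 = A 1 0 * x + A 1 1 * y + A 1 2 * z" "u $ 2 = A 2 0 * x + A 2 1 * y + A 2 2 * z" for u x y z
    unfolding h_def
  proof (rule the_equality)
    show "\<exists>x y' z'. u $ 0 = A 0 0 * x + A 0 1 * y' + A 0 2 * z' \<and>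
     u $ 1 = A 1 0 * x + A 1 1 * y' + A 1 2 * z' \<and> u $ 2 = A 2 0 * x + A 2 1 * y' + A 2 2 * z' \<and> y * c 2 - z * c 1 = y' * c 2 - z' * c 1"
      using u by blast
    fix p assume "\<exists>x y z. u $ 0 = A 0 0 * x + A 0 1 * y + A 0 2 * z \<and>
     u $ 1 = A 1 0 * x + A 1 1 * y + A 1 2 * z \<and> u $ 2 = A 2 0 * x + A 2 1 * y + A 2 2 * z \<and> p = y * c 2 - z * c 1"
    then obtain x' y' z' where u': "u $ 0 = A 0 0 * x' + A 0 1 * y' + A 0 2 * z'"
      "u $ 1 = A 1 0 * x' + A 1 1 * y' + A 1 2 * z'" "u $ 2 = A 2 0 * x' + A 2 1 * y' + A 2 2 * z'"
      and p: "p = y' * c 2 - z' * c 1" by blast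
    have r: "A a 0 * (x' - x) + A a 1 * (y' - y) + A a 2 * (z' - z) = 0"
      if "A a 0 * x' + A a 1 * y' + A a 2 * z' = A a 0 * x + A a 1 * y + A a 2 * z" for a
    proof -
      have "A a 0 * (x' - x) + A a 1 * (y' - y) + A a 2 * (z' - z) =
        (A a 0 * x' + A a 1 * y' + A a 2 * z') - (A a 0 * x + A a 1 * y + A a 2 * z)" by (simp add: algebra_simps)
      then show ?thesis unfolding that by (simp only: diff_self)
    qed
    have "\<exists>t. x' - x = c 0 * t \<and> y' - y = c 1 * t \<and> z' - z = c 2 * t"
      by (rule exact1_rows[OF r[OF trans[OF u'(1)[symmetric] u(1)]] r[OF trans[OF u'(2)[symmetric] u(2)]]
            r[OF trans[OF u'(3)[symmetric] u(3)]]])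
    then obtain t where t: "y' - y = c 1 * t" "z' - z = c 2 * t" by blast
    have "p - (y * c 2 - z * c 1) = (y' - y) * c 2 - (z' - z) * c 1" unfolding p by (simp add: algebra_simps)
    also have "\<dots> = 0" unfolding t by simp
    finally show "p = y * c 2 - z * c 1" by simp
  qed
  have lift: "\<exists>x y z. u $ 0 = A 0 0 * x + A 0 1 * y + A 0 2 * z \<and> u $ 1 = A 1 0 * x + A 1 1 * y + A 1 2 * z \<and>
     u $ 2 = A 2 0 * x + A 2 1 * y + A 2 2 * z" if "u \<in> Syz ?g" for u
    using exact0 that unfolding Syz by blast
  have inS: "vec3 (A 0 0 * x + A 0 1 * y + A 0 2 * z, A 1 0 * x + A 1 1 * y + A 1 2 * z, A 2 0 * x + A 2 1 * y + A 2 2 * z) \<in> Syz ?g" for x y z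
  proof -
    have "f 0 * (A 0 0 * x + A 0 1 * y + A 0 2 * z) + f 1 * (A 1 0 * x + A 1 1 * y + A 1 2 * z) + f 2 * (A 2 0 * x + A 2 1 * y + A 2 2 * z) =
      (f 0 * A 0 0 + f 1 * A 1 0 + f 2 * A 2 0) * x + (f 0 * A 0 1 + f 1 * A 1 1 + f 2 * A 2 1) * y + (f 0 * A 0 2 + f 1 * A 1 2 + f 2 * A 2 2) * z"
      by (simp add: algebra_simps)
    also have "\<dots> = 0" by (simp only: complex0[OF less3(1)] complex0[OF less3(2)] complex0[OF less3(3)] mult_zero_left add_0)
    finally show ?thesis unfolding Syz by simp
  qed
  have carr: "u \<in> carrier_vec 3" if "u \<in> Syz ?g" for u using that unfolding Syz by blast
  have add: "\<forall>u\<in>Syz ?g. \<forall>w\<in>Syz ?g. h (u + w) = h u + h w"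
  proof (intro ballI)
    fix u w assume uw: "u \<in> Syz ?g" "w \<in> Syz ?g"
    from lift[OF uw(1)] obtain x y z where u: "u $ 0 = A 0 0 * x + A 0 1 * y + A 0 2 * z"
      "u $ 1 = A 1 0 * x + A 1 1 * y + A 1 2 * z" "u $ 2 = A 2 0 * x + A 2 1 * y + A 2 2 * z" by blast
    from lift[OF uw(2)] obtain x' y' z' where w: "w $ 0 = A 0 0 * x' + A 0 1 * y' + A 0 2 * z'"
      "w $ 1 = A 1 0 * x' + A 1 1 * y' + A 1 2 * z'" "w $ 2 = A 2 0 * x' + A 2 1 * y' + A 2 2 * z'" by blast
    have i: "(u + w) $ i = u $ i + w $ i" if "i < 3" for i using carr[OF uw(2)] that by simp
    have "h (u + w) = (y + y') * c 2 - (z + z') * c 1"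
      by (rule h[of _ "x + x'"]; simp only: i[OF less3(1)] i[OF less3(2)] i[OF less3(3)] u w distrib_left add_ac)
    then show "h (u + w) = h u + h w" unfolding h[OF u] h[OF w] by (simp add: algebra_simps)
  qed
  have scale: "\<forall>r. \<forall>u\<in>Syz ?g. h (r \<cdot>\<^sub>v u) = r * h u"
  proof (intro allI ballI)
    fix r u assume uS: "u \<in> Syz ?g"
    from lift[OF uS] obtain x y z where u: "u $ 0 = A 0 0 * x + A 0 1 * y + A 0 2 * z"
      "u $ 1 = A 1 0 * x + A 1 1 * y + A 1 2 * z" "u $ 2 = A 2 0 * x + A 2 1 * y + A 2 2 * z" by blast
    have i: "(r \<cdot>\<^sub>v u) $ i = r * u $ i" if "i < 3" for i using carr[OF uS] that by simp
    have "h (r \<cdot>\<^sub>v u) = (r * y) * c 2 - (r * z) * c 1"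
      by (rule h[of _ "r * x"]; simp only: i[OF less3(1)] i[OF less3(2)] i[OF less3(3)] u distrib_left mult_ac)
    then show "h (r \<cdot>\<^sub>v u) = r * h u" unfolding h[OF u] by (simp add: algebra_simps)
  qed
  have deg: "\<forall>d. \<forall>u\<in>Syz ?g. form_vec d u \<longrightarrow> form (d + (\<delta> 0 - 3)) (h u)"
  proof (intro allI ballI impI)
    fix d u assume uS: "u \<in> Syz ?g" and fu: "form_vec d u"
    from lift[OF uS] obtain x y z where u: "u $ 0 = A 0 0 * x + A 0 1 * y + A 0 2 * z"
      "u $ 1 = A 1 0 * x + A 1 1 * y + A 1 2 * z" "u $ 2 = A 2 0 * x + A 2 1 * y + A 2 2 * z" by blast
    let ?x = "hom_component (d - \<delta> 0) x" and ?y = "hom_component (d - \<delta> 1) y" and ?z = "hom_component (d - \<delta> 2) z"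
    have hcA: "hom_component d (A a 0 * x + A a 1 * y + A a 2 * z) = A a 0 * ?x + A a 1 * ?y + A a 2 * ?z" if a: "a < 3" for a
      by (simp only: hom_component_add hom_component_mult_form[OF form_A[OF a less3(1)]]
          hom_component_mult_form[OF form_A[OF a less3(2)]] hom_component_mult_form[OF form_A[OF a less3(3)]])
    have fu: "form d (u $ 0)" "form d (u $ 1)" "form d (u $ 2)" using fu form_vec_iff[OF carr[OF uS]] by blast+
    have hc: "u $ i = hom_component d (u $ i)" if "form d (u $ i)" for i using hom_component_form[OF that, of d] by simp
    have "h u = ?y * c 2 - ?z * c 1"
    proof (rule h)
      show "u $ 0 = A 0 0 * ?x + A 0 1 * ?y + A 0 2 * ?z" using hc[OF fu(1)] hcA[OF less3(1)] unfolding u by simp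
      show "u $ 1 = A 1 0 * ?x + A 1 1 * ?y + A 1 2 * ?z" using hc[OF fu(2)] hcA[OF less3(2)] unfolding u by simp
      show "u $ 2 = A 2 0 * ?x + A 2 1 * ?y + A 2 2 * ?z" using hc[OF fu(3)] hcA[OF less3(3)] unfolding u by simp
    qed
    moreover have "form (d + (\<delta> 0 - 3)) (?y * c 2)" by (rule form_mult'[OF form_hom_component form_c[OF less3(3)]]) (simp add: s)
    moreover have "form (d + (\<delta> 0 - 3)) (?z * c 1)" by (rule form_mult'[OF form_hom_component form_c[OF less3(2)]]) (simp add: s)
    ultimately show "form (d + (\<delta> 0 - 3)) (h u)" by (simp add: form_diff)
  qed
  have image: "h ` Syz ?g = ?I"
  proof (intro equalityI subsetI)
    fix p assume "p \<in> h ` Syz ?g"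
    then obtain u where uS: "u \<in> Syz ?g" "p = h u" by blast
    from lift[OF uS(1)] obtain x y z where u: "u $ 0 = A 0 0 * x + A 0 1 * y + A 0 2 * z"
      "u $ 1 = A 1 0 * x + A 1 1 * y + A 1 2 * z" "u $ 2 = A 2 0 * x + A 2 1 * y + A 2 2 * z" by blast
    have "p = c 1 * (- z) + c 2 * y" unfolding uS(2) h[OF u] by (simp add: algebra_simps)
    then show "p \<in> ?I" unfolding span_pair by blast
  next
    fix p assume "p \<in> ?I"
    then obtain a b where p: "p = c 1 * a + c 2 * b" unfolding span_pair by blast
    \<comment> \<open>The coordinates \<open>(0, b, -a)\<close> are chosen so that the cross product
      formula returns \<open>b * c 2 + a * c 1\<close>.\<close>
    let ?u = "vec3 (A 0 0 * 0 + A 0 1 * b + A 0 2 * (- a), A 1 0 * 0 + A 1 1 * b + A 1 2 * (- a), A 2 0 * 0 + A 2 1 * b + A 2 2 * (- a))"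
    have "h ?u = b * c 2 - (- a) * c 1" by (rule h[of _ 0]) simp_all
    then have "p = h ?u" unfolding p by (simp add: algebra_simps)
    then show "p \<in> h ` Syz ?g" using inS by blast
  qed
  have kernel: "{u \<in> Syz ?g. h u = 0} = {r \<cdot>\<^sub>v ?v | r. True}"
  proof (intro equalityI subsetI)
    fix u assume "u \<in> {u \<in> Syz ?g. h u = 0}"
    then have uS: "u \<in> Syz ?g" "h u = 0" by blast+
    from lift[OF uS(1)] obtain x y z where u: "u $ 0 = A 0 0 * x + A 0 1 * y + A 0 2 * z"
      "u $ 1 = A 1 0 * x + A 1 1 * y + A 1 2 * z" "u $ 2 = A 2 0 * x + A 2 1 * y + A 2 2 * z" by blast
    have "c 1 * z + c 2 * (- y) = 0" using uS(2) unfolding h[OF u] by (simp add: algebra_simps)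
    \<comment> \<open>Regularity of \<open>c 1, c 2\<close> makes \<open>(y, z)\<close> a multiple
      of \<open>(c 1, c 2)\<close>; subtracting that multiple of the relation \<open>c\<close>
      leaves only the first column.\<close>
    from regular_pair_c[OF this] obtain t where t: "z = c 2 * t" "- y = - (c 1 * t)" by blast
    have y: "y = c 1 * t" using t(2) by simp
    have e: "A a 0 * x + A a 1 * y + A a 2 * z = (x - c 0 * t) * A a 0" if "a < 3" for a
    proof -
      have "A a 0 * x + A a 1 * y + A a 2 * z = (x - c 0 * t) * A a 0 + (A a 0 * c 0 + A a 1 * c 1 + A a 2 * c 2) * t"
        unfolding y t(1) by (simp add: algebra_simps)
      then show ?thesis unfolding complex1[OF that] by simp
    qed
    have "u = (x - c 0 * t) \<cdot>\<^sub>v ?v"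
      using carr[OF uS(1)] u unfolding vec3_smult e[OF less3(1)] e[OF less3(2)] e[OF less3(3)] by (intro vec3_eqI) simp_all
    then show "u \<in> {r \<cdot>\<^sub>v ?v | r. True}" by blast
  next
    fix u assume "u \<in> {r \<cdot>\<^sub>v ?v | r. True}"
    then obtain r where r: "u = r \<cdot>\<^sub>v ?v" by blast
    have uvec: "u = vec3 (A 0 0 * r + A 0 1 * 0 + A 0 2 * 0, A 1 0 * r + A 1 1 * 0 + A 1 2 * 0, A 2 0 * r + A 2 1 * 0 + A 2 2 * 0)"
      unfolding r vec3_smult by (simp add: mult.commute)
    have "u \<in> Syz ?g" unfolding uvec by (rule inS)
    moreover have "h u = 0 * c 2 - 0 * c 1" unfolding uvec by (rule h[of _ r]) simp_all
    ultimately show "u \<in> {u \<in> Syz ?g. h u = 0}" by simp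
  qed
  have hom: "homogeneous_ideal ?I"
  proof (rule homogeneous_ideal_span_forms)
    fix p assume "p \<in> {c 1, c 2}"
    then show "\<exists>d. form d p" using form_c[OF less3(2)] form_c[OF less3(3)] by auto
  qed
  have "int (mpoly3_vs.dim (syzygies3 f d)) = forms_dim TYPE('n) TYPE('k) (d - \<delta> 0) + int (mpoly_vs.dim {p \<in> ?I. form (d + (\<delta> 0 - 3)) p})" for d
    using syz_quotient_dim[OF g(1,2) vS v0 vf add scale deg image kernel, of d] unfolding syz3 .
  then have le: "height ?I \<le> 2" by (intro quotient_ideal_invariants(2)[OF n hom]) auto
  have chain: "prime_chain 2 Q" if "prime_ideal Q" "?I \<subseteq> Q" for Q
    using that ring_ideal.span_superset[of "{c 1, c 2}"] by (intro prime_chain_c) auto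
  have "enat 2 \<le> height ?I" by (rule height_ge) (rule chain)
  then have height: "height ?I = 2" using le by (simp add: numeral_eq_enat)
  have "unmixed ?I"
    unfolding unmixed_def height
  proof (intro allI impI)
    fix Q assume "associated_prime ?I Q"
    then obtain x where Q: "prime_ideal Q" "Q = {r. r * x \<in> ?I}" unfolding associated_prime_def by blast
    \<comment> \<open>An associated prime contains the ideal, so it inherits the lower bound for its
      height from the complete intersection.\<close>
    have IQ: "?I \<subseteq> Q"
    proof
      fix p assume "p \<in> ?I"
      then have "x * p \<in> ?I" by (rule ring_ideal.span_scale)
      then show "p \<in> Q" unfolding Q(2) by (simp add: mult.commute)
    qed
    have Q2: "Q = {r. \<exists>a b. r * x = c 1 * a + c 2 * b}" unfolding Q(2) span_pair by blast
    have "height Q \<le> enat 2"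
      by (rule height_le[OF Q(1) order_refl]) (rule associated_prime_chain_le_2[OF regular_pair_c c_nonzero(3) Q(1) Q2])
    moreover have "enat 2 \<le> height Q"
    proof (rule height_ge)
      fix P assume "prime_ideal P" "Q \<subseteq> P"
      then show "prime_chain 2 P" using IQ by (intro chain) auto
    qed
    ultimately show "height Q = 2" by (simp add: numeral_eq_enat)
  qed
  moreover have "syz_quotient_iso ?g ?v ?I"
    unfolding syz_quotient_iso_def using add scale deg image kernel by (intro exI[of _ h] exI[of _ "\<delta> 0 - 3"] conjI)
  ultimately show ?thesis using init hom height by blast
qed

text \<open>The constructed ideal shows that the definite description has a solution, and the
  independence of choices shows that every solution has this value.\<close>

lemma bourbaki_degree_ideal:
  assumes n: "CARD('n) \<ge> 3" and sorted: "\<delta> 0 \<le> \<delta> 1" "\<delta> 1 \<le> \<delta> 2"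
    and np: "\<not> perfect_of_height_two (ideal3 f)"
  shows "bourbaki_degree (ideal3 f) = of_int ((\<delta> 0 + \<delta> 1 - 3) * (\<delta> 0 + \<delta> 2 - 3))"
proof -
  obtain v I where vI: "initial_syzygy (vec3 (f 0, f 1, f 2)) v" "homogeneous_ideal I" "unmixed I" "height I = 2"
    "syz_quotient_iso (vec3 (f 0, f 1, f 2)) v I" using bourbaki_ideal_exists[OF n sorted] by blast
  have val: "codim2_degree I = of_int ((\<delta> 0 + \<delta> 1 - 3) * (\<delta> 0 + \<delta> 2 - 3))"
    by (rule bourbaki_ideal_degree[OF n sorted generators_minimal vI(1,2,4,5)])
  have "(THE b. \<exists>d f' v I. minimally_generated_by_three_forms (ideal3 f) d f' \<and> initial_syzygy f' v \<and>
             homogeneous_ideal I \<and> unmixed I \<and> height I = 2 \<and> syz_quotient_iso f' v I \<and> b = codim2_degree I) =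
        of_int ((\<delta> 0 + \<delta> 1 - 3) * (\<delta> 0 + \<delta> 2 - 3))"
  proof (rule the_equality)
    show "\<exists>d f' v I. minimally_generated_by_three_forms (ideal3 f) d f' \<and> initial_syzygy f' v \<and>
             homogeneous_ideal I \<and> unmixed I \<and> height I = 2 \<and> syz_quotient_iso f' v I \<and> 
             of_int ((\<delta> 0 + \<delta> 1 - 3) * (\<delta> 0 + \<delta> 2 - 3)) = codim2_degree I"
      using generators_minimal vI val by metis
    fix b assume "\<exists>d f' v I. minimally_generated_by_three_forms (ideal3 f) d f' \<and> initial_syzygy f' v \<and>
             homogeneous_ideal I \<and> unmixed I \<and> height I = 2 \<and> syz_quotient_iso f' v I \<and> b = codim2_degree I"
    then obtain d f' v I where *: "minimally_generated_by_three_forms (ideal3 f) d f'" "initial_syzygy f' v"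
      "homogeneous_ideal I" "height I = 2" "syz_quotient_iso f' v I" "b = codim2_degree I" by blast
    show "b = of_int ((\<delta> 0 + \<delta> 1 - 3) * (\<delta> 0 + \<delta> 2 - 3))"
      unfolding *(6) by (rule bourbaki_ideal_degree[OF n sorted *(1-5)])
  qed
  then show ?thesis unfolding bourbaki_degree_def using np by simp
qed

end

section \<open>Exact complexes and resolutions\<close>

lemma mult_mat_vec_3:
  assumes "M \<in> carrier_mat n 3" "v \<in> carrier_vec 3" "a < n"
  shows "(M *\<^sub>v v) $ a = M $$ (a, 0) * v $ 0 + M $$ (a, 1) * v $ 1 + M $$ (a, 2) * (v $ 2 :: 'a::comm_ring_1)"
  using assms by (simp add: scalar_prod_3)

lemma mult_mat_vec_1:
  assumes "M \<in> carrier_mat n 1" "v \<in> carrier_vec 1" "a < n"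
  shows "(M *\<^sub>v v) $ a = M $$ (a, 0) * (v $ 0 :: 'a::comm_ring_1)"
  using assms by (simp add: scalar_prod_def)

lemma mat_kernel_3:
  fixes M :: "'a::comm_ring_1 mat"
  assumes "M \<in> carrier_mat n 3"
  shows "v \<in> mat_kernel M \<longleftrightarrow>
    v \<in> carrier_vec 3 \<and> (\<forall>a<n. M $$ (a, 0) * v $ 0 + M $$ (a, 1) * v $ 1 + M $$ (a, 2) * v $ 2 = 0)"
proof -
  have "v \<in> mat_kernel M \<longleftrightarrow> v \<in> carrier_vec 3 \<and> M *\<^sub>v v = 0\<^sub>v n" using assms unfolding mat_kernel_def by auto
  also have "\<dots> \<longleftrightarrow> v \<in> carrier_vec 3 \<and> (\<forall>a<n. (M *\<^sub>v v) $ a = 0)" using assms unfolding vec_eq_iff by auto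
  finally show ?thesis using mult_mat_vec_3[OF assms] by auto
qed

lemma mat_kernel_1:
  fixes M :: "'a::comm_ring_1 mat"
  assumes "M \<in> carrier_mat n 1"
  shows "v \<in> mat_kernel M \<longleftrightarrow> v \<in> carrier_vec 1 \<and> (\<forall>a<n. M $$ (a, 0) * v $ 0 = 0)"
proof -
  have "v \<in> mat_kernel M \<longleftrightarrow> v \<in> carrier_vec 1 \<and> M *\<^sub>v v = 0\<^sub>v n" using assms unfolding mat_kernel_def by auto
  also have "\<dots> \<longleftrightarrow> v \<in> carrier_vec 1 \<and> (\<forall>a<n. (M *\<^sub>v v) $ a = 0)" using assms unfolding vec_eq_iff by auto
  finally show ?thesis using mult_mat_vec_1[OF assms] by auto
qed

lemma mat_image_3:
  fixes M :: "'a::comm_ring_1 mat"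
  assumes M: "M \<in> carrier_mat n 3"
  shows "v \<in> mat_image M \<longleftrightarrow>
    v \<in> carrier_vec n \<and> (\<exists>x y z. \<forall>a<n. v $ a = M $$ (a, 0) * x + M $$ (a, 1) * y + M $$ (a, 2) * z)"
proof
  assume "v \<in> mat_image M"
  then obtain u where u: "u \<in> carrier_vec 3" "v = M *\<^sub>v u" using M unfolding mat_image_def by auto
  have *: "\<forall>a<n. v $ a = M $$ (a, 0) * u $ 0 + M $$ (a, 1) * u $ 1 + M $$ (a, 2) * u $ 2"
    unfolding u(2) using mult_mat_vec_3[OF M u(1)] by blast
  have "v \<in> carrier_vec n" unfolding u(2) using M u(1) by (rule mult_mat_vec_carrier)
  then show "v \<in> carrier_vec n \<and> (\<exists>x y z. \<forall>a<n. v $ a = M $$ (a, 0) * x + M $$ (a, 1) * y + M $$ (a, 2) * z)"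
    using * by (intro conjI exI)
next
  assume "v \<in> carrier_vec n \<and> (\<exists>x y z. \<forall>a<n. v $ a = M $$ (a, 0) * x + M $$ (a, 1) * y + M $$ (a, 2) * z)"
  then obtain x y z where v: "v \<in> carrier_vec n" "\<forall>a<n. v $ a = M $$ (a, 0) * x + M $$ (a, 1) * y + M $$ (a, 2) * z"
    by blast
  have "v = M *\<^sub>v vec3 (x, y, z)"
  proof (rule eq_vecI)
    fix a assume "a < dim_vec (M *\<^sub>v vec3 (x, y, z))"
    then have a: "a < n" using M by simp
    show "v $ a = (M *\<^sub>v vec3 (x, y, z)) $ a" unfolding mult_mat_vec_3[OF M vec3_carrier a] using v(2) a by simp
  qed (use M v in simp)
  then show "v \<in> mat_image M" using M unfolding mat_image_def by simp
qed

lemma mat_image_1: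
  fixes M :: "'a::comm_ring_1 mat"
  assumes M: "M \<in> carrier_mat n 1"
  shows "v \<in> mat_image M \<longleftrightarrow> v \<in> carrier_vec n \<and> (\<exists>t. \<forall>a<n. v $ a = M $$ (a, 0) * t)"
proof
  assume "v \<in> mat_image M"
  then obtain u where u: "u \<in> carrier_vec 1" "v = M *\<^sub>v u" using M unfolding mat_image_def by auto
  have *: "\<forall>a<n. v $ a = M $$ (a, 0) * u $ 0" unfolding u(2) using mult_mat_vec_1[OF M u(1)] by blast
  have "v \<in> carrier_vec n" unfolding u(2) using M u(1) by (rule mult_mat_vec_carrier)
  then show "v \<in> carrier_vec n \<and> (\<exists>t. \<forall>a<n. v $ a = M $$ (a, 0) * t)" using * by (intro conjI exI)
next
  assume "v \<in> carrier_vec n \<and> (\<exists>t. \<forall>a<n. v $ a = M $$ (a, 0) * t)"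
  then obtain t where v: "v \<in> carrier_vec n" "\<forall>a<n. v $ a = M $$ (a, 0) * t" by blast
  let ?u = "vec 1 (\<lambda>_. t)"
  have u: "?u \<in> carrier_vec 1" by simp
  have "v = M *\<^sub>v ?u"
  proof (rule eq_vecI)
    fix a assume "a < dim_vec (M *\<^sub>v ?u)"
    then have a: "a < n" using M by simp
    show "v $ a = (M *\<^sub>v ?u) $ a" unfolding mult_mat_vec_1[OF M u a] using v(2) a by simp
  qed (use M v in simp)
  then show "v \<in> mat_image M" using M u unfolding mat_image_def by auto
qed

lemma all_less_1: "(\<forall>a<1. P (a :: nat)) \<longleftrightarrow> P 0"
  by auto

lemma mat_image_row:
  fixes M :: "'a::comm_ring_1 mat"
  assumes M: "M \<in> carrier_mat 1 3"
  shows "(\<lambda>v. v $ 0) ` mat_image M = ideal3 (\<lambda>j. M $$ (0, j))"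
proof (intro equalityI subsetI)
  fix p assume "p \<in> (\<lambda>v. v $ 0) ` mat_image M"
  then obtain v where v: "v \<in> mat_image M" "p = v $ 0" by (rule imageE)
  from v(1) show "p \<in> ideal3 (\<lambda>j. M $$ (0, j))"
    unfolding mat_image_3[OF M] all_less_1 ideal3_def v(2) by (elim conjE exE) (intro CollectI exI conjI TrueI)
next
  fix p assume "p \<in> ideal3 (\<lambda>j. M $$ (0, j))"
  then obtain x y z where p: "p = M $$ (0, 0) * x + M $$ (0, 1) * y + M $$ (0, 2) * z" unfolding ideal3_def by blast
  have "vec 1 (\<lambda>_. p) \<in> mat_image M" unfolding mat_image_3[OF M] all_less_1 using p by auto
  then show "p \<in> (\<lambda>v. v $ 0) ` mat_image M" by (rule rev_image_eqI) simp
qed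

text \<open>The ring homomorphism laws of \<open>ct\<close> are discharged once for the constant
  term, so that only exactness, minimality and degrees remain.\<close>

lemma graded_exact_complexI:
  fixes f :: "nat \<Rightarrow> ('n::{finite, linorder}, 'k::field) mpoly"
  assumes "\<And>p q r. f 0 * p + f 1 * q + f 2 * r = 0 \<Longrightarrow> \<exists>x y z.
      p = A 0 0 * x + A 0 1 * y + A 0 2 * z \<and>
      q = A 1 0 * x + A 1 1 * y + A 1 2 * z \<and>
      r = A 2 0 * x + A 2 1 * y + A 2 2 * z"
    and "\<And>j. j < 3 \<Longrightarrow> f 0 * A 0 j + f 1 * A 1 j + f 2 * A 2 j = 0"
    and "\<And>x y z. (\<And>a. a < 3 \<Longrightarrow> A a 0 * x + A a 1 * y + A a 2 * z = 0) \<Longrightarrow> \<exists>t. x = c 0 * t \<and> y = c 1 * t \<and> z = c 2 * t"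
    and "\<And>a. a < 3 \<Longrightarrow> A a 0 * c 0 + A a 1 * c 1 + A a 2 * c 2 = 0"
    and "c 0 \<noteq> 0 \<or> c 1 \<noteq> 0 \<or> c 2 \<noteq> 0"
    and "\<And>a i. a < 3 \<Longrightarrow> i < 3 \<Longrightarrow> lookup (A a i) 0 = 0"
    and "\<And>i. i < 3 \<Longrightarrow> lookup (c i) 0 = 0"
    and "\<And>a. a < 3 \<Longrightarrow> form 3 (f a)"
    and "\<And>a i. a < 3 \<Longrightarrow> i < 3 \<Longrightarrow> form (\<delta> i) (A a i)"
    and "\<And>i. i < 3 \<Longrightarrow> form (\<delta> 0 + \<delta> 1 + \<delta> 2 - 3 - \<delta> i) (c i)"
  shows "graded_exact_complex f A c \<delta>"
  by unfold_locales ((fact assms)+ | simp add: lookup_add lookup_0_mult)+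

text \<open>Shifts \<open>\<delta>\<^sub>i\<close> of a resolution are indexed from \<open>1\<close>, those of a complex from \<open>0\<close>.\<close>

abbreviation shifts :: "int \<Rightarrow> int \<Rightarrow> int \<Rightarrow> nat \<Rightarrow> int" where
  "shifts a b c i \<equiv> if i = 0 then a else if i = 1 then b else c"

lemma graded_exact_complex_of_resolution:
  fixes J :: "('n::{finite, linorder}, 'k::field) mpoly set"
  assumes "minimal_graded_free_resolution J [[3, 3, 3], [3 + \<delta>1, 3 + \<delta>2, 3 + \<delta>3], [\<delta>1 + \<delta>2 + \<delta>3]] M"
  shows "\<exists>f A c. graded_exact_complex f A c (shifts \<delta>1 \<delta>2 \<delta>3) \<and> J = ideal3 f"
proof -
  let ?F = "[[3, 3, 3], [3 + \<delta>1, 3 + \<delta>2, 3 + \<delta>3], [\<delta>1 + \<delta>2 + \<delta>3]]"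
  let ?\<delta> = "shifts \<delta>1 \<delta>2 \<delta>3"
  have res: "graded_matrix [0] (complex_term ?F 0) (M 0)"
    "\<And>i. graded_matrix (complex_term ?F i) (complex_term ?F (Suc i)) (M (Suc i))"
    "(\<lambda>v. v $ 0) ` mat_image (M 0) = J" "\<And>i. mat_kernel (M i) = mat_image (M (Suc i))"
    and min: "\<And>i p. p \<in> elements_mat (M (Suc i)) \<Longrightarrow> lookup p 0 = 0"
    using assms unfolding minimal_graded_free_resolution_def graded_free_resolution_def by blast+
  have g0: "graded_matrix [0] [3, 3, 3] (M 0)" using res(1) by (simp add: complex_term_def)
  have g1: "graded_matrix [3, 3, 3] [3 + \<delta>1, 3 + \<delta>2, 3 + \<delta>3] (M 1)" using res(2)[of 0] by (simp add: complex_term_def)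
  have g2: "graded_matrix [3 + \<delta>1, 3 + \<delta>2, 3 + \<delta>3] [\<delta>1 + \<delta>2 + \<delta>3] (M 2)"
    using res(2)[of 1] by (simp add: complex_term_def numeral_2_eq_2)
  have g3: "graded_matrix [\<delta>1 + \<delta>2 + \<delta>3] [] (M 3)"
    using res(2)[of 2] by (simp add: complex_term_def numeral_3_eq_3 numeral_2_eq_2)
  have M0: "M 0 \<in> carrier_mat 1 3" and M1: "M 1 \<in> carrier_mat 3 3" and M2: "M 2 \<in> carrier_mat 3 1" and M3: "M 3 \<in> carrier_mat 1 0"
    using g0 g1 g2 g3 unfolding graded_matrix_def by (simp_all add: numeral_3_eq_3)
  have k0: "mat_kernel (M 0) = mat_image (M 1)" using res(4)[of 0] by simp
  have k1: "mat_kernel (M 1) = mat_image (M 2)" using res(4)[of 1] by (simp add: numeral_2_eq_2)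
  have k2: "mat_kernel (M 2) = mat_image (M 3)" using res(4)[of 2] by (simp add: numeral_3_eq_3 numeral_2_eq_2)
  let ?f = "\<lambda>j. M 0 $$ (0, j)" and ?A = "\<lambda>a i. M 1 $$ (a, i)" and ?c = "\<lambda>i. M 2 $$ (i, 0)"
  have ker1: "v \<in> mat_kernel (M 1) \<longleftrightarrow> v \<in> carrier_vec 3 \<and> (\<forall>a<3. ?A a 0 * v $ 0 + ?A a 1 * v $ 1 + ?A a 2 * v $ 2 = 0)" for v
    by (rule mat_kernel_3[OF M1])
  have ker0: "v \<in> mat_kernel (M 0) \<longleftrightarrow> v \<in> carrier_vec 3 \<and> ?f 0 * v $ 0 + ?f 1 * v $ 1 + ?f 2 * v $ 2 = 0" for v
    unfolding mat_kernel_3[OF M0] all_less_1 ..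
  have im1: "v \<in> mat_image (M 1) \<longleftrightarrow> v \<in> carrier_vec 3 \<and> (\<exists>x y z. v $ 0 = ?A 0 0 * x + ?A 0 1 * y + ?A 0 2 * z \<and>
    v $ 1 = ?A 1 0 * x + ?A 1 1 * y + ?A 1 2 * z \<and> v $ 2 = ?A 2 0 * x + ?A 2 1 * y + ?A 2 2 * z)" for v
    unfolding mat_image_3[OF M1] all_less_3 ..
  have im2: "v \<in> mat_image (M 2) \<longleftrightarrow> v \<in> carrier_vec 3 \<and> (\<exists>t. v $ 0 = ?c 0 * t \<and> v $ 1 = ?c 1 * t \<and> v $ 2 = ?c 2 * t)" for v
    unfolding mat_image_1[OF M2] all_less_3 ..
  have v1: "vec3 (p, q, r) $ 1 = q" for p q r :: "('n, 'k) mpoly" by simp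
  have "graded_exact_complex ?f ?A ?c ?\<delta>"
  proof (rule graded_exact_complexI)
    fix p q r assume "?f 0 * p + ?f 1 * q + ?f 2 * r = 0"
    then have "vec3 (p, q, r) \<in> mat_kernel (M 0)" unfolding ker0 vec3_index v1 by simp
    then show "\<exists>x y z. p = ?A 0 0 * x + ?A 0 1 * y + ?A 0 2 * z \<and> q = ?A 1 0 * x + ?A 1 1 * y + ?A 1 2 * z \<and>
      r = ?A 2 0 * x + ?A 2 1 * y + ?A 2 2 * z"
      unfolding k0 im1 vec3_index v1 by (rule conjunct2)
  next
    fix j :: nat assume j: "j < 3"
    let ?v = "vec3 (?A 0 j, ?A 1 j, ?A 2 j)"
    \<comment> \<open>Column \<open>j\<close> is the image of the \<open>j\<close>-th unit
      vector.\<close>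
    let ?d = "\<lambda>i. if i = j then 1 :: ('n, 'k) mpoly else 0"
    have "?v \<in> mat_image (M 1)" unfolding im1 vec3_index v1
      using j unfolding less_3_cases by (intro conjI vec3_carrier exI[of _ "?d 0"] exI[of _ "?d 1"] exI[of _ "?d 2"]) auto
    then show "?f 0 * ?A 0 j + ?f 1 * ?A 1 j + ?f 2 * ?A 2 j = 0"
      unfolding k0[symmetric] ker0 vec3_index v1 by (rule conjunct2)
  next
    fix x y z assume "\<And>a. a < 3 \<Longrightarrow> ?A a 0 * x + ?A a 1 * y + ?A a 2 * z = 0"
    then have "vec3 (x, y, z) \<in> mat_kernel (M 1)" unfolding ker1 vec3_index v1 by (intro conjI vec3_carrier allI impI)
    then show "\<exists>t. x = ?c 0 * t \<and> y = ?c 1 * t \<and> z = ?c 2 * t" unfolding k1 im2 vec3_index v1 by (rule conjunct2)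
  next
    have "vec3 (?c 0, ?c 1, ?c 2) \<in> mat_image (M 2)" unfolding im2 vec3_index v1 by (intro conjI vec3_carrier exI[of _ 1]) simp_all
    then show "?A a 0 * ?c 0 + ?A a 1 * ?c 1 + ?A a 2 * ?c 2 = 0" if "a < 3" for a
      using that unfolding k1[symmetric] ker1 vec3_index v1 by (elim conjE allE impE)
  next
    show "?c 0 \<noteq> 0 \<or> ?c 1 \<noteq> 0 \<or> ?c 2 \<noteq> 0"
    proof (rule ccontr)
      assume "\<not> (?c 0 \<noteq> 0 \<or> ?c 1 \<noteq> 0 \<or> ?c 2 \<noteq> 0)"
      then have "\<forall>a<3. ?c a = 0" unfolding all_less_3 by simp
      \<comment> \<open>The term after the last one is zero, so \<open>M 2\<close> is injective; a
        zero column would have \<open>1\<close> in its kernel.\<close>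
      then have "vec 1 (\<lambda>_. 1) \<in> mat_kernel (M 2)" unfolding mat_kernel_1[OF M2] by simp
      then have "vec 1 (\<lambda>_. 1) = (0\<^sub>v 1 :: ('n, 'k) mpoly vec)" unfolding k2 mat_image_carrier_0[OF M3] by simp
      then have "vec 1 (\<lambda>_. 1) $ 0 = (0\<^sub>v 1 :: ('n, 'k) mpoly vec) $ 0" by simp
      then show False by simp
    qed
  next
    fix a i :: nat assume "a < 3" "i < 3"
    then have "?A a i \<in> elements_mat (M (Suc 0))" using M1 by (intro elements_matI[of _ 3 3]) simp_all
    then show "lookup (?A a i) 0 = 0" by (rule min)
  next
    fix i :: nat assume "i < 3"
    then have "?c i \<in> elements_mat (M (Suc 1))" using M2 by (intro elements_matI[of _ 3 1]) (simp_all add: numeral_2_eq_2)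
    then show "lookup (?c i) 0 = 0" by (rule min)
  next
    fix a :: nat assume a: "a < 3"
    have "form ([3, 3, 3] ! a - [0] ! 0) (?f a)" using g0 a unfolding graded_matrix_def by (simp add: numeral_3_eq_3)
    then show "form 3 (?f a)" using a unfolding less_3_cases by (elim disjE) simp_all
  next
    fix a i :: nat assume a: "a < 3" and i: "i < 3"
    have "form ([3 + \<delta>1, 3 + \<delta>2, 3 + \<delta>3] ! i - [3, 3, 3] ! a) (?A a i)"
      using g1 a i unfolding graded_matrix_def by (simp add: numeral_3_eq_3)
    then show "form (?\<delta> i) (?A a i)" using a i unfolding less_3_cases by (elim disjE) simp_all
  next
    fix i :: nat assume i: "i < 3"
    have "form ([\<delta>1 + \<delta>2 + \<delta>3] ! 0 - [3 + \<delta>1, 3 + \<delta>2, 3 + \<delta>3] ! i) (?c i)"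
      using g2 i unfolding graded_matrix_def by (simp add: numeral_3_eq_3)
    then show "form (?\<delta> 0 + ?\<delta> 1 + ?\<delta> 2 - 3 - ?\<delta> i) (?c i)"
      using i unfolding less_3_cases by (elim disjE) (simp_all add: algebra_simps)
  qed
  moreover have "J = ideal3 ?f" using res(3) unfolding mat_image_row[OF M0] by simp
  ultimately show ?thesis by blast
qed

lemma (in graded_exact_complex) resolution_exists:
  "\<exists>M. minimal_graded_free_resolution (ideal3 f) [[3, 3, 3], [3 + \<delta> 0, 3 + \<delta> 1, 3 + \<delta> 2], [\<delta> 0 + \<delta> 1 + \<delta> 2]] M"
proof -
  let ?F = "[[3, 3, 3], [3 + \<delta> 0, 3 + \<delta> 1, 3 + \<delta> 2], [\<delta> 0 + \<delta> 1 + \<delta> 2]]"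
  define M0 where "M0 = mat 1 3 (\<lambda>(i, j). f j)"
  define M1 where "M1 = mat 3 3 (\<lambda>(a, i). A a i)"
  define M2 where "M2 = mat 3 1 (\<lambda>(i, j). c i)"
  \<comment> \<open>\<open>M 3\<close> has one row and no columns, so exactness at that place says
    that \<open>M 2\<close> is injective; from there on all matrices are empty.\<close>
  define M where "M i = (if i = 0 then M0 else if i = 1 then M1 else if i = 2 then M2 else if i = 3 then 0\<^sub>m 1 0 else 0\<^sub>m 0 0)"
    for i :: nat
  have C: "M0 \<in> carrier_mat 1 3" "M1 \<in> carrier_mat 3 3" "M2 \<in> carrier_mat 3 1" by (simp_all add: M0_def M1_def M2_def)
  have i0: "M0 $$ (0, j) = f j" if "j < 3" for j using that by (simp add: M0_def)
  have i1: "M1 $$ (a, i) = A a i" if "a < 3" "i < 3" for a i using that by (simp add: M1_def)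
  have i2: "M2 $$ (i, 0) = c i" if "i < 3" for i using that by (simp add: M2_def)
  note i0s = i0[OF less3(1)] i0[OF less3(2)] i0[OF less3(3)]
  note i2s = i2[OF less3(1)] i2[OF less3(2)] i2[OF less3(3)]
  have g0: "graded_matrix [0] (complex_term ?F 0) M0"
    unfolding graded_matrix_def complex_term_def M0_def using form_f
    by (auto simp: less_Suc_eq numeral_2_eq_2 numeral_3_eq_3)
  have sh: "[3 + \<delta> 0, 3 + \<delta> 1, 3 + \<delta> 2] ! i = 3 + \<delta> i" "[3, 3, 3] ! i = (3 :: int)" if "i < 3" for i
    using that unfolding less_3_cases by (elim disjE; simp)+
  have g1: "graded_matrix (complex_term ?F 0) (complex_term ?F 1) M1"
  proof -
    have "form ([3 + \<delta> 0, 3 + \<delta> 1, 3 + \<delta> 2] ! i - [3, 3, 3] ! a) (M1 $$ (a, i))" if "a < 3" "i < 3" for a i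
      unfolding sh(1)[OF that(2)] sh(2)[OF that(1)] i1[OF that] using form_A[OF that] by simp
    then show ?thesis using C(2) unfolding graded_matrix_def complex_term_def by (simp add: numeral_3_eq_3)
  qed
  have g2: "graded_matrix (complex_term ?F 1) (complex_term ?F 2) M2"
  proof -
    have "form ([\<delta> 0 + \<delta> 1 + \<delta> 2] ! 0 - [3 + \<delta> 0, 3 + \<delta> 1, 3 + \<delta> 2] ! i) (M2 $$ (i, 0))" if "i < 3" for i
      unfolding sh(1)[OF that] i2[OF that] using form_c[OF that] by (simp add: s algebra_simps)
    then show ?thesis using C(3) unfolding graded_matrix_def complex_term_def by (simp add: numeral_3_eq_3)
  qed
  have gr: "graded_matrix (complex_term ?F i) (complex_term ?F (Suc i)) (M (Suc i))" for i
  proof -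
    consider "i = 0" | "i = 1" | "i = 2" | "i \<ge> 3" by linarith
    then show ?thesis
    proof cases
      case 1 then show ?thesis using g1 by (simp add: M_def)
    next
      case 2 then show ?thesis using g2 by (simp add: M_def numeral_2_eq_2)
    next
      case 3 then show ?thesis by (simp add: M_def graded_matrix_def complex_term_def)
    next
      case 4 then show ?thesis by (simp add: M_def graded_matrix_def complex_term_def)
    qed
  qed
  have k0: "mat_kernel M0 = mat_image M1"
  proof (rule Set.set_eqI)
    fix v
    have ker: "v \<in> mat_kernel M0 \<longleftrightarrow> v \<in> carrier_vec 3 \<and> f 0 * v $ 0 + f 1 * v $ 1 + f 2 * v $ 2 = 0"
      unfolding mat_kernel_3[OF C(1)] all_less_1 i0s ..
    have im: "v \<in> mat_image M1 \<longleftrightarrow> v \<in> carrier_vec 3 \<and> (\<exists>x y z. v $ 0 = A 0 0 * x + A 0 1 * y + A 0 2 * z \<and>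
      v $ 1 = A 1 0 * x + A 1 1 * y + A 1 2 * z \<and> v $ 2 = A 2 0 * x + A 2 1 * y + A 2 2 * z)"
      unfolding mat_image_3[OF C(2)] all_less_3
      by (simp only: i1[OF less3(1) less3(1)] i1[OF less3(1) less3(2)] i1[OF less3(1) less3(3)]
        i1[OF less3(2) less3(1)] i1[OF less3(2) less3(2)] i1[OF less3(2) less3(3)]
        i1[OF less3(3) less3(1)] i1[OF less3(3) less3(2)] i1[OF less3(3) less3(3)])
    show "v \<in> mat_kernel M0 \<longleftrightarrow> v \<in> mat_image M1"
      unfolding ker im
    proof (intro conj_cong refl iffI)
      assume "f 0 * v $ 0 + f 1 * v $ 1 + f 2 * v $ 2 = 0"
      then show "\<exists>x y z. v $ 0 = A 0 0 * x + A 0 1 * y + A 0 2 * z \<and>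
        v $ 1 = A 1 0 * x + A 1 1 * y + A 1 2 * z \<and> v $ 2 = A 2 0 * x + A 2 1 * y + A 2 2 * z" by (rule exact0)
    next
      assume "\<exists>x y z. v $ 0 = A 0 0 * x + A 0 1 * y + A 0 2 * z \<and>
        v $ 1 = A 1 0 * x + A 1 1 * y + A 1 2 * z \<and> v $ 2 = A 2 0 * x + A 2 1 * y + A 2 2 * z"
      then obtain x y z where v: "v $ 0 = A 0 0 * x + A 0 1 * y + A 0 2 * z"
        "v $ 1 = A 1 0 * x + A 1 1 * y + A 1 2 * z" "v $ 2 = A 2 0 * x + A 2 1 * y + A 2 2 * z" by (elim exE conjE)
      have "f 0 * v $ 0 + f 1 * v $ 1 + f 2 * v $ 2 =
        (f 0 * A 0 0 + f 1 * A 1 0 + f 2 * A 2 0) * x + (f 0 * A 0 1 + f 1 * A 1 1 + f 2 * A 2 1) * y + (f 0 * A 0 2 + f 1 * A 1 2 + f 2 * A 2 2) * z"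
        unfolding v by (simp add: algebra_simps)
      then show "f 0 * v $ 0 + f 1 * v $ 1 + f 2 * v $ 2 = 0"
        by (simp only: complex0[OF less3(1)] complex0[OF less3(2)] complex0[OF less3(3)] mult_zero_left add_0)
    qed
  qed
  have k1: "mat_kernel M1 = mat_image M2"
  proof (rule Set.set_eqI)
    fix v
    have ker: "v \<in> mat_kernel M1 \<longleftrightarrow> v \<in> carrier_vec 3 \<and> (\<forall>a<3. A a 0 * v $ 0 + A a 1 * v $ 1 + A a 2 * v $ 2 = 0)"
      unfolding mat_kernel_3[OF C(2)] by (simp only: i1[OF _ less3(1)] i1[OF _ less3(2)] i1[OF _ less3(3)] cong: imp_cong)
    have im: "v \<in> mat_image M2 \<longleftrightarrow> v \<in> carrier_vec 3 \<and> (\<exists>t. v $ 0 = c 0 * t \<and> v $ 1 = c 1 * t \<and> v $ 2 = c 2 * t)"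
      unfolding mat_image_1[OF C(3)] all_less_3 i2s ..
    show "v \<in> mat_kernel M1 \<longleftrightarrow> v \<in> mat_image M2"
      unfolding ker im
    proof (intro conj_cong refl iffI allI impI)
      assume "\<forall>a<3. A a 0 * v $ 0 + A a 1 * v $ 1 + A a 2 * v $ 2 = 0"
      then show "\<exists>t. v $ 0 = c 0 * t \<and> v $ 1 = c 1 * t \<and> v $ 2 = c 2 * t" by (intro exact1) simp
    next
      fix a :: nat assume a: "a < 3" and "\<exists>t. v $ 0 = c 0 * t \<and> v $ 1 = c 1 * t \<and> v $ 2 = c 2 * t"
      then obtain t where v: "v $ 0 = c 0 * t" "v $ 1 = c 1 * t" "v $ 2 = c 2 * t" by (elim exE conjE)
      have "A a 0 * v $ 0 + A a 1 * v $ 1 + A a 2 * v $ 2 = (A a 0 * c 0 + A a 1 * c 1 + A a 2 * c 2) * t"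
        unfolding v by (simp add: algebra_simps)
      then show "A a 0 * v $ 0 + A a 1 * v $ 1 + A a 2 * v $ 2 = 0" by (simp only: complex1[OF a] mult_zero_left)
    qed
  qed
  have k2: "mat_kernel M2 = {0\<^sub>v 1}"
  proof (intro equalityI subsetI)
    fix v assume "v \<in> mat_kernel M2"
    then have v: "v \<in> carrier_vec 1" "c 0 * v $ 0 = 0" unfolding mat_kernel_1[OF C(3)] all_less_3 i2s by blast+
    then have "v $ 0 = 0" using c_nonzero(1) by simp
    then show "v \<in> {0\<^sub>v 1}" using v(1) by (auto intro!: eq_vecI)
  qed (simp add: mat_kernel_1[OF C(3)])
  have ke: "mat_kernel (M i) = mat_image (M (Suc i))" for i
  proof -
    consider "i = 0" | "i = 1" | "i = 2" | "i = 3" | "i > 3" by linarith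
    then show ?thesis
    proof cases
      case 1 then show ?thesis using k0 by (simp add: M_def)
    next
      case 2 then show ?thesis using k1 by (simp add: M_def numeral_2_eq_2)
    next
      case 3 then show ?thesis using k2 mat_image_carrier_0[OF zero_carrier_mat[of 1 0, where ?'a = "('n, 'k) mpoly"]] by (simp add: M_def)
    next
      case 4
      have "mat_kernel (0\<^sub>m 1 0 :: ('n, 'k) mpoly mat) = {0\<^sub>v 0}" by (auto simp: mat_kernel_def intro!: eq_vecI)
      then show ?thesis using 4 mat_image_carrier_0[OF zero_carrier_mat[of 0 0, where ?'a = "('n, 'k) mpoly"]] by (simp add: M_def)
    next
      case 5
      have "mat_kernel (0\<^sub>m 0 0 :: ('n, 'k) mpoly mat) = {0\<^sub>v 0}" by (auto simp: mat_kernel_def intro!: eq_vecI)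
      then show ?thesis using 5 mat_image_carrier_0[OF zero_carrier_mat[of 0 0, where ?'a = "('n, 'k) mpoly"]] by (simp add: M_def)
    qed
  qed
  have J: "(\<lambda>v. v $ 0) ` mat_image (M 0) = ideal3 f"
    unfolding M_def using mat_image_row[OF C(1)] by (simp add: ideal3_def i0 i0s)
  have min: "lookup p 0 = 0" if p: "p \<in> elements_mat (M (Suc i))" for i p
  proof -
    consider "i = 0" | "i = 1" | "i \<ge> 2" by linarith
    then show ?thesis
    proof cases
      case 1
      then obtain a j where "a < 3" "j < 3" "p = M1 $$ (a, j)"
        using elements_matD[OF p] C(2) by (auto simp: M_def)
      then show ?thesis using i1 ct_A by simp
    next
      case 2
      then obtain a where "a < 3" "p = M2 $$ (a, 0)"
        using elements_matD[OF p] C(3) by (auto simp: M_def)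
      then show ?thesis using i2 ct_c by simp
    next
      case 3
      then show ?thesis using elements_matD[OF p] by (auto simp: M_def split: if_splits)
    qed
  qed
  have g: "graded_matrix [0] (complex_term ?F 0) (M 0)" using g0 by (simp add: M_def)
  have "minimal_graded_free_resolution (ideal3 f) ?F M"
    unfolding minimal_graded_free_resolution_def graded_free_resolution_def
    by (intro conjI allI ballI) (rule g J gr ke min, assumption?)+
  then show ?thesis by blast
qed

section \<open>Monomial examples\<close>

lemma var_power_dvd:
  fixes p :: "('n, 'k::comm_ring_1) mpoly"
  assumes "\<And>m. m \<in> keys p \<Longrightarrow> a \<le> lookup m i"
  shows "var_power i a dvd p"
proof -
  have "p = (\<Sum>m\<in>keys p. single m (lookup p m))" by (rule poly_mapping_sum_monomials)
  moreover have "var_power i a dvd single m (lookup p m)" if "m \<in> keys p" for m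
  proof -
    have "single i a + (m - single i a) = m"
      using assms[OF that] by (intro poly_mapping_eqI) (auto simp: lookup_add lookup_minus lookup_single when_def)
    then have "single m (lookup p m) = var_power i a * single (m - single i a) (lookup p m)"
      by (simp add: mult_single)
    then show ?thesis by (rule dvdI)
  qed
  ultimately show ?thesis using dvd_sum[of "keys p" "var_power i a" "\<lambda>m. single m (lookup p m)"] by simp
qed

lemma var_power_keys:
  fixes p :: "('n, 'k::idom) mpoly"
  assumes "m \<in> keys (var_power i a * p)"
  shows "a \<le> lookup m i"
  using assms unfolding keys_single_mult[OF one_neq_zero] by (auto simp: lookup_add lookup_single)

text \<open>Multiplication by a power of variable \<open>i\<close> translates the exponents without
  changing the exponent of \<open>j\<close>, so divisibility can be read off each monomial.\<close>

lemma var_power_coprime: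
  fixes u v :: "('n, 'k::idom) mpoly"
  assumes "i \<noteq> j" and eq: "var_power i a * u = var_power j b * v"
  shows "var_power j b dvd u"
proof (rule var_power_dvd)
  fix m assume "m \<in> keys u"
  then have "single i a + m \<in> keys (var_power i a * u)" unfolding keys_single_mult[OF one_neq_zero] by blast
  then have "b \<le> lookup (single i a + m) j" unfolding eq by (rule var_power_keys)
  then show "b \<le> lookup m j" using assms(1) by (simp add: lookup_add lookup_single when_def)
qed

text \<open>Every monomial of \<open>w\<close> is divisible by one of the two powers, since
  multiplication by a power of \<open>l\<close> changes neither exponent. Sorting the monomials
  accordingly splits \<open>w\<close>.\<close>

lemma var_power_regular:
  fixes u v w :: "('n, 'k::idom) mpoly"
  assumes "l \<noteq> i" "l \<noteq> j" and eq: "var_power l c * w = var_power i a * u + var_power j b * v"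
  shows "\<exists>p q. w = var_power i a * p + var_power j b * q"
proof -
  let ?S = "{m. a \<le> lookup m i}"
  have key: "a \<le> lookup m i \<or> b \<le> lookup m j" if "m \<in> keys w" for m
  proof -
    have "single l c + m \<in> keys (var_power l c * w)" unfolding keys_single_mult[OF one_neq_zero] using that by blast
    then have "single l c + m \<in> keys (var_power i a * u) \<union> keys (var_power j b * v)"
      unfolding eq by (rule subsetD[OF keys_add])
    then have "single l c + m \<in> keys (var_power i a * u) \<or> single l c + m \<in> keys (var_power j b * v)"
      unfolding Un_iff .
    then have "a \<le> lookup (single l c + m) i \<or> b \<le> lookup (single l c + m) j" by (elim disjE) (erule var_power_keys[THEN disjI1] | erule var_power_keys[THEN disjI2])+
    then show ?thesis using assms(1,2) by (simp add: lookup_add lookup_single when_def)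
  qed
  have "var_power i a dvd restrict_keys ?S w" by (rule var_power_dvd) (simp add: keys_restrict_keys)
  then obtain p where p: "restrict_keys ?S w = var_power i a * p" by (rule dvdE)
  have "var_power j b dvd restrict_keys (- ?S) w"
    by (rule var_power_dvd) (use key in \<open>auto simp: keys_restrict_keys\<close>)
  then obtain q where q: "restrict_keys (- ?S) w = var_power j b * q" by (rule dvdE)
  have "w = restrict_keys ?S w + restrict_keys (- ?S) w"
    by (rule poly_mapping_eqI) (simp add: lookup_add lookup_restrict_keys when_def)
  then show ?thesis unfolding p q by blast
qed

lemma coprime_mult:
  fixes p q l :: "'a::comm_ring_1"
  assumes "\<And>u v. p * u = l * v \<Longrightarrow> l dvd u" "\<And>u v. q * u = l * v \<Longrightarrow> l dvd u" "p * q * u = l * v"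
  shows "l dvd u"
proof -
  have "p * (q * u) = l * v" using assms(3) by (simp add: mult.assoc)
  from assms(1)[OF this] obtain w where "q * u = l * w" by (rule dvdE)
  then show ?thesis by (rule assms(2))
qed

text \<open>The rows of the matrix are those of the Koszul matrix of \<open>c\<close>, multiplied by \<open>l\<^sub>0, l\<^sub>1, l\<^sub>2\<close>.\<close>

definition scaled_koszul :: "(nat \<Rightarrow> 'a) \<Rightarrow> (nat \<Rightarrow> 'a) \<Rightarrow> nat \<Rightarrow> nat \<Rightarrow> 'a::comm_ring_1" where
  "scaled_koszul l c a i = l a *
    (if a = 0 then if i = 0 then 0 else if i = 1 then - c 2 else c 1
     else if a = 1 then if i = 0 then c 2 else if i = 1 then 0 else - c 0
     else if i = 0 then - c 1 else if i = 1 then c 0 else 0)"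

text \<open>Chosen so that the entry \<open>a\<close> times \<open>l a\<close> is
  \<open>c a * l 0 * l 1 * l 2\<close>: the composite with the scaled matrix is then a multiple of
  \<open>c\<close> times its Koszul matrix, which is zero.\<close>

definition scaled_generators :: "(nat \<Rightarrow> 'a) \<Rightarrow> (nat \<Rightarrow> 'a) \<Rightarrow> nat \<Rightarrow> 'a::comm_ring_1" where
  "scaled_generators l c a = (if a = 0 then c 0 * l 1 * l 2 else if a = 1 then c 1 * l 0 * l 2 else c 2 * l 0 * l 1)"

lemma scaled_koszul_rows:
  "scaled_koszul l c 0 0 * x + scaled_koszul l c 0 1 * y + scaled_koszul l c 0 2 * z = l 0 * (c 1 * z - c 2 * y)"
  "scaled_koszul l c 1 0 * x + scaled_koszul l c 1 1 * y + scaled_koszul l c 1 2 * z = l 1 * (c 2 * x - c 0 * z)"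
  "scaled_koszul l c 2 0 * x + scaled_koszul l c 2 1 * y + scaled_koszul l c 2 2 * z = l 2 * (c 0 * y - c 1 * x)"
  unfolding scaled_koszul_def by (simp_all add: algebra_simps)

lemma scaled_generators_simps:
  "scaled_generators l c 0 = c 0 * l 1 * l 2" "scaled_generators l c 1 = c 1 * l 0 * l 2"
  "scaled_generators l c 2 = c 2 * l 0 * l 1"
  unfolding scaled_generators_def by simp_all

text \<open>By coprimality \<open>l a\<close> divides the entry \<open>a\<close> of a syzygy. The
  quotients form a syzygy of the regular sequence \<open>c\<close>, hence a Koszul one.\<close>

lemma scaled_koszul_exact0:
  fixes l c :: "nat \<Rightarrow> 'a::idom"
  assumes nz: "l 0 \<noteq> 0" "l 1 \<noteq> 0" "l 2 \<noteq> 0" "c 0 \<noteq> 0"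
    and cop: "\<And>u v. c 0 * l 1 * l 2 * u = l 0 * v \<Longrightarrow> l 0 dvd u" "\<And>u v. c 1 * l 0 * l 2 * u = l 1 * v \<Longrightarrow> l 1 dvd u"
      "\<And>u v. c 2 * l 0 * l 1 * u = l 2 * v \<Longrightarrow> l 2 dvd u"
    and reg: "\<And>u v. c 1 * u = c 0 * v \<Longrightarrow> c 0 dvd u" "\<And>u v w. c 2 * w = c 0 * u + c 1 * v \<Longrightarrow> \<exists>a b. w = c 0 * a + c 1 * b"
    and eq: "c 0 * l 1 * l 2 * p + c 1 * l 0 * l 2 * q + c 2 * l 0 * l 1 * r = 0"
  shows "\<exists>x y z. p = l 0 * (c 1 * z - c 2 * y) \<and> q = l 1 * (c 2 * x - c 0 * z) \<and> r = l 2 * (c 0 * y - c 1 * x)"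
proof -
  have "c 0 * l 1 * l 2 * p = l 0 * (- (c 1 * l 2 * q + c 2 * l 1 * r))" 
    using eq by (simp add: algebra_simps eq_neg_iff_add_eq_0)
  from cop(1)[OF this] obtain p' where p: "p = l 0 * p'" by (rule dvdE)
  have "c 1 * l 0 * l 2 * q = l 1 * (- (c 0 * l 2 * p + c 2 * l 0 * r))" 
    using eq by (simp add: algebra_simps eq_neg_iff_add_eq_0)
  from cop(2)[OF this] obtain q' where q: "q = l 1 * q'" by (rule dvdE)
  have "c 2 * l 0 * l 1 * r = l 2 * (- (c 0 * l 1 * p + c 1 * l 0 * q))" 
    using eq by (simp add: algebra_simps eq_neg_iff_add_eq_0)
  from cop(3)[OF this] obtain r' where r: "r = l 2 * r'" by (rule dvdE)
  have "l 0 * l 1 * l 2 * (c 0 * p' + c 1 * q' + c 2 * r') = 0"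
    using eq unfolding p q r by (simp add: algebra_simps)
  then have k: "c 0 * p' + c 1 * q' + c 2 * r' = 0" using nz by simp
  then have "c 2 * r' = c 0 * (- p') + c 1 * (- q')" by (simp add: algebra_simps eq_neg_iff_add_eq_0)
  from reg(2)[OF this] obtain y x where r': "r' = c 0 * y + c 1 * x" by blast
  have *: "c 1 * (q' + c 2 * x) = c 0 * (- (p' + c 2 * y))"
    using k unfolding r' by (simp add: algebra_simps eq_neg_iff_add_eq_0)
  from reg(1)[OF this] obtain z where z: "q' + c 2 * x = c 0 * z" by (rule dvdE)
  have "c 0 * (c 1 * z) = c 0 * (- (p' + c 2 * y))" using * unfolding z by (simp add: mult.left_commute)
  then have z': "c 1 * z = - (p' + c 2 * y)" using nz(4) by (simp only: mult_cancel_left simp_thms)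
  have "p' = - (c 1 * z) - c 2 * y" unfolding z' by simp
  then have "p' = c 1 * (- z) - c 2 * y" by simp
  moreover have "q' = c 2 * (- x) - c 0 * (- z)" using z by (simp add: algebra_simps)
  moreover have "r' = c 0 * y - c 1 * (- x)" using r' by simp
  ultimately have "p = l 0 * (c 1 * (- z) - c 2 * y) \<and> q = l 1 * (c 2 * (- x) - c 0 * (- z)) \<and>
    r = l 2 * (c 0 * y - c 1 * (- x))" unfolding p q r by (simp only: simp_thms)
  then show ?thesis by (intro exI)
qed

lemma scaled_koszul_exact1:
  fixes l c :: "nat \<Rightarrow> 'a::idom"
  assumes nz: "l 0 \<noteq> 0" "l 1 \<noteq> 0" "l 2 \<noteq> 0" "c 0 \<noteq> 0"
    and reg: "\<And>u v. c 1 * u = c 0 * v \<Longrightarrow> c 0 dvd u"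
    and eq: "l 1 * (c 2 * x - c 0 * z) = 0" "l 2 * (c 0 * y - c 1 * x) = 0"
  shows "\<exists>t. x = c 0 * t \<and> y = c 1 * t \<and> z = c 2 * t"
proof -
  have xy: "c 1 * x = c 0 * y" and xz: "c 2 * x = c 0 * z" using eq nz by simp_all
  from reg[OF xy] obtain t where t: "x = c 0 * t" by (rule dvdE)
  have "c 0 * y = c 0 * (c 1 * t)" "c 0 * z = c 0 * (c 2 * t)"
    unfolding xy[symmetric] xz[symmetric] t by (simp_all add: mult.left_commute)
  then have "y = c 1 * t" "z = c 2 * t" using nz(4) by (simp_all only: mult_cancel_left simp_thms)
  then show ?thesis using t by blast
qed

lemma prime_ideal_var:
  assumes Q: "prime_ideal (Q :: ('n, 'k::comm_ring_1) mpoly set)" and "var_power i a \<in> Q"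
  shows "var_power i 1 \<in> Q"
  using assms(2)
proof (induction a)
  case 0
  then show ?case using Q unfolding prime_ideal_def by simp
next
  case (Suc a)
  have "var_power i 1 * var_power i a \<in> Q" using Suc.prems unfolding var_power_mult by simp
  then show ?case using prime_ideal_multD[OF Q] Suc.IH by blast
qed

text \<open>Here \<open>k i\<close> is the defect \<open>3 - \<delta> i\<close>, and the degree
  \<open>s - 3 - \<delta> i\<close> of \<open>c i\<close> becomes \<open>3\<close> minus the other
  two defects. The generators are \<open>x^(3-k1) z^k1\<close>, \<open>y^(3-k2) x^k2\<close> and
  \<open>z^(3-k0) y^k0\<close>, where \<open>k0, k1, k2\<close> stand for the values of
  \<open>k\<close>.\<close>

lemma monomial_example:
  fixes k :: "nat \<Rightarrow> nat"
  assumes "CARD('n::{finite, linorder}) \<ge> 3" and k: "k 1 + k 2 < 3" "k 0 + k 2 < 3" "k 0 + k 1 < 3"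
  shows "\<exists>f A c. graded_exact_complex (f :: nat \<Rightarrow> ('n, 'k::field) mpoly) A c (\<lambda>i. 3 - int (k i)) \<and> height (ideal3 f) \<ge> 2"
proof -
  obtain T :: "'n set" where "card T = 3" using obtain_subset_with_card_n[OF assms(1)] by blast
  then obtain x y z :: 'n where xyz: "x \<noteq> y" "x \<noteq> z" "y \<noteq> z" unfolding card_3_iff by blast
  \<comment> \<open>The variables are permuted cyclically: the variable of \<open>l i\<close> occurs
    neither in \<open>c i\<close> nor in the other two factors, which is the coprimality required
    for exactness.\<close>
  define l :: "nat \<Rightarrow> ('n, 'k) mpoly" where "l i = var_power (if i = 0 then y else if i = 1 then z else x) (k i)" for i
  define c :: "nat \<Rightarrow> ('n, 'k) mpoly" where
    "c i = (if i = 0 then var_power x (3 - k 1 - k 2) else if i = 1 then var_power y (3 - k 0 - k 2) else var_power z (3 - k 0 - k 1))" for i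
  have l: "l 0 = var_power y (k 0)" "l 1 = var_power z (k 1)" "l 2 = var_power x (k 2)" by (simp_all add: l_def)
  have c: "c 0 = var_power x (3 - k 1 - k 2)" "c 1 = var_power y (3 - k 0 - k 2)" "c 2 = var_power z (3 - k 0 - k 1)"
    by (simp_all add: c_def)
  have nzv: "var_power i a \<noteq> (0 :: ('n, 'k) mpoly)" for i a
  proof
    assume "var_power i a = (0 :: ('n, 'k) mpoly)"
    then have "lookup (var_power i a) (single i a) = lookup (0 :: ('n, 'k) mpoly) (single i a)" by (rule arg_cong)
    then show False by simp
  qed
  have nz: "l 0 \<noteq> 0" "l 1 \<noteq> 0" "l 2 \<noteq> 0" "c 0 \<noteq> 0" unfolding l c by (rule nzv)+
  have cop1: "var_power j b dvd u" if "i \<noteq> j" "var_power i a * u = var_power j b * v" for i j a b and u v :: "('n, 'k) mpoly"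
    using that by (rule var_power_coprime)
  have cop: "var_power j b dvd u"
    if "var_power i1 a1 * var_power i2 a2 * var_power i3 a3 * u = var_power j b * v" "i1 \<noteq> j" "i2 \<noteq> j" "i3 \<noteq> j"
    for i1 i2 i3 j a1 a2 a3 b and u v :: "('n, 'k) mpoly"
  proof -
    have c12: "var_power j b dvd u'" if "var_power i1 a1 * var_power i2 a2 * u' = var_power j b * v'" for u' v' :: "('n, 'k) mpoly"
      by (rule coprime_mult[where p = "var_power i1 a1" and q = "var_power i2 a2"])
        (erule cop1[OF \<open>i1 \<noteq> j\<close>], erule cop1[OF \<open>i2 \<noteq> j\<close>], rule that)
    show ?thesis
      by (rule coprime_mult[where p = "var_power i1 a1 * var_power i2 a2" and q = "var_power i3 a3"])
        (erule c12, erule cop1[OF \<open>i3 \<noteq> j\<close>], rule that(1))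
  qed
  have cops: "l 0 dvd u" if "c 0 * l 1 * l 2 * u = l 0 * v" for u v
    using that unfolding l c by (rule cop) (use xyz in auto)
  have cops1: "l 1 dvd u" if "c 1 * l 0 * l 2 * u = l 1 * v" for u v
    using that unfolding l c by (rule cop) (use xyz in auto)
  have cops2: "l 2 dvd u" if "c 2 * l 0 * l 1 * u = l 2 * v" for u v
    using that unfolding l c by (rule cop) (use xyz in auto)
  have reg1: "c 0 dvd u" if "c 1 * u = c 0 * v" for u v
    using that unfolding c by (rule cop1[rotated]) (use xyz in auto)
  have reg2: "\<exists>a b. w = c 0 * a + c 1 * b" if "c 2 * w = c 0 * u + c 1 * v" for u v w
    using that unfolding c by (rule var_power_regular[rotated 2]) (use xyz in auto)
  let ?f = "scaled_generators l c" and ?A = "scaled_koszul l c"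
  have fl: "form (int (k i)) (l i)" for i by (simp add: l_def form_single)
  have fc: "form (3 - int (k 1) - int (k 2)) (c 0)" "form (3 - int (k 0) - int (k 2)) (c 1)" "form (3 - int (k 0) - int (k 1)) (c 2)"
    unfolding c form_single using k by simp_all
  have fA: "form (3 - int (k i)) (?A a i)" if "a < 3" "i < 3" for a i
  proof -
    have P: "form (3 - int (k 0)) (l 1 * c 2)" "form (3 - int (k 0)) (l 2 * c 1)" "form (3 - int (k 1)) (l 0 * c 2)"
      "form (3 - int (k 1)) (l 2 * c 0)" "form (3 - int (k 2)) (l 0 * c 1)" "form (3 - int (k 2)) (l 1 * c 0)"
      by (rule form_mult'[OF fl fc(3)] form_mult'[OF fl fc(2)] form_mult'[OF fl fc(1)]; simp)+
    show ?thesis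
      by (insert that[unfolded less_3_cases], elim disjE; insert P; simp add: scaled_koszul_def)
  qed
  have complex: "graded_exact_complex ?f ?A c (\<lambda>i. 3 - int (k i))"
  proof (rule graded_exact_complexI)
    fix p q r assume e: "?f 0 * p + ?f 1 * q + ?f 2 * r = 0"
    show "\<exists>x y z. p = ?A 0 0 * x + ?A 0 1 * y + ?A 0 2 * z \<and> q = ?A 1 0 * x + ?A 1 1 * y + ?A 1 2 * z \<and>
      r = ?A 2 0 * x + ?A 2 1 * y + ?A 2 2 * z"
      unfolding scaled_koszul_rows
      by (rule scaled_koszul_exact0[where l = l and c = c, OF nz])
        (erule cops, erule cops1, erule cops2, erule reg1, erule reg2, rule e[unfolded scaled_generators_simps])
  next
    fix j :: nat assume "j < 3"
    then show "?f 0 * ?A 0 j + ?f 1 * ?A 1 j + ?f 2 * ?A 2 j = 0"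
      unfolding less_3_cases by (elim disjE) (simp_all add: scaled_koszul_def scaled_generators_def algebra_simps)
  next
    fix p q r assume e: "\<And>a. a < 3 \<Longrightarrow> ?A a 0 * p + ?A a 1 * q + ?A a 2 * r = 0"
    have "(1 :: nat) < 3" "(2 :: nat) < 3" by simp_all
    note e12 = e[OF this(1), unfolded scaled_koszul_rows] e[OF this(2), unfolded scaled_koszul_rows]
    show "\<exists>t. p = c 0 * t \<and> q = c 1 * t \<and> r = c 2 * t"
      by (rule scaled_koszul_exact1[where l = l and c = c, OF nz]) (erule reg1, rule e12(1), rule e12(2))
  next
    fix a :: nat assume "a < 3"
    then show "?A a 0 * c 0 + ?A a 1 * c 1 + ?A a 2 * c 2 = 0"
      unfolding less_3_cases by (elim disjE) (simp_all add: scaled_koszul_def algebra_simps)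
  next
    show "c 0 \<noteq> 0 \<or> c 1 \<noteq> 0 \<or> c 2 \<noteq> 0" using nz(4) by blast
  next
    fix a i :: nat assume "a < 3" "i < 3"
    moreover have "3 - int (k i) \<noteq> 0" by (insert \<open>i < 3\<close>[unfolded less_3_cases], elim disjE; insert k; simp)
    ultimately show "lookup (?A a i) 0 = 0" by (intro lookup_0_form[OF fA])
  next
    fix i :: nat assume "i < 3"
    moreover have "lookup (c 0) 0 = 0" "lookup (c 1) 0 = 0" "lookup (c 2) 0 = 0"
      by (rule lookup_0_form[OF fc(1)] lookup_0_form[OF fc(2)] lookup_0_form[OF fc(3)]; use k in simp)+
    ultimately show "lookup (c i) 0 = 0" by (auto simp: less_3_cases)
  next
    fix a :: nat assume "a < 3"
    moreover have "form 3 (?f 0)" "form 3 (?f 1)" "form 3 (?f 2)" unfolding scaled_generators_simps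
      by (rule form_mult'[OF form_mult'[OF fc(1) fl refl] fl], simp) 
        (rule form_mult'[OF form_mult'[OF fc(2) fl refl] fl], simp, rule form_mult'[OF form_mult'[OF fc(3) fl refl] fl], simp)
    ultimately show "form 3 (?f a)" by (auto simp: less_3_cases)
  next
    show "form (3 - int (k i)) (?A a i)" if "a < 3" "i < 3" for a i using that by (rule fA)
  next
    fix i :: nat assume "i < 3"
    then show "form (3 - int (k 0) + (3 - int (k 1)) + (3 - int (k 2)) - 3 - (3 - int (k i))) (c i)"
      unfolding less_3_cases by (elim disjE; insert fc; simp add: algebra_simps)
  qed
  \<comment> \<open>A prime containing the three monomials contains one variable of each pair among
    \<open>x, y, z\<close>, hence at least two of the three.\<close>
  have chain: "prime_chain 2 Q" if Q: "prime_ideal Q" "ideal3 ?f \<subseteq> Q" for Q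
  proof -
    have f: "{?f 0, ?f 1, ?f 2} \<subseteq> Q" using ring_ideal.span_superset Q(2) unfolding ideal3_eq_span by (rule subset_trans)
    then have m: "c 0 * l 1 * l 2 \<in> Q" "c 1 * l 0 * l 2 \<in> Q" "c 2 * l 0 * l 1 \<in> Q"
      unfolding scaled_generators_simps by (simp_all only: insert_subset)
    have D: "var_power i1 1 \<in> Q \<or> var_power i2 1 \<in> Q \<or> var_power i3 1 \<in> Q"
      if p: "var_power i1 a1 * var_power i2 a2 * var_power i3 a3 \<in> Q" for i1 i2 i3 a1 a2 a3
    proof (rule disjE[OF prime_ideal_multD[OF Q(1) p]])
      assume q: "var_power i1 a1 * var_power i2 a2 \<in> Q"
      show ?thesis by (rule disjE[OF prime_ideal_multD[OF Q(1) q]]; drule prime_ideal_var[OF Q(1)]; simp)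
    next
      assume "var_power i3 a3 \<in> Q"
      then show ?thesis using prime_ideal_var[OF Q(1)] by simp
    qed
    have xyzQ: "var_power x 1 \<in> Q \<or> var_power z 1 \<in> Q" "var_power y 1 \<in> Q \<or> var_power x 1 \<in> Q" "var_power z 1 \<in> Q \<or> var_power y 1 \<in> Q"
      using D[OF m(1)[unfolded l c]] D[OF m(2)[unfolded l c]] D[OF m(3)[unfolded l c]] by argo+
    have "prime_chain 2 Q" if "i \<noteq> j" "var_power i 1 \<in> Q" "var_power j 1 \<in> Q" for i j
      using Q(1) that(2,3) nzv by (rule prime_chain_2) (rule cop1[OF that(1)[symmetric]])
    from this[of x y] this[of x z] this[of y z] show ?thesis using xyzQ xyz by argo
  qed
  have "enat 2 \<le> height (ideal3 ?f)" by (rule height_ge) (rule chain)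
  then have "height (ideal3 ?f) \<ge> 2" by (simp add: numeral_eq_enat)
  with complex show ?thesis by (intro exI conjI)
qed

section \<open>The list of vectors and their realisation\<close>

lemma (in graded_exact_complex) classification:
  assumes n: "CARD('n) \<ge> 3" and sorted: "\<delta> 0 \<le> \<delta> 1" "\<delta> 1 \<le> \<delta> 2" and height: "height (ideal3 f) \<ge> 2"
  shows "((\<delta> 0, \<delta> 1, \<delta> 2), codim2_degree (ideal3 f), bourbaki_degree (ideal3 f)) \<in>
    {((1, 3, 3), 6, 1), ((2, 2, 2), 6, 1), ((2, 2, 3), 5, 2), ((2, 3, 3), 3, 4), ((3, 3, 3), 0, 9)}"
proof -
  obtain M where "minimal_graded_free_resolution (ideal3 f) [[3, 3, 3], [3 + \<delta> 0, 3 + \<delta> 1, 3 + \<delta> 2], [\<delta> 0 + \<delta> 1 + \<delta> 2]] M"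
    using resolution_exists ..
  then have "\<not> perfect_of_height_two (ideal3 f)" by (rule not_perfect)
  note b = bourbaki_degree_ideal[OF n sorted this]
  let ?e = "3 * s - (\<delta> 0 * \<delta> 1 + \<delta> 0 * \<delta> 2 + \<delta> 1 * \<delta> 2)"
  note d = codim2_degree_ideal(2)[OF n height refl]
  \<comment> \<open>For \<open>(3, 3, 3)\<close> the expression \<open>?e\<close> is
    \<open>27 - 27 = 0\<close> and the Hilbert polynomial argument gives no degree; this case is
    settled by the height.\<close>
  have d0: "codim2_degree (ideal3 f) = 0" if "\<delta> 0 = 3 \<and> \<delta> 1 = 3 \<and> \<delta> 2 = 3"
    by (rule codim2_degree_ideal_0) (use that in \<open>auto simp: less_3_cases\<close>)
  consider "\<delta> 0 = 1 \<and> \<delta> 1 = 3 \<and> \<delta> 2 = 3" | "\<delta> 0 = 2 \<and> \<delta> 1 = 2 \<and> \<delta> 2 = 2" | "\<delta> 0 = 2 \<and> \<delta> 1 = 2 \<and> \<delta> 2 = 3"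
    | "\<delta> 0 = 2 \<and> \<delta> 1 = 3 \<and> \<delta> 2 = 3" | "\<delta> 0 = 3 \<and> \<delta> 1 = 3 \<and> \<delta> 2 = 3"
    using delta_cases[OF sorted] by auto
  then show ?thesis
  proof cases
    case 1 then show ?thesis using b d by (simp add: s)
  next
    case 2 then show ?thesis using b d by (simp add: s)
  next
    case 3 then show ?thesis using b d by (simp add: s)
  next
    case 4 then show ?thesis using b d by (simp add: s)
  next
    case 5 then show ?thesis using b d0 by simp
  qed
qed

theorem proposition3p14:
  assumes "CARD('n::{finite, linorder}) \<ge> 3"
  shows "{((\<delta>1, \<delta>2, \<delta>3), \<epsilon>1, degree_RJ, Bour_J) | \<delta>1 \<delta>2 \<delta>3 \<epsilon>1 degree_RJ Bour_J.
            \<exists>J :: ('n, 'k::{alg_closed_field, field_char_0}) mpoly set.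
              (\<exists>f. minimally_generated_by_three_forms J 3 f) \<and>
              height J \<ge> 2 \<and>
              \<delta>1 \<le> \<delta>2 \<and> \<delta>2 \<le> \<delta>3 \<and>
              (\<exists>A. minimal_graded_free_resolution J
                     [[3, 3, 3], [3 + \<delta>1, 3 + \<delta>2, 3 + \<delta>3], [\<delta>1 + \<delta>2 + \<delta>3]] A) \<and>
              3 + \<delta>3 + \<epsilon>1 = \<delta>1 + \<delta>2 + \<delta>3 \<and>
              degree_RJ = codim2_degree J \<and>
              Bour_J = bourbaki_degree J} =
         {((1, 3, 3), 1, 6, 1),
          ((2, 2, 2), 1, 6, 1),
          ((2, 2, 3), 1, 5, 2),
          ((2, 3, 3), 2, 3, 4),
          ((3, 3, 3), 3, 0, 9)}" (is "?L = ?R")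
proof (intro Set.equalityI Set.subsetI)
  fix t assume "t \<in> ?L"
  then obtain \<delta>1 \<delta>2 \<delta>3 \<epsilon>1 d b and J :: "('n, 'k) mpoly set" and A where t: "t = ((\<delta>1, \<delta>2, \<delta>3), \<epsilon>1, d, b)"
    and J: "height J \<ge> 2" "\<delta>1 \<le> \<delta>2" "\<delta>2 \<le> \<delta>3"
      "minimal_graded_free_resolution J [[3, 3, 3], [3 + \<delta>1, 3 + \<delta>2, 3 + \<delta>3], [\<delta>1 + \<delta>2 + \<delta>3]] A"
    and e: "3 + \<delta>3 + \<epsilon>1 = \<delta>1 + \<delta>2 + \<delta>3" and db: "d = codim2_degree J" "b = bourbaki_degree J"
    unfolding mem_Collect_eq by (elim exE conjE) (rule that)
  obtain f A' c where fAc: "graded_exact_complex f A' c (shifts \<delta>1 \<delta>2 \<delta>3)" and J': "J = ideal3 f"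
    using graded_exact_complex_of_resolution[OF J(4)] by (elim exE conjE)
  have v: "((\<delta>1, \<delta>2, \<delta>3), d, b) \<in> {((1, 3, 3), 6, 1), ((2, 2, 2), 6, 1), ((2, 2, 3), 5, 2), ((2, 3, 3), 3, 4), ((3, 3, 3), 0, 9)}"
    using graded_exact_complex.classification[OF fAc assms] J(1-3) unfolding db J' by simp
  have "\<epsilon>1 = \<delta>1 + \<delta>2 - 3" using e by simp
  then show "t \<in> ?R"
    unfolding t by (insert v[unfolded insert_iff prod.inject empty_iff], elim disjE conjE; simp)
next
  \<comment> \<open>The parameters are the defects \<open>3 - \<delta> i\<close>. The hypothesis
    \<open>val\<close> says that the table determines \<open>d\<close> and \<open>b\<close> from the
    shifts, so the invariants of the monomial ideal come from the classification and need no
    computation of their own.\<close>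
  have ex: "((3 - int k0, 3 - int k1, 3 - int k2), 3 - int k0 - int k1, d, b) \<in> ?L"
    if k: "k1 + k2 < 3" "k0 + k2 < 3" "k0 + k1 < 3" "k1 \<le> k0" "k2 \<le> k1"
      and val: "\<And>d' b'. ((3 - int k0, 3 - int k1, 3 - int k2), d', b') \<in>
        {((1, 3, 3), 6, 1), ((2, 2, 2), 6, 1), ((2, 2, 3), 5, 2), ((2, 3, 3), 3, 4), ((3, 3, 3), 0, 9)} \<Longrightarrow> d = d' \<and> b = b'"
    for k0 k1 k2 :: nat and d b :: rat
  proof -
    define k where "k i = (if i = 0 then k0 else if i = 1 then k1 else k2)" for i :: nat
    have kk: "k 0 = k0" "k 1 = k1" "k 2 = k2" by (simp_all add: k_def)
    note m = monomial_example[OF assms, where ?'k = 'k, of k, unfolded kk, OF k(1-3)]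
    from m obtain f :: "nat \<Rightarrow> ('n, 'k) mpoly" and A c where
      fAc: "graded_exact_complex f A c (\<lambda>i. 3 - int (k i))" and h: "height (ideal3 f) \<ge> 2"
      by (elim exE conjE)
    from graded_exact_complex.classification[OF fAc assms] h k(4,5)
    have "((3 - int k0, 3 - int k1, 3 - int k2), codim2_degree (ideal3 f), bourbaki_degree (ideal3 f)) \<in>
        {((1, 3, 3), 6, 1), ((2, 2, 2), 6, 1), ((2, 2, 3), 5, 2), ((2, 3, 3), 3, 4), ((3, 3, 3), 0, 9)}"
      unfolding kk by simp
    from val[OF this] have v: "d = codim2_degree (ideal3 f)" "b = bourbaki_degree (ideal3 f)" by blast+
    have res: "\<exists>M. minimal_graded_free_resolution (ideal3 f) [[3, 3, 3], [3 + (3 - int k0), 3 + (3 - int k1), 3 + (3 - int k2)],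
        [(3 - int k0) + (3 - int k1) + (3 - int k2)]] M"
      using graded_exact_complex.resolution_exists[OF fAc] unfolding kk .
    have min: "\<exists>g. minimally_generated_by_three_forms (ideal3 f) 3 g"
      using graded_exact_complex.generators_minimal[OF fAc] ..
    show ?thesis
      unfolding mem_Collect_eq
      by (rule exI[of _ "3 - int k0"], rule exI[of _ "3 - int k1"], rule exI[of _ "3 - int k2"],
          rule exI[of _ "3 - int k0 - int k1"], rule exI[of _ d], rule exI[of _ b],
          intro conjI exI[of _ "ideal3 f"]; (rule refl min h res v)?; use k(4,5) in simp)
  qed
  fix t assume "t \<in> ?R"
  then consider "t = ((1, 3, 3), 1, 6, 1)" | "t = ((2, 2, 2), 1, 6, 1)" | "t = ((2, 2, 3), 1, 5, 2)"
    | "t = ((2, 3, 3), 2, 3, 4)" | "t = ((3, 3, 3), 3, 0, 9)" by auto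
  then show "t \<in> ?L"
  proof cases
    \<comment> \<open>The first three arguments of \<open>ex\<close> are \<open>k1, k2, k0\<close>,
      in the order in which these variables occur in its statement.\<close>
    case 1 then show ?thesis using ex[of 0 0 2 6 1] by simp
  next
    case 2 then show ?thesis using ex[of 1 1 1 6 1] by simp
  next
    case 3 then show ?thesis using ex[of 1 0 1 5 2] by simp
  next
    case 4 then show ?thesis using ex[of 0 0 1 3 4] by simp
  next
    case 5 then show ?thesis using ex[of 0 0 0 0 9] by simp
  qed
qed

end
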